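(* Let $T>0$, $X$ a real Banach space, $Y,Z$ real normed spaces, $\Omega\subset X$ and $U\subset Y$ non-empty open subsets, $\xi_0\in\Omega$, $m,q\ge1$ integers, and let $f^0:[0,T]\times\Omega\times U\times Z\to\mathbb R$, $f:[0,T]\times\Omega\times U\times Z\to X$, $g^i:\Omega\times Z\to\mathbb R$ ($0\le i\le m$), $h^j:\Omega\times Z\to\mathbb R$ ($1\le j\le q$) be mappings. For $\pi\in Z$ let $(\mathcal B,\pi)$ be the Bolza problem and $V[\pi]$ its value, as in the context. Fix $\pi_0\in Z$ and assume: (SO) There is an open neighborhood $P$ of $\pi_0$ in $Z$ such that for every $\pi\in P$ there is a solution $(x[\pi],u[\pi])\in PC^1([0,T],\Omega)\times NPC^0_R([0,T],U)$ of $(\mathcal B,\pi)$; and $\delta\pi\in Z$ is such that $D_G^+x[\pi_0;\delta\pi]$ and $D_G^+u[\pi_0;\delta\pi]$ exist. (IC1) $f^0\in C^0([0,T]\times\Omega\times U\times P,\mathbb R)$; $D_{G,2}f^0(t,\xi,\zeta,\pi)$ exists for all $(t,\xi,\zeta,\pi)\in[0,T]\times\Omega\times U\times P$; and for all $\pi\in P$ and all non-empty compact $K\subset\Omega\times U$, $\sup_{(t,\xi,\zeta)\in[0,T]\times K}\|D_{G,2}f^0(t,\xi,\zeta,\pi)\|<+\infty$. (IC2) For all $t\in[0,T]$, $D_{H,(2,3,4)}f^0(t,x[\pi_0](t),u[\pi_0](t),\pi_0)$ exists; for all $\pi\in P$, $D_{H,3}f^0(T,x[\pi](T),u[\pi](T),\pi)$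 exists, and $[\pi\mapsto D_{H,3}f^0(T,x[\pi](T),u[\pi](T),\pi)]\in C^0(P,Y^* )$. (IC3) There are $\kappa\in\mathcal L^1(([0,T],\mathcal B([0,T])),\mathfrak m_1;\mathbb R_+)$ and $\rho>0$ such that for all $t\in[0,T]$ and all $(\xi_1,\zeta_1,\pi_1),(\xi_2,\zeta_2,\pi_2)\in B_{\|\cdot\|_1}((x[\pi_0](t),u[\pi_0](t),\pi_0),\rho)$, $|f^0(t,\xi_1,\zeta_1,\pi_1)-f^0(t,\xi_2,\zeta_2,\pi_2)|\le\kappa(t)\|(\xi_1,\zeta_1,\pi_1)-(\xi_2,\zeta_2,\pi_2)\|$. (IC4) For all $(t,\zeta,\pi)\in[0,T]\times U\times P$, $D_{F,2}f^0(t,x[\pi](t),\zeta,\pi)$ exists, and for all $\pi\in P$, $[(t,\zeta)\mapsto D_{F,2}f^0(t,x[\pi](t),\zeta,\pi)]\in C^0([0,T]\times U,X^* )$. (V1) For all $\pi\in P$, $[(t,\xi,\zeta)\mapsto f(t,\xi,\zeta,\pi)]\in C^0([0,T]\times\Omega\times U,X)$; $D_{G,2}f(t,\xi,\zeta,\pi)$ exists for all $(t,\xi,\zeta,\pi)\in[0,T]\times\Omega\times U\times P$; and for all $\pi\in P$ and all non-empty compact $K\subset\Omega\times U$, $\sup_{(t,\xi,\zeta)\in[0,T]\times K}\|D_{G,2}f(t,\xi,\zeta,\pi)\|<+\infty$. (V2) For all $t\in[0,T]$, $D_{H,(2,3,4)}f(t,x[\pi_0](t),u[\pi_0](t),\pi_0)$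 exists; for all $\pi\in P$, $D_{H,3}f(T,x[\pi](T),u[\pi](T),\pi)$ exists. (V3) For all $(t,\zeta,\pi)\in[0,T]\times U\times P$, $D_{F,2}f(t,x[\pi](t),\zeta,\pi)$ exists, and for all $\pi\in P$, $[(t,\zeta)\mapsto D_{F,2}f(t,x[\pi](t),\zeta,\pi)]\in C^0([0,T]\times U,\mathcal L(X,X))$. (CT1) For all $\phi\in\{g^i:0\le i\le m\}\cup\{h^j:1\le j\le q\}$, $D_H\phi(x[\pi_0](T),\pi_0)$ exists and, for all $\pi\in P$, $D_{H,1}\phi(x[\pi](T),\pi)$ exists. (CT2) For all $\pi\in P$ and $j\in\{1,\dots,q\}$, $h^j(\cdot,\pi)$ is continuous on a neighborhood of $x[\pi](T)$. (CVT1) The family consisting of $D_{H,1}g^i(x[\pi_0](T),\pi_0)\circ D_{H,3}f(T,x[\pi_0](T),u[\pi_0](T),\pi_0)$ ($1\le i\le m$) and $D_{H,1}h^j(x[\pi_0](T),\pi_0)\circ D_{H,3}f(T,x[\pi_0](T),u[\pi_0](T),\pi_0)$ ($1\le j\le q$) is linearly independent. (CVT2) For all $\phi\in\{g^i:0\le i\le m\}\cup\{h^j:1\le j\le q\}$, $[\pi\mapsto D_{H,1}\phi(x[\pi](T),\pi)\circ D_{H,3}f(T,x[\pi](T),u[\pi](T),\pi)]\in C^0(P,Y^* )$. (ESP) There is an inner product $(\cdot|\cdot)$ on $Y^*$ which is continuous on $(Y^*,\|\cdot\|_{Y^*})^2$. Then $D_G^+V[\pi_0;\delta\pi]$ exists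 and $$\begin{aligned}D_G^+V[\pi_0;\delta\pi]={}&D_{H,2}g^0(x[\pi_0](T),\pi_0)\cdot\delta\pi+\sum_{i=1}^m\lambda_i[\pi_0]D_{H,2}g^i(x[\pi_0](T),\pi_0)\cdot\delta\pi\\&+\sum_{j=1}^q\mu_j[\pi_0]D_{H,2}h^j(x[\pi_0](T),\pi_0)\cdot\delta\pi\\&+\int_{[0,T]}D_{H,4}f^0(t,x[\pi_0](t),u[\pi_0](t),\pi_0)\cdot\delta\pi\,d\mathfrak m_1(t)\\&+\int_{[0,T]}p[\pi_0](t)\cdot D_{H,4}f(t,x[\pi_0](t),u[\pi_0](t),\pi_0)\cdot\delta\pi\,d\mathfrak m_1(t),\end{aligned}$$ where $((\lambda_i[\pi_0])_{0\le i\le m},(\mu_j[\pi_0])_{1\le j\le q},p[\pi_0])$ is the unique Pontryagin triple, with $\lambda_0[\pi_0]=1$, of the solution $(x[\pi_0],u[\pi_0])$ of $(\mathcal B,\pi_0)$.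
   Context: Function spaces. For a Hausdorff topological space $W$, $PC^0([0,T],W)$ is the set of $x:[0,T]\to W$ which are continuous, or for which there is a subdivision $0=\tau_0<\dots<\tau_{k+1}=T$ such that $x$ is continuous at every $t\notin\{\tau_i\}$, the right limit $x(\tau_i+)$ exists in $W$ for $0\le i\le k$ and the left limit $x(\tau_i-)$ exists in $W$ for $1\le i\le k+1$. $NPC^0_R([0,T],W)$ is the set of $x\in PC^0([0,T],W)$ right-continuous on $[0,T[$ and left-continuous at $T$. For $W$ a subset of a real normed space, $PC^1([0,T],W)$ is the set of continuous $x:[0,T]\to W$ which are continuously differentiable, or for which there is a subdivision $0=\tau_0<\dots<\tau_{k+1}=T$ such that $x$ is continuously differentiable at every $t\notin\{\tau_i\}$, $x'_R(\tau_i)=x'(\tau_i+)$ exists for $0\le i\le k$ and $x'_L(\tau_i)=x'(\tau_i-)$ exists for $1\le i\le k+1$. The extended derivative is $\underline d x(t):=x'(t)$ if $t\notin\{\tau_i\}$, $\underline d x(\tau_i):=x'_R(\tau_i)$ for $0\le i\le k$, $\underline d x(T):=x'_L(T)$. For a normed space $W$, $NPC^0_R([0,T],W)$ has the sup norm $\|\cdot\|_\infty$, and $PC^1([0,T],W)$ has the norm $\|x\|_\infty+\|\underline dx\|_\infty$; the variations $D_G^+x[\pi;\delta\pi]$, $D_G^+u[\pi;\delta\pi]$ of $\pi\mapsto x[\pi]$, $\pi\mapsto u[\pi]$ are taken in $PC^1([0,T],X)$ and $NPC^0_R([0,T],Y)$. Differentials. $D_G^+\mathfrak f(x;v)=\lim_{\theta\to0+}(\mathfrak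 f(x+\theta v)-\mathfrak f(x))/\theta$ is the right Gâteaux variation. $D_G,D_H,D_F$ are the Gâteaux, Hadamard, Fréchet differentials (continuous linear maps): $D_G\mathfrak f(x)\cdot v=D^+_G\mathfrak f(x;v)$ for all $v$; $\mathfrak f$ is Hadamard differentiable at $x$ when moreover $\lim_{\theta\to0+,\,w\to v}(\mathfrak f(x+\theta w)-\mathfrak f(x))/\theta=D_H\mathfrak f(x)\cdot v$ for all $v$. Subscripts $i$ denote partial differentials in the $i$-th variable; $D_{H,(2,3,4)}$ is the Hadamard differential jointly in the 2nd, 3rd, 4th variables. $\mathfrak m_1$ is Lebesgue measure on the Borel $\sigma$-algebra $\mathcal B([0,T])$, $\mathcal L^1$ the integrable functions. On $X\times Y\times Z$, $\|(\xi,\zeta,\pi)\|_1=\|\xi\|+\|\zeta\|+\|\pi\|$; balls in (IC3) are understood to be in $\Omega\times U\times P$. Problem $(\mathcal B,\pi)$: maximize $\int_0^Tf^0(t,x(t),u(t),\pi)\,dt+g^0(x(T),\pi)$ over the pairs $(x,u)\in PC^1([0,T],\Omega)\times NPC^0_R([0,T],U)$ with $\underline dx(t)=f(t,x(t),u(t),\pi)$ for all $t\in[0,T]$, $x(0)=\xi_0$, $g^i(x(T),\pi)\ge0$ ($1\le i\le m$), $h^j(x(T),\pi)=0$ ($1\le j\le q$). A solution attains the maximum; $V[\pi]$ is the value (supremum). Pontryagin triple: let $H_\pi(t,\xi,\zeta,p,\lambda):=p\cdot f(t,\xi,\zeta,\pi)+\lambda f^0(t,\xi,\zeta,\pi)$.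 A Pontryagin triple of a solution $(x[\pi],u[\pi])$ of $(\mathcal B,\pi)$ is $((\lambda_i)_{0\le i\le m},(\mu_j)_{1\le j\le q},p)\in\mathbb R^{1+m}\times\mathbb R^q\times PC^1([0,T],X^* )$ with: $((\lambda_i),(\mu_j))\ne0$; $\lambda_i\ge0$ for all $i$; $\lambda_ig^i(x[\pi](T),\pi)=0$ for $1\le i\le m$; $\sum_{i=0}^m\lambda_iD_{H,1}g^i(x[\pi](T),\pi)+\sum_{j=1}^q\mu_jD_{H,1}h^j(x[\pi](T),\pi)=p(T)$; $\underline dp(t)=-D_{F,2}H_\pi(t,x[\pi](t),u[\pi](t),p(t),\lambda_0)$ for all $t$; $H_\pi(t,x[\pi](t),u[\pi](t),p(t),\lambda_0)\ge H_\pi(t,x[\pi](t),\zeta,p(t),\lambda_0)$ for all $t\in[0,T]$, $\zeta\in U$; and $t\mapsto H_\pi(t,x[\pi](t),u[\pi](t),p(t),\lambda_0)$ continuous on $[0,T]$. Under the assumptions of the claim, the triple with $\lambda_0=1$ exists and is unique for $\pi=\pi_0$. *)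

theory Defs
  imports "HOL-Analysis.Analysis"
begin

text \<open>Functions on \<open>[0,T]\<close> are total functions on \<open>real\<close> of which only the values on
  \<open>{0..T}\<close> are used, likewise for maps defined on \<open>[0,T] \<times> \<Omega> \<times> U \<times> Z\<close>. All
  derivatives in the state, control and parameter variables are taken at points of open sets,
  so they do not depend on values outside the domain.\<close>

text \<open>A subdivision \<open>0 = \<tau>\<^sub>0 < \<dots> < \<tau>\<^bsub>k+1\<^esub> = T\<close> is given by the finite set of its points.\<close>

definition subdivision :: "real \<Rightarrow> real set \<Rightarrow> bool" where
  "subdivision T S \<longleftrightarrow> finite S \<and> {0, T} \<subseteq> S \<and> S \<subseteq> {0..T}"

definition PC0 :: "real \<Rightarrow> 'a::t2_space set \<Rightarrow> (real \<Rightarrow> 'a) set" where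
  "PC0 T W = {x. (\<forall>t\<in>{0..T}. x t \<in> W) \<and>
     (continuous_on {0..T} x \<or>
      (\<exists>S. subdivision T S \<and>
         (\<forall>t\<in>{0..T} - S. continuous (at t within {0..T}) x) \<and>
         (\<forall>\<tau>\<in>S - {T}. \<exists>l\<in>W. (x \<longlongrightarrow> l) (at_right \<tau>)) \<and>
         (\<forall>\<tau>\<in>S - {0}. \<exists>l\<in>W. (x \<longlongrightarrow> l) (at_left \<tau>))))}"

definition NPC0R :: "real \<Rightarrow> 'a::t2_space set \<Rightarrow> (real \<Rightarrow> 'a) set" where
  "NPC0R T W = {x \<in> PC0 T W.
     (\<forall>t\<in>{0..<T}. continuous (at_right t) x) \<and> continuous (at_left T) x}"

definition C1_on_interval :: "real \<Rightarrow> (real \<Rightarrow> 'a::real_normed_vector) \<Rightarrow> bool" where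
  "C1_on_interval T x \<longleftrightarrow>
     (\<exists>d. continuous_on {0..T} d \<and>
        (\<forall>t\<in>{0..T}. (x has_vector_derivative d t) (at t within {0..T})))"

definition C1_at :: "(real \<Rightarrow> 'a::real_normed_vector) \<Rightarrow> real \<Rightarrow> bool" where
  "C1_at x t \<longleftrightarrow>
     (\<forall>\<^sub>F s in nhds t. x differentiable (at s)) \<and> isCont (\<lambda>s. vector_derivative x (at s)) t"

definition PC1_subdivision ::
  "real \<Rightarrow> (real \<Rightarrow> 'a::real_normed_vector) \<Rightarrow> real set \<Rightarrow> bool" where
  "PC1_subdivision T x S \<longleftrightarrow> subdivision T S \<and>
     (\<forall>t\<in>{0..T} - S. C1_at x t) \<and>
     (\<forall>\<tau>\<in>S - {T}. \<exists>d. (x has_vector_derivative d) (at_right \<tau>) \<and>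
        ((\<lambda>t. vector_derivative x (at t)) \<longlongrightarrow> d) (at_right \<tau>)) \<and>
     (\<forall>\<tau>\<in>S - {0}. \<exists>d. (x has_vector_derivative d) (at_left \<tau>) \<and>
        ((\<lambda>t. vector_derivative x (at t)) \<longlongrightarrow> d) (at_left \<tau>))"

definition PC1 :: "real \<Rightarrow> 'a::real_normed_vector set \<Rightarrow> (real \<Rightarrow> 'a) set" where
  "PC1 T W = {x. continuous_on {0..T} x \<and> (\<forall>t\<in>{0..T}. x t \<in> W) \<and>
     (C1_on_interval T x \<or> (\<exists>S. PC1_subdivision T x S))}"

text \<open>The extended derivative is independent of the choice of the subdivision, see
  \<open>ext_deriv_eq\<close> below; if \<open>x\<close> is continuously differentiable on \<open>[0,T]\<close>, then
  \<open>{0, T}\<close> is an admissible choice.\<close>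

definition ext_deriv :: "real \<Rightarrow> (real \<Rightarrow> 'a::real_normed_vector) \<Rightarrow> real \<Rightarrow> 'a" where
  "ext_deriv T x t =
     (let S = (SOME S. PC1_subdivision T x S) in
        if t \<notin> S then vector_derivative x (at t)
        else if t < T then vector_derivative x (at_right t)
        else vector_derivative x (at_left t))"

lemma C1_on_interval_imp_PC1_subdivision:
  assumes "0 < T" "C1_on_interval T x"
  shows "PC1_subdivision T x {0, T}"
proof -
  obtain d where d: "continuous_on {0..T} d"
    and xd: "\<And>t. t \<in> {0..T} \<Longrightarrow> (x has_vector_derivative d t) (at t within {0..T})"
    using assms(2) unfolding C1_on_interval_def by blast
  have int: "(x has_vector_derivative d t) (at t)" if "0 < t" "t < T" for t
    using xd[of t] that by (simp add: at_within_Icc_at)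
  then have vd: "vector_derivative x (at t) = d t" if "0 < t" "t < T" for t
    using that vector_derivative_at by blast
  have C1: "C1_at x t" if t: "t \<in> {0..T} - {0, T}" for t
  proof -
    have t': "t \<in> {0<..<T}" using t by auto
    have ev: "\<forall>\<^sub>F s in nhds t. s \<in> {0<..<T}"
      using t' by (intro eventually_nhds_in_open) auto
    have "isCont d t"
      using d t' by (metis continuous_on_interior interior_atLeastAtMost_real)
    moreover have "\<forall>\<^sub>F s in nhds t. vector_derivative x (at s) = d s"
      using ev by eventually_elim (auto simp: vd)
    ultimately have "isCont (\<lambda>s. vector_derivative x (at s)) t"
      by (simp add: isCont_cong)
    moreover have "\<forall>\<^sub>F s in nhds t. x differentiable (at s)"
      using ev by eventually_elim (use int in \<open>auto intro: differentiableI_vector\<close>)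
    ultimately show ?thesis by (simp add: C1_at_def)
  qed
  have R: "(x has_vector_derivative d 0) (at_right 0)"
    using xd[of 0] assms(1) by (simp add: at_within_Icc_at_right)
  have L: "(x has_vector_derivative d T) (at_left T)"
    using xd[of T] assms(1) by (simp add: at_within_Icc_at_left)
  have "(d \<longlongrightarrow> d 0) (at_right 0)"
    using d assms(1) by (simp add: continuous_on_Icc_at_rightD)
  moreover have "\<forall>\<^sub>F t in at_right 0. vector_derivative x (at t) = d t"
    using eventually_at_right_real[OF assms(1)] by eventually_elim (auto simp: vd)
  ultimately have R': "((\<lambda>t. vector_derivative x (at t)) \<longlongrightarrow> d 0) (at_right 0)"
    by (simp add: tendsto_cong)
  have "(d \<longlongrightarrow> d T) (at_left T)"
    using d assms(1) by (simp add: continuous_on_Icc_at_leftD)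
  moreover have "\<forall>\<^sub>F t in at_left T. vector_derivative x (at t) = d t"
    using eventually_at_left_real[OF assms(1)] by eventually_elim (auto simp: vd)
  ultimately have L': "((\<lambda>t. vector_derivative x (at t)) \<longlongrightarrow> d T) (at_left T)"
    by (simp add: tendsto_cong)
  show ?thesis
    unfolding PC1_subdivision_def subdivision_def
    using assms(1) C1 R R' L L' by auto
qed

lemma ext_deriv_eq:
  assumes "0 < T" "x \<in> PC1 T W" "t \<in> {0..T}"
  shows "ext_deriv T x t =
    (if t < T then vector_derivative x (at_right t) else vector_derivative x (at_left t))"
proof -
  define S where "S = (SOME S. PC1_subdivision T x S)"
  have "\<exists>S. PC1_subdivision T x S"
    using assms(1,2) C1_on_interval_imp_PC1_subdivision unfolding PC1_def by blast
  then have S: "PC1_subdivision T x S"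
    unfolding S_def by (rule someI_ex)
  show ?thesis
  proof (cases "t \<in> S")
    case True
    then show ?thesis unfolding ext_deriv_def S_def[symmetric] by simp
  next
    case False
    then have "C1_at x t"
      using S assms(3) unfolding PC1_subdivision_def by blast
    have "T \<in> S"
      using S unfolding PC1_subdivision_def subdivision_def by simp
    with False assms(3) have "t < T"
      by (cases "t = T") auto
    from \<open>C1_at x t\<close> have "x differentiable (at t)"
      unfolding C1_at_def by (auto dest: eventually_nhds_x_imp_x)
    then have "(x has_vector_derivative vector_derivative x (at t)) (at_right t)"
      using vector_derivative_works has_vector_derivative_at_within by blast
    then have "vector_derivative x (at_right t) = vector_derivative x (at t)"
      by (intro vector_derivative_within) (simp_all add: trivial_limit_at_right_real)
    then show ?thesis
      using False \<open>t < T\<close> unfolding ext_deriv_def S_def[symmetric] by simp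
  qed
qed

definition sup_norm :: "real \<Rightarrow> (real \<Rightarrow> 'a::real_normed_vector) \<Rightarrow> real" where
  "sup_norm T x = (SUP t\<in>{0..T}. norm (x t))"

definition PC1_norm :: "real \<Rightarrow> (real \<Rightarrow> 'a::real_normed_vector) \<Rightarrow> real" where
  "PC1_norm T x = sup_norm T x + sup_norm T (ext_deriv T x)"

definition has_gateaux_variation ::
  "('a::real_vector \<Rightarrow> 'b::real_normed_vector) \<Rightarrow> 'a \<Rightarrow> 'a \<Rightarrow> 'b \<Rightarrow> bool" where
  "has_gateaux_variation F x v D \<longleftrightarrow>
     ((\<lambda>\<theta>. (F (x + \<theta> *\<^sub>R v) - F x) /\<^sub>R \<theta>) \<longlongrightarrow> D) (at_right 0)"

text \<open>Existence of the right variation of a map \<open>F\<close> into a space \<open>E\<close> of functions on \<open>[0,T]\<close>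
  normed by \<open>N\<close>.\<close>

definition gateaux_variation_exists_in ::
  "(real \<Rightarrow> 'b::real_vector) set \<Rightarrow> ((real \<Rightarrow> 'b) \<Rightarrow> real) \<Rightarrow>
   ('a::real_vector \<Rightarrow> real \<Rightarrow> 'b) \<Rightarrow> 'a \<Rightarrow> 'a \<Rightarrow> bool" where
  "gateaux_variation_exists_in E N F x v \<longleftrightarrow>
     (\<exists>D\<in>E. ((\<lambda>\<theta>. N (\<lambda>t. (F (x + \<theta> *\<^sub>R v) t - F x t) /\<^sub>R \<theta> - D t)) \<longlongrightarrow> 0) (at_right 0))"

definition has_gateaux_diff ::
  "('a::real_normed_vector \<Rightarrow> 'b::real_normed_vector) \<Rightarrow> 'a \<Rightarrow> ('a \<Rightarrow>\<^sub>L 'b) \<Rightarrow> bool" where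
  "has_gateaux_diff F x D \<longleftrightarrow> (\<forall>v. has_gateaux_variation F x v (blinfun_apply D v))"

definition has_hadamard_diff ::
  "('a::real_normed_vector \<Rightarrow> 'b::real_normed_vector) \<Rightarrow> 'a \<Rightarrow> ('a \<Rightarrow>\<^sub>L 'b) \<Rightarrow> bool" where
  "has_hadamard_diff F x D \<longleftrightarrow> has_gateaux_diff F x D \<and>
     (\<forall>v. ((\<lambda>(\<theta>, w). (F (x + \<theta> *\<^sub>R w) - F x) /\<^sub>R \<theta>) \<longlongrightarrow> blinfun_apply D v)
            (at_right 0 \<times>\<^sub>F nhds v))"

definition gateaux_differentiable ::
  "('a::real_normed_vector \<Rightarrow> 'b::real_normed_vector) \<Rightarrow> 'a \<Rightarrow> bool" where
  "gateaux_differentiable F x \<longleftrightarrow> (\<exists>D. has_gateaux_diff F x D)"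

definition hadamard_differentiable ::
  "('a::real_normed_vector \<Rightarrow> 'b::real_normed_vector) \<Rightarrow> 'a \<Rightarrow> bool" where
  "hadamard_differentiable F x \<longleftrightarrow> (\<exists>D. has_hadamard_diff F x D)"

definition DG :: "('a::real_normed_vector \<Rightarrow> 'b::real_normed_vector) \<Rightarrow> 'a \<Rightarrow> ('a \<Rightarrow>\<^sub>L 'b)" where
  "DG F x = (THE D. has_gateaux_diff F x D)"

definition DH :: "('a::real_normed_vector \<Rightarrow> 'b::real_normed_vector) \<Rightarrow> 'a \<Rightarrow> ('a \<Rightarrow>\<^sub>L 'b)" where
  "DH F x = (THE D. has_hadamard_diff F x D)"

definition DF :: "('a::real_normed_vector \<Rightarrow> 'b::real_normed_vector) \<Rightarrow> 'a \<Rightarrow> ('a \<Rightarrow>\<^sub>L 'b)" where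
  "DF F x = Blinfun (frechet_derivative F (at x))"

definition norm1 ::
  "'x::real_normed_vector \<times> 'y::real_normed_vector \<times> 'z::real_normed_vector \<Rightarrow> real" where
  "norm1 = (\<lambda>(\<xi>, \<zeta>, \<pi>). norm \<xi> + norm \<zeta> + norm \<pi>)"

definition lin_indep_family :: "'i set \<Rightarrow> ('i \<Rightarrow> 'a::real_vector) \<Rightarrow> bool" where
  "lin_indep_family I v \<longleftrightarrow> (\<forall>c. (\<Sum>i\<in>I. c i *\<^sub>R v i) = 0 \<longrightarrow> (\<forall>i\<in>I. c i = 0))"

definition is_inner_product :: "('a::real_vector \<Rightarrow> 'a \<Rightarrow> real) \<Rightarrow> bool" where
  "is_inner_product ip \<longleftrightarrow> bilinear ip \<and> (\<forall>a b. ip a b = ip b a) \<and> (\<forall>a. a \<noteq> 0 \<longrightarrow> 0 < ip a a)"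

text \<open>The data are the horizon \<open>T\<close>, the open sets \<open>\<Omega>\<close> and \<open>U\<close>, the initial state \<open>\<xi>0\<close>, the
  integrand \<open>f0\<close>, the vector field \<open>f\<close>, the numbers \<open>m\<close> and \<open>q\<close> of inequality and equality
  constraints, \<open>g 0\<close> (terminal reward), \<open>g 1, \<dots>, g m\<close> and \<open>h 1, \<dots>, h q\<close>.\<close>

definition bolza_admissible ::
  "real \<Rightarrow> 'x::real_normed_vector set \<Rightarrow> 'y::real_normed_vector set \<Rightarrow> 'x \<Rightarrow>
   (real \<Rightarrow> 'x \<Rightarrow> 'y \<Rightarrow> 'z \<Rightarrow> 'x) \<Rightarrow> nat \<Rightarrow> nat \<Rightarrow>
   (nat \<Rightarrow> 'x \<Rightarrow> 'z \<Rightarrow> real) \<Rightarrow> (nat \<Rightarrow> 'x \<Rightarrow> 'z \<Rightarrow> real) \<Rightarrow>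
   'z \<Rightarrow> (real \<Rightarrow> 'x) \<Rightarrow> (real \<Rightarrow> 'y) \<Rightarrow> bool" where
  "bolza_admissible T \<Omega> U \<xi>0 f m q g h \<pi> x u \<longleftrightarrow>
     x \<in> PC1 T \<Omega> \<and> u \<in> NPC0R T U \<and>
     (\<forall>t\<in>{0..T}. ext_deriv T x t = f t (x t) (u t) \<pi>) \<and>
     x 0 = \<xi>0 \<and>
     (\<forall>i\<in>{1..m}. g i (x T) \<pi> \<ge> 0) \<and>
     (\<forall>j\<in>{1..q}. h j (x T) \<pi> = 0)"

definition bolza_objective ::
  "real \<Rightarrow> (real \<Rightarrow> 'x \<Rightarrow> 'y \<Rightarrow> 'z \<Rightarrow> real) \<Rightarrow> (nat \<Rightarrow> 'x \<Rightarrow> 'z \<Rightarrow> real) \<Rightarrow>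
   'z \<Rightarrow> (real \<Rightarrow> 'x) \<Rightarrow> (real \<Rightarrow> 'y) \<Rightarrow> real" where
  "bolza_objective T f0 g \<pi> x u = (LINT t:{0..T}|lborel. f0 t (x t) (u t) \<pi>) + g 0 (x T) \<pi>"

definition bolza_solution ::
  "real \<Rightarrow> 'x::real_normed_vector set \<Rightarrow> 'y::real_normed_vector set \<Rightarrow> 'x \<Rightarrow>
   (real \<Rightarrow> 'x \<Rightarrow> 'y \<Rightarrow> 'z \<Rightarrow> real) \<Rightarrow> (real \<Rightarrow> 'x \<Rightarrow> 'y \<Rightarrow> 'z \<Rightarrow> 'x) \<Rightarrow> nat \<Rightarrow> nat \<Rightarrow>
   (nat \<Rightarrow> 'x \<Rightarrow> 'z \<Rightarrow> real) \<Rightarrow> (nat \<Rightarrow> 'x \<Rightarrow> 'z \<Rightarrow> real) \<Rightarrow>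
   'z \<Rightarrow> (real \<Rightarrow> 'x) \<Rightarrow> (real \<Rightarrow> 'y) \<Rightarrow> bool" where
  "bolza_solution T \<Omega> U \<xi>0 f0 f m q g h \<pi> x u \<longleftrightarrow>
     bolza_admissible T \<Omega> U \<xi>0 f m q g h \<pi> x u \<and>
     (\<forall>y v. bolza_admissible T \<Omega> U \<xi>0 f m q g h \<pi> y v \<longrightarrow>
        bolza_objective T f0 g \<pi> y v \<le> bolza_objective T f0 g \<pi> x u)"

text \<open>The supremum is taken in \<open>real\<close>; it is meaningful for every \<open>\<pi>\<close> for which a solution
  exists, because it is then a maximum.\<close>

definition bolza_value ::
  "real \<Rightarrow> 'x::real_normed_vector set \<Rightarrow> 'y::real_normed_vector set \<Rightarrow> 'x \<Rightarrow>
   (real \<Rightarrow> 'x \<Rightarrow> 'y \<Rightarrow> 'z \<Rightarrow> real) \<Rightarrow> (real \<Rightarrow> 'x \<Rightarrow> 'y \<Rightarrow> 'z \<Rightarrow> 'x) \<Rightarrow> nat \<Rightarrow> nat \<Rightarrow>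
   (nat \<Rightarrow> 'x \<Rightarrow> 'z \<Rightarrow> real) \<Rightarrow> (nat \<Rightarrow> 'x \<Rightarrow> 'z \<Rightarrow> real) \<Rightarrow> 'z \<Rightarrow> real" where
  "bolza_value T \<Omega> U \<xi>0 f0 f m q g h \<pi> =
     Sup {bolza_objective T f0 g \<pi> x u | x u. bolza_admissible T \<Omega> U \<xi>0 f m q g h \<pi> x u}"

definition hamiltonian ::
  "(real \<Rightarrow> 'x \<Rightarrow> 'y \<Rightarrow> 'z \<Rightarrow> real) \<Rightarrow> (real \<Rightarrow> 'x::real_normed_vector \<Rightarrow> 'y \<Rightarrow> 'z \<Rightarrow> 'x) \<Rightarrow>
   'z \<Rightarrow> real \<Rightarrow> 'x \<Rightarrow> 'y \<Rightarrow> ('x \<Rightarrow>\<^sub>L real) \<Rightarrow> real \<Rightarrow> real" where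
  "hamiltonian f0 f \<pi> t \<xi> \<zeta> p l = blinfun_apply p (f t \<xi> \<zeta> \<pi>) + l * f0 t \<xi> \<zeta> \<pi>"

text \<open>Only \<open>lam 0, \<dots>, lam m\<close>, \<open>mu 1, \<dots>, mu q\<close> and the restriction of \<open>p\<close> to \<open>[0,T]\<close> matter.\<close>

definition pontryagin_triple ::
  "real \<Rightarrow> 'y set \<Rightarrow>
   (real \<Rightarrow> 'x \<Rightarrow> 'y \<Rightarrow> 'z \<Rightarrow> real) \<Rightarrow> (real \<Rightarrow> 'x::real_normed_vector \<Rightarrow> 'y \<Rightarrow> 'z \<Rightarrow> 'x) \<Rightarrow>
   nat \<Rightarrow> nat \<Rightarrow> (nat \<Rightarrow> 'x \<Rightarrow> 'z \<Rightarrow> real) \<Rightarrow> (nat \<Rightarrow> 'x \<Rightarrow> 'z \<Rightarrow> real) \<Rightarrow>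
   'z \<Rightarrow> (real \<Rightarrow> 'x) \<Rightarrow> (real \<Rightarrow> 'y) \<Rightarrow>
   (nat \<Rightarrow> real) \<Rightarrow> (nat \<Rightarrow> real) \<Rightarrow> (real \<Rightarrow> ('x \<Rightarrow>\<^sub>L real)) \<Rightarrow> bool" where
  "pontryagin_triple T U f0 f m q g h \<pi> x u lam mu p \<longleftrightarrow>
     p \<in> PC1 T UNIV \<and>
     \<not> ((\<forall>i\<in>{0..m}. lam i = 0) \<and> (\<forall>j\<in>{1..q}. mu j = 0)) \<and>
     (\<forall>i\<in>{0..m}. lam i \<ge> 0) \<and>
     (\<forall>i\<in>{1..m}. lam i * g i (x T) \<pi> = 0) \<and>
     (\<Sum>i=0..m. lam i *\<^sub>R DH (\<lambda>\<xi>. g i \<xi> \<pi>) (x T)) +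
       (\<Sum>j=1..q. mu j *\<^sub>R DH (\<lambda>\<xi>. h j \<xi> \<pi>) (x T)) = p T \<and>
     (\<forall>t\<in>{0..T}. ext_deriv T p t =
        - DF (\<lambda>\<xi>. hamiltonian f0 f \<pi> t \<xi> (u t) (p t) (lam 0)) (x t)) \<and>
     (\<forall>t\<in>{0..T}. \<forall>\<zeta>\<in>U.
        hamiltonian f0 f \<pi> t (x t) (u t) (p t) (lam 0) \<ge>
        hamiltonian f0 f \<pi> t (x t) \<zeta> (p t) (lam 0)) \<and>
     continuous_on {0..T} (\<lambda>t. hamiltonian f0 f \<pi> t (x t) (u t) (p t) (lam 0))"

end

theory Submission
  imports Defs
begin

text \<open>Along the optimal pairs the value is \<open>V[\<pi>] = \<integral> f0 + g 0\<close>, so \<open>V\<close> is differentiated along the curve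
  \<open>\<pi>0 + \<theta> *\<^sub>R \<delta>\<pi>\<close> by the Hadamard chain rule and dominated convergence. The terms containing the
  variations of state and control are then eliminated: the adjoint equation turns the state terms
  into \<open>p T (y T)\<close>, where \<open>y\<close> is the variation of the state, the control terms cancel because the Hamiltonian is stationary in the control, and
  \<open>p T\<close> is replaced by the transversality condition. For an inequality constraint with a positive multiplier
  the differential of \<open>g i (x \<pi> T) \<pi>\<close> in the direction \<open>\<delta>\<pi>\<close> vanishes since, by the continuous
  dependence of the terminal differentials on \<open>\<pi>\<close>, such a constraint stays active for all nearby \<open>\<pi>\<close>:
  otherwise the solution at \<open>\<pi>\<close> could be improved.

  Improvements come from needle variations. The terminal functions are only Hadamard differentiable and
  continuous, so the equality constraints are met by a Poincare--Miranda argument rather than by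
  an implicit function theorem. By the linear independence there are control directions at the final time
  that are dual to the constraint differentials. These correct the constraints after any
  additional needle, which yields the maximum principle directly in its normal form, with the multipliers
  read off, up to sign, as the values of the objective's differential on the dual directions.\<close>

section \<open>Piecewise continuous and piecewise differentiable functions\<close>

text \<open>Two asymmetries of the hypotheses shape the proof. At parameters other than
  \<open>\<pi>0\<close> the control derivative of the dynamics is available at time \<open>T\<close>
  only, so the directions that correct the constraints come from needles starting shortly before
  \<open>T\<close>, where the transport to the terminal state is nearly the identity. Their duality
  is established at \<open>\<pi>0\<close> alone; at a nearby \<open>\<pi>\<close> the same control
  directions are kept, and the pairings are merely close to their values at \<open>\<pi>0\<close>.
  Hence every improvement criterion is a strict inequality with a margin \<open>\<epsilon>\<close>
  instead of an exact duality relation, and no multipliers are computed at parameters other than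
  \<open>\<pi>0\<close>. Secondly, \<open>f0\<close> has an integrable Lipschitz bound in all
  variables, and no such bound is given for \<open>f\<close>. Dominated convergence handles the
  reward, whereas the dynamics are differentiated through the \<open>PC1\<close> norm, whose
  derivative part controls the difference quotients of \<open>f\<close> along the solutions. The
  integrability of \<open>p\<close> applied to the parameter differential of \<open>f\<close> is a
  consequence of the final identity, not of a bound.\<close>

lemma at_right_le_within_Icc:
  fixes t T :: real
  assumes "0 \<le> t" "t < T"
  shows "at_right t \<le> at t within {0..T}"
proof -
  have "at_right t = at t within {t..T}"
    using assms by (simp add: at_within_Icc_at_right)
  then show ?thesis using assms by (auto intro!: at_le)
qed

lemma at_left_le_within_Icc:
  fixes t T :: real
  assumes "0 < t" "t \<le> T"
  shows "at_left t \<le> at t within {0..T}"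
proof -
  have "at_left t = at t within {0..t}"
    using assms by (simp add: at_within_Icc_at_left)
  then show ?thesis using assms by (auto intro!: at_le)
qed

text \<open>At a point of continuity both one-sided limits exist automatically and lie in
  \<open>W\<close>, so the alternative in the definition collapses to pointwise conditions. The
  exceptional set may be any finite set; intersecting it with \<open>{0..T}\<close> and adding the
  endpoints makes it a subdivision.\<close>

lemma PC0_iff:
  fixes x :: "real \<Rightarrow> 'a::t2_space"
  assumes "0 < T"
  shows "x \<in> PC0 T W \<longleftrightarrow> (\<forall>t\<in>{0..T}. x t \<in> W) \<and>
    (\<exists>S. finite S \<and> (\<forall>t\<in>{0..T} - S. continuous (at t within {0..T}) x)) \<and>
    (\<forall>t\<in>{0..<T}. \<exists>l\<in>W. (x \<longlongrightarrow> l) (at_right t)) \<and>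
    (\<forall>t\<in>{0<..T}. \<exists>l\<in>W. (x \<longlongrightarrow> l) (at_left t))" (is "_ \<longleftrightarrow> ?W \<and> ?C \<and> ?R \<and> ?L")
proof
  assume x: "x \<in> PC0 T W"
  have W: ?W using x by (auto simp: PC0_def)
  have r: "\<exists>l\<in>W. (x \<longlongrightarrow> l) (at_right t)"
    if "t \<in> {0..<T}" "continuous (at t within {0..T}) x" for t
    using that W at_right_le_within_Icc[of t T] by (auto simp: continuous_within intro: tendsto_mono)
  have l: "\<exists>l\<in>W. (x \<longlongrightarrow> l) (at_left t)"
    if "t \<in> {0<..T}" "continuous (at t within {0..T}) x" for t
    using that W at_left_le_within_Icc[of t T] by (auto simp: continuous_within intro: tendsto_mono)
  consider "continuous_on {0..T} x" | S where "subdivision T S"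
         "\<forall>t\<in>{0..T} - S. continuous (at t within {0..T}) x"
         "\<forall>\<tau>\<in>S - {T}. \<exists>l\<in>W. (x \<longlongrightarrow> l) (at_right \<tau>)"
         "\<forall>\<tau>\<in>S - {0}. \<exists>l\<in>W. (x \<longlongrightarrow> l) (at_left \<tau>)"
    using x by (auto simp: PC0_def)
  then show "?W \<and> ?C \<and> ?R \<and> ?L"
  proof cases
    case 1
    then have "\<forall>t\<in>{0..T}. continuous (at t within {0..T}) x"
      by (simp add: continuous_on_eq_continuous_within)
    moreover from this have ?R ?L using r l by auto
    ultimately show ?thesis using W by (auto intro!: exI[of _ "{}"])
  next
    case 2
    have "\<exists>l\<in>W. (x \<longlongrightarrow> l) (at_right t)" if "t \<in> {0..<T}" for t
      using r[of t] that 2(2,3) by (cases "t \<in> S") auto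
    moreover have "\<exists>l\<in>W. (x \<longlongrightarrow> l) (at_left t)" if "t \<in> {0<..T}" for t
      using l[of t] that 2(2,4) by (cases "t \<in> S") auto
    ultimately show ?thesis using W 2 by (auto simp: subdivision_def)
  qed
next
  assume *: "?W \<and> ?C \<and> ?R \<and> ?L"
  then obtain S where "finite S" "\<forall>t\<in>{0..T} - S. continuous (at t within {0..T}) x" by auto
  then show "x \<in> PC0 T W"
    using * assms unfolding PC0_def
    by (auto simp: subdivision_def intro!: exI[of _ "(S \<inter> {0..T}) \<union> {0, T}"])
qed

lemma NPC0R_iff:
  "x \<in> NPC0R T W \<longleftrightarrow>
     x \<in> PC0 T W \<and> (\<forall>t\<in>{0..<T}. (x \<longlongrightarrow> x t) (at_right t)) \<and> (x \<longlongrightarrow> x T) (at_left T)"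
  by (auto simp: NPC0R_def continuous_within)

lemma PC0_D: "x \<in> PC0 T W \<Longrightarrow> t \<in> {0..T} \<Longrightarrow> x t \<in> W"
  by (auto simp: PC0_def)

lemma NPC0R_D: "x \<in> NPC0R T W \<Longrightarrow> t \<in> {0..T} \<Longrightarrow> x t \<in> W"
  by (auto simp: PC0_def NPC0R_def)

lemma NPC0R_PC0: "x \<in> NPC0R T W \<Longrightarrow> x \<in> PC0 T W"
  by (auto simp: NPC0R_def)

text \<open>By bisection it suffices to look near one point \<open>t\<close>, and there only
  \<open>t\<close> itself can be exceptional. The principle replaces an enumeration of the
  subdivision points in increasing order.\<close>

lemma PC0_induct [consumes 2, case_names trans piece]:
  fixes x :: "real \<Rightarrow> 'a::t2_space"
  assumes T: "0 < T" and x: "x \<in> PC0 T W"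
    and trans: "\<And>a b c. P a b \<Longrightarrow> P b c \<Longrightarrow> a \<le> b \<Longrightarrow> b \<le> c \<Longrightarrow> P a c"
    and piece: "\<And>a b v. 0 \<le> a \<Longrightarrow> a \<le> b \<Longrightarrow> b \<le> T \<Longrightarrow> continuous_on {a..b} v \<Longrightarrow> v ` {a..b} \<subseteq> W \<Longrightarrow>
      (\<And>t. t \<in> {a<..<b} \<Longrightarrow> v t = x t) \<Longrightarrow> P a b"
  shows "P 0 T"
proof -
  \<comment> \<open>Bisection tests the property on all short intervals, also on those that leave
    \<open>[0,T]\<close>; the guard makes it vacuous there.\<close>
  define Q where "Q a b \<longleftrightarrow> (0 \<le> a \<and> a \<le> b \<and> b \<le> T \<longrightarrow> P a b)" for a b
  obtain S where S: "finite S" "\<And>t. t \<in> {0..T} - S \<Longrightarrow> continuous (at t within {0..T}) x"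
    using x unfolding PC0_iff[OF T] by auto
  have W: "\<And>t. t \<in> {0..T} \<Longrightarrow> x t \<in> W" using x by (rule PC0_D)
  from T have "0 \<le> T" by simp
  then have "Q 0 T"
  proof (induction rule: Bolzano)
    case (trans a b c)
    then show ?case using assms(3)[of a b c] by (auto simp: Q_def)
  next
    case (local t)
    obtain d where d: "d > 0" "\<And>s. s \<in> S \<Longrightarrow> s \<noteq> t \<Longrightarrow> d \<le> dist t s"
      using finite_set_avoid[OF S(1)] by blast
    have cont: "continuous (at s within {0..T}) x" if "s \<noteq> t" "dist t s < d" "s \<in> {0..T}" for s
      using that d S(2) by force
    have "P a b" if ab: "a \<le> t" "t \<le> b" "b - a < d" "0 \<le> a" "b \<le> T" for a b
    proof -
      have left: "P a t"
      proof (cases "a = t")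
        case True
        then show ?thesis using W ab T by (intro piece[of _ _ "\<lambda>_. x t"]) auto
      next
        case False
        then have "a < t" using ab by simp
        then have "t \<in> {0<..T}" using ab by auto
        then obtain l where l: "l \<in> W" "(x \<longlongrightarrow> l) (at_left t)"
          using x unfolding PC0_iff[OF T] by blast
        \<comment> \<open>Replacing the value at \<open>t\<close> by the left limit makes the piece
          continuous up to its right end; the limit belongs to \<open>W\<close> by the definition of
          \<open>PC0\<close>.\<close>
        define v where "v s = (if s = t then l else x s)" for s
        have "(v \<longlongrightarrow> v s) (at s within {a..t})" if s: "s \<in> {a..t}" for s
        proof (cases "s = t")
          case True
          have "\<forall>\<^sub>F s in at_left t. v s = x s"
            by (auto simp: eventually_at_filter v_def)
          then show ?thesis
            using True l \<open>a < t\<close> by (simp add: at_within_Icc_at_left v_def tendsto_cong)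
        next
          case False
          then have "(x \<longlongrightarrow> x s) (at s within {0..T})"
            using s ab cont[of s] by (auto simp: continuous_within dist_real_def)
          then have "(x \<longlongrightarrow> x s) (at s within {a..t})"
            by (rule tendsto_mono[rotated]) (use s ab in \<open>auto intro!: at_le\<close>)
          moreover have "\<forall>\<^sub>F r in at s within {a..t}. v r = x r"
            using s False unfolding eventually_at_topological
            by (intro exI[of _ "{..<t}"]) (auto simp: v_def)
          ultimately show ?thesis using False by (simp add: v_def[of s] tendsto_cong)
        qed
        then have "continuous_on {a..t} v" by (simp add: continuous_on_def)
        then show ?thesis
          using W ab T l(1) by (intro piece[of a t v]) (auto simp: v_def)
      qed
      have right: "P t b"
      proof (cases "b = t")
        case True
        then show ?thesis using W ab T by (intro piece[of _ _ "\<lambda>_. x t"]) auto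
      next
        case False
        then have "t < b" using ab by simp
        then have "t \<in> {0..<T}" using ab by auto
        then obtain l where l: "l \<in> W" "(x \<longlongrightarrow> l) (at_right t)"
          using x unfolding PC0_iff[OF T] by blast
        define v where "v s = (if s = t then l else x s)" for s
        have "(v \<longlongrightarrow> v s) (at s within {t..b})" if s: "s \<in> {t..b}" for s
        proof (cases "s = t")
          case True
          have "\<forall>\<^sub>F s in at_right t. v s = x s"
            by (auto simp: eventually_at_filter v_def)
          then show ?thesis
            using True l \<open>t < b\<close> by (simp add: at_within_Icc_at_right v_def tendsto_cong)
        next
          case False
          then have "(x \<longlongrightarrow> x s) (at s within {0..T})"
            using s ab cont[of s] by (auto simp: continuous_within dist_real_def)
          then have "(x \<longlongrightarrow> x s) (at s within {t..b})"
            by (rule tendsto_mono[rotated]) (use s ab in \<open>auto intro!: at_le\<close>)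
          moreover have "\<forall>\<^sub>F r in at s within {t..b}. v r = x r"
            using s False unfolding eventually_at_topological
            by (intro exI[of _ "{t<..}"]) (auto simp: v_def)
          ultimately show ?thesis using False by (simp add: v_def[of s] tendsto_cong)
        qed
        then have "continuous_on {t..b} v" by (simp add: continuous_on_def)
        then show ?thesis
          using W ab T l(1) by (intro piece[of t b v]) (auto simp: v_def)
      qed
      show ?thesis using assms(3)[OF left right] ab by simp
    qed
    then show ?case using d(1) by (auto simp: Q_def)
  qed
  then show ?thesis using T by (simp add: Q_def)
qed

section \<open>Integration, compactness and composition of piecewise continuous functions\<close>

lemma PC0_integrable:
  fixes x :: "real \<Rightarrow> 'a::banach"
  assumes "0 < T" "x \<in> PC0 T W"
  shows "x integrable_on {0..T}"
  using assms
proof (induction rule: PC0_induct)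
  case (trans a b c)
  then show ?case using Henstock_Kurzweil_Integration.integrable_combine by blast
next
  case (piece a b v)
  show ?case
    by (rule integrable_spike_finite[of "{a, b}" _ _ v])
      (use piece in \<open>auto intro: integrable_continuous_real\<close>)
qed

text \<open>The one-sided limits belong to \<open>W\<close>, so every continuous piece has a compact
  image inside \<open>W\<close>, and only the values at the division points are added. Boundedness
  alone would not give a compact subset of an open control set, which the Lipschitz estimates
  require.\<close>

lemma PC0_compact:
  fixes x :: "real \<Rightarrow> 'a::t2_space"
  assumes "0 < T" "x \<in> PC0 T W"
  shows "\<exists>K. compact K \<and> K \<subseteq> W \<and> x ` {0..T} \<subseteq> K"
  using assms
proof (induction rule: PC0_induct)
  case (trans a b c)
  then obtain K L where "compact K \<and> K \<subseteq> W \<and> x ` {a..b} \<subseteq> K" "compact L \<and> L \<subseteq> W \<and> x ` {b..c} \<subseteq> L"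
    by blast
  moreover have "{a..c} = {a..b} \<union> {b..c}" using trans by auto
  ultimately show ?case by (intro exI[of _ "K \<union> L"]) (auto intro: compact_Un)
next
  case (piece a b v)
  have "x t \<in> insert (x a) (insert (x b) (v ` {a..b}))" if t: "t \<in> {a..b}" for t
  proof (cases "t = a \<or> t = b")
    case False
    then have "x t = v t" using t piece(6)[of t] by auto
    then show ?thesis using t by auto
  qed auto
  moreover have "x a \<in> W" "x b \<in> W" using PC0_D[OF assms(2)] piece by auto
  moreover have "compact (v ` {a..b})" using piece by (intro compact_continuous_image) auto
  ultimately show ?case
    using piece by (intro exI[of _ "insert (x a) (insert (x b) (v ` {a..b}))"] conjI compact_insert subsetI) blast+
qed

lemma PC0_bounded:
  fixes x :: "real \<Rightarrow> 'a::real_normed_vector"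
  assumes "0 < T" "x \<in> PC0 T W"
  obtains B where "B \<ge> 0" "\<And>t. t \<in> {0..T} \<Longrightarrow> norm (x t) \<le> B"
proof -
  obtain K where K: "compact K" "x ` {0..T} \<subseteq> K" using PC0_compact[OF assms] by blast
  then obtain B where "\<forall>k\<in>K. norm k \<le> B" using compact_imp_bounded bounded_iff by blast
  then show ?thesis using K that[of "max B 0"] by fastforce
qed

text \<open>Measurability comes from continuity off a finite set after extension by zero, and
  boundedness does the rest. The objective is a Lebesgue integral whereas the differential equations
  are integrated in the gauge sense, so both forms of integrability are provided.\<close>

lemma PC0_set_integrable:
  fixes x :: "real \<Rightarrow> real"
  assumes "0 < T" "x \<in> PC0 T W"
  shows "set_integrable lborel {0..T} x"
proof -
  obtain B where B: "\<And>t. t \<in> {0..T} \<Longrightarrow> norm (x t) \<le> B" using PC0_bounded[OF assms] by blast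
  obtain S where S: "finite S" "\<And>t. t \<in> {0..T} - S \<Longrightarrow> continuous (at t within {0..T}) x"
    using assms(2) unfolding PC0_iff[OF assms(1)] by auto
  define z where "z t = indicator {0..T} t *\<^sub>R x t" for t
  have "continuous_on (- (S \<union> {0, T})) z"
  proof (rule continuous_at_imp_continuous_on, rule ballI)
    fix t assume t: "t \<in> - (S \<union> {0, T})"
    show "isCont z t"
    proof (cases "t \<in> {0..T}")
      case True
      then have "t \<in> {0<..<T}" using t by auto
      then have "isCont x t" using t S(2)[of t] by (auto simp: at_within_Icc_at)
      moreover have "\<forall>\<^sub>F s in nhds t. z s = x s"
        using eventually_nhds_in_open[of "{0<..<T}" t] \<open>t \<in> {0<..<T}\<close>
        by (auto simp: z_def elim!: eventually_mono)
      ultimately show ?thesis using isCont_cong by blast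
    next
      case False
      have "\<forall>\<^sub>F s in nhds t. s \<in> - {0..T}"
        using False by (intro eventually_nhds_in_open) (auto intro: open_Compl)
      then have "\<forall>\<^sub>F s in nhds t. z s = 0"
        by eventually_elim (simp add: z_def)
      then show ?thesis using isCont_cong[of z "\<lambda>_. 0" t] by simp
    qed
  qed
  then have "z \<in> borel_measurable borel"
    using S(1) by (intro borel_measurable_continuous_countable_exceptions[of "S \<union> {0, T}"])
      (auto intro: countable_finite)
  then have "integrable lborel z"
    using B by (intro integrableI_bounded_set[where A="{0..T}" and B=B])
      (auto simp: z_def emeasure_lborel_Icc_eq)
  then show ?thesis by (simp add: set_integrable_def z_def[abs_def])
qed

text \<open>The one-sided limits of \<open>x\<close> stay in \<open>W\<close>, so continuity of
  \<open>G\<close> on \<open>W\<close> itself suffices and no closure is involved.\<close>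

lemma PC0_comp:
  fixes x :: "real \<Rightarrow> 'a::t2_space" and G :: "'a \<Rightarrow> 'b::t2_space"
  assumes T: "0 < T" and x: "x \<in> PC0 T W" and G: "continuous_on W G" "\<And>w. w \<in> W \<Longrightarrow> G w \<in> V"
  shows "(\<lambda>t. G (x t)) \<in> PC0 T V"
proof -
  have W: "\<And>t. t \<in> {0..T} \<Longrightarrow> x t \<in> W" using x by (rule PC0_D)
  have ev: "\<forall>\<^sub>F s in F. x s \<in> W" if "F \<le> at t within {0..T}" for F t
    by (rule filter_leD[OF that]) (auto simp: eventually_at_filter W)
  have cont: "continuous (at t within {0..T}) (\<lambda>t. G (x t))"
    if "continuous (at t within {0..T}) x" "t \<in> {0..T}" for t
    using continuous_on_tendsto_compose[OF G(1)] that W ev[OF order_refl]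
    unfolding continuous_within by blast
  have lim: "\<exists>l\<in>V. ((\<lambda>t. G (x t)) \<longlongrightarrow> l) F"
    if "\<exists>l\<in>W. (x \<longlongrightarrow> l) F" "F \<le> at t within {0..T}" for t F
    using continuous_on_tendsto_compose[OF G(1)] that G(2) ev by blast
  obtain S where S: "finite S" "\<And>t. t \<in> {0..T} - S \<Longrightarrow> continuous (at t within {0..T}) x"
    using x unfolding PC0_iff[OF T] by auto
  have "\<exists>l\<in>V. ((\<lambda>t. G (x t)) \<longlongrightarrow> l) (at_right t)" if "t \<in> {0..<T}" for t
    using x that unfolding PC0_iff[OF T] by (auto intro!: lim at_right_le_within_Icc)
  moreover have "\<exists>l\<in>V. ((\<lambda>t. G (x t)) \<longlongrightarrow> l) (at_left t)" if "t \<in> {0<..T}" for t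
    using x that unfolding PC0_iff[OF T] by (auto intro!: lim at_left_le_within_Icc)
  ultimately show ?thesis
    unfolding PC0_iff[OF T] using W G S cont by (auto intro!: exI[of _ S])
qed

lemma PC0_Pair:
  fixes x :: "real \<Rightarrow> 'a::t2_space" and y :: "real \<Rightarrow> 'b::t2_space"
  assumes T: "0 < T" and x: "x \<in> PC0 T A" and y: "y \<in> PC0 T B"
  shows "(\<lambda>t. (x t, y t)) \<in> PC0 T (A \<times> B)"
proof -
  obtain S where S: "finite S" "\<And>t. t \<in> {0..T} - S \<Longrightarrow> continuous (at t within {0..T}) x"
    using x unfolding PC0_iff[OF T] by auto
  obtain R where R: "finite R" "\<And>t. t \<in> {0..T} - R \<Longrightarrow> continuous (at t within {0..T}) y"
    using y unfolding PC0_iff[OF T] by auto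
  have lim: "\<exists>l\<in>A \<times> B. ((\<lambda>t. (x t, y t)) \<longlongrightarrow> l) F"
    if "\<exists>l\<in>A. (x \<longlongrightarrow> l) F" "\<exists>l\<in>B. (y \<longlongrightarrow> l) F" for F
    using that by (auto intro: tendsto_Pair)
  have "\<forall>t\<in>{0..<T}. \<exists>l\<in>A \<times> B. ((\<lambda>t. (x t, y t)) \<longlongrightarrow> l) (at_right t)"
    "\<forall>t\<in>{0<..T}. \<exists>l\<in>A \<times> B. ((\<lambda>t. (x t, y t)) \<longlongrightarrow> l) (at_left t)"
    using x y lim unfolding PC0_iff[OF T] by blast+
  moreover have "\<forall>t\<in>{0..T} - (S \<union> R). continuous (at t within {0..T}) (\<lambda>t. (x t, y t))"
    using S R by (auto intro!: continuous_Pair)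
  moreover have "\<forall>t\<in>{0..T}. (x t, y t) \<in> A \<times> B" using PC0_D[OF x] PC0_D[OF y] by auto
  ultimately show ?thesis
    unfolding PC0_iff[OF T] using S(1) R(1) by blast
qed

lemma PC0_continuous:
  fixes x :: "real \<Rightarrow> 'a::t2_space"
  assumes "continuous_on {0..T} x" "\<And>t. t \<in> {0..T} \<Longrightarrow> x t \<in> W"
  shows "x \<in> PC0 T W"
  using assms by (auto simp: PC0_def)

text \<open>Time reversal exchanges left and right limits, hence it acts on \<open>PC0\<close> but
  not on \<open>NPC0R\<close>. It turns the terminal value problem for the resolvent into an initial
  value problem.\<close>

lemma PC0_reflect:
  fixes x :: "real \<Rightarrow> 'a::t2_space"
  assumes T: "0 < T" and x: "x \<in> PC0 T W"
  shows "(\<lambda>t. x (T - t)) \<in> PC0 T W"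
proof -
  obtain S where S: "finite S" "\<And>t. t \<in> {0..T} - S \<Longrightarrow> continuous (at t within {0..T}) x"
    using x unfolding PC0_iff[OF T] by auto
  have fr: "filterlim (\<lambda>t. T - t) (at_left (T - t)) (at_right t)" for t
    unfolding filterlim_at by (auto intro!: tendsto_eq_intros simp: eventually_at_filter)
  have fl: "filterlim (\<lambda>t. T - t) (at_right (T - t)) (at_left t)" for t
    unfolding filterlim_at by (auto intro!: tendsto_eq_intros simp: eventually_at_filter)
  have "continuous (at t within {0..T}) (\<lambda>t. x (T - t))" if t: "t \<in> {0..T} - (\<lambda>s. T - s) ` S" for t
  proof -
    have "T - t \<notin> S" using t by (metis DiffD2 diff_diff_eq2 add_diff_cancel_left' image_eqI)
    then have "(x \<longlongrightarrow> x (T - t)) (at (T - t) within {0..T})"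
      using S(2)[of "T - t"] t by (auto simp: continuous_within)
    moreover have "filterlim (\<lambda>t. T - t) (at (T - t) within {0..T}) (at t within {0..T})"
      unfolding filterlim_at by (auto intro!: tendsto_eq_intros simp: eventually_at_filter)
    ultimately show ?thesis unfolding continuous_within by (rule filterlim_compose)
  qed
  moreover have "\<exists>l\<in>W. ((\<lambda>t. x (T - t)) \<longlongrightarrow> l) (at_right t)" if "t \<in> {0..<T}" for t
  proof -
    have "T - t \<in> {0<..T}" using that by auto
    then show ?thesis
      using x filterlim_compose[OF _ fr[of t]] unfolding PC0_iff[OF T] by blast
  qed
  moreover have "\<exists>l\<in>W. ((\<lambda>t. x (T - t)) \<longlongrightarrow> l) (at_left t)" if "t \<in> {0<..T}" for t
  proof -
    have "T - t \<in> {0..<T}" using that by auto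
    then show ?thesis
      using x filterlim_compose[OF _ fl[of t]] unfolding PC0_iff[OF T] by blast
  qed
  ultimately show ?thesis
    unfolding PC0_iff[OF T] using S(1) PC0_D[OF x] by (auto intro!: exI[of _ "(\<lambda>s. T - s) ` S"])
qed

lemma NPC0R_comp:
  fixes x :: "real \<Rightarrow> 'a::t2_space" and G :: "'a \<Rightarrow> 'b::t2_space"
  assumes T: "0 < T" and x: "x \<in> NPC0R T W" and G: "continuous_on W G" "\<And>w. w \<in> W \<Longrightarrow> G w \<in> V"
  shows "(\<lambda>t. G (x t)) \<in> NPC0R T V"
proof -
  have W: "\<And>t. t \<in> {0..T} \<Longrightarrow> x t \<in> W" using x by (rule NPC0R_D)
  have ev: "\<forall>\<^sub>F s in F. x s \<in> W" if "F \<le> at t within {0..T}" for F t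
    by (rule filter_leD[OF that]) (auto simp: eventually_at_filter W)
  have "((\<lambda>t. G (x t)) \<longlongrightarrow> G (x t)) F" if "(x \<longlongrightarrow> x t) F" "F \<le> at t within {0..T}" "t \<in> {0..T}" for t F
    using continuous_on_tendsto_compose[OF G(1)] that W ev by blast
  then have "\<forall>t\<in>{0..<T}. ((\<lambda>t. G (x t)) \<longlongrightarrow> G (x t)) (at_right t)"
    "((\<lambda>t. G (x t)) \<longlongrightarrow> G (x T)) (at_left T)"
    using x T at_right_le_within_Icc at_left_le_within_Icc[of T T] unfolding NPC0R_iff by force+
  then show ?thesis
    using PC0_comp[OF T _ G] x unfolding NPC0R_iff by auto
qed

lemma NPC0R_Pair:
  fixes x :: "real \<Rightarrow> 'a::t2_space" and y :: "real \<Rightarrow> 'b::t2_space"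
  assumes T: "0 < T" and x: "x \<in> NPC0R T A" and y: "y \<in> NPC0R T B"
  shows "(\<lambda>t. (x t, y t)) \<in> NPC0R T (A \<times> B)"
  using PC0_Pair[OF T] assms unfolding NPC0R_iff by (auto intro!: tendsto_Pair)

lemma NPC0R_continuous:
  fixes x :: "real \<Rightarrow> 'a::t2_space"
  assumes "0 < T" "continuous_on {0..T} x" "\<And>t. t \<in> {0..T} \<Longrightarrow> x t \<in> W"
  shows "x \<in> NPC0R T W"
proof -
  have "(x \<longlongrightarrow> x t) F" if "F \<le> at t within {0..T}" "t \<in> {0..T}" for t F
    using assms(2) that by (auto simp: continuous_on_def intro: tendsto_mono)
  then have "\<forall>t\<in>{0..<T}. (x \<longlongrightarrow> x t) (at_right t)" "(x \<longlongrightarrow> x T) (at_left T)"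
    using assms(1) at_right_le_within_Icc at_left_le_within_Icc[of T T] by force+
  then show ?thesis
    using PC0_continuous[of T x W, OF assms(2,3)] unfolding NPC0R_iff by simp
qed

text \<open>An interval closed on the left and open on the right keeps the control right-continuous,
  and \<open>s' < T\<close> leaves a left neighbourhood of \<open>T\<close>, hence the left
  continuity there, untouched. Empty intervals are allowed, since needle lengths may vanish.\<close>

lemma NPC0R_override:
  fixes u :: "real \<Rightarrow> 'a::t2_space"
  assumes T: "0 < T" and u: "u \<in> NPC0R T U" and s: "0 \<le> s" "s' < T" and z: "\<zeta> \<in> U"
  shows "(\<lambda>t. if s \<le> t \<and> t < s' then \<zeta> else u t) \<in> NPC0R T U"
proof (cases "s < s'")
  case False
  then have "(\<lambda>t. if s \<le> t \<and> t < s' then \<zeta> else u t) = u" by (intro ext) auto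
  then show ?thesis using u by simp
next
  case ss: True
  define v where "v t = (if s \<le> t \<and> t < s' then \<zeta> else u t)" for t
  obtain S where S: "finite S" "\<And>t. t \<in> {0..T} - S \<Longrightarrow> continuous (at t within {0..T}) u"
    using NPC0R_PC0[OF u] unfolding PC0_iff[OF T] by auto
  have vo: "v t = u t" if "t < s \<or> s' \<le> t" for t using that by (auto simp: v_def)
  have vi: "v t = \<zeta>" if "s \<le> t" "t < s'" for t using that by (auto simp: v_def)
  have evu: "(\<forall>\<^sub>F r in F. v r = u r) \<Longrightarrow> (u \<longlongrightarrow> l) F \<Longrightarrow> (v \<longlongrightarrow> l) F" for F l
    by (simp add: tendsto_cong)
  have out: "\<forall>\<^sub>F r in at t. v r = u r" if "t < s \<or> s' < t" for t
    unfolding eventually_at_topological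
    by (rule exI[of _ "{..<s} \<union> {s'<..}"]) (use that in \<open>auto simp: vo\<close>)
  have inside: "\<forall>\<^sub>F r in at t. v r = \<zeta>" if "s < t" "t < s'" for t
    unfolding eventually_at_topological
    by (rule exI[of _ "{s<..<s'}"]) (use that in \<open>auto simp: vi\<close>)
  have R: "(v \<longlongrightarrow> v t) (at_right t)" if t: "t \<in> {0..<T}" for t
  proof (cases "s \<le> t \<and> t < s'")
    case True
    have "\<forall>\<^sub>F r in at_right t. r < s'" using True eventually_at_right by blast
    then have "\<forall>\<^sub>F r in at_right t. v r = \<zeta>"
      using eventually_at_right_less[of t] by eventually_elim (use True in \<open>simp add: vi\<close>)
    then show ?thesis using vi[of t] True tendsto_eventually by metis
  next
    case False
    have "\<forall>\<^sub>F r in at_right t. v r = u r"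
    proof (cases "t < s")
      case True
      then show ?thesis using out[of t] eventually_at_split by blast
    next
      case f: False
      show ?thesis
        using eventually_at_right_less[of t] by eventually_elim (use f False in \<open>simp add: vo\<close>)
    qed
    then show ?thesis using evu u t vo[of t] False unfolding NPC0R_iff by auto
  qed
  have L: "\<exists>l\<in>U. (v \<longlongrightarrow> l) (at_left t)" if t: "t \<in> {0<..T}" for t
  proof (cases "s < t \<and> t \<le> s'")
    case True
    have "\<forall>\<^sub>F r in at_left t. s < r" using True eventually_at_left by blast
    moreover have "\<forall>\<^sub>F r in at_left t. r < t" by (simp add: eventually_at_filter)
    ultimately have "\<forall>\<^sub>F r in at_left t. v r = \<zeta>"
      by eventually_elim (use True in \<open>simp add: vi\<close>)
    then show ?thesis using z tendsto_eventually by metis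
  next
    case False
    have "\<forall>\<^sub>F r in at_left t. r < t" by (simp add: eventually_at_filter)
    then have "\<forall>\<^sub>F r in at_left t. v r = u r"
    proof (cases "s' < t")
      case True
      then show ?thesis using out[of t] eventually_at_split by blast
    next
      case f: False
      show ?thesis
        using \<open>\<forall>\<^sub>F r in at_left t. r < t\<close> by eventually_elim (use f False in \<open>simp add: vo\<close>)
    qed
    moreover obtain l where "l \<in> U" "(u \<longlongrightarrow> l) (at_left t)"
      using NPC0R_PC0[OF u] t unfolding PC0_iff[OF T] by blast
    ultimately show ?thesis using evu by blast
  qed
  have vU: "v t \<in> U" if "t \<in> {0..T}" for t using NPC0R_D[OF u that] z by (simp add: v_def)
  have "continuous (at t within {0..T}) v" if t: "t \<in> {0..T} - (S \<union> {s, s'})" for t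
  proof -
    consider "t < s \<or> s' < t" | "s < t \<and> t < s'" using t by force
    then show ?thesis
    proof cases
      case 1
      have "(u \<longlongrightarrow> u t) (at t within {0..T})" using S(2)[of t] t by (simp add: continuous_within)
      then have "(v \<longlongrightarrow> u t) (at t within {0..T})"
        by (rule evu[rotated]) (rule filter_leD[OF at_le out[OF 1]], simp)
      moreover have "v t = u t" using 1 by (auto intro: vo)
      ultimately show ?thesis by (simp add: continuous_within)
    next
      case 2
      then have "\<forall>\<^sub>F r in at t within {0..T}. v r = \<zeta>"
        by (intro filter_leD[OF at_le inside]) auto
      then have "(v \<longlongrightarrow> \<zeta>) (at t within {0..T})" by (rule tendsto_eventually)
      then show ?thesis using 2 by (simp add: continuous_within vi)
    qed
  qed
  then have "\<exists>R. finite R \<and> (\<forall>t\<in>{0..T} - R. continuous (at t within {0..T}) v)"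
    using S(1) by (intro exI[of _ "S \<union> {s, s'}"]) auto
  moreover have "\<forall>t\<in>{0..<T}. \<exists>l\<in>U. (v \<longlongrightarrow> l) (at_right t)"
    using R vU by (meson atLeastLessThan_iff atLeastAtMost_iff less_imp_le)
  ultimately have "v \<in> PC0 T U" using L vU unfolding PC0_iff[OF T] by blast
  moreover have "(v \<longlongrightarrow> v T) (at_left T)"
  proof -
    have "\<forall>\<^sub>F r in at_left T. v r = u r" using out[of T] s(2) eventually_at_split by blast
    then show ?thesis using evu u s(2) vo[of T] unfolding NPC0R_iff by auto
  qed
  ultimately have "v \<in> NPC0R T U" using R unfolding NPC0R_iff by blast
  then show ?thesis by (simp add: v_def[abs_def])
qed

section \<open>One-sided derivatives and piecewise continuously differentiable functions\<close>

lemma vector_derivative_increment_bound: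
  fixes x :: "real \<Rightarrow> 'a::real_normed_vector"
  assumes "a < b" "continuous_on {a..b} x"
    and "\<And>t. t \<in> {a<..<b} \<Longrightarrow> (x has_vector_derivative d t) (at t)"
    and "\<And>t. t \<in> {a<..<b} \<Longrightarrow> norm (d t - l) \<le> e"
  shows "norm (x b - x a - (b - a) *\<^sub>R l) \<le> e * (b - a)"
proof -
  have "norm ((x b - b *\<^sub>R l) - (x a - a *\<^sub>R l)) \<le> e * b - e * a"
  proof (rule differentiable_bound_general[where f = "\<lambda>t. x t - t *\<^sub>R l" and \<phi> = "\<lambda>t. e * t"
        and f' = "\<lambda>t. d t - l" and \<phi>' = "\<lambda>_. e"])
    show "((\<lambda>t. x t - t *\<^sub>R l) has_vector_derivative d t - l) (at t)" if "a < t" "t < b" for t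
      using assms(3)[of t] that by (auto intro!: derivative_eq_intros)
    show "((*) e has_vector_derivative e) (at t)" for t
      by (auto intro!: derivative_eq_intros simp: has_real_derivative_iff_has_vector_derivative[symmetric])
  qed (use assms in \<open>auto intro!: continuous_intros\<close>)
  then show ?thesis by (simp add: algebra_simps)
qed

text \<open>The mean value inequality on \<open>[a,y]\<close> compares the increment with
  \<open>l\<close> times the length, and the derivative is uniformly close to \<open>l\<close> near
  \<open>a\<close>.\<close>

lemma has_vector_derivative_at_right_limit:
  fixes x :: "real \<Rightarrow> 'a::real_normed_vector"
  assumes ab: "a < b" and x: "continuous_on {a..b} x"
    and d: "\<And>t. t \<in> {a<..<b} \<Longrightarrow> (x has_vector_derivative d t) (at t)" "(d \<longlongrightarrow> l) (at_right a)"
  shows "(x has_vector_derivative l) (at_right a)"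
  unfolding has_vector_derivative_def has_derivative_within_alt
proof (intro conjI allI impI)
  show "bounded_linear (\<lambda>h. h *\<^sub>R l)" by (rule bounded_linear_scaleR_left)
  fix e :: real assume "0 < e"
  then have "\<forall>\<^sub>F t in at_right a. dist (d t) l < e" using d(2) tendstoD by blast
  then obtain c where c: "c > a" "\<And>t. a < t \<Longrightarrow> t < c \<Longrightarrow> dist (d t) l < e"
    unfolding eventually_at_right_field by blast
  show "\<exists>\<delta>>0. \<forall>y\<in>{a<..}. norm (y - a) < \<delta> \<longrightarrow> norm (x y - x a - (y - a) *\<^sub>R l) \<le> e * norm (y - a)"
  proof (intro exI[of _ "min (c - a) (b - a)"] conjI ballI impI)
    fix y assume y: "y \<in> {a<..}" "norm (y - a) < min (c - a) (b - a)"
    have "norm (x y - x a - (y - a) *\<^sub>R l) \<le> e * (y - a)"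
    proof (rule vector_derivative_increment_bound)
      show "continuous_on {a..y} x" by (rule continuous_on_subset[OF x]) (use y in auto)
      show "(x has_vector_derivative d t) (at t)" if "t \<in> {a<..<y}" for t using d(1) y that by auto
      show "norm (d t - l) \<le> e" if "t \<in> {a<..<y}" for t
        using c(2)[of t] y that by (auto simp: dist_norm)
    qed (use y in auto)
    then show "norm (x y - x a - (y - a) *\<^sub>R l) \<le> e * norm (y - a)" using y by auto
  qed (use c ab in auto)
qed

lemma has_vector_derivative_at_left_limit:
  fixes x :: "real \<Rightarrow> 'a::real_normed_vector"
  assumes ab: "a < b" and x: "continuous_on {a..b} x"
    and d: "\<And>t. t \<in> {a<..<b} \<Longrightarrow> (x has_vector_derivative d t) (at t)" "(d \<longlongrightarrow> l) (at_left b)"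
  shows "(x has_vector_derivative l) (at_left b)"
  unfolding has_vector_derivative_def has_derivative_within_alt
proof (intro conjI allI impI)
  show "bounded_linear (\<lambda>h. h *\<^sub>R l)" by (rule bounded_linear_scaleR_left)
  fix e :: real assume "0 < e"
  then have "\<forall>\<^sub>F t in at_left b. dist (d t) l < e" using d(2) tendstoD by blast
  then obtain c where c: "c < b" "\<And>t. c < t \<Longrightarrow> t < b \<Longrightarrow> dist (d t) l < e"
    unfolding eventually_at_left_field by blast
  show "\<exists>\<delta>>0. \<forall>y\<in>{..<b}. norm (y - b) < \<delta> \<longrightarrow> norm (x y - x b - (y - b) *\<^sub>R l) \<le> e * norm (y - b)"
  proof (intro exI[of _ "min (b - c) (b - a)"] conjI ballI impI)
    fix y assume y: "y \<in> {..<b}" "norm (y - b) < min (b - c) (b - a)"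
    have "norm (x b - x y - (b - y) *\<^sub>R l) \<le> e * (b - y)"
    proof (rule vector_derivative_increment_bound)
      show "continuous_on {y..b} x" by (rule continuous_on_subset[OF x]) (use y in auto)
      show "(x has_vector_derivative d t) (at t)" if "t \<in> {y<..<b}" for t using d(1) y that by auto
      show "norm (d t - l) \<le> e" if "t \<in> {y<..<b}" for t
        using c(2)[of t] y that by (auto simp: dist_norm)
    qed (use y in auto)
    moreover have "x y - x b - (y - b) *\<^sub>R l = - (x b - x y - (b - y) *\<^sub>R l)"
      by (simp add: algebra_simps)
    ultimately show "norm (x y - x b - (y - b) *\<^sub>R l) \<le> e * norm (y - b)"
      using y by (simp only: norm_minus_cancel) auto
  qed (use c ab in auto)
qed

text \<open>A limit of the derivative at an endpoint is a one-sided derivative, so a normalised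
  candidate \<open>d\<close> that is the derivative off a finite set already determines all
  one-sided data. The subdivision then consists of the points of \<open>R\<close>, the
  discontinuities of \<open>d\<close> and the endpoints.\<close>

lemma PC1I:
  fixes x :: "real \<Rightarrow> 'a::real_normed_vector"
  assumes T: "0 < T" and x: "continuous_on {0..T} x" "\<And>t. t \<in> {0..T} \<Longrightarrow> x t \<in> W"
    and d: "d \<in> NPC0R T UNIV" and R: "finite R"
      "\<And>t. t \<in> {0<..<T} - R \<Longrightarrow> (x has_vector_derivative d t) (at t)"
  shows "x \<in> PC1 T W" and "\<And>t. t \<in> {0..T} \<Longrightarrow> ext_deriv T x t = d t"
    and "\<And>t. t \<in> {0..<T} \<Longrightarrow> (x has_vector_derivative d t) (at_right t)"
proof -
  note dPC0 = NPC0R_PC0[OF d]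
  obtain S where S: "finite S" "\<And>t. t \<in> {0..T} - S \<Longrightarrow> continuous (at t within {0..T}) d"
    using dPC0 unfolding PC0_iff[OF T] by auto
  have av: "\<exists>e>0. \<forall>s. s \<noteq> t \<longrightarrow> \<bar>s - t\<bar> < e \<longrightarrow> s \<notin> R" for t
    using finite_set_avoid[OF R(1), of t] by (force simp: dist_real_def)
  have right: "(x has_vector_derivative l) (at_right t)"
    if t: "t \<in> {0..<T}" and l: "(d \<longlongrightarrow> l) (at_right t)" for t l
  proof -
    obtain e where e: "e > 0" "\<And>s. s \<noteq> t \<Longrightarrow> \<bar>s - t\<bar> < e \<Longrightarrow> s \<notin> R" using av by blast
    show ?thesis
    proof (rule has_vector_derivative_at_right_limit[OF _ _ _ l, of "min T (t + e)"])
      show "continuous_on {t..min T (t + e)} x" by (rule continuous_on_subset[OF x(1)]) (use t in auto)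
    qed (use t e in \<open>auto intro!: R(2)\<close>)
  qed
  have left: "(x has_vector_derivative l) (at_left t)"
    if t: "t \<in> {0<..T}" and l: "(d \<longlongrightarrow> l) (at_left t)" for t l
  proof -
    obtain e where e: "e > 0" "\<And>s. s \<noteq> t \<Longrightarrow> \<bar>s - t\<bar> < e \<Longrightarrow> s \<notin> R" using av by blast
    show ?thesis
    proof (rule has_vector_derivative_at_left_limit[OF _ _ _ l, of "max 0 (t - e)"])
      show "continuous_on {max 0 (t - e)..t} x" by (rule continuous_on_subset[OF x(1)]) (use t in auto)
    qed (use t e in \<open>auto intro!: R(2)\<close>)
  qed
  have evD: "\<forall>\<^sub>F s in at t within {0..T}. vector_derivative x (at s) = d s" for t
  proof -
    obtain e where e: "e > 0" "\<And>s. s \<noteq> t \<Longrightarrow> \<bar>s - t\<bar> < e \<Longrightarrow> s \<notin> R" using av by blast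
    obtain e' where e': "e' > 0" "\<And>s. s \<noteq> t \<Longrightarrow> \<bar>s - t\<bar> < e' \<Longrightarrow> s \<notin> {0, T}"
      using finite_set_avoid[of "{0, T}" t] by (force simp: dist_real_def)
    show ?thesis
      unfolding eventually_at
    proof (intro exI[of _ "min e e'"] conjI ballI impI)
      fix s assume s: "s \<in> {0..T}" "s \<noteq> t \<and> dist s t < min e e'"
      then have "s \<noteq> 0" "s \<noteq> T" "s \<notin> R" using e e' by (auto simp: dist_real_def)
      then have "(x has_vector_derivative d s) (at s)" using s by (intro R(2)) auto
      then show "vector_derivative x (at s) = d s" by (rule vector_derivative_at)
    qed (use e e' in auto)
  qed
  have limD: "((\<lambda>s. vector_derivative x (at s)) \<longlongrightarrow> l) F"
    if "(d \<longlongrightarrow> l) F" "F \<le> at t within {0..T}" for F t l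
    using that(1) tendsto_cong[OF filter_leD[OF that(2) evD]] by blast
  define S' where "S' = ((R \<union> S) \<inter> {0..T}) \<union> {0, T}"
  have C1: "C1_at x t" if t: "t \<in> {0..T} - S'" for t
  proof -
    have "open ({0<..<T} - S')" using R(1) S(1) by (auto simp: S'_def intro!: open_Diff finite_imp_closed)
    moreover have "t \<in> {0<..<T} - S'" using t by (auto simp: S'_def)
    ultimately have "\<forall>\<^sub>F s in nhds t. s \<in> {0<..<T} - S'" by (rule eventually_nhds_in_open)
    then have ev: "\<forall>\<^sub>F s in nhds t. (x has_vector_derivative d s) (at s)"
      by eventually_elim (auto simp: S'_def intro!: R(2))
    then have "\<forall>\<^sub>F s in nhds t. x differentiable (at s)"
      by eventually_elim (rule differentiableI_vector)
    moreover have "\<forall>\<^sub>F s in nhds t. vector_derivative x (at s) = d s"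
      using ev by eventually_elim (rule vector_derivative_at)
    moreover have "isCont d t"
      using S(2)[of t] t by (auto simp: S'_def at_within_Icc_at)
    ultimately show ?thesis unfolding C1_at_def using isCont_cong[of "\<lambda>s. vector_derivative x (at s)" d t] by blast
  qed
  have "PC1_subdivision T x S'"
    unfolding PC1_subdivision_def
  proof (intro conjI ballI)
    show "subdivision T S'" using R(1) S(1) T by (auto simp: subdivision_def S'_def)
    show "C1_at x t" if "t \<in> {0..T} - S'" for t by (rule C1[OF that])
    show "\<exists>l. (x has_vector_derivative l) (at_right \<tau>) \<and>
        ((\<lambda>t. vector_derivative x (at t)) \<longlongrightarrow> l) (at_right \<tau>)" if "\<tau> \<in> S' - {T}" for \<tau>
    proof -
      have \<tau>: "\<tau> \<in> {0..<T}" using that T by (auto simp: S'_def)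
      then obtain l where "(d \<longlongrightarrow> l) (at_right \<tau>)" using dPC0 unfolding PC0_iff[OF T] by blast
      then show ?thesis
        using right[OF \<tau>] limD[OF _ at_right_le_within_Icc[of \<tau> T]] \<tau> by auto
    qed
    show "\<exists>l. (x has_vector_derivative l) (at_left \<tau>) \<and>
        ((\<lambda>t. vector_derivative x (at t)) \<longlongrightarrow> l) (at_left \<tau>)" if "\<tau> \<in> S' - {0}" for \<tau>
    proof -
      have \<tau>: "\<tau> \<in> {0<..T}" using that T by (auto simp: S'_def)
      then obtain l where "(d \<longlongrightarrow> l) (at_left \<tau>)" using dPC0 unfolding PC0_iff[OF T] by blast
      then show ?thesis
        using left[OF \<tau>] limD[OF _ at_left_le_within_Icc[of \<tau> T]] \<tau> by auto
    qed
  qed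
  then show PC1: "x \<in> PC1 T W" using x by (auto simp: PC1_def)
  show r: "(x has_vector_derivative d t) (at_right t)" if "t \<in> {0..<T}" for t
    using right[OF that] d that unfolding NPC0R_iff by blast
  show "ext_deriv T x t = d t" if t: "t \<in> {0..T}" for t
  proof (cases "t < T")
    case True
    then have "vector_derivative x (at_right t) = d t"
      using t by (intro vector_derivative_within r) (auto simp: trivial_limit_at_right_real)
    then show ?thesis using ext_deriv_eq[OF T PC1 t] True by simp
  next
    case False
    then have "t = T" using t by simp
    have "(x has_vector_derivative d T) (at_left T)"
      using left[of T] d T unfolding NPC0R_iff by simp
    then have "vector_derivative x (at_left T) = d T"
      by (intro vector_derivative_within) (auto simp: trivial_limit_at_left_real)
    then show ?thesis using ext_deriv_eq[OF T PC1 t] \<open>t = T\<close> by simp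
  qed
qed

text \<open>Converse of the preceding criterion: on \<open>[0,T]\<close> the extended derivative
  differs from the classical one at most at the subdivision points, so both have the same one-sided
  limits. With this pair of lemmas a finite exceptional set replaces the subdivision in all later
  arguments.\<close>

lemma PC1D:
  fixes x :: "real \<Rightarrow> 'a::real_normed_vector"
  assumes T: "0 < T" and x: "x \<in> PC1 T W"
  shows "continuous_on {0..T} x" "\<And>t. t \<in> {0..T} \<Longrightarrow> x t \<in> W" "ext_deriv T x \<in> NPC0R T UNIV"
    "\<exists>S. finite S \<and> (\<forall>t\<in>{0<..<T} - S. (x has_vector_derivative ext_deriv T x t) (at t))"
proof -
  show "continuous_on {0..T} x" and "\<And>t. t \<in> {0..T} \<Longrightarrow> x t \<in> W" using x by (auto simp: PC1_def)
  obtain S where S: "PC1_subdivision T x S"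
    using x T C1_on_interval_imp_PC1_subdivision unfolding PC1_def by blast
  define D where "D t = vector_derivative x (at t)" for t
  define e where "e = ext_deriv T x"
  have fin: "finite S" "0 \<in> S" "T \<in> S" using S by (auto simp: PC1_subdivision_def subdivision_def)
  have eR: "e t = l" if "t \<in> {0..<T}" "(x has_vector_derivative l) (at_right t)" for t l
    using that ext_deriv_eq[OF T x, of t] vector_derivative_within[of t "{t<..}" x l]
    by (auto simp: e_def trivial_limit_at_right_real)
  have eL: "e T = l" if "(x has_vector_derivative l) (at_left T)" for l
    using that ext_deriv_eq[OF T x, of T] T vector_derivative_within[of T "{..<T}" x l]
    by (auto simp: e_def trivial_limit_at_left_real)
  have C1: "C1_at x t" if "t \<in> {0..T} - S" for t using S that by (auto simp: PC1_subdivision_def)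
  have der: "(x has_vector_derivative D t) (at t)" if "t \<in> {0..T} - S" for t
    using C1[OF that] unfolding C1_at_def D_def
    by (auto dest: eventually_nhds_x_imp_x simp: vector_derivative_works)
  have eD: "e t = D t" if t: "t \<in> {0..T} - S" for t
  proof (rule eR)
    show "t \<in> {0..<T}" using t fin by (cases "t = T") auto
    show "(x has_vector_derivative D t) (at_right t)" using der[OF t] has_vector_derivative_at_within by blast
  qed
  have ev: "\<forall>\<^sub>F s in at t within {0..T}. e s = D s" for t
  proof -
    obtain r where r: "r > 0" "\<And>s. s \<in> S \<Longrightarrow> s \<noteq> t \<Longrightarrow> r \<le> dist t s"
      using finite_set_avoid[OF fin(1)] by blast
    then show ?thesis
      unfolding eventually_at by (intro exI[of _ r]) (force simp: dist_commute intro!: eD)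
  qed
  have lim: "(e \<longlongrightarrow> l) F" if "(D \<longlongrightarrow> l) F" "F \<le> at t within {0..T}" for F t l
    using that(1) tendsto_cong[OF filter_leD[OF that(2) ev]] by blast
  have cont: "(e \<longlongrightarrow> e t) (at t within {0..T})" if t: "t \<in> {0..T} - S" for t
  proof -
    have "(D \<longlongrightarrow> D t) (at t)" using C1[OF t] by (simp add: C1_at_def D_def[abs_def] continuous_at)
    then have "(D \<longlongrightarrow> D t) (at t within {0..T})" using tendsto_within_subset by blast
    then show ?thesis using lim[OF _ order_refl] eD[OF t] by metis
  qed
  have R: "(e \<longlongrightarrow> e t) (at_right t)" if t: "t \<in> {0..<T}" for t
  proof (cases "t \<in> S")
    case True
    then obtain l where "(x has_vector_derivative l) (at_right t)" "(D \<longlongrightarrow> l) (at_right t)"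
      using S t unfolding PC1_subdivision_def D_def[abs_def] by force
    then show ?thesis using eR[OF t] lim[OF _ at_right_le_within_Icc] t by auto
  next
    case False
    then show ?thesis using cont[of t] t at_right_le_within_Icc[of t T] tendsto_mono by force
  qed
  have L: "\<exists>l. (e \<longlongrightarrow> l) (at_left t)" if t: "t \<in> {0<..T}" for t
  proof (cases "t \<in> S")
    case True
    then obtain l where "(D \<longlongrightarrow> l) (at_left t)"
      using S t unfolding PC1_subdivision_def D_def[abs_def] by force
    then show ?thesis using lim[OF _ at_left_le_within_Icc] t by auto
  next
    case False
    then show ?thesis using cont[of t] t at_left_le_within_Icc[of t T] tendsto_mono by force
  qed
  have "(e \<longlongrightarrow> e T) (at_left T)"
  proof -
    obtain l where "(x has_vector_derivative l) (at_left T)" "(D \<longlongrightarrow> l) (at_left T)"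
      using S T fin unfolding PC1_subdivision_def D_def[abs_def] by force
    then show ?thesis using eL lim[OF _ at_left_le_within_Icc[of T T]] T by auto
  qed
  moreover have "\<forall>t\<in>{0..<T}. \<exists>l\<in>UNIV. (e \<longlongrightarrow> l) (at_right t)" "\<forall>t\<in>{0<..T}. \<exists>l\<in>UNIV. (e \<longlongrightarrow> l) (at_left t)"
    using R L by blast+
  moreover have "\<exists>S. finite S \<and> (\<forall>t\<in>{0..T} - S. continuous (at t within {0..T}) e)"
    using cont fin(1) unfolding continuous_within by blast
  ultimately show "ext_deriv T x \<in> NPC0R T UNIV"
    unfolding e_def[symmetric] NPC0R_iff PC0_iff[OF T] using R by (intro conjI) simp_all
  show "\<exists>S. finite S \<and> (\<forall>t\<in>{0<..<T} - S. (x has_vector_derivative ext_deriv T x t) (at t))"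
    using fin(1) der eD by (intro exI[of _ S]) (auto simp: e_def[symmetric])
qed

lemma PC1_add_scaleR:
  fixes x y :: "real \<Rightarrow> 'a::real_normed_vector"
  assumes T: "0 < T" and x: "x \<in> PC1 T A" and y: "y \<in> PC1 T B"
  shows "(\<lambda>t. x t + c *\<^sub>R y t) \<in> PC1 T UNIV"
    and "\<And>t. t \<in> {0..T} \<Longrightarrow> ext_deriv T (\<lambda>t. x t + c *\<^sub>R y t) t = ext_deriv T x t + c *\<^sub>R ext_deriv T y t"
proof -
  obtain S where S: "finite S" "\<And>t. t \<in> {0<..<T} - S \<Longrightarrow> (x has_vector_derivative ext_deriv T x t) (at t)"
    using PC1D(4)[OF T x] by blast
  obtain R where R: "finite R" "\<And>t. t \<in> {0<..<T} - R \<Longrightarrow> (y has_vector_derivative ext_deriv T y t) (at t)"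
    using PC1D(4)[OF T y] by blast
  have d: "(\<lambda>t. ext_deriv T x t + c *\<^sub>R ext_deriv T y t) \<in> NPC0R T UNIV"
  proof -
    have "continuous_on (UNIV \<times> UNIV) (\<lambda>p::'a \<times> 'a. fst p + c *\<^sub>R snd p)" by (intro continuous_intros)
    from NPC0R_comp[OF T NPC0R_Pair[OF T PC1D(3)[OF T x] PC1D(3)[OF T y]] this, of UNIV] show ?thesis by simp
  qed
  have v: "((\<lambda>t. x t + c *\<^sub>R y t) has_vector_derivative ext_deriv T x t + c *\<^sub>R ext_deriv T y t) (at t)"
    if "t \<in> {0<..<T} - (S \<union> R)" for t
    using S(2)[of t] R(2)[of t] that by (auto intro!: derivative_eq_intros)
  have co: "continuous_on {0..T} (\<lambda>t. x t + c *\<^sub>R y t)"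
    using PC1D(1)[OF T x] PC1D(1)[OF T y] by (intro continuous_intros)
  have fin: "finite (S \<union> R)" using S R by simp
  note * = PC1I[OF T co _ d fin v, of UNIV]
  show "(\<lambda>t. x t + c *\<^sub>R y t) \<in> PC1 T UNIV" using *(1) by simp
  show "ext_deriv T (\<lambda>t. x t + c *\<^sub>R y t) t = ext_deriv T x t + c *\<^sub>R ext_deriv T y t" if "t \<in> {0..T}" for t
    using *(2) that by simp
qed

lemma PC1_has_integral:
  fixes x :: "real \<Rightarrow> 'a::banach"
  assumes T: "0 < T" and x: "x \<in> PC1 T W" and ab: "0 \<le> a" "a \<le> b" "b \<le> T"
  shows "(ext_deriv T x has_integral x b - x a) {a..b}"
proof -
  obtain S where S: "finite S" "\<And>t. t \<in> {0<..<T} - S \<Longrightarrow> (x has_vector_derivative ext_deriv T x t) (at t)"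
    using PC1D(4)[OF T x] by blast
  show ?thesis
    by (rule fundamental_theorem_of_calculus_interior_strong[OF S(1) ab(2)])
      (use S(2) ab in \<open>auto intro: continuous_on_subset[OF PC1D(1)[OF T x]]\<close>)
qed

lemma PC0_indefinite_integral:
  fixes d :: "real \<Rightarrow> 'a::banach"
  assumes T: "0 < T" and d: "d \<in> PC0 T W"
  shows "continuous_on {0..T} (\<lambda>t. integral {0..t} d)"
    "\<exists>S. finite S \<and> (\<forall>t\<in>{0<..<T} - S. ((\<lambda>t. integral {0..t} d) has_vector_derivative d t) (at t))"
proof -
  have i: "d integrable_on {0..T}" by (rule PC0_integrable[OF T d])
  then show "continuous_on {0..T} (\<lambda>t. integral {0..t} d)" by (rule indefinite_integral_continuous_1)
  obtain S where S: "finite S" "\<And>t. t \<in> {0..T} - S \<Longrightarrow> continuous (at t within {0..T}) d"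
    using d unfolding PC0_iff[OF T] by auto
  have "((\<lambda>t. integral {0..t} d) has_vector_derivative d t) (at t)" if "t \<in> {0<..<T} - S" for t
    using integral_has_vector_derivative_continuous_at[OF i, of t "{}"] S(2)[of t] that
    by (auto simp: at_within_Icc_at)
  then show "\<exists>S. finite S \<and> (\<forall>t\<in>{0<..<T} - S. ((\<lambda>t. integral {0..t} d) has_vector_derivative d t) (at t))"
    using S(1) by blast
qed

section \<open>Integral and linear differential equations\<close>

lemma has_integral_exp_Icc:
  fixes L :: real
  assumes "0 < L" "0 \<le> t"
  shows "((\<lambda>s. exp (2 * L * s)) has_integral (exp (2 * L * t) - 1) / (2 * L)) {0..t}"
proof -
  have "((\<lambda>s. exp (2 * L * s)) has_integral exp (2 * L * t) / (2 * L) - exp (2 * L * 0) / (2 * L)) {0..t}"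
    by (rule fundamental_theorem_of_calculus[OF assms(2)])
      (use assms in \<open>auto intro!: derivative_eq_intros simp: has_real_derivative_iff_has_vector_derivative[symmetric]\<close>)
  then show ?thesis by (simp add: diff_divide_distrib)
qed

text \<open>The weight \<open>exp (2 * L * t)\<close> turns the Volterra operator into a contraction with factor
  \<open>1/2\<close>, both here and in \<open>picard\<close> below.\<close>

lemma gronwall_integral:
  fixes \<phi> :: "real \<Rightarrow> real"
  assumes L: "0 < L" and c: "0 \<le> c" and cont: "continuous_on {0..T} \<phi>"
    and le: "\<And>t. t \<in> {0..T} \<Longrightarrow> \<phi> t \<le> c + L * integral {0..t} \<phi>"
    and t: "t \<in> {0..T}"
  shows "\<phi> t \<le> 2 * c * exp (2 * L * t)"
proof -
  define \<psi> where "\<psi> s = exp (- (2 * L * s)) * \<phi> s" for s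
  have "continuous_on {0..T} \<psi>" unfolding \<psi>_def by (intro continuous_intros cont)
  \<comment> \<open>At the maximum of the weighted function the inequality can be absorbed: it
    becomes \<open>\<psi> t0 * (E + 1) \<le> 2 * c\<close>, where \<open>E\<close> is at least
    1.\<close>
  then obtain t0 where t0: "t0 \<in> {0..T}" "\<And>s. s \<in> {0..T} \<Longrightarrow> \<psi> s \<le> \<psi> t0"
    using continuous_attains_sup[of "{0..T}" \<psi>] t by fastforce
  have phi: "\<phi> s = \<psi> s * exp (2 * L * s)" for s
    by (simp add: \<psi>_def exp_minus field_simps)
  have "\<psi> t0 \<le> 2 * c"
  proof (cases "\<psi> t0 \<le> 0")
    case False
    define E where "E = exp (2 * L * t0)"
    have E: "E \<ge> 1" using L t0(1) by (simp add: E_def)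
    have "integral {0..t0} \<phi> \<le> \<psi> t0 * ((E - 1) / (2 * L))"
    proof (rule has_integral_le)
      show "(\<phi> has_integral integral {0..t0} \<phi>) {0..t0}"
        using t0(1) by (intro integrable_integral integrable_continuous_real continuous_on_subset[OF cont]) auto
      show "((\<lambda>s. \<psi> t0 * exp (2 * L * s)) has_integral \<psi> t0 * ((E - 1) / (2 * L))) {0..t0}"
        unfolding E_def using has_integral_exp_Icc[OF L, of t0] t0(1) by (intro has_integral_mult_right) auto
      show "\<phi> s \<le> \<psi> t0 * exp (2 * L * s)" if "s \<in> {0..t0}" for s
        unfolding phi using t0 that by (intro mult_right_mono) auto
    qed
    then have "L * integral {0..t0} \<phi> \<le> \<psi> t0 * (E - 1) / 2"
      using L by (simp add: field_simps)
    moreover have "\<phi> t0 = \<psi> t0 * E" by (simp add: phi E_def)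
    ultimately have "\<psi> t0 * E \<le> c + \<psi> t0 * (E - 1) / 2" using le[OF t0(1)] by linarith
    then have "\<psi> t0 * (E + 1) \<le> 2 * c" by (simp add: field_simps)
    moreover have "\<psi> t0 * 1 \<le> \<psi> t0 * (E + 1)" using E False by (intro mult_left_mono) auto
    ultimately show ?thesis by simp
  qed (use c in simp)
  then have "\<psi> t \<le> 2 * c" using t0(2)[OF t] by simp
  then show ?thesis unfolding phi by (intro mult_right_mono) auto
qed

text \<open>The Lipschitz bound is needed only on the ball of radius \<open>r\<close>: the iterates
  start at 0, and their increments sum to at most \<open>2 * c * exp (2 * L * t)\<close>, so they
  never leave it. The constant \<open>c\<close> bounds the integral of \<open>G s 0\<close> and not
  \<open>G s 0\<close> itself; a perturbation that is large on a short time set still gives a small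
  solution, as needles demand.\<close>

lemma picard:
  fixes G :: "real \<Rightarrow> 'a::banach \<Rightarrow> 'a"
  assumes T: "0 < T" and L: "0 < L" and c: "0 \<le> c" and r: "2 * c * exp (2 * L * T) \<le> r"
    and int: "\<And>w. continuous_on {0..T} w \<Longrightarrow> (\<And>t. t \<in> {0..T} \<Longrightarrow> norm (w t) \<le> r) \<Longrightarrow>
      (\<lambda>t. G t (w t)) integrable_on {0..T}"
    and lip: "\<And>t v w. t \<in> {0..T} \<Longrightarrow> norm v \<le> r \<Longrightarrow> norm w \<le> r \<Longrightarrow> norm (G t v - G t w) \<le> L * norm (v - w)"
    and G0: "\<And>t. t \<in> {0..T} \<Longrightarrow> norm (integral {0..t} (\<lambda>s. G s 0)) \<le> c"
  obtains w where "continuous_on {0..T} w" "\<And>t. t \<in> {0..T} \<Longrightarrow> norm (w t) \<le> r"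
    "\<And>t. t \<in> {0..T} \<Longrightarrow> w t = integral {0..t} (\<lambda>s. G s (w s))"
proof -
  define W where "W = rec_nat (\<lambda>_. 0) (\<lambda>_ w t. integral {0..t} (\<lambda>s. G s (w s)))"
  have W0: "W 0 t = 0" and WS: "W (Suc n) t = integral {0..t} (\<lambda>s. G s (W n s))" for n t
    by (simp_all add: W_def)
  have bound_r: "k * exp (2 * L * t) \<le> r" if "k \<le> 2 * c" "0 \<le> k" "t \<in> {0..T}" for k t
  proof -
    have "k * exp (2 * L * t) \<le> 2 * c * exp (2 * L * T)"
      using that c L by (intro mult_mono) auto
    then show ?thesis using r by simp
  qed
  have sub: "f integrable_on {0..t}" if "f integrable_on {0..T}" "t \<in> {0..T}" for f :: "real \<Rightarrow> 'a" and t
    by (rule integrable_on_subinterval[OF that(1)]) (use that in auto)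
  \<comment> \<open>Increments halve in the weighted norm, so the iterates are bounded by partial
    sums of a geometric series with first term \<open>c\<close>, which is the factor
    \<open>2 * c * (1 - (1/2)^n)\<close>.\<close>
  have main: "continuous_on {0..T} (W n) \<and>
      (\<forall>t\<in>{0..T}. norm (W n t) \<le> 2 * c * (1 - (1/2)^n) * exp (2 * L * t) \<and>
         norm (W (Suc n) t - W n t) \<le> c * (1/2)^n * exp (2 * L * t))" for n
  proof (induction n)
    case 0
    have "norm (W (Suc 0) t) \<le> c * exp (2 * L * t)" if "t \<in> {0..T}" for t
    proof -
      have "c * 1 \<le> c * exp (2 * L * t)" using L c that by (intro mult_left_mono) auto
      then show ?thesis using G0[OF that] by (simp add: WS W0)
    qed
    moreover have "continuous_on {0..T} (W 0)" unfolding W0 by (rule continuous_on_const)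
    ultimately show ?case by (simp add: W0)
  next
    case (Suc n)
    have pw: "(1/2)^n \<le> (1::real)" by (simp add: power_le_one)
    have n1: "norm (W (Suc n) t) \<le> 2 * c * (1 - (1/2)^Suc n) * exp (2 * L * t)" if t: "t \<in> {0..T}" for t
    proof -
      have "norm (W (Suc n) t) \<le> norm (W n t) + norm (W (Suc n) t - W n t)"
        using norm_triangle_ineq[of "W n t" "W (Suc n) t - W n t"] by simp
      also have "\<dots> \<le> 2 * c * (1 - (1/2)^n) * exp (2 * L * t) + c * (1/2)^n * exp (2 * L * t)"
        using Suc t by (intro add_mono) auto
      also have "\<dots> = 2 * c * (1 - (1/2)^Suc n) * exp (2 * L * t)" by (simp add: algebra_simps)
      finally show ?thesis .
    qed
    have nr: "norm (W n t) \<le> r" if t: "t \<in> {0..T}" for t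
    proof -
      have "2 * c * (1 - (1/2)^n) \<le> 2 * c * 1" using c by (intro mult_left_mono) auto
      moreover have "0 \<le> 2 * c * (1 - (1/2)^n)" using c pw by auto
      ultimately show ?thesis using Suc t bound_r[of "2 * c * (1 - (1/2)^n)" t] by force
    qed
    have pw': "(1/2)^Suc n \<le> (1::real)" by (rule power_le_one) auto
    have nr': "norm (W (Suc n) t) \<le> r" if t: "t \<in> {0..T}" for t
    proof -
      have "2 * c * (1 - (1/2)^Suc n) \<le> 2 * c * 1" using c by (intro mult_left_mono) auto
      moreover have "0 \<le> 2 * c * (1 - (1/2)^Suc n)" using c pw' by (intro mult_nonneg_nonneg) auto
      ultimately show ?thesis using n1[OF t] t bound_r[of "2 * c * (1 - (1/2)^Suc n)" t] by linarith
    qed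
    have in1: "(\<lambda>s. G s (W n s)) integrable_on {0..T}" using Suc nr by (intro int) auto
    have c1: "continuous_on {0..T} (W (Suc n))"
      using indefinite_integral_continuous_1[OF in1] by (simp add: WS[abs_def])
    have in2: "(\<lambda>s. G s (W (Suc n) s)) integrable_on {0..T}" using c1 nr' by (intro int) auto
    have "norm (W (Suc (Suc n)) t - W (Suc n) t) \<le> c * (1/2)^Suc n * exp (2 * L * t)" if t: "t \<in> {0..T}" for t
    proof -
      have "W (Suc (Suc n)) t - W (Suc n) t = integral {0..t} (\<lambda>s. G s (W (Suc n) s) - G s (W n s))"
        using sub[OF in1 t] sub[OF in2 t] by (simp only: WS[of "Suc n"] WS[of n] Henstock_Kurzweil_Integration.integral_diff)
      also have "norm \<dots> \<le> integral {0..t} (\<lambda>s. (L * c * (1/2)^n) * exp (2 * L * s))"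
      proof (rule Henstock_Kurzweil_Integration.integral_norm_bound_integral)
        show "(\<lambda>s. G s (W (Suc n) s) - G s (W n s)) integrable_on {0..t}"
          using sub[OF in1 t] sub[OF in2 t] by (rule integrable_diff[rotated])
        show "(\<lambda>s. (L * c * (1/2)^n) * exp (2 * L * s)) integrable_on {0..t}"
          by (intro integrable_continuous_real continuous_intros)
        show "norm (G s (W (Suc n) s) - G s (W n s)) \<le> (L * c * (1/2)^n) * exp (2 * L * s)" if "s \<in> {0..t}" for s
        proof -
          have s: "s \<in> {0..T}" using that t by auto
          have "norm (G s (W (Suc n) s) - G s (W n s)) \<le> L * norm (W (Suc n) s - W n s)"
            by (rule lip[OF s nr'[OF s] nr[OF s]])
          also have "\<dots> \<le> L * (c * (1/2)^n * exp (2 * L * s))"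
            using Suc s L by (intro mult_left_mono) auto
          finally show ?thesis by (simp add: mult.assoc)
        qed
      qed
      also have "\<dots> = (L * c * (1/2)^n) * ((exp (2 * L * t) - 1) / (2 * L))"
        using has_integral_exp_Icc[OF L, of t] t by (intro integral_unique has_integral_mult_right) auto
      also have "\<dots> = c * (1/2)^Suc n * (exp (2 * L * t) - 1)" using L by simp
      also have "\<dots> \<le> c * (1/2)^Suc n * exp (2 * L * t)" using c by (intro mult_left_mono) auto
      finally show ?thesis .
    qed
    then show ?case using c1 n1 by blast
  qed
  have nW: "norm (W n t) \<le> r" if t: "t \<in> {0..T}" for n t
  proof -
    have "(1/2)^n \<le> (1::real)" by (simp add: power_le_one)
    then have "0 \<le> 2 * c * (1 - (1/2)^n)" "2 * c * (1 - (1/2)^n) \<le> 2 * c * 1"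
      using c by (simp, intro mult_left_mono) auto
    then have "2 * c * (1 - (1/2)^n) * exp (2 * L * t) \<le> r" using bound_r[of "2 * c * (1 - (1/2)^n)" t] t by simp
    moreover have "norm (W n t) \<le> 2 * c * (1 - (1/2)^n) * exp (2 * L * t)" using main t by blast
    ultimately show ?thesis by linarith
  qed
  define w where "w t = suminf (\<lambda>n. W (Suc n) t - W n t)" for t
  have "uniform_limit {0..T} (\<lambda>n t. \<Sum>i<n. W (Suc i) t - W i t) w sequentially"
    unfolding w_def
  proof (rule Weierstrass_m_test)
    show "norm (W (Suc n) t - W n t) \<le> c * exp (2 * L * T) * (1/2)^n" if t: "t \<in> {0..T}" for n t
    proof -
      have "norm (W (Suc n) t - W n t) \<le> c * (1/2)^n * exp (2 * L * t)" using main t by blast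
      also have "\<dots> \<le> c * (1/2)^n * exp (2 * L * T)" using c L t by (intro mult_left_mono) auto
      finally show ?thesis by (simp add: mult_ac)
    qed
    show "summable (\<lambda>n. c * exp (2 * L * T) * (1/2)^n)" by (intro summable_mult summable_geometric) simp
  qed
  moreover have "(\<Sum>i<n. W (Suc i) t - W i t) = W n t" for n t
    using sum_lessThan_telescope[of "\<lambda>n. W n t" n] by (simp add: W0)
  ultimately have ul: "uniform_limit {0..T} W w sequentially" by simp
  have wc: "continuous_on {0..T} w"
    by (rule uniform_limit_theorem[OF _ ul]) (use main in auto)
  have lim: "(\<lambda>n. W n t) \<longlonglongrightarrow> w t" if "t \<in> {0..T}" for t using tendsto_uniform_limitI[OF ul that] .
  have wr: "norm (w t) \<le> r" if t: "t \<in> {0..T}" for t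
    by (rule LIMSEQ_le_const2[OF tendsto_norm[OF lim[OF t]]]) (use nW t in blast)
  have iw: "(\<lambda>s. G s (w s)) integrable_on {0..T}" using wc wr by (intro int) auto
  have iW: "(\<lambda>s. G s (W n s)) integrable_on {0..T}" for n using main nW by (intro int) auto
  have "w t = integral {0..t} (\<lambda>s. G s (w s))" if t: "t \<in> {0..T}" for t
  proof (rule LIMSEQ_unique)
    show "(\<lambda>n. W (Suc n) t) \<longlonglongrightarrow> w t" using lim[OF t] by (rule LIMSEQ_Suc)
    show "(\<lambda>n. W (Suc n) t) \<longlonglongrightarrow> integral {0..t} (\<lambda>s. G s (w s))"
    proof (rule tendstoI)
      fix e :: real assume e: "0 < e"
      define e' where "e' = e / (2 * L * T)"
      have "0 < e'" using e L T by (simp add: e'_def)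
      from uniform_limitD[OF ul this] show "\<forall>\<^sub>F n in sequentially. dist (W (Suc n) t) (integral {0..t} (\<lambda>s. G s (w s))) < e"
      proof eventually_elim
        case (elim n)
        have "W (Suc n) t - integral {0..t} (\<lambda>s. G s (w s)) = integral {0..t} (\<lambda>s. G s (W n s) - G s (w s))"
          using sub[OF iw t] sub[OF iW t] by (simp only: WS[of n] Henstock_Kurzweil_Integration.integral_diff)
        also have "norm \<dots> \<le> integral {0..t} (\<lambda>s. L * e')"
        proof (rule Henstock_Kurzweil_Integration.integral_norm_bound_integral)
          show "(\<lambda>s. G s (W n s) - G s (w s)) integrable_on {0..t}"
            using sub[OF iw t] sub[OF iW t] by (rule integrable_diff[rotated])
          show "norm (G s (W n s) - G s (w s)) \<le> L * e'" if "s \<in> {0..t}" for s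
          proof -
            have s: "s \<in> {0..T}" using that t by auto
            have "norm (G s (W n s) - G s (w s)) \<le> L * norm (W n s - w s)"
              by (rule lip[OF s nW[OF s] wr[OF s]])
            also have "\<dots> \<le> L * e'"
              using elim s L by (intro mult_left_mono) (auto simp: dist_norm less_imp_le)
            finally show ?thesis .
          qed
        qed auto
        also have "\<dots> = L * e' * t" using t by simp
        also have "\<dots> \<le> L * e' * T" using t L \<open>0 < e'\<close> by (intro mult_left_mono) auto
        also have "\<dots> < e" using e L T by (simp add: e'_def)
        finally show ?case by (simp add: dist_norm)
      qed
    qed
  qed
  then show thesis using wc wr that by blast
qed

section \<open>The resolvent of a linear equation with terminal condition\<close>

lemma norm_integral_le_const:
  fixes f :: "real \<Rightarrow> 'a::banach"
  assumes "f integrable_on {0..t}" "\<And>s. s \<in> {0..t} \<Longrightarrow> norm (f s) \<le> K" "0 \<le> t"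
  shows "norm (integral {0..t} f) \<le> K * t"
proof -
  have "norm (integral {0..t} f) \<le> integral {0..t} (\<lambda>_. K)"
    by (rule Henstock_Kurzweil_Integration.integral_norm_bound_integral) (use assms in auto)
  then show ?thesis using assms(3) by (simp add: mult.commute)
qed

text \<open>\<open>M t\<close> is the evolution operator from time \<open>t\<close> to time
  \<open>T\<close> of the linear equation with coefficient \<open>A\<close>, which explains the sign
  and the order of the factors in \<open>M t o\<^sub>L A t\<close>. The unknown of the integral
  equation is \<open>M (T - s) - id_blinfun\<close>, which starts at 0 as the fixed point lemma
  requires; \<open>S\<close> accounts for the discontinuities of \<open>A\<close>.\<close>

lemma backward_resolvent:
  fixes A :: "real \<Rightarrow> ('a::banach \<Rightarrow>\<^sub>L 'a)"
  assumes T: "0 < T" and A: "A \<in> PC0 T UNIV"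
  obtains M :: "real \<Rightarrow> ('a \<Rightarrow>\<^sub>L 'a)" and S where "continuous_on {0..T} M" "M T = id_blinfun" "finite S"
    "\<And>t. t \<in> {0<..<T} - S \<Longrightarrow> (M has_vector_derivative - (M t o\<^sub>L A t)) (at t)"
proof -
  note AR = PC0_reflect[OF T A]
  obtain K where K: "K \<ge> 0" "\<And>t. t \<in> {0..T} \<Longrightarrow> norm (A (T - t)) \<le> K" using PC0_bounded[OF T AR] by blast
  define G where "G t w = (id_blinfun + w) o\<^sub>L A (T - t)" for t w
  have GPC: "(\<lambda>t. G t (w t)) \<in> PC0 T UNIV" if "continuous_on {0..T} w" for w
  proof -
    have "continuous_on (UNIV \<times> UNIV) (\<lambda>(v, a). (id_blinfun + v) o\<^sub>L (a :: 'a \<Rightarrow>\<^sub>L 'a))"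
      unfolding case_prod_unfold
      by (intro bounded_bilinear.continuous_on[OF bounded_bilinear_blinfun_compose] continuous_intros)
    from PC0_comp[OF T PC0_Pair[OF T PC0_continuous[OF that] AR] this, where V = UNIV] show ?thesis
      by (simp add: G_def)
  qed
  have G0: "norm (integral {0..t} (\<lambda>s. G s 0)) \<le> K * T" if "t \<in> {0..T}" for t
  proof -
    have "norm (integral {0..t} (\<lambda>s. G s 0)) \<le> K * t"
    proof (rule norm_integral_le_const)
      have "(\<lambda>s. G s 0) integrable_on {0..T}"
        using PC0_integrable[OF T GPC[of "\<lambda>_. 0"]] by simp
      then show "(\<lambda>s. G s 0) integrable_on {0..t}"
        by (rule integrable_on_subinterval) (use that in auto)
      show "norm (G s 0) \<le> K" if "s \<in> {0..t}" for s
      proof -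
        have "G s 0 = A (T - s)" by (simp add: G_def blinfun_eqI)
        then show ?thesis using K(2)[of s] that \<open>t \<in> {0..T}\<close> by simp
      qed
    qed (use that in auto)
    also have "\<dots> \<le> K * T" using that K by (intro mult_left_mono) auto
    finally show ?thesis .
  qed
  have lip: "norm (G t v - G t w) \<le> (K + 1) * norm (v - w)"
    if "t \<in> {0..T}" for t v w
  proof -
    have "G t v - G t w = (v - w) o\<^sub>L A (T - t)"
      by (simp add: G_def bounded_bilinear.diff_left[OF bounded_bilinear_blinfun_compose, symmetric])
    also have "norm \<dots> \<le> norm (v - w) * norm (A (T - t))" by (rule norm_blinfun_compose)
    also have "\<dots> \<le> norm (v - w) * (K + 1)" using K(2)[OF that] by (intro mult_left_mono) auto
    finally show ?thesis by (simp add: mult.commute)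
  qed
  have int: "(\<lambda>t. G t (w t)) integrable_on {0..T}" if "continuous_on {0..T} w" for w
    by (rule PC0_integrable[OF T GPC[OF that]])
  have K': "0 < K + 1" "0 \<le> K * T" using K(1) T by auto
  obtain w where w: "continuous_on {0..T} w"
      "\<And>t. t \<in> {0..T} \<Longrightarrow> w t = integral {0..t} (\<lambda>s. G s (w s))"
  proof (rule picard[OF T K' order_refl, of G])
    fix w assume "continuous_on {0..T} w" "\<And>t. t \<in> {0..T} \<Longrightarrow> w t = integral {0..t} (\<lambda>s. G s (w s))"
    then show thesis by (rule that)
  qed (auto intro: int lip G0)
  obtain S where S: "finite S"
    "\<And>t. t \<in> {0<..<T} - S \<Longrightarrow> ((\<lambda>t. integral {0..t} (\<lambda>s. G s (w s))) has_vector_derivative G t (w t)) (at t)"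
    using PC0_indefinite_integral(2)[OF T GPC[OF w(1)]] by blast
  have wd: "(w has_vector_derivative G t (w t)) (at t)" if "t \<in> {0<..<T} - S" for t
    by (rule has_vector_derivative_transform_within_open[OF S(2)[OF that], of "{0<..<T}"])
      (use that w(2) in auto)
  show thesis
  proof
    have "continuous_on {0..T} (\<lambda>t. w (T - t))"
      by (rule continuous_on_compose2[OF w(1)]) (auto intro!: continuous_intros)
    then show "continuous_on {0..T} (\<lambda>t. id_blinfun + w (T - t))" by (intro continuous_intros)
    show "id_blinfun + w (T - T) = id_blinfun" using w(2)[of 0] T by simp
    show "finite ((\<lambda>s. T - s) ` S)" using S(1) by simp
    show "((\<lambda>t. id_blinfun + w (T - t)) has_vector_derivative - ((id_blinfun + w (T - t)) o\<^sub>L A t)) (at t)"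
      if t: "t \<in> {0<..<T} - (\<lambda>s. T - s) ` S" for t
    proof -
      have "T - t \<notin> S" using t by (metis DiffD2 diff_diff_eq2 add_diff_cancel_left' image_eqI)
      then have "(w has_vector_derivative G (T - t) (w (T - t))) (at (T - t))" using t by (intro wd) auto
      moreover have "((\<lambda>t. T - t) has_real_derivative - 1) (at t)" by (auto intro!: derivative_eq_intros)
      ultimately have "((w \<circ> (\<lambda>t. T - t)) has_vector_derivative (- 1) *\<^sub>R G (T - t) (w (T - t))) (at t)"
        by (intro vector_diff_chain_at) (simp_all add: has_real_derivative_iff_has_vector_derivative)
      then show ?thesis by (auto intro!: derivative_eq_intros simp: o_def G_def)
    qed
  qed
qed

section \<open>Needle variations\<close>

lemma has_integral_indicator_Ico:
  fixes D :: "'a::banach"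
  assumes "0 \<le> p" "p \<le> p'" "p' \<le> T"
  shows "((\<lambda>t. indicat_real {p..<p'} t *\<^sub>R D) has_integral (p' - p) *\<^sub>R D) {0..T}"
proof -
  have "((\<lambda>_. D) has_integral measure lborel {p..p'} *\<^sub>R D) {p..p'}" by (rule has_integral_const_real)
  then have "((\<lambda>t. if t \<in> {p..p'} then D else 0) has_integral (p' - p) *\<^sub>R D) {0..T}"
    using assms by (subst has_integral_restrict) auto
  then show ?thesis
    by (rule has_integral_spike_finite[of "{p'}", rotated 2]) (auto simp: indicator_def)
qed

lemma finite_right_neighbourhood:
  fixes P :: "nat \<Rightarrow> real \<Rightarrow> bool"
  assumes "\<forall>i<N. \<forall>\<^sub>F r in at_right 0. P i r"
  shows "\<exists>r>0. \<forall>i<N. \<forall>s. 0 < s \<longrightarrow> s \<le> r \<longrightarrow> P i s"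
proof -
  have "\<forall>\<^sub>F r in at_right 0. \<forall>i\<in>{..<N}. P i r"
    by (rule eventually_ball_finite) (use assms in auto)
  then obtain b where b: "b > 0" "\<And>s. 0 < s \<Longrightarrow> s < b \<Longrightarrow> \<forall>i\<in>{..<N}. P i s"
    unfolding eventually_at_right_field by auto
  show ?thesis by (rule exI[of _ "b / 2"]) (use b in force)
qed

text \<open>Only the lengths \<open>a\<close> are variables; starting times and values stay fixed,
  and zero lengths give back \<open>u\<close>. Where needles overlap the last one wins, so the
  recursion needs no disjointness, which enters only when the control is evaluated inside a
  needle.\<close>

primrec needle_control :: "(real \<Rightarrow> 'y) \<Rightarrow> (nat \<Rightarrow> real) \<Rightarrow> (nat \<Rightarrow> 'y) \<Rightarrow> nat \<Rightarrow> (nat \<Rightarrow> real) \<Rightarrow> real \<Rightarrow> 'y"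
  where
    "needle_control u \<tau> \<zeta> 0 a = u"
  | "needle_control u \<tau> \<zeta> (Suc n) a =
      (\<lambda>t. if \<tau> n \<le> t \<and> t < \<tau> n + a n then \<zeta> n else needle_control u \<tau> \<zeta> n a t)"

lemma needle_control_NPC0R:
  fixes u :: "real \<Rightarrow> 'y::t2_space"
  assumes "0 < T" "u \<in> NPC0R T U" "\<And>i. i < n \<Longrightarrow> 0 \<le> \<tau> i \<and> \<tau> i + a i < T \<and> \<zeta> i \<in> U"
  shows "needle_control u \<tau> \<zeta> n a \<in> NPC0R T U"
  using assms(3) by (induction n) (auto intro!: NPC0R_override assms)

lemma needle_control_outside:
  assumes "\<And>i. i < n \<Longrightarrow> t \<notin> {\<tau> i..<\<tau> i + a i}"
  shows "needle_control u \<tau> \<zeta> n a t = u t"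
  using assms
proof (induction n)
  case (Suc n)
  then have "\<not> (\<tau> n \<le> t \<and> t < \<tau> n + a n)" using Suc.prems[of n] by auto
  with Suc show ?case by auto
qed simp

lemma needle_control_range: "needle_control u \<tau> \<zeta> n a t \<in> insert (u t) (\<zeta> ` {..<n})"
  by (induction n) auto

lemma needle_control_inside:
  assumes "i < n" "t \<in> {\<tau> i..<\<tau> i + a i}" "\<And>j. j < n \<Longrightarrow> j \<noteq> i \<Longrightarrow> t \<notin> {\<tau> j..<\<tau> j + a j}"
  shows "needle_control u \<tau> \<zeta> n a t = \<zeta> i"
  using assms
proof (induction n)
  case (Suc n)
  show ?case
  proof (cases "i = n")
    case False
    then have "\<not> (\<tau> n \<le> t \<and> t < \<tau> n + a n)" using Suc.prems(3)[of n] by auto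
    then show ?thesis using Suc False by auto
  qed (use Suc in auto)
qed simp

text \<open>Two needles with a common start differ only between their ends, so the set where the
  controls differ has measure at most the sum of the \<open>\<bar>a i - b i\<bar>\<close>. This is
  the source of the Lipschitz dependence on the lengths.\<close>

lemma needle_control_cong:
  assumes "\<And>i. i < n \<Longrightarrow> t \<notin> {\<tau> i + min (a i) (b i)..<\<tau> i + max (a i) (b i)}"
  shows "needle_control u \<tau> \<zeta> n a t = needle_control u \<tau> \<zeta> n b t"
  using assms
proof (induction n)
  case (Suc n)
  have "(\<tau> n \<le> t \<and> t < \<tau> n + a n) = (\<tau> n \<le> t \<and> t < \<tau> n + b n)" using Suc.prems[of n] by auto
  with Suc show ?case by auto
qed simp

text \<open>A reference pair of a control system without running reward. Lipschitz continuity is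
  asked only in a tube around \<open>y\<close>, uniformly over compact sets of controls, and Frechet
  differentiability only along the pair itself: on a needle the state deviation is of the order of
  the needle lengths, so an estimate suffices there.\<close>

locale mayer_system =
  fixes T :: real and \<Omega> :: "'e::banach set" and U :: "'y::real_normed_vector set"
    and F :: "real \<Rightarrow> 'e \<Rightarrow> 'y \<Rightarrow> 'e" and y :: "real \<Rightarrow> 'e" and u :: "real \<Rightarrow> 'y"
    and A M :: "real \<Rightarrow> ('e \<Rightarrow>\<^sub>L 'e)"
  assumes T: "0 < T"
    and F_cont: "continuous_on ({0..T} \<times> \<Omega> \<times> U) (\<lambda>(t, \<xi>, \<zeta>). F t \<xi> \<zeta>)"
    and tube: "\<And>K. compact K \<Longrightarrow> K \<subseteq> U \<Longrightarrow> \<exists>r>0. \<exists>L. \<forall>t\<in>{0..T}. cball (y t) r \<subseteq> \<Omega> \<and>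
      (\<forall>\<zeta>\<in>K. \<forall>\<xi>\<in>cball (y t) r. \<forall>\<xi>'\<in>cball (y t) r. norm (F t \<xi> \<zeta> - F t \<xi>' \<zeta>) \<le> L * norm (\<xi> - \<xi>'))"
    and y: "y \<in> PC1 T \<Omega>" and u: "u \<in> NPC0R T U"
    and ode: "\<And>t. t \<in> {0..T} \<Longrightarrow> ext_deriv T y t = F t (y t) (u t)"
    and A: "A \<in> PC0 T UNIV"
    and F_deriv: "\<And>t. t \<in> {0..T} \<Longrightarrow> ((\<lambda>\<xi>. F t \<xi> (u t)) has_derivative blinfun_apply (A t)) (at (y t))"
    and M: "continuous_on {0..T} M" "M T = id_blinfun"
      "\<exists>S. finite S \<and> (\<forall>t\<in>{0<..<T} - S. (M has_vector_derivative - (M t o\<^sub>L A t)) (at t))"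
begin

text \<open>The jump of the velocity caused by the value \<open>\<zeta>\<close> at time
  \<open>t\<close>, transported to \<open>T\<close>. For \<open>t < T\<close> this is the derivative
  of the terminal state with respect to the length of a needle starting at \<open>t\<close>.\<close>

definition needle_direction :: "'y \<Rightarrow> real \<Rightarrow> 'e" where
  "needle_direction \<zeta> t = M t (F t (y t) \<zeta> - F t (y t) (u t))"

lemma F_PC0:
  assumes "continuous_on {0..T} w" "\<And>t. t \<in> {0..T} \<Longrightarrow> w t \<in> \<Omega>" "v \<in> PC0 T U"
  shows "(\<lambda>t. F t (w t) (v t)) \<in> PC0 T UNIV"
proof -
  have "(\<lambda>t. t) \<in> PC0 T {0..T}" by (rule PC0_continuous) auto
  from PC0_comp[OF T PC0_Pair[OF T this PC0_Pair[OF T PC0_continuous[OF assms(1,2)] assms(3)]] F_cont, of UNIV]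
  show ?thesis by simp
qed

lemma F_NPC0R:
  assumes "continuous_on {0..T} w" "\<And>t. t \<in> {0..T} \<Longrightarrow> w t \<in> \<Omega>" "v \<in> NPC0R T U"
  shows "(\<lambda>t. F t (w t) (v t)) \<in> NPC0R T UNIV"
proof -
  have "(\<lambda>t. t) \<in> NPC0R T {0..T}" by (rule NPC0R_continuous[OF T]) auto
  from NPC0R_comp[OF T NPC0R_Pair[OF T this NPC0R_Pair[OF T NPC0R_continuous[OF T assms(1,2)] assms(3)]] F_cont, of UNIV]
  show ?thesis by simp
qed

lemmas y_cont = PC1D(1)[OF T y] and y_\<Omega> = PC1D(2)[OF T y] and u_PC0 = NPC0R_PC0[OF u]

text \<open>Right continuity makes the direction almost constant along a short needle; left
  continuity at \<open>T\<close> lets needles near \<open>T\<close> approximate the direction at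
  \<open>T\<close>, where no needle can start.\<close>

lemma needle_direction_NPC0R:
  assumes "\<zeta> \<in> U"
  shows "needle_direction \<zeta> \<in> NPC0R T UNIV"
proof -
  have 1: "(\<lambda>t. F t (y t) \<zeta>) \<in> NPC0R T UNIV"
    using assms by (intro F_NPC0R y_cont y_\<Omega> NPC0R_continuous[OF T]) auto
  have 2: "(\<lambda>t. F t (y t) (u t)) \<in> NPC0R T UNIV" by (intro F_NPC0R y_cont y_\<Omega> u)
  have "continuous_on (UNIV \<times> UNIV \<times> UNIV) (\<lambda>(m :: 'e \<Rightarrow>\<^sub>L 'e, a, b). m (a - b))"
    unfolding case_prod_unfold by (intro continuous_intros)
  from NPC0R_comp[OF T NPC0R_Pair[OF T NPC0R_continuous[OF T M(1)] NPC0R_Pair[OF T 1 2]] this, of UNIV]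
  show ?thesis by (simp add: needle_direction_def[abs_def])
qed

text \<open>Outside the needles the deviation from \<open>y\<close> solves the linearised equation
  up to a small remainder, inside them the velocity jumps; variation of constants with
  \<open>M\<close> sums these effects at \<open>T\<close>. The expansion is uniform in the vector of
  lengths, not only along rays, and comes with Lipschitz dependence, because the lengths will later
  be selected as a zero of a continuous map.\<close>

proposition needle_variation:
  fixes \<tau> :: "nat \<Rightarrow> real" and \<zeta> :: "nat \<Rightarrow> 'y"
  assumes \<tau>: "\<And>i. i < N \<Longrightarrow> \<tau> i \<in> {0..<T}" "inj_on \<tau> {..<N}" and \<zeta>: "\<And>i. i < N \<Longrightarrow> \<zeta> i \<in> U"
  obtains r Y V C where "0 < r"
    "\<And>a. (\<forall>i<N. 0 \<le> a i \<and> a i \<le> r) \<Longrightarrow> Y a \<in> PC1 T \<Omega> \<and> V a \<in> NPC0R T U \<and> Y a 0 = y 0 \<and>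
       (\<forall>t\<in>{0..T}. ext_deriv T (Y a) t = F t (Y a t) (V a t))"
    "\<And>a b. (\<forall>i<N. 0 \<le> a i \<and> a i \<le> r) \<Longrightarrow> (\<forall>i<N. 0 \<le> b i \<and> b i \<le> r) \<Longrightarrow>
       norm (Y a T - Y b T) \<le> C * (\<Sum>i<N. \<bar>a i - b i\<bar>)"
    "\<And>e. 0 < e \<Longrightarrow> \<exists>\<delta>>0. \<forall>a. (\<forall>i<N. 0 \<le> a i \<and> a i \<le> r) \<longrightarrow> (\<Sum>i<N. a i) \<le> \<delta> \<longrightarrow>
       norm (Y a T - y T - (\<Sum>i<N. a i *\<^sub>R needle_direction (\<zeta> i) (\<tau> i))) \<le> e * (\<Sum>i<N. a i)"
proof -

  \<comment> \<open>Constants uniform along the reference trajectory\<close>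
  obtain Ku where Ku: "compact Ku" "Ku \<subseteq> U" "u ` {0..T} \<subseteq> Ku" using PC0_compact[OF T u_PC0] by blast
  define K where "K = Ku \<union> \<zeta> ` {..<N}"
  have "compact (\<zeta> ` {..<N})" by (intro finite_imp_compact) simp
  then have K: "compact K" "K \<subseteq> U" using Ku \<zeta> by (auto simp: K_def compact_Un)
  have uK: "u t \<in> K" if "t \<in> {0..T}" for t using Ku that by (auto simp: K_def)
  have \<zeta>K: "\<zeta> i \<in> K" if "i < N" for i using that by (auto simp: K_def)
  obtain \<rho> L0 where \<rho>: "\<rho> > 0" "\<And>t. t \<in> {0..T} \<Longrightarrow> cball (y t) \<rho> \<subseteq> \<Omega>"
    and L0: "\<And>t \<zeta> \<xi> \<xi>'. t \<in> {0..T} \<Longrightarrow> \<zeta> \<in> K \<Longrightarrow> \<xi> \<in> cball (y t) \<rho> \<Longrightarrow> \<xi>' \<in> cball (y t) \<rho> \<Longrightarrow>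
      norm (F t \<xi> \<zeta> - F t \<xi>' \<zeta>) \<le> L0 * norm (\<xi> - \<xi>')"
    using tube[OF K] by metis
  define L where "L = max L0 1"
  have L: "0 < L" by (simp add: L_def)
  have lip: "norm (F t (y t + v) z - F t (y t + w) z) \<le> L * norm (v - w)"
    if "t \<in> {0..T}" "z \<in> K" "norm v \<le> \<rho>" "norm w \<le> \<rho>" for t z v w
  proof -
    have "norm (F t (y t + v) z - F t (y t + w) z) \<le> L0 * norm ((y t + v) - (y t + w))"
      using that by (intro L0) (auto simp: dist_norm)
    also have "\<dots> \<le> L * norm (v - w)" by (auto simp: L_def intro!: mult_right_mono)
    finally show ?thesis .
  qed
  have "continuous_on ({0..T} \<times> K) (\<lambda>(t, z). F t (y t) z)"
  proof -
    have "continuous_on ({0..T} \<times> K) ((\<lambda>(t, \<xi>, \<zeta>). F t \<xi> \<zeta>) \<circ> (\<lambda>(t, z). (t, y t, z)))"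
    proof (rule continuous_on_compose)
      show "continuous_on ({0..T} \<times> K) (\<lambda>(t, z). (t, y t, z))"
        unfolding case_prod_unfold
        by (intro continuous_intros continuous_on_compose2[OF y_cont]) auto
      show "continuous_on ((\<lambda>(t, z). (t, y t, z)) ` ({0..T} \<times> K)) (\<lambda>(t, \<xi>, \<zeta>). F t \<xi> \<zeta>)"
        by (rule continuous_on_subset[OF F_cont]) (use K(2) y_\<Omega> in auto)
    qed
    then show ?thesis by (simp add: o_def case_prod_unfold)
  qed
  then have "compact ((\<lambda>(t, z). F t (y t) z) ` ({0..T} \<times> K))"
    by (rule compact_continuous_image) (use K in \<open>auto intro: compact_Times\<close>)
  then have "bounded ((\<lambda>(t, z). F t (y t) z) ` ({0..T} \<times> K))" by (rule compact_imp_bounded)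
  then obtain B where B: "B > 0" "\<And>t z. t \<in> {0..T} \<Longrightarrow> z \<in> K \<Longrightarrow> norm (F t (y t) z) \<le> B"
    unfolding bounded_pos by auto
  obtain r1 where r1: "r1 > 0" "\<And>i. i < N \<Longrightarrow> \<tau> i + r1 < T"
    "\<And>i j. i < N \<Longrightarrow> j < N \<Longrightarrow> j \<noteq> i \<Longrightarrow> r1 < \<bar>\<tau> i - \<tau> j\<bar>"
  proof -
    have "\<forall>\<^sub>F r in at_right 0. \<tau> i + r < T \<and> (\<forall>j\<in>{..<N} - {i}. r < \<bar>\<tau> i - \<tau> j\<bar>)" if i: "i < N" for i
    proof (intro eventually_conj eventually_ball_finite ballI)
      show "\<forall>\<^sub>F r in at_right 0. \<tau> i + r < T"
      proof -
        have "0 < T - \<tau> i" using \<tau>(1)[OF i] by simp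
        from eventually_at_right_real[OF this] show ?thesis by eventually_elim simp
      qed
      show "\<forall>\<^sub>F r in at_right 0. r < \<bar>\<tau> i - \<tau> j\<bar>" if "j \<in> {..<N} - {i}" for j
      proof -
        have "\<tau> i \<noteq> \<tau> j" using \<tau>(2) i that by (auto simp: inj_on_def)
        then have "0 < \<bar>\<tau> i - \<tau> j\<bar>" by simp
        from eventually_at_right_real[OF this] show ?thesis by eventually_elim simp
      qed
    qed auto
    then have "\<forall>i<N. \<forall>\<^sub>F r in at_right 0. \<tau> i + r < T \<and> (\<forall>j\<in>{..<N} - {i}. r < \<bar>\<tau> i - \<tau> j\<bar>)" by blast
    from finite_right_neighbourhood[of N "\<lambda>i s. \<tau> i + s < T \<and> (\<forall>j\<in>{..<N} - {i}. s < \<bar>\<tau> i - \<tau> j\<bar>)", OF this]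
    obtain r where r: "r > 0"
      "\<forall>i<N. \<forall>s. 0 < s \<longrightarrow> s \<le> r \<longrightarrow> \<tau> i + s < T \<and> (\<forall>j\<in>{..<N} - {i}. s < \<bar>\<tau> i - \<tau> j\<bar>)"
      by (elim exE conjE)
    then have "\<forall>i<N. \<tau> i + r < T \<and> (\<forall>j\<in>{..<N} - {i}. r < \<bar>\<tau> i - \<tau> j\<bar>)" by simp
    then show thesis using r(1) by (intro that[of r]) simp_all
  qed
  define E where "E = exp (2 * L * T)"
  have E: "E > 0" by (simp add: E_def)
  \<comment> \<open>The second bound keeps deviations of size \<open>C0 * \<sigma> a\<close> inside
    the tube of radius \<open>\<rho>\<close>; \<open>real N + 1\<close> instead of \<open>N\<close>
    also covers the case without needles.\<close>
  define r where "r = min r1 (\<rho> / (4 * B * (real N + 1) * E))"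
  have r: "0 < r" "r \<le> r1" using r1 \<rho> B E by (auto simp: r_def)
  define box where "box a \<longleftrightarrow> (\<forall>i<N. 0 \<le> a i \<and> a i \<le> r)" for a :: "nat \<Rightarrow> real"
  \<comment> \<open>\<open>C0 * \<sigma> a\<close> is the radius
    \<open>2 * c * exp (2 * L * T)\<close> of the fixed point lemma for
    \<open>c = 2 * B * \<sigma> a\<close>.\<close>
  define C0 where "C0 = 4 * B * E"
  have C0: "C0 \<ge> 0" using B E by (simp add: C0_def)
  define \<sigma> where "\<sigma> a = (\<Sum>i<N. a i)" for a :: "nat \<Rightarrow> real"
  have \<sigma>0: "0 \<le> \<sigma> a" if "box a" for a using that by (auto simp: \<sigma>_def box_def intro!: sum_nonneg)
  have \<sigma>\<rho>: "C0 * \<sigma> a \<le> \<rho>" if "box a" for a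
  proof -
    have "\<sigma> a \<le> (\<Sum>i<N. r)" using that unfolding \<sigma>_def box_def by (intro sum_mono) auto
    also have "\<dots> \<le> (real N + 1) * r" using r by (simp add: algebra_simps)
    also have "\<dots> \<le> (real N + 1) * (\<rho> / (4 * B * (real N + 1) * E))" by (intro mult_left_mono) (auto simp: r_def)
    also have "\<dots> = \<rho> / C0"
    proof -
      have "n * (\<rho> / (4 * B * n * E)) = \<rho> / (4 * B * E)" if "n > 0" for n :: real
        using that B(1) E by (simp add: field_simps)
      from this[of "real N + 1"] show ?thesis by (simp add: C0_def)
    qed
    finally have "\<sigma> a \<le> \<rho> / C0" .
    then have "C0 * \<sigma> a \<le> C0 * (\<rho> / C0)" using C0 by (intro mult_left_mono) auto
    also have "\<dots> = \<rho>" using B E by (simp add: C0_def)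
    finally show ?thesis .
  qed

  \<comment> \<open>Needle controls and their distance\<close>
  define V where "V a = needle_control u \<tau> \<zeta> N a" for a
  have V_NPC: "V a \<in> NPC0R T U" if "box a" for a
    unfolding V_def
  proof (rule needle_control_NPC0R[OF T u])
    fix i assume i: "i < N"
    then have "a i \<le> r" using that by (simp add: box_def)
    then show "0 \<le> \<tau> i \<and> \<tau> i + a i < T \<and> \<zeta> i \<in> U"
      using \<tau>(1)[OF i] \<zeta>[OF i] r1(2)[OF i] r(2) by auto
  qed
  have VK: "V a t \<in> K" if "t \<in> {0..T}" for a t
    using needle_control_range[of u \<tau> \<zeta> N a t] uK[OF that] \<zeta>K by (auto simp: V_def)
  \<comment> \<open>\<open>\<eta>\<close> counts the needles whose two versions, of length
    \<open>a i\<close> and \<open>b i\<close>, disagree at \<open>t\<close>. It dominates the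
    indicator of the set where the controls differ, and its integral is the distance of the length
    vectors.\<close>
  define \<eta> where "\<eta> a b t = (\<Sum>i<N. indicat_real {\<tau> i + min (a i) (b i)..<\<tau> i + max (a i) (b i)} t)" for a b :: "nat \<Rightarrow> real" and t
  have \<eta>0: "0 \<le> \<eta> a b t" for a b t by (auto simp: \<eta>_def intro!: sum_nonneg)
  have \<eta>_int: "(\<eta> a b has_integral (\<Sum>i<N. \<bar>a i - b i\<bar>)) {0..T}" if "box a" "box b" for a b
  proof -
    have "((\<lambda>t. \<Sum>i<N. indicat_real {\<tau> i + min (a i) (b i)..<\<tau> i + max (a i) (b i)} t *\<^sub>R (1::real)) has_integral
        (\<Sum>i<N. ((\<tau> i + max (a i) (b i)) - (\<tau> i + min (a i) (b i))) *\<^sub>R 1)) {0..T}"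
    proof (intro has_integral_sum has_integral_indicator_Ico)
      fix i assume "i \<in> {..<N}"
      then have i: "i < N" by simp
      then show "\<tau> i + max (a i) (b i) \<le> T" "0 \<le> \<tau> i + min (a i) (b i)"
        using that \<tau>(1)[OF i] r1(2)[OF i] r(2) unfolding box_def by force+
    qed auto
    moreover have "((\<tau> i + max (a i) (b i)) - (\<tau> i + min (a i) (b i))) *\<^sub>R (1::real) = \<bar>a i - b i\<bar>" for i by auto
    ultimately show ?thesis by (simp add: \<eta>_def[abs_def])
  qed
  have \<eta>_le: "\<eta> a b integrable_on {0..t}" "integral {0..t} (\<eta> a b) \<le> (\<Sum>i<N. \<bar>a i - b i\<bar>)"
    if "box a" "box b" "t \<in> {0..T}" for a b t
  proof -
    have i: "\<eta> a b integrable_on {0..T}" using \<eta>_int[OF that(1,2)] by blast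
    then show it: "\<eta> a b integrable_on {0..t}" by (rule integrable_on_subinterval) (use that in auto)
    have "integral {0..t} (\<eta> a b) \<le> integral {0..T} (\<eta> a b)"
      by (rule integral_subset_le[OF _ it i]) (use that \<eta>0 in auto)
    then show "integral {0..t} (\<eta> a b) \<le> (\<Sum>i<N. \<bar>a i - b i\<bar>)"
      using \<eta>_int[OF that(1,2)] by (simp add: integral_unique)
  qed
  have V_eq: "V a t = V b t \<or> 1 \<le> \<eta> a b t" for a b t
  proof (cases "\<exists>i<N. t \<in> {\<tau> i + min (a i) (b i)..<\<tau> i + max (a i) (b i)}")
    case True
    then obtain i where i: "i < N" "t \<in> {\<tau> i + min (a i) (b i)..<\<tau> i + max (a i) (b i)}" by blast
    then have "indicat_real {\<tau> i + min (a i) (b i)..<\<tau> i + max (a i) (b i)} t \<le> \<eta> a b t"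
      unfolding \<eta>_def by (intro member_le_sum) auto
    then show ?thesis using i by simp
  next
    case False
    then show ?thesis using needle_control_cong[of N t \<tau> a b u \<zeta>] by (auto simp: V_def)
  qed
  define zero where "zero = (\<lambda>_::nat. 0::real)"
  have box0: "box zero" using r by (simp add: box_def zero_def)
  have V0: "V zero t = u t" for t
    unfolding V_def zero_def by (rule needle_control_outside) auto
  have \<sigma>abs: "(\<Sum>i<N. \<bar>a i - zero i\<bar>) = \<sigma> a" if "box a" for a
    using that by (auto simp: \<sigma>_def zero_def box_def intro!: sum.cong)

  \<comment> \<open>Trajectories of the needle controls\<close>
  define G where "G a t w = F t (y t + w) (V a t) - F t (y t) (u t)" for a t w
  have y\<rho>: "y t + w \<in> \<Omega>" if "t \<in> {0..T}" "norm w \<le> \<rho>" for t w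
    using \<rho>(2)[OF that(1)] that(2) by (auto simp: subset_iff dist_norm)
  have FyV: "(\<lambda>t. F t (y t + w t) (v t)) \<in> PC0 T UNIV"
    if "v \<in> PC0 T U" "continuous_on {0..T} w" "\<And>t. t \<in> {0..T} \<Longrightarrow> norm (w t) \<le> \<rho>" for v w
    using that by (intro F_PC0 continuous_intros y_cont y\<rho>) auto
  have diffPC0: "(\<lambda>t. h t - k t) \<in> PC0 T UNIV" if "h \<in> PC0 T UNIV" "k \<in> PC0 T UNIV" for h k :: "real \<Rightarrow> 'e"
  proof -
    have "continuous_on (UNIV \<times> UNIV) (\<lambda>p::'e \<times> 'e. fst p - snd p)" by (intro continuous_intros)
    from PC0_comp[OF T PC0_Pair[OF T that] this, of UNIV] show ?thesis by simp
  qed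
  have Fyu: "(\<lambda>t. F t (y t) (u t)) \<in> PC0 T UNIV" by (intro F_PC0 y_cont y_\<Omega> u_PC0)
  have GPC: "(\<lambda>t. G a t (w t)) \<in> PC0 T UNIV"
    if "box a" "continuous_on {0..T} w" "\<And>t. t \<in> {0..T} \<Longrightarrow> norm (w t) \<le> \<rho>" for a w
    unfolding G_def by (intro diffPC0 FyV Fyu NPC0R_PC0[OF V_NPC] that)
  have sub: "f integrable_on {0..t}" if "f \<in> PC0 T UNIV" "t \<in> {0..T}" for f :: "real \<Rightarrow> 'e" and t
    by (rule integrable_on_subinterval[OF PC0_integrable[OF T that(1)]]) (use that in auto)
  \<comment> \<open>The fixed point lemma is applied with a radius proportional to
    \<open>\<sigma> a\<close>, so that existence and the bound by the total length come out
    together; at deviation 0 the integrand is supported on the needles.\<close>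
  have "\<exists>w. continuous_on {0..T} w \<and> (\<forall>t\<in>{0..T}. norm (w t) \<le> C0 * \<sigma> a) \<and>
      (\<forall>t\<in>{0..T}. w t = integral {0..t} (\<lambda>s. G a s (w s)))" if a: "box a" for a
  proof (rule picard[of T L "2 * B * \<sigma> a" "C0 * \<sigma> a" "G a"])
    show "2 * (2 * B * \<sigma> a) * exp (2 * L * T) \<le> C0 * \<sigma> a" by (simp add: C0_def E_def)
    show "(\<lambda>t. G a t (w t)) integrable_on {0..T}"
      if "continuous_on {0..T} w" "\<And>t. t \<in> {0..T} \<Longrightarrow> norm (w t) \<le> C0 * \<sigma> a" for w
      by (rule PC0_integrable[OF T GPC[OF a that(1)]]) (use that(2) \<sigma>\<rho>[OF a] in force)
    show "norm (G a t v - G a t w) \<le> L * norm (v - w)"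
      if "t \<in> {0..T}" "norm v \<le> C0 * \<sigma> a" "norm w \<le> C0 * \<sigma> a" for t v w
      using lip[of t "V a t" v w] VK[of t a] that \<sigma>\<rho>[OF a] by (simp add: G_def)
    show "norm (integral {0..t} (\<lambda>s. G a s 0)) \<le> 2 * B * \<sigma> a" if t: "t \<in> {0..T}" for t
    proof -
      have "norm (integral {0..t} (\<lambda>s. G a s 0)) \<le> integral {0..t} (\<lambda>s. 2 * B * \<eta> a zero s)"
      proof (rule Henstock_Kurzweil_Integration.integral_norm_bound_integral)
        show "(\<lambda>s. G a s 0) integrable_on {0..t}"
          by (rule sub[OF GPC t]) (use a \<rho> in auto)
        show "(\<lambda>s. 2 * B * \<eta> a zero s) integrable_on {0..t}"
          using \<eta>_le(1)[OF a box0 t] by (intro integrable_on_mult_right) auto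
        show "norm (G a s 0) \<le> 2 * B * \<eta> a zero s" if "s \<in> {0..t}" for s
        proof (cases "V a s = u s")
          case True
          then show ?thesis using B \<eta>0[of a zero s] by (simp add: G_def)
        next
          case False
          have s: "s \<in> {0..T}" using that t by auto
          have "norm (G a s 0) \<le> norm (F s (y s) (V a s)) + norm (F s (y s) (u s))"
            by (simp add: G_def norm_triangle_ineq4)
          also have "\<dots> \<le> B + B" by (intro add_mono B(2) s VK uK)
          also have "\<dots> \<le> 2 * B * \<eta> a zero s" using False V_eq[of a s zero] V0 B by simp
          finally show ?thesis .
        qed
      qed
      also have "\<dots> = 2 * B * integral {0..t} (\<eta> a zero)" by simp
      also have "\<dots> \<le> 2 * B * \<sigma> a"
        using \<eta>_le(2)[OF a box0 t] B \<sigma>abs[OF a] by (intro mult_left_mono) auto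
      finally show ?thesis .
    qed
  qed (use T L B \<sigma>0[OF a] in auto)
  then obtain w where w: "\<And>a. box a \<Longrightarrow> continuous_on {0..T} (w a)"
    "\<And>a t. box a \<Longrightarrow> t \<in> {0..T} \<Longrightarrow> norm (w a t) \<le> C0 * \<sigma> a"
    "\<And>a t. box a \<Longrightarrow> t \<in> {0..T} \<Longrightarrow> w a t = integral {0..t} (\<lambda>s. G a s (w a s))"
    by metis
  have w\<rho>: "norm (w a t) \<le> \<rho>" if "box a" "t \<in> {0..T}" for a t
    using w(2)[OF that] \<sigma>\<rho>[OF that(1)] by linarith
  have w0: "w a 0 = 0" if "box a" for a using w(3)[OF that, of 0] T by simp
  have wder: "\<exists>S. finite S \<and> (\<forall>t\<in>{0<..<T} - S. (w a has_vector_derivative G a t (w a t)) (at t))"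
    if a: "box a" for a
  proof -
    obtain S where S: "finite S" "\<And>t. t \<in> {0<..<T} - S \<Longrightarrow>
        ((\<lambda>t. integral {0..t} (\<lambda>s. G a s (w a s))) has_vector_derivative G a t (w a t)) (at t)"
      using PC0_indefinite_integral(2)[OF T GPC[OF a w(1)[OF a] w\<rho>[OF a]]] by blast
    have "(w a has_vector_derivative G a t (w a t)) (at t)" if "t \<in> {0<..<T} - S" for t
      by (rule has_vector_derivative_transform_within_open[OF S(2)[OF that], of "{0<..<T}"])
        (use that w(3)[OF a] in auto)
    then show ?thesis using S(1) by blast
  qed
  define Y where "Y a t = y t + w a t" for a t
  have Y: "Y a \<in> PC1 T \<Omega> \<and> V a \<in> NPC0R T U \<and> Y a 0 = y 0 \<and>
       (\<forall>t\<in>{0..T}. ext_deriv T (Y a) t = F t (Y a t) (V a t))" if a: "box a" for a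
  proof -
    have Yc: "continuous_on {0..T} (Y a)" unfolding Y_def by (intro continuous_intros y_cont w(1)[OF a])
    have Y\<Omega>: "Y a t \<in> \<Omega>" if "t \<in> {0..T}" for t unfolding Y_def using y\<rho> w\<rho>[OF a] that by blast
    have d: "(\<lambda>t. F t (Y a t) (V a t)) \<in> NPC0R T UNIV" by (intro F_NPC0R Yc Y\<Omega> V_NPC a)
    obtain S where S: "finite S" "\<And>t. t \<in> {0<..<T} - S \<Longrightarrow> (w a has_vector_derivative G a t (w a t)) (at t)"
      using wder[OF a] by blast
    obtain R where R: "finite R" "\<And>t. t \<in> {0<..<T} - R \<Longrightarrow> (y has_vector_derivative ext_deriv T y t) (at t)"
      using PC1D(4)[OF T y] by blast
    have fin: "finite (S \<union> R)" using S R by simp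
    have v: "(Y a has_vector_derivative F t (Y a t) (V a t)) (at t)" if t: "t \<in> {0<..<T} - (S \<union> R)" for t
    proof -
      have "((\<lambda>t. y t + w a t) has_vector_derivative F t (y t) (u t) + G a t (w a t)) (at t)"
        using S(2)[of t] R(2)[of t] ode[of t] t by (intro has_vector_derivative_add) auto
      then show ?thesis by (simp add: Y_def[abs_def] G_def)
    qed
    show ?thesis
      using PC1I(1,2)[OF T Yc Y\<Omega> d fin v] V_NPC[OF a] w0[OF a] by (simp add: Y_def[of a 0])
  qed

  \<comment> \<open>Lipschitz dependence of the terminal state on the lengths\<close>
  define C1 where "C1 = 4 * (B + L * \<rho>) * E"
  have lipschitz: "norm (Y a T - Y b T) \<le> C1 * (\<Sum>i<N. \<bar>a i - b i\<bar>)" if a: "box a" and b: "box b" for a b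
  proof -
    define s where "s = (\<Sum>i<N. \<bar>a i - b i\<bar>)"
    \<comment> \<open>Bounds the difference of two velocities at the same state of the tube:
      \<open>B\<close> on the reference trajectory plus the Lipschitz variation up to distance
      \<open>\<rho>\<close>, taken twice. The factor \<open>2 * exp (2 * L * T)\<close> of the
      Gronwall estimate then gives \<open>C1\<close>.\<close>
    define B' where "B' = 2 * (B + L * \<rho>)"
    have B': "B' \<ge> 0" using B L \<rho> by (simp add: B'_def)
    have s0: "0 \<le> s" unfolding s_def by (intro sum_nonneg) auto
    have cd: "continuous_on {0..T} (\<lambda>t. norm (w a t - w b t))" by (intro continuous_intros w a b)
    have "norm (w a T - w b T) \<le> 2 * (B' * s) * exp (2 * L * T)"
    proof (rule gronwall_integral[OF L _ cd])
      show "0 \<le> B' * s" using B' s0 by simp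
      show "norm (w a t - w b t) \<le> B' * s + L * integral {0..t} (\<lambda>t. norm (w a t - w b t))" if t: "t \<in> {0..T}" for t
      proof -
        have ia: "(\<lambda>s. G a s (w a s)) integrable_on {0..t}" by (intro sub GPC a w w\<rho> t)
        have ib: "(\<lambda>s. G b s (w b s)) integrable_on {0..t}" by (intro sub GPC b w w\<rho> t)
        have "w a t - w b t = integral {0..t} (\<lambda>s. G a s (w a s) - G b s (w b s))"
          unfolding w(3)[OF a t] w(3)[OF b t] by (rule Henstock_Kurzweil_Integration.integral_diff[OF ia ib, symmetric])
        also have "norm \<dots> \<le> integral {0..t} (\<lambda>s. L * norm (w a s - w b s) + B' * \<eta> a b s)"
        proof (rule Henstock_Kurzweil_Integration.integral_norm_bound_integral)
          show "(\<lambda>s. G a s (w a s) - G b s (w b s)) integrable_on {0..t}" by (rule integrable_diff[OF ia ib])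
          have "(\<lambda>s. norm (w a s - w b s)) integrable_on {0..t}"
            by (rule integrable_continuous_real[OF continuous_on_subset[OF cd]]) (use t in auto)
          then show "(\<lambda>s. L * norm (w a s - w b s) + B' * \<eta> a b s) integrable_on {0..t}"
            using \<eta>_le(1)[OF a b t] by (intro integrable_add integrable_on_mult_right)
          show "norm (G a s (w a s) - G b s (w b s)) \<le> L * norm (w a s - w b s) + B' * \<eta> a b s" if "s \<in> {0..t}" for s
          proof -
            have s: "s \<in> {0..T}" using that t by auto
            note wa = w\<rho>[OF a s] and wb = w\<rho>[OF b s]
            have FB: "norm (F s (y s + w b s) z) \<le> B + L * \<rho>" if z: "z \<in> K" for z
            proof -
              have "norm (F s (y s + w b s) z) \<le> norm (F s (y s) z) + norm (F s (y s + w b s) z - F s (y s + 0) z)"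
                using norm_triangle_ineq[of "F s (y s) z" "F s (y s + w b s) z - F s (y s) z"] by simp
              also have "\<dots> \<le> B + L * norm (w b s - 0)"
                using \<rho> by (intro add_mono B(2) lip s z wb) auto
              also have "\<dots> \<le> B + L * \<rho>" using wb L by simp
              finally show ?thesis .
            qed
            have "G a s (w a s) - G b s (w b s) = (F s (y s + w a s) (V a s) - F s (y s + w b s) (V a s))
                + (F s (y s + w b s) (V a s) - F s (y s + w b s) (V b s))" by (simp add: G_def)
            also have "norm \<dots> \<le> L * norm (w a s - w b s) + B' * \<eta> a b s"
            proof (rule norm_triangle_mono)
              show "norm (F s (y s + w a s) (V a s) - F s (y s + w b s) (V a s)) \<le> L * norm (w a s - w b s)"
                by (intro lip s VK wa wb)
              show "norm (F s (y s + w b s) (V a s) - F s (y s + w b s) (V b s)) \<le> B' * \<eta> a b s"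
              proof (cases "V a s = V b s")
                case True
                then show ?thesis using B' \<eta>0[of a b s] by simp
              next
                case False
                have "norm (F s (y s + w b s) (V a s) - F s (y s + w b s) (V b s)) \<le> (B + L * \<rho>) + (B + L * \<rho>)"
                  using FB[OF VK[OF s]] by (intro order_trans[OF norm_triangle_ineq4] add_mono)
                also have "\<dots> = B' * 1" by (simp add: B'_def)
                also have "\<dots> \<le> B' * \<eta> a b s" using False V_eq[of a s b] B' by (intro mult_left_mono) auto
                finally show ?thesis .
              qed
            qed
            finally show ?thesis .
          qed
        qed
        also have "\<dots> = L * integral {0..t} (\<lambda>s. norm (w a s - w b s)) + B' * integral {0..t} (\<eta> a b)"
        proof -
          have "(\<lambda>s. norm (w a s - w b s)) integrable_on {0..t}"
            by (rule integrable_continuous_real[OF continuous_on_subset[OF cd]]) (use t in auto)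
          then show ?thesis using \<eta>_le(1)[OF a b t]
            by (subst Henstock_Kurzweil_Integration.integral_add) (auto intro!: integrable_on_mult_right)
        qed
        also have "\<dots> \<le> L * integral {0..t} (\<lambda>s. norm (w a s - w b s)) + B' * s"
          using \<eta>_le(2)[OF a b t] B' by (auto simp: s_def intro!: mult_left_mono)
        finally show ?thesis by simp
      qed
    qed (use T in auto)
    also have "\<dots> = C1 * s" by (simp add: C1_def B'_def E_def)
    finally show ?thesis by (simp add: Y_def s_def)
  qed

  \<comment> \<open>The remainder of the linearisation\<close>
  define R where "R a t = F t (y t + w a t) (u t) - F t (y t) (u t) - A t (w a t)" for a t
  obtain KA where KA: "KA \<ge> 0" "\<And>t. t \<in> {0..T} \<Longrightarrow> norm (A t) \<le> KA" using PC0_bounded[OF T A] by blast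
  have Aw: "norm (A t (w a t)) \<le> KA * norm (w a t)" if "t \<in> {0..T}" for a t
    using norm_blinfun[of "A t" "w a t"] mult_right_mono[OF KA(2)[OF that], of "norm (w a t)"] by auto
  have APC: "(\<lambda>t. A t (w a t)) \<in> PC0 T UNIV" if "box a" for a
  proof -
    have "continuous_on (UNIV \<times> UNIV) (\<lambda>p::('e \<Rightarrow>\<^sub>L 'e) \<times> 'e. blinfun_apply (fst p) (snd p))" by (intro continuous_intros)
    from PC0_comp[OF T PC0_Pair[OF T A PC0_continuous[OF w(1)[OF that]]] this, of UNIV] show ?thesis by simp
  qed
  have RPC: "(\<lambda>t. norm (R a t)) \<in> PC0 T UNIV" if "box a" for a
  proof -
    have "R a \<in> PC0 T UNIV" unfolding R_def by (intro diffPC0 FyV Fyu APC u_PC0 w that w\<rho>)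
    from PC0_comp[OF T this, of norm UNIV] show ?thesis by (auto intro: continuous_intros)
  qed
  have R_le: "norm (R a t) \<le> (L + KA) * norm (w a t)" if a: "box a" and t: "t \<in> {0..T}" for a t
  proof -
    have "norm (R a t) \<le> norm (F t (y t + w a t) (u t) - F t (y t + 0) (u t)) + norm (A t (w a t))"
      by (simp add: R_def norm_triangle_ineq4)
    also have "\<dots> \<le> L * norm (w a t - 0) + KA * norm (w a t)"
      using \<rho> by (intro add_mono lip t uK Aw w\<rho>[OF a]) auto
    finally show ?thesis by (simp add: algebra_simps)
  qed
  \<comment> \<open>Frechet differentiability is pointwise in \<open>t\<close> and not uniform, so
    the remainder is small only in the mean, by dominated convergence along a hypothetical bad
    sequence; the linear bound \<open>R_le\<close> supplies the majorant.\<close>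
  have R_small: "\<exists>\<delta>>0. \<forall>a. box a \<longrightarrow> \<sigma> a \<le> \<delta> \<longrightarrow> integral {0..T} (\<lambda>t. norm (R a t)) \<le> e * \<sigma> a" if e: "0 < e" for e
  proof (rule ccontr)
    assume neg: "\<not> ?thesis"
    have "\<exists>a. box a \<and> \<sigma> a \<le> 1 / real (Suc n) \<and> \<not> integral {0..T} (\<lambda>t. norm (R a t)) \<le> e * \<sigma> a" for n
      using neg by (metis of_nat_0_less_iff zero_less_Suc zero_less_divide_1_iff)
    then obtain a where a: "\<And>n. box (a n)" "\<And>n. \<sigma> (a n) \<le> 1 / real (Suc n)"
      "\<And>n. \<not> integral {0..T} (\<lambda>t. norm (R (a n) t)) \<le> e * \<sigma> (a n)" by metis
    \<comment> \<open>A zero total length gives a zero deviation, for which the assumed failure is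
      impossible; hence quotients by \<open>\<sigma> (a n)\<close> make sense.\<close>
    have pos: "0 < \<sigma> (a n)" for n
    proof (rule ccontr)
      assume "\<not> ?thesis"
      then have "\<sigma> (a n) = 0" using \<sigma>0[OF a(1), of n] by simp
      then have "norm (R (a n) t) = 0" if "t \<in> {0..T}" for t
        using w(2)[OF a(1) that, of n] by (simp add: R_def)
      then have "integral {0..T} (\<lambda>t. norm (R (a n) t)) = integral {0..T} (\<lambda>t. 0)"
        by (intro integral_cong) auto
      then show False using a(3)[of n] \<open>\<sigma> (a n) = 0\<close> by simp
    qed
    have \<sigma>lim: "(\<lambda>n. \<sigma> (a n)) \<longlonglongrightarrow> 0"
      by (rule tendsto_sandwich[OF _ _ tendsto_const LIMSEQ_inverse_real_of_nat])
        (use a(2) pos in \<open>auto simp: inverse_eq_divide intro!: always_eventually less_imp_le\<close>)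
    have "(\<lambda>n. integral {0..T} (\<lambda>t. norm (R (a n) t) / \<sigma> (a n))) \<longlonglongrightarrow> integral {0..T} (\<lambda>_. 0)"
    proof (rule dominated_convergence(2))
      show "(\<lambda>t. norm (R (a n) t) / \<sigma> (a n)) integrable_on {0..T}" for n
        using PC0_integrable[OF T RPC[OF a(1)]] by (rule integrable_on_divide)
      show "(\<lambda>_. (L + KA) * C0) integrable_on {0..T}" by auto
      show "norm (norm (R (a n) t) / \<sigma> (a n)) \<le> (L + KA) * C0" if "t \<in> {0..T}" for n t
      proof -
        have "norm (R (a n) t) \<le> (L + KA) * norm (w (a n) t)" by (rule R_le[OF a(1) that])
        also have "\<dots> \<le> (L + KA) * (C0 * \<sigma> (a n))" using w(2)[OF a(1) that] L KA by (intro mult_left_mono) auto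
        finally show ?thesis using pos[of n] by (simp add: field_simps)
      qed
      show "(\<lambda>n. norm (R (a n) t) / \<sigma> (a n)) \<longlonglongrightarrow> 0" if t: "t \<in> {0..T}" for t
      proof (rule tendstoI)
        fix e' :: real assume e': "0 < e'"
        define e'' where "e'' = e' / (2 * (C0 + 1))"
        have "0 < e''" using e' C0 by (simp add: e''_def)
        then obtain d where d: "d > 0" "\<And>x. norm (x - y t) < d \<Longrightarrow>
            norm (F t x (u t) - F t (y t) (u t) - A t (x - y t)) \<le> e'' * norm (x - y t)"
          using F_deriv[OF t] unfolding has_derivative_at_alt by blast
        have "(\<lambda>n. C0 * \<sigma> (a n)) \<longlonglongrightarrow> 0" using tendsto_mult_right_zero[OF \<sigma>lim] by simp
        then have "\<forall>\<^sub>F n in sequentially. C0 * \<sigma> (a n) < d" using d(1) by (rule order_tendstoD(2))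
        then show "\<forall>\<^sub>F n in sequentially. dist (norm (R (a n) t) / \<sigma> (a n)) 0 < e'"
        proof eventually_elim
          case (elim n)
          have wn: "norm (w (a n) t) \<le> C0 * \<sigma> (a n)" by (rule w(2)[OF a(1) t])
          then have "norm (R (a n) t) \<le> e'' * norm (w (a n) t)"
            using d(2)[of "y t + w (a n) t"] elim by (simp add: R_def)
          also have "\<dots> \<le> e'' * (C0 * \<sigma> (a n))" using wn \<open>0 < e''\<close> by (intro mult_left_mono) auto
          finally have "norm (R (a n) t) / \<sigma> (a n) \<le> e'' * C0" using pos[of n] by (simp add: field_simps)
          also have "\<dots> < e'"
          proof -
            have "e'' * C0 \<le> e'' * (C0 + 1)" using \<open>0 < e''\<close> by (intro mult_left_mono) auto
            also have "\<dots> = e' / 2" using C0 by (simp add: e''_def field_simps)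
            finally show ?thesis using e' by simp
          qed
          finally show ?case using pos[of n] by simp
        qed
      qed
    qed
    then have "\<forall>\<^sub>F n in sequentially. integral {0..T} (\<lambda>t. norm (R (a n) t) / \<sigma> (a n)) < e"
      using e by (intro order_tendstoD(2)) auto
    then obtain n where "integral {0..T} (\<lambda>t. norm (R (a n) t) / \<sigma> (a n)) < e"
      using eventually_happens' sequentially_bot by blast
    then have "integral {0..T} (\<lambda>t. norm (R (a n) t)) < e * \<sigma> (a n)"
      using pos[of n] by (simp add: integral_divide field_simps)
    then show False using a(3)[of n] by simp
  qed

  \<comment> \<open>First-order expansion of the terminal state\<close>
  have "compact (M ` {0..T})" using M(1) by (rule compact_continuous_image) auto
  then have "bounded (M ` {0..T})" by (rule compact_imp_bounded)
  then obtain m0 where m0: "m0 > 0" "\<And>t. t \<in> {0..T} \<Longrightarrow> norm (M t) \<le> m0"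
    unfolding bounded_pos by auto
  define D where "D i = needle_direction (\<zeta> i) (\<tau> i)" for i
  have expansion: "\<exists>\<delta>>0. \<forall>a. box a \<longrightarrow> \<sigma> a \<le> \<delta> \<longrightarrow> norm (Y a T - y T - (\<Sum>i<N. a i *\<^sub>R D i)) \<le> e * \<sigma> a"
    if e: "0 < e" for e
  proof -
    obtain \<delta>1 where \<delta>1: "\<delta>1 > 0"
      "\<And>a. box a \<Longrightarrow> \<sigma> a \<le> \<delta>1 \<Longrightarrow> integral {0..T} (\<lambda>t. norm (R a t)) \<le> e / (2 * m0) * \<sigma> a"
      using R_small[of "e / (2 * m0)"] e m0 by auto
    have "\<forall>\<^sub>F s in at_right 0. norm (needle_direction (\<zeta> i) (\<tau> i + s) - D i) \<le> e / 4" if i: "i < N" for i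
    proof -
      have "(needle_direction (\<zeta> i) \<longlongrightarrow> D i) (at_right (\<tau> i))"
        using needle_direction_NPC0R[OF \<zeta>[OF i]] \<tau>(1)[OF i] unfolding NPC0R_iff D_def by blast
      then have "\<forall>\<^sub>F t in at_right (\<tau> i). dist (needle_direction (\<zeta> i) t) (D i) < e / 4"
        using e by (intro tendstoD) auto
      then have "\<forall>\<^sub>F s in at_right 0. dist (needle_direction (\<zeta> i) (s + \<tau> i)) (D i) < e / 4"
        unfolding at_right_to_0[of "\<tau> i"] eventually_filtermap .
      then show ?thesis by eventually_elim (simp add: dist_norm add.commute less_imp_le)
    qed
    then have "\<forall>i<N. \<forall>\<^sub>F s in at_right 0. norm (needle_direction (\<zeta> i) (\<tau> i + s) - D i) \<le> e / 4" by blast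
    from finite_right_neighbourhood[of N "\<lambda>i s. norm (needle_direction (\<zeta> i) (\<tau> i + s) - D i) \<le> e / 4", OF this]
    obtain \<delta>2 where \<delta>2: "\<delta>2 > 0"
      "\<forall>i<N. \<forall>s. 0 < s \<longrightarrow> s \<le> \<delta>2 \<longrightarrow> norm (needle_direction (\<zeta> i) (\<tau> i + s) - D i) \<le> e / 4"
      by (elim exE conjE)
    \<comment> \<open>Bounds the transported error on a needle per unit of total length; adding 1
      makes it positive.\<close>
    define c3 where "c3 = m0 * (L + KA) * C0 + 1"
    have c3: "c3 > 0" using m0 L KA C0 by (auto simp: c3_def intro!: add_nonneg_pos mult_nonneg_nonneg)
    define \<delta> where "\<delta> = min \<delta>1 (min \<delta>2 (e / (4 * c3)))"
    have \<delta>: "\<delta> > 0" using \<delta>1 \<delta>2 e c3 by (simp add: \<delta>_def)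
    have "norm (Y a T - y T - (\<Sum>i<N. a i *\<^sub>R D i)) \<le> e * \<sigma> a" if a: "box a" and small: "\<sigma> a \<le> \<delta>" for a
    proof -
      have a_le: "a i \<le> \<sigma> a" if "i < N" for i
        unfolding \<sigma>_def by (rule member_le_sum) (use a that in \<open>auto simp: box_def\<close>)
      have a01: "0 \<le> a i" "a i \<le> r" if "i < N" for i using a that by (auto simp: box_def)
      \<comment> \<open>\<open>H\<close> is the derivative of \<open>M t (w a t)\<close>: the
        equation for \<open>M\<close> subtracts the linear part \<open>A t (w a t)\<close> from the
        velocity difference. Since \<open>w a 0 = 0\<close> and \<open>M T\<close> is the identity,
        its integral is the deviation at \<open>T\<close>.\<close>
      define H where "H t = M t (G a t (w a t) - A t (w a t))" for t
      obtain S where S: "finite S" "\<And>t. t \<in> {0<..<T} - S \<Longrightarrow> (w a has_vector_derivative G a t (w a t)) (at t)"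
        using wder[OF a] by blast
      obtain R' where R': "finite R'" "\<And>t. t \<in> {0<..<T} - R' \<Longrightarrow> (M has_vector_derivative - (M t o\<^sub>L A t)) (at t)"
        using M(3) by blast
      have "(H has_integral M T (w a T) - M 0 (w a 0)) {0..T}"
      proof (rule fundamental_theorem_of_calculus_interior_strong)
        show "finite (S \<union> R')" using S R' by simp
        show "((\<lambda>t. M t (w a t)) has_vector_derivative H t) (at t)" if "t \<in> {0<..<T} - (S \<union> R')" for t
        proof -
          have "((\<lambda>t. M t (w a t)) has_vector_derivative M t (G a t (w a t)) + (- (M t o\<^sub>L A t)) (w a t)) (at t)"
            using S(2) R'(2) that
            by (intro bounded_bilinear.has_vector_derivative[OF bounded_bilinear_blinfun_apply]) auto
          then show ?thesis by (simp add: H_def blinfun.bilinear_simps)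
        qed
        show "continuous_on {0..T} (\<lambda>t. M t (w a t))" by (intro continuous_intros M w a)
      qed (use T in auto)
      then have Hint: "(H has_integral w a T) {0..T}" using w0[OF a] M(2) by simp
      have Dint: "((\<lambda>t. \<Sum>i<N. indicat_real {\<tau> i..<\<tau> i + a i} t *\<^sub>R D i) has_integral
          (\<Sum>i<N. (\<tau> i + a i - \<tau> i) *\<^sub>R D i)) {0..T}"
      proof (intro has_integral_sum has_integral_indicator_Ico)
        fix i assume "i \<in> {..<N}"
        then have i: "i < N" by simp
        then show "0 \<le> \<tau> i" "\<tau> i \<le> \<tau> i + a i" "\<tau> i + a i \<le> T"
          using \<tau>(1)[OF i] a01[OF i] r1(2)[OF i] r(2) by auto
      qed auto
      have diff: "((\<lambda>t. H t - (\<Sum>i<N. indicat_real {\<tau> i..<\<tau> i + a i} t *\<^sub>R D i)) has_integral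
          w a T - (\<Sum>i<N. a i *\<^sub>R D i)) {0..T}"
        using has_integral_diff[OF Hint Dint] by simp
      have \<eta>a: "(\<eta> a zero has_integral \<sigma> a) {0..T}" using \<eta>_int[OF a box0] \<sigma>abs[OF a] by simp
      \<comment> \<open>The integrand is compared pointwise with the needle directions: off the
        needles \<open>H\<close> is the transported remainder, and on a needle the difference is at
        most \<open>e / 2\<close>, which integrates to \<open>e / 2 * \<sigma> a\<close>.\<close>
      have "norm (integral {0..T} (\<lambda>t. H t - (\<Sum>i<N. indicat_real {\<tau> i..<\<tau> i + a i} t *\<^sub>R D i)))
          \<le> integral {0..T} (\<lambda>t. m0 * norm (R a t) + e / 2 * \<eta> a zero t)"
      proof (rule Henstock_Kurzweil_Integration.integral_norm_bound_integral)
        show "(\<lambda>t. H t - (\<Sum>i<N. indicat_real {\<tau> i..<\<tau> i + a i} t *\<^sub>R D i)) integrable_on {0..T}"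
          using diff by blast
        show "(\<lambda>t. m0 * norm (R a t) + e / 2 * \<eta> a zero t) integrable_on {0..T}"
          using \<eta>a by (intro integrable_add integrable_on_mult_right PC0_integrable[OF T RPC[OF a]]) blast
        show "norm (H t - (\<Sum>i<N. indicat_real {\<tau> i..<\<tau> i + a i} t *\<^sub>R D i)) \<le> m0 * norm (R a t) + e / 2 * \<eta> a zero t"
          if t: "t \<in> {0..T}" for t
        proof (cases "\<exists>i<N. t \<in> {\<tau> i..<\<tau> i + a i}")
          case False
          then have "V a t = u t" unfolding V_def by (intro needle_control_outside) auto
          then have "H t = M t (R a t)" by (simp add: H_def G_def R_def)
          then have "norm (H t) \<le> m0 * norm (R a t)"
            using norm_blinfun[of "M t" "R a t"] mult_right_mono[OF m0(2)[OF t], of "norm (R a t)"] by auto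
          moreover have "(\<Sum>i<N. indicat_real {\<tau> i..<\<tau> i + a i} t *\<^sub>R D i) = 0"
            using False by (intro sum.neutral) auto
          moreover have "0 \<le> e / 2 * \<eta> a zero t" using \<eta>0[of a zero t] e by simp
          ultimately show ?thesis by simp
        next
          case True
          then obtain i where i: "i < N" "t \<in> {\<tau> i..<\<tau> i + a i}" by blast
          have other: "t \<notin> {\<tau> j..<\<tau> j + a j}" if j: "j < N" "j \<noteq> i" for j
          proof
            assume "t \<in> {\<tau> j..<\<tau> j + a j}"
            then have "\<bar>\<tau> i - \<tau> j\<bar> < r1" using i(2) a01[OF i(1)] a01[OF j(1)] r(2) by auto
            then show False using r1(3)[OF i(1) j(1) j(2)] by simp
          qed
          have Vt: "V a t = \<zeta> i" unfolding V_def by (rule needle_control_inside[OF i(1), of t \<tau> a]) (use i(2) other in auto)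
          have "(\<Sum>i<N. indicat_real {\<tau> i..<\<tau> i + a i} t *\<^sub>R D i) = (\<Sum>j\<in>{i}. indicat_real {\<tau> j..<\<tau> j + a j} t *\<^sub>R D j)"
            by (rule sum.mono_neutral_right) (use i(1) other in auto)
          also have "\<dots> = D i" using i(2) by simp
          finally have sumD: "(\<Sum>i<N. indicat_real {\<tau> i..<\<tau> i + a i} t *\<^sub>R D i) = D i" .
          have wt: "norm (w a t) \<le> C0 * \<sigma> a" by (rule w(2)[OF a t])
          \<comment> \<open>No state derivative is assumed for the control value
            \<open>\<zeta> i\<close>. The crude estimate of order \<open>\<sigma> a\<close> is
            enough, because the needle itself has length at most \<open>\<sigma> a\<close>.\<close>
          have 1: "norm (M t (F t (y t + w a t) (\<zeta> i) - F t (y t) (\<zeta> i) - A t (w a t))) \<le> e / 4"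
          proof -
            have "norm (F t (y t + w a t) (\<zeta> i) - F t (y t) (\<zeta> i) - A t (w a t))
                \<le> norm (F t (y t + w a t) (\<zeta> i) - F t (y t + 0) (\<zeta> i)) + norm (A t (w a t))"
              by (simp add: norm_triangle_ineq4)
            also have "\<dots> \<le> L * norm (w a t - 0) + KA * norm (w a t)"
              using \<rho> by (intro add_mono lip t \<zeta>K Aw w\<rho>[OF a] i) auto
            also have "\<dots> = (L + KA) * norm (w a t)" by (simp add: algebra_simps)
            also have "\<dots> \<le> (L + KA) * (C0 * \<sigma> a)" using wt L KA by (intro mult_left_mono) auto
            finally have "m0 * norm (F t (y t + w a t) (\<zeta> i) - F t (y t) (\<zeta> i) - A t (w a t))
                \<le> m0 * ((L + KA) * (C0 * \<sigma> a))" using m0 by (intro mult_left_mono) auto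
            also have "\<dots> \<le> c3 * \<sigma> a" using \<sigma>0[OF a] by (simp add: c3_def algebra_simps)
            also have "\<dots> \<le> c3 * (e / (4 * c3))" using small c3 by (intro mult_left_mono) (auto simp: \<delta>_def)
            also have "\<dots> = e / 4" using c3 by simp
            finally have "m0 * norm (F t (y t + w a t) (\<zeta> i) - F t (y t) (\<zeta> i) - A t (w a t)) \<le> e / 4" .
            moreover have "norm (M t (F t (y t + w a t) (\<zeta> i) - F t (y t) (\<zeta> i) - A t (w a t)))
                \<le> m0 * norm (F t (y t + w a t) (\<zeta> i) - F t (y t) (\<zeta> i) - A t (w a t))"
              by (rule order_trans[OF norm_blinfun]) (intro mult_right_mono m0(2)[OF t] norm_ge_zero)
            ultimately show ?thesis by linarith
          qed
          have 2: "norm (needle_direction (\<zeta> i) t - D i) \<le> e / 4"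
          proof (cases "t = \<tau> i")
            case True
            then show ?thesis using e by (simp add: D_def)
          next
            case False
            have "t - \<tau> i \<le> \<delta>2" using i a_le[OF i(1)] small by (auto simp: \<delta>_def)
            then show ?thesis using \<delta>2(2)[rule_format, OF i(1), of "t - \<tau> i"] False i(2) by auto
          qed
          have "H t - D i = M t (F t (y t + w a t) (\<zeta> i) - F t (y t) (\<zeta> i) - A t (w a t))
              + (needle_direction (\<zeta> i) t - D i)"
            by (simp add: H_def G_def Vt needle_direction_def blinfun.bilinear_simps)
          also have "norm \<dots> \<le> e / 4 + e / 4" by (rule norm_triangle_mono[OF 1 2])
          also have "\<dots> \<le> e / 2 * \<eta> a zero t"
          proof -
            have "indicat_real {\<tau> i + min (a i) (zero i)..<\<tau> i + max (a i) (zero i)} t \<le> \<eta> a zero t"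
              unfolding \<eta>_def by (intro member_le_sum) (use i in auto)
            moreover have "{\<tau> i + min (a i) (zero i)..<\<tau> i + max (a i) (zero i)} = {\<tau> i..<\<tau> i + a i}"
              using a01[OF i(1)] by (auto simp: zero_def)
            ultimately have "1 \<le> \<eta> a zero t" using i(2) by simp
            then show ?thesis using e by simp
          qed
          finally show ?thesis using m0 by (simp add: sumD add_increasing)
        qed
      qed
      also have "\<dots> = m0 * integral {0..T} (\<lambda>t. norm (R a t)) + e / 2 * \<sigma> a"
      proof -
        have "((\<lambda>t. m0 * norm (R a t) + e / 2 * \<eta> a zero t) has_integral
            m0 * integral {0..T} (\<lambda>t. norm (R a t)) + e / 2 * \<sigma> a) {0..T}"
          using \<eta>a PC0_integrable[OF T RPC[OF a]]
          by (intro has_integral_add has_integral_mult_right integrable_integral)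
        then show ?thesis by (rule integral_unique)
      qed
      also have "\<dots> \<le> m0 * (e / (2 * m0) * \<sigma> a) + e / 2 * \<sigma> a"
      proof -
        have "\<sigma> a \<le> \<delta>1" using small by (simp add: \<delta>_def)
        from mult_left_mono[OF \<delta>1(2)[OF a this], of m0] m0(1) show ?thesis by linarith
      qed
      also have "\<dots> = e * \<sigma> a" using m0 by simp
      finally show ?thesis using integral_unique[OF diff] by (simp add: Y_def)
    qed
    then show ?thesis using \<delta> by blast
  qed
  show thesis
    by (rule that[of r Y V C1])
      (use r(1) Y lipschitz expansion in \<open>auto simp: box_def[abs_def] \<sigma>_def[abs_def] D_def\<close>)
qed

end

section \<open>Improvement under finitely many constraints\<close>

text \<open>Coordinates are treated one after another, each extraction preserving the limits already
  found; the bound \<open>e\<close> supplies compactness in each coordinate.\<close>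

lemma convergent_subsequence_coordinates:
  fixes b :: "nat \<Rightarrow> nat \<Rightarrow> real"
  assumes "\<And>k i. i < n \<Longrightarrow> \<bar>b k i\<bar> \<le> e"
  shows "\<exists>\<rho> \<beta>. strict_mono \<rho> \<and> (\<forall>i<n. (\<lambda>k. b (\<rho> k) i) \<longlonglongrightarrow> \<beta> i)"
  using assms
proof (induction n)
  case 0
  then show ?case by (auto intro!: exI[of _ id] simp: strict_mono_def)
next
  case (Suc n)
  then obtain \<rho> \<beta> where \<rho>: "strict_mono \<rho>" "\<And>i. i < n \<Longrightarrow> (\<lambda>k. b (\<rho> k) i) \<longlonglongrightarrow> \<beta> i" by force
  have "\<forall>k. b (\<rho> k) n \<in> {-e..e}" using Suc.prems[of n] by (auto simp: abs_le_iff minus_le_iff)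
  then obtain l r where r: "strict_mono r" "((\<lambda>k. b (\<rho> k) n) \<circ> r) \<longlonglongrightarrow> l"
    using compact_imp_seq_compact[OF compact_Icc] unfolding seq_compact_def by metis
  have "(\<lambda>k. b ((\<rho> \<circ> r) k) i) \<longlonglongrightarrow> (\<beta>(n := l)) i" if "i < Suc n" for i
  proof (cases "i = n")
    case True
    then show ?thesis using r(2) by (simp add: o_def)
  next
    case False
    then show ?thesis using LIMSEQ_subseq_LIMSEQ[OF \<rho>(2) r(1), of i] that by (simp add: o_def)
  qed
  then show ?case using strict_mono_o[OF \<rho>(1) r(1)] by blast
qed

text \<open>Poincare--Miranda with coordinates indexed by \<open>{..<n}\<close>, since the number of constraints is not a type.\<close>

lemma poincare_miranda:
  fixes F :: "(nat \<Rightarrow> real) \<Rightarrow> nat \<Rightarrow> real"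
  assumes e: "0 < e"
    and cont: "\<And>\<sigma> \<beta> l. (\<And>k i. i < n \<Longrightarrow> \<bar>\<sigma> k i\<bar> \<le> e) \<Longrightarrow> (\<And>i. i < n \<Longrightarrow> (\<lambda>k. \<sigma> k i) \<longlonglongrightarrow> \<beta> i) \<Longrightarrow> l < n \<Longrightarrow>
      (\<lambda>k. F (\<sigma> k) l) \<longlonglongrightarrow> F \<beta> l"
    and lo: "\<And>\<beta> l. (\<And>i. i < n \<Longrightarrow> \<bar>\<beta> i\<bar> \<le> e) \<Longrightarrow> l < n \<Longrightarrow> \<beta> l = - e \<Longrightarrow> F \<beta> l \<le> 0"
    and hi: "\<And>\<beta> l. (\<And>i. i < n \<Longrightarrow> \<bar>\<beta> i\<bar> \<le> e) \<Longrightarrow> l < n \<Longrightarrow> \<beta> l = e \<Longrightarrow> 0 \<le> F \<beta> l"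
  shows "\<exists>\<beta>. (\<forall>i<n. \<bar>\<beta> i\<bar> \<le> e) \<and> (\<forall>l<n. F \<beta> l = 0)"
proof -
  \<comment> \<open>Kuhn's combinatorial lemma on a grid of mesh \<open>2 * e / p\<close> yields a
    cell among whose corners each component takes both signs; the corners \<open>c\<close> and
    \<open>d\<close> may depend on the component.\<close>
  have cell: "\<exists>b. (\<forall>i<n. \<bar>b i\<bar> \<le> e) \<and> (\<forall>i<n. \<exists>c d. (\<forall>j<n. \<bar>c j\<bar> \<le> e \<and> \<bar>d j\<bar> \<le> e \<and>
      \<bar>c j - b j\<bar> \<le> 2 * e / real p \<and> \<bar>d j - b j\<bar> \<le> 2 * e / real p) \<and> F c i \<le> 0 \<and> 0 \<le> F d i)"
    if p: "0 < p" for p :: nat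
  proof -
    define pt where "pt x i = - e + 2 * e * real (x i) / real p" for x :: "nat \<Rightarrow> nat" and i :: nat
    have pt_box: "\<bar>pt x i\<bar> \<le> e" if "x i \<le> p" for x i
    proof -
      have "2 * e * real (x i) / real p \<le> 2 * e" "0 \<le> 2 * e * real (x i) / real p"
        using that p e by (auto simp: divide_simps)
      then show ?thesis by (auto simp: pt_def)
    qed
    \<comment> \<open>On the faces the label is forced, as the combinatorial lemma requires;
      \<open>lo\<close> and \<open>hi\<close> guarantee that the forced label agrees with the sign
      of \<open>F\<close>.\<close>
    define label where "label x i = (if x i = 0 then 0 else if x i = p then 1 else if F (pt x) i \<le> 0 then 0 else 1 :: nat)"
      for x i
    obtain q where q: "\<forall>i<n. q i < p" "\<forall>i<n. \<exists>r s. (\<forall>j<n. q j \<le> r j \<and> r j \<le> q j + 1) \<and>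
        (\<forall>j<n. q j \<le> s j \<and> s j \<le> q j + 1) \<and> label r i \<noteq> label s i"
      by (rule kuhn_lemma[of p n label]) (use p in \<open>auto simp: label_def\<close>)
    have l0: "F (pt x) i \<le> 0" if "label x i = 0" "\<And>j. j < n \<Longrightarrow> x j \<le> p" "i < n" for x i
    proof (cases "x i = 0")
      case True
      then have "pt x i = - e" by (simp add: pt_def)
      then show ?thesis using lo[of "pt x" i] pt_box that by blast
    qed (use that in \<open>auto simp: label_def split: if_splits\<close>)
    have l1: "0 \<le> F (pt x) i" if "label x i = 1" "\<And>j. j < n \<Longrightarrow> x j \<le> p" "i < n" for x i
    proof (cases "x i = p")
      case True
      then have "pt x i = e" using p by (simp add: pt_def)
      then show ?thesis using hi[of "pt x" i] pt_box that by blast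
    qed (use that in \<open>auto simp: label_def split: if_splits\<close>)
    have near: "\<bar>pt x j - pt q j\<bar> \<le> 2 * e / real p" if "q j \<le> x j" "x j \<le> q j + 1" for x j
    proof -
      have "pt x j - pt q j = 2 * e * (real (x j) - real (q j)) / real p"
        by (simp add: pt_def diff_divide_distrib algebra_simps)
      moreover have "\<bar>real (x j) - real (q j)\<bar> \<le> 1" using that by auto
      then have "2 * e * \<bar>real (x j) - real (q j)\<bar> / real p \<le> 2 * e * 1 / real p"
        using e p by (intro divide_right_mono mult_left_mono) auto
      ultimately show ?thesis using e by (simp add: abs_mult)
    qed
    have "\<exists>c d. (\<forall>j<n. \<bar>c j\<bar> \<le> e \<and> \<bar>d j\<bar> \<le> e \<and>
      \<bar>c j - pt q j\<bar> \<le> 2 * e / real p \<and> \<bar>d j - pt q j\<bar> \<le> 2 * e / real p) \<and> F c i \<le> 0 \<and> 0 \<le> F d i" if i: "i < n" for i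
    proof -
      obtain r s where rs: "\<forall>j<n. q j \<le> r j \<and> r j \<le> q j + 1" "\<forall>j<n. q j \<le> s j \<and> s j \<le> q j + 1"
        "label r i \<noteq> label s i" using q(2) i by blast
      have rp: "r j \<le> p" "s j \<le> p" if "j < n" for j using rs(1,2) q(1) that by fastforce+
      have b: "\<forall>j<n. \<bar>pt r j\<bar> \<le> e \<and> \<bar>pt s j\<bar> \<le> e \<and>
          \<bar>pt r j - pt q j\<bar> \<le> 2 * e / real p \<and> \<bar>pt s j - pt q j\<bar> \<le> 2 * e / real p"
        using near rs(1,2) pt_box rp by blast
      have "label r i = 0 \<and> label s i = 1 \<or> label r i = 1 \<and> label s i = 0"
        using rs(3) by (auto simp: label_def split: if_splits)
      then show ?thesis
      proof
        assume "label r i = 0 \<and> label s i = 1"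
        then show ?thesis using b l0[of r i] l1[of s i] rp i by (intro exI[of _ "pt r"] exI[of _ "pt s"]) auto
      next
        assume "label r i = 1 \<and> label s i = 0"
        then show ?thesis using b l0[of s i] l1[of r i] rp i by (intro exI[of _ "pt s"] exI[of _ "pt r"]) auto
      qed
    qed
    moreover have "\<forall>i<n. \<bar>pt q i\<bar> \<le> e" by (intro allI impI pt_box) (use q(1) in \<open>simp add: less_imp_le\<close>)
    ultimately show ?thesis by blast
  qed
  then have "\<forall>k. \<exists>b. (\<forall>i<n. \<bar>b i\<bar> \<le> e) \<and> (\<forall>i<n. \<exists>c d. (\<forall>j<n. \<bar>c j\<bar> \<le> e \<and> \<bar>d j\<bar> \<le> e \<and>
      \<bar>c j - b j\<bar> \<le> 2 * e / real (Suc k) \<and> \<bar>d j - b j\<bar> \<le> 2 * e / real (Suc k)) \<and> F c i \<le> 0 \<and> 0 \<le> F d i)"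
    by blast
  then obtain b where b: "\<And>k i. i < n \<Longrightarrow> \<bar>b k i\<bar> \<le> e"
    and cd: "\<And>k i. i < n \<Longrightarrow> \<exists>c d. (\<forall>j<n. \<bar>c j\<bar> \<le> e \<and> \<bar>d j\<bar> \<le> e \<and>
      \<bar>c j - b k j\<bar> \<le> 2 * e / real (Suc k) \<and> \<bar>d j - b k j\<bar> \<le> 2 * e / real (Suc k)) \<and> F c i \<le> 0 \<and> 0 \<le> F d i"
    by metis
  obtain c d where c: "\<And>k i j. i < n \<Longrightarrow> j < n \<Longrightarrow> \<bar>c k i j\<bar> \<le> e \<and> \<bar>c k i j - b k j\<bar> \<le> 2 * e / real (Suc k)"
    and d: "\<And>k i j. i < n \<Longrightarrow> j < n \<Longrightarrow> \<bar>d k i j\<bar> \<le> e \<and> \<bar>d k i j - b k j\<bar> \<le> 2 * e / real (Suc k)"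
    and F: "\<And>k i. i < n \<Longrightarrow> F (c k i) i \<le> 0" "\<And>k i. i < n \<Longrightarrow> 0 \<le> F (d k i) i"
  proof -
    have "\<forall>k i. \<exists>c d. i < n \<longrightarrow> (\<forall>j<n. \<bar>c j\<bar> \<le> e \<and> \<bar>d j\<bar> \<le> e \<and>
      \<bar>c j - b k j\<bar> \<le> 2 * e / real (Suc k) \<and> \<bar>d j - b k j\<bar> \<le> 2 * e / real (Suc k)) \<and> F c i \<le> 0 \<and> 0 \<le> F d i"
      using cd by blast
    then have "\<exists>c d. \<forall>k i. i < n \<longrightarrow> (\<forall>j<n. \<bar>c k i j\<bar> \<le> e \<and> \<bar>d k i j\<bar> \<le> e \<and>
      \<bar>c k i j - b k j\<bar> \<le> 2 * e / real (Suc k) \<and> \<bar>d k i j - b k j\<bar> \<le> 2 * e / real (Suc k)) \<and>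
      F (c k i) i \<le> 0 \<and> 0 \<le> F (d k i) i"
      unfolding choice_iff .
    then show thesis using that by blast
  qed
  \<comment> \<open>As the mesh shrinks, all corners of a cell converge with its base point, so both
    sign conditions pass to the limit at one and the same point.\<close>
  obtain \<rho> \<beta> where \<rho>: "strict_mono \<rho>" "\<And>i. i < n \<Longrightarrow> (\<lambda>k. b (\<rho> k) i) \<longlonglongrightarrow> \<beta> i"
    using convergent_subsequence_coordinates[of n b e] b by blast
  have lim0: "(\<lambda>k. 2 * e / real (Suc (\<rho> k))) \<longlonglongrightarrow> 0"
  proof -
    have "(\<lambda>k. 2 * e * inverse (real (Suc k))) \<longlonglongrightarrow> 2 * e * 0"
      by (intro tendsto_mult tendsto_const LIMSEQ_inverse_real_of_nat)
    from LIMSEQ_subseq_LIMSEQ[OF this \<rho>(1)] show ?thesis by (simp add: o_def divide_inverse)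
  qed
  have conv: "(\<lambda>k. x k j) \<longlonglongrightarrow> \<beta> j"
    if "j < n" "\<And>k. \<bar>x k j - b (\<rho> k) j\<bar> \<le> 2 * e / real (Suc (\<rho> k))" for x :: "nat \<Rightarrow> nat \<Rightarrow> real" and j
  proof -
    have "(\<lambda>k. x k j - b (\<rho> k) j) \<longlonglongrightarrow> 0"
      by (rule Lim_null_comparison[OF _ lim0]) (use that in \<open>auto intro!: always_eventually\<close>)
    from tendsto_add[OF this \<rho>(2)[OF that(1)]] show ?thesis by simp
  qed
  have "\<bar>\<beta> i\<bar> \<le> e" if "i < n" for i
    by (rule LIMSEQ_le_const2[OF tendsto_rabs[OF \<rho>(2)[OF that]]]) (use b that in auto)
  moreover have "F \<beta> i = 0" if i: "i < n" for i
  proof (rule antisym)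
    have "(\<lambda>k. F (c (\<rho> k) i) i) \<longlonglongrightarrow> F \<beta> i"
    proof (rule cont[OF _ _ i])
      show "\<bar>c (\<rho> k) i j\<bar> \<le> e" if "j < n" for k j using c[OF i that] by blast
      show "(\<lambda>k. c (\<rho> k) i j) \<longlonglongrightarrow> \<beta> j" if "j < n" for j by (rule conv[OF that]) (use c[OF i that] in blast)
    qed
    then show "F \<beta> i \<le> 0" by (rule LIMSEQ_le_const2) (use F(1)[OF i] in auto)
    have "(\<lambda>k. F (d (\<rho> k) i) i) \<longlonglongrightarrow> F \<beta> i"
    proof (rule cont[OF _ _ i])
      show "\<bar>d (\<rho> k) i j\<bar> \<le> e" if "j < n" for k j using d[OF i that] by blast
      show "(\<lambda>k. d (\<rho> k) i j) \<longlonglongrightarrow> \<beta> j" if "j < n" for j by (rule conv[OF that]) (use d[OF i that] in blast)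
    qed
    then show "0 \<le> F \<beta> i" by (rule LIMSEQ_le_const) (use F(2)[OF i] in auto)
  qed
  ultimately show ?thesis by blast
qed

text \<open>The derivative is a plain function, which suits functionals of the augmented state that
  are not given as elements of the type of bounded linear maps. For such elements the notion agrees
  with \<open>has_hadamard_diff\<close>, since constant directions are a special case.\<close>

definition hadamard_lim :: "('a::real_normed_vector \<Rightarrow> 'b::real_normed_vector) \<Rightarrow> 'a \<Rightarrow> ('a \<Rightarrow> 'b) \<Rightarrow> bool" where
  "hadamard_lim \<phi> z D \<longleftrightarrow>
     (\<forall>v. ((\<lambda>(\<theta>, w). (\<phi> (z + \<theta> *\<^sub>R w) - \<phi> z) /\<^sub>R \<theta>) \<longlongrightarrow> D v) (at_right 0 \<times>\<^sub>F nhds v))"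

lemma hadamard_lim_compose:
  assumes "hadamard_lim \<phi> z D" "filterlim \<theta> (at_right 0) F" "(w \<longlongrightarrow> v) F"
  shows "((\<lambda>n. (\<phi> (z + \<theta> n *\<^sub>R w n) - \<phi> z) /\<^sub>R \<theta> n) \<longlongrightarrow> D v) F"
  using filterlim_compose[OF _ filterlim_Pair[OF assms(2,3)]] assms(1)
  unfolding hadamard_lim_def by fastforce

text \<open>From a violating sequence a subsequence with convergent directions is extracted, and
  along it the quotient and \<open>D\<close> have the same limit. The lemma substitutes for Frechet
  differentiability, since the directions that occur range over a compact set.\<close>

lemma hadamard_lim_uniform:
  fixes \<phi> :: "'a::real_normed_vector \<Rightarrow> real"
  assumes h: "hadamard_lim \<phi> z D" and D: "bounded_linear D" and K: "compact K" and \<eta>: "0 < \<eta>"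
  shows "\<exists>\<delta>>0. \<forall>\<theta> w v. 0 < \<theta> \<longrightarrow> \<theta> < \<delta> \<longrightarrow> w \<in> K \<longrightarrow> dist v w < \<delta> \<longrightarrow>
    \<bar>(\<phi> (z + \<theta> *\<^sub>R v) - \<phi> z) / \<theta> - D w\<bar> < \<eta>"
proof (rule ccontr)
  assume neg: "\<not> ?thesis"
  have "\<exists>\<theta> w v. 0 < \<theta> \<and> \<theta> < 1 / real (Suc n) \<and> w \<in> K \<and> dist v w < 1 / real (Suc n) \<and>
      \<not> \<bar>(\<phi> (z + \<theta> *\<^sub>R v) - \<phi> z) / \<theta> - D w\<bar> < \<eta>" for n
    using neg by (metis of_nat_0_less_iff zero_less_Suc zero_less_divide_1_iff)
  then obtain \<theta> w v where *: "\<And>n. 0 < \<theta> n" "\<And>n. \<theta> n < 1 / real (Suc n)" "\<And>n. w n \<in> K"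
    "\<And>n. dist (v n) (w n) < 1 / real (Suc n)"
    "\<And>n. \<not> \<bar>(\<phi> (z + \<theta> n *\<^sub>R v n) - \<phi> z) / \<theta> n - D (w n)\<bar> < \<eta>" by metis
  obtain l r where r: "strict_mono r" "(w \<circ> r) \<longlonglongrightarrow> l"
    using compact_imp_seq_compact[OF K] *(3) unfolding seq_compact_def by metis
  have inv: "(\<lambda>n. 1 / real (Suc (r n))) \<longlonglongrightarrow> 0"
    using LIMSEQ_subseq_LIMSEQ[OF LIMSEQ_inverse_real_of_nat r(1)] by (simp add: o_def inverse_eq_divide)
  have "(\<lambda>n. \<theta> (r n)) \<longlonglongrightarrow> 0"
    by (rule tendsto_sandwich[OF _ _ tendsto_const inv]) (use * in \<open>auto intro!: always_eventually less_imp_le\<close>)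
  moreover have "0 < \<theta> (r n) \<and> \<theta> (r n) \<noteq> 0" for n using *(1)[of "r n"] by simp
  ultimately have \<theta>: "filterlim (\<lambda>n. \<theta> (r n)) (at_right 0) sequentially"
    by (simp add: filterlim_at)
  have "(\<lambda>n. v (r n) - w (r n)) \<longlonglongrightarrow> 0"
    by (rule Lim_null_comparison[OF _ inv])
      (use *(4) in \<open>auto simp: dist_norm intro!: always_eventually less_imp_le\<close>)
  from tendsto_add[OF this r(2)[unfolded o_def]] have "(\<lambda>n. v (r n)) \<longlonglongrightarrow> l" by simp
  from hadamard_lim_compose[OF h \<theta> this]
  have "(\<lambda>n. (\<phi> (z + \<theta> (r n) *\<^sub>R v (r n)) - \<phi> z) / \<theta> (r n)) \<longlonglongrightarrow> D l" by (simp add: divide_inverse mult.commute)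
  moreover have "(\<lambda>n. D (w (r n))) \<longlonglongrightarrow> D l"
    using bounded_linear.tendsto[OF D r(2)] by (simp add: o_def)
  ultimately have "(\<lambda>n. (\<phi> (z + \<theta> (r n) *\<^sub>R v (r n)) - \<phi> z) / \<theta> (r n) - D (w (r n))) \<longlonglongrightarrow> D l - D l"
    by (rule tendsto_diff)
  then have "\<forall>\<^sub>F n in sequentially. \<bar>(\<phi> (z + \<theta> (r n) *\<^sub>R v (r n)) - \<phi> z) / \<theta> (r n) - D (w (r n))\<bar> < \<eta>"
    using tendstoD[OF _ \<eta>] by (fastforce simp: dist_real_def)
  then obtain n where "\<bar>(\<phi> (z + \<theta> (r n) *\<^sub>R v (r n)) - \<phi> z) / \<theta> (r n) - D (w (r n))\<bar> < \<eta>"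
    using eventually_happens' sequentially_bot by blast
  then show False using *(5)[of "r n"] by simp
qed

text \<open>The coefficient functions are restricted only below \<open>n\<close>, so compactness is
  obtained for the set of sums, by adding one segment at a time.\<close>

lemma compact_box_combinations:
  fixes \<omega> :: "nat \<Rightarrow> 'a::real_normed_vector"
  shows "compact {(\<Sum>j<n. \<beta> j *\<^sub>R \<omega> j) |\<beta>. \<forall>j<n. \<bar>\<beta> j\<bar> \<le> (e::real)}"
proof (induction n)
  case (Suc n)
  let ?S = "\<lambda>n. {(\<Sum>j<n. \<beta> j *\<^sub>R \<omega> j) |\<beta>. \<forall>j<n. \<bar>\<beta> j\<bar> \<le> e}"
  have "compact ((\<lambda>s. s *\<^sub>R \<omega> n) ` {-e..e})"
    by (rule compact_continuous_image) (auto intro!: continuous_intros)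
  from compact_sums[OF Suc this]
  have "compact {x + y |x y. x \<in> ?S n \<and> y \<in> (\<lambda>s. s *\<^sub>R \<omega> n) ` {-e..e}}" .
  also have "{x + y |x y. x \<in> ?S n \<and> y \<in> (\<lambda>s. s *\<^sub>R \<omega> n) ` {-e..e}} = ?S (Suc n)"
  proof (intro equalityI subsetI)
    fix p assume "p \<in> {x + y |x y. x \<in> ?S n \<and> y \<in> (\<lambda>s. s *\<^sub>R \<omega> n) ` {-e..e}}"
    then obtain \<beta> s where *: "\<forall>j<n. \<bar>\<beta> j\<bar> \<le> e" "s \<in> {-e..e}" "p = (\<Sum>j<n. \<beta> j *\<^sub>R \<omega> j) + s *\<^sub>R \<omega> n" by blast
    define \<beta>' where "\<beta>' = \<beta>(n := s)"
    have "(\<Sum>j<n. \<beta> j *\<^sub>R \<omega> j) = (\<Sum>j<n. \<beta>' j *\<^sub>R \<omega> j)" by (intro sum.cong) (auto simp: \<beta>'_def)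
    then have "p = (\<Sum>j<Suc n. \<beta>' j *\<^sub>R \<omega> j)" using *(3) by (simp add: \<beta>'_def)
    moreover have "\<forall>j<Suc n. \<bar>\<beta>' j\<bar> \<le> e" using * by (auto simp: \<beta>'_def less_Suc_eq)
    ultimately show "p \<in> ?S (Suc n)" by blast
  next
    fix p assume "p \<in> ?S (Suc n)"
    then obtain \<beta> where \<beta>: "\<forall>j<Suc n. \<bar>\<beta> j\<bar> \<le> e" "p = (\<Sum>j<n. \<beta> j *\<^sub>R \<omega> j) + \<beta> n *\<^sub>R \<omega> n" by auto
    then have "\<beta> n \<in> {-e..e}" by (auto simp: abs_le_iff minus_le_iff)
    then show "p \<in> {x + y |x y. x \<in> ?S n \<and> y \<in> (\<lambda>s. s *\<^sub>R \<omega> n) ` {-e..e}}" using \<beta> by force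
  qed
  finally show ?case .
qed simp

text \<open>At scale \<open>\<theta>\<close> the attainable directions
  \<open>e \<theta> \<beta>\<close> are close to \<open>w\<close> plus a combination of the
  \<open>\<omega> j\<close>. By \<open>w\<psi>\<close> the equality differentials reproduce
  \<open>\<beta>\<close> on the box with an error below \<open>\<epsilon>\<close>, so the signs on
  opposite faces are right and some \<open>\<beta>\<close> meets all equalities. By
  \<open>w\<phi>\<close> every \<open>\<beta>\<close> of the box is an improvement, hence also the
  selected one, about which nothing else is known. Functionals over \<open>J\<close> have to
  increase, those over \<open>J'\<close> only to stay positive.\<close>

lemma constrained_improvement:
  fixes z w :: "'e::real_normed_vector" and \<omega> :: "nat \<Rightarrow> 'e" and e :: "real \<Rightarrow> (nat \<Rightarrow> real) \<Rightarrow> 'e"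
    and \<psi> D\<psi> :: "nat \<Rightarrow> 'e \<Rightarrow> real" and \<phi> D\<phi> :: "'i \<Rightarrow> 'e \<Rightarrow> real" and \<epsilon> :: real
  assumes \<epsilon>: "0 < \<epsilon>"
    and unif: "\<And>\<eta>. 0 < \<eta> \<Longrightarrow> \<forall>\<^sub>F \<theta> in at_right 0. \<forall>\<beta>. (\<forall>j<q. \<bar>\<beta> j\<bar> \<le> \<epsilon>) \<longrightarrow>
      norm (e \<theta> \<beta> - (w + (\<Sum>j<q. \<beta> j *\<^sub>R \<omega> j))) < \<eta>"
    and cont: "\<forall>\<^sub>F \<theta> in at_right 0. \<forall>\<sigma> \<beta>. (\<forall>k. \<forall>j<q. \<bar>\<sigma> k j\<bar> \<le> \<epsilon>) \<longrightarrow> (\<forall>j<q. \<bar>\<beta> j\<bar> \<le> \<epsilon>) \<longrightarrow>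
      (\<forall>j<q. (\<lambda>k. \<sigma> k j) \<longlonglongrightarrow> \<beta> j) \<longrightarrow> (\<lambda>k. e \<theta> (\<sigma> k)) \<longlonglongrightarrow> e \<theta> \<beta>"
    and \<psi>: "\<And>l. l < q \<Longrightarrow> hadamard_lim (\<psi> l) z (D\<psi> l)" "\<And>l. l < q \<Longrightarrow> bounded_linear (D\<psi> l)"
      "\<And>l. l < q \<Longrightarrow> \<psi> l z = 0"
    and N: "open N" "z \<in> N" "\<And>l. l < q \<Longrightarrow> continuous_on N (\<psi> l)"
    and \<phi>: "finite J" "\<And>i. i \<in> J \<Longrightarrow> hadamard_lim (\<phi> i) z (D\<phi> i)" "\<And>i. i \<in> J \<Longrightarrow> bounded_linear (D\<phi> i)"
    and \<phi>': "finite J'" "\<And>i. i \<in> J' \<Longrightarrow> hadamard_lim (\<phi> i) z (D\<phi> i)" "\<And>i. i \<in> J' \<Longrightarrow> bounded_linear (D\<phi> i)"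
      "\<And>i. i \<in> J' \<Longrightarrow> 0 < \<phi> i z"
    and w\<psi>: "\<And>l. l < q \<Longrightarrow> \<bar>D\<psi> l w\<bar> + \<epsilon> * (\<Sum>j<q. \<bar>D\<psi> l (\<omega> j) - (if j = l then 1 else 0)\<bar>) < \<epsilon>"
    and w\<phi>: "\<And>i. i \<in> J \<Longrightarrow> \<epsilon> * (\<Sum>j<q. \<bar>D\<phi> i (\<omega> j)\<bar>) < D\<phi> i w"
  shows "\<forall>\<^sub>F \<theta> in at_right 0. \<exists>\<beta>. (\<forall>j<q. \<bar>\<beta> j\<bar> \<le> \<epsilon>) \<and> (\<forall>l<q. \<psi> l (z + \<theta> *\<^sub>R e \<theta> \<beta>) = 0) \<and>
    (\<forall>i\<in>J. \<phi> i z < \<phi> i (z + \<theta> *\<^sub>R e \<theta> \<beta>)) \<and> (\<forall>i\<in>J'. 0 < \<phi> i (z + \<theta> *\<^sub>R e \<theta> \<beta>))"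
proof -
  define box where "box \<beta> \<longleftrightarrow> (\<forall>j<q. \<bar>\<beta> j\<bar> \<le> \<epsilon>)" for \<beta> :: "nat \<Rightarrow> real"
  define W where "W \<beta> = w + (\<Sum>j<q. \<beta> j *\<^sub>R \<omega> j)" for \<beta>
  define K where "K = W ` Collect box"
  have "{(\<Sum>j<q. \<beta> j *\<^sub>R \<omega> j) |\<beta>. \<forall>j<q. \<bar>\<beta> j\<bar> \<le> \<epsilon>} = (\<lambda>\<beta>. \<Sum>j<q. \<beta> j *\<^sub>R \<omega> j) ` Collect box"
    by (auto simp: box_def)
  then have "K = (\<lambda>x. w + x) ` {(\<Sum>j<q. \<beta> j *\<^sub>R \<omega> j) |\<beta>. \<forall>j<q. \<bar>\<beta> j\<bar> \<le> \<epsilon>}"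
    by (simp add: K_def W_def image_image)
  then have K: "compact K"
    by (simp add: compact_translation compact_box_combinations)
  obtain BK where BK: "BK > 0" "\<And>k. k \<in> K \<Longrightarrow> norm k \<le> BK"
    using compact_imp_bounded[OF K] unfolding bounded_pos by blast
  have WK: "W \<beta> \<in> K" if "box \<beta>" for \<beta> using that by (auto simp: K_def)
  have DW: "D (W \<beta>) = D w + (\<Sum>j<q. \<beta> j * D (\<omega> j))" if "bounded_linear D" for D :: "'e \<Rightarrow> real" and \<beta>
    using bounded_linear.linear[OF that]
    by (simp add: W_def linear_add linear_sum linear_scale)
  \<comment> \<open>Replaces difference quotients by differentials, uniformly over the box, so that
    only linear inequalities remain to be checked.\<close>
  have key: "\<forall>\<^sub>F \<theta> in at_right 0. \<forall>\<beta>. box \<beta> \<longrightarrow> \<bar>(f (z + \<theta> *\<^sub>R e \<theta> \<beta>) - f z) / \<theta> - D (W \<beta>)\<bar> < \<eta>"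
    if f: "hadamard_lim f z D" "bounded_linear D" and \<eta>: "0 < \<eta>" for f D \<eta>
  proof -
    obtain \<delta> where \<delta>: "\<delta> > 0" "\<And>\<theta> w v. 0 < \<theta> \<Longrightarrow> \<theta> < \<delta> \<Longrightarrow> w \<in> K \<Longrightarrow> dist v w < \<delta> \<Longrightarrow>
        \<bar>(f (z + \<theta> *\<^sub>R v) - f z) / \<theta> - D w\<bar> < \<eta>"
      using hadamard_lim_uniform[OF f K \<eta>] by blast
    show ?thesis using unif[OF \<delta>(1)] eventually_at_right_real[OF \<delta>(1)]
    proof eventually_elim
      case (elim \<theta>)
      show ?case
      proof (intro allI impI)
        fix \<beta> assume b: "box \<beta>"
        then have "dist (e \<theta> \<beta>) (W \<beta>) < \<delta>" using elim(1) by (simp add: box_def W_def dist_norm)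
        then show "\<bar>(f (z + \<theta> *\<^sub>R e \<theta> \<beta>) - f z) / \<theta> - D (W \<beta>)\<bar> < \<eta>" using elim(2) WK[OF b] by (intro \<delta>(2)) auto
      qed
    qed
  qed
  have pos: "\<forall>\<^sub>F \<theta>::real in at_right 0. 0 < \<theta>" by (simp add: eventually_at_filter)
  have sum_le: "\<bar>\<Sum>j<q. \<beta> j * c j\<bar> \<le> \<epsilon> * (\<Sum>j<q. \<bar>c j\<bar>)" if "box \<beta>" for \<beta> c :: "nat \<Rightarrow> real"
  proof -
    have "\<bar>\<Sum>j<q. \<beta> j * c j\<bar> \<le> (\<Sum>j<q. \<epsilon> * \<bar>c j\<bar>)"
      using that by (intro order_trans[OF sum_abs] sum_mono) (auto simp: box_def abs_mult intro!: mult_right_mono)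
    then show ?thesis by (simp add: sum_distrib_left)
  qed
  have "\<forall>\<^sub>F \<theta> in at_right 0. \<forall>\<beta>. box \<beta> \<longrightarrow> (\<beta> l = - \<epsilon> \<longrightarrow> \<psi> l (z + \<theta> *\<^sub>R e \<theta> \<beta>) \<le> 0) \<and>
      (\<beta> l = \<epsilon> \<longrightarrow> 0 \<le> \<psi> l (z + \<theta> *\<^sub>R e \<theta> \<beta>))" if l: "l < q" for l
  proof -
    \<comment> \<open>The slack in \<open>w\<psi>\<close>; it pays for the distance between the
      quotient and the differential.\<close>
    define \<eta> where "\<eta> = \<epsilon> - (\<bar>D\<psi> l w\<bar> + \<epsilon> * (\<Sum>j<q. \<bar>D\<psi> l (\<omega> j) - (if j = l then 1 else 0)\<bar>))"
    have "0 < \<eta>" using w\<psi>[OF l] by (simp add: \<eta>_def)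
    from key[OF \<psi>(1,2)[OF l] this] pos show ?thesis
    proof eventually_elim
      case (elim \<theta>)
      show ?case
      proof (intro allI impI)
        fix \<beta> assume b: "box \<beta>"
        let ?d = "\<lambda>j. D\<psi> l (\<omega> j) - (if j = l then 1 else 0)"
        have "(\<Sum>j<q. \<beta> j * D\<psi> l (\<omega> j)) = (\<Sum>j<q. \<beta> j * ?d j + (if j = l then \<beta> j else 0))"
          by (intro sum.cong) (auto simp: algebra_simps)
        also have "\<dots> = (\<Sum>j<q. \<beta> j * ?d j) + (\<Sum>j<q. if j = l then \<beta> j else 0)" by (rule sum.distrib)
        also have "\<dots> = (\<Sum>j<q. \<beta> j * ?d j) + \<beta> l" using l by simp
        finally have "\<bar>D\<psi> l (W \<beta>) - \<beta> l\<bar> \<le> \<epsilon> - \<eta>"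
          using sum_le[OF b, of ?d] unfolding DW[OF \<psi>(2)[OF l]] \<eta>_def by linarith
        moreover have "\<bar>\<psi> l (z + \<theta> *\<^sub>R e \<theta> \<beta>) / \<theta> - D\<psi> l (W \<beta>)\<bar> < \<eta>" using elim(1) b \<psi>(3)[OF l] by simp
        \<comment> \<open>The scaled constraint differs from \<open>\<beta> l\<close> by less than
          \<open>\<epsilon>\<close>, which fixes its sign on the faces
          \<open>\<beta> l = - \<epsilon>\<close> and \<open>\<beta> l = \<epsilon>\<close>.\<close>
        ultimately have "\<bar>\<psi> l (z + \<theta> *\<^sub>R e \<theta> \<beta>) / \<theta> - \<beta> l\<bar> < \<epsilon>" by linarith
        then have "(\<beta> l = - \<epsilon> \<longrightarrow> \<psi> l (z + \<theta> *\<^sub>R e \<theta> \<beta>) / \<theta> < 0) \<and> (\<beta> l = \<epsilon> \<longrightarrow> 0 < \<psi> l (z + \<theta> *\<^sub>R e \<theta> \<beta>) / \<theta>)" by auto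
        then show "(\<beta> l = - \<epsilon> \<longrightarrow> \<psi> l (z + \<theta> *\<^sub>R e \<theta> \<beta>) \<le> 0) \<and> (\<beta> l = \<epsilon> \<longrightarrow> 0 \<le> \<psi> l (z + \<theta> *\<^sub>R e \<theta> \<beta>))"
          using elim(2) by (auto simp: divide_less_0_iff zero_less_divide_iff)
      qed
    qed
  qed
  then have ev\<psi>: "\<forall>\<^sub>F \<theta> in at_right 0. \<forall>l\<in>{..<q}. \<forall>\<beta>. box \<beta> \<longrightarrow> (\<beta> l = - \<epsilon> \<longrightarrow> \<psi> l (z + \<theta> *\<^sub>R e \<theta> \<beta>) \<le> 0) \<and>
      (\<beta> l = \<epsilon> \<longrightarrow> 0 \<le> \<psi> l (z + \<theta> *\<^sub>R e \<theta> \<beta>))" by (intro eventually_ball_finite) auto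
  have "\<forall>\<^sub>F \<theta> in at_right 0. \<forall>\<beta>. box \<beta> \<longrightarrow> \<phi> i z < \<phi> i (z + \<theta> *\<^sub>R e \<theta> \<beta>)" if i: "i \<in> J" for i
  proof -
    define \<eta> where "\<eta> = D\<phi> i w - \<epsilon> * (\<Sum>j<q. \<bar>D\<phi> i (\<omega> j)\<bar>)"
    have "0 < \<eta>" using w\<phi>[OF i] by (simp add: \<eta>_def)
    from key[OF \<phi>(2,3)[OF i] this] pos show ?thesis
    proof eventually_elim
      case (elim \<theta>)
      show ?case
      proof (intro allI impI)
        fix \<beta> assume b: "box \<beta>"
        have "\<eta> \<le> D\<phi> i (W \<beta>)"
          using sum_le[OF b, of "\<lambda>j. D\<phi> i (\<omega> j)"] unfolding DW[OF \<phi>(3)[OF i]] \<eta>_def by linarith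
        moreover have "\<bar>(\<phi> i (z + \<theta> *\<^sub>R e \<theta> \<beta>) - \<phi> i z) / \<theta> - D\<phi> i (W \<beta>)\<bar> < \<eta>" using elim(1) b by simp
        ultimately have "0 < (\<phi> i (z + \<theta> *\<^sub>R e \<theta> \<beta>) - \<phi> i z) / \<theta>" by linarith
        then show "\<phi> i z < \<phi> i (z + \<theta> *\<^sub>R e \<theta> \<beta>)" using elim(2) by (auto simp: zero_less_divide_iff)
      qed
    qed
  qed
  then have ev\<phi>: "\<forall>\<^sub>F \<theta> in at_right 0. \<forall>i\<in>J. \<forall>\<beta>. box \<beta> \<longrightarrow> \<phi> i z < \<phi> i (z + \<theta> *\<^sub>R e \<theta> \<beta>)"
    using \<phi>(1) by (intro eventually_ball_finite) auto
  have "\<forall>\<^sub>F \<theta> in at_right 0. \<forall>\<beta>. box \<beta> \<longrightarrow> 0 < \<phi> i (z + \<theta> *\<^sub>R e \<theta> \<beta>)" if i: "i \<in> J'" for i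
  proof -
    obtain kD where kD: "kD > 0" "\<And>x. norm (D\<phi> i x) \<le> norm x * kD"
      using bounded_linear.pos_bounded[OF \<phi>'(3)[OF i]] by blast
    \<comment> \<open>Inactive constraints carry no sign condition on their differential;
      \<open>\<theta>\<close> is taken so small that a loss at rate \<open>BK * kD + 1\<close>
      cannot consume the positive value \<open>\<phi> i z\<close>.\<close>
    have "0 < \<phi> i z / (BK * kD + 1)" using \<phi>'(4)[OF i] BK kD by (intro divide_pos_pos add_pos_pos mult_pos_pos) auto
    from eventually_at_right_real[OF this] key[OF \<phi>'(2,3)[OF i] zero_less_one] show ?thesis
    proof eventually_elim
      case (elim \<theta>)
      have th: "0 < \<theta>" using elim(1) by simp
      show ?case
      proof (intro allI impI)
        fix \<beta> assume b: "box \<beta>"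
        have "norm (D\<phi> i (W \<beta>)) \<le> BK * kD"
          by (rule order_trans[OF kD(2)]) (use BK(2)[OF WK[OF b]] kD(1) in \<open>intro mult_right_mono, auto\<close>)
        then have "\<bar>D\<phi> i (W \<beta>)\<bar> \<le> BK * kD" by simp
        moreover have "\<bar>(\<phi> i (z + \<theta> *\<^sub>R e \<theta> \<beta>) - \<phi> i z) / \<theta> - D\<phi> i (W \<beta>)\<bar> < 1" using elim(2) b by simp
        ultimately have "- (BK * kD + 1) \<le> (\<phi> i (z + \<theta> *\<^sub>R e \<theta> \<beta>) - \<phi> i z) / \<theta>" by linarith
        then have "- (BK * kD + 1) * \<theta> \<le> \<phi> i (z + \<theta> *\<^sub>R e \<theta> \<beta>) - \<phi> i z"
          using th by (simp add: pos_le_divide_eq)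
        moreover have "0 < BK * kD + 1" using BK kD by (intro add_pos_pos mult_pos_pos) auto
        then have "\<theta> * (BK * kD + 1) < \<phi> i z" using elim(1) by (simp add: pos_less_divide_eq)
        ultimately show "0 < \<phi> i (z + \<theta> *\<^sub>R e \<theta> \<beta>)" by (simp add: algebra_simps)
      qed
    qed
  qed
  then have ev\<phi>': "\<forall>\<^sub>F \<theta> in at_right 0. \<forall>i\<in>J'. \<forall>\<beta>. box \<beta> \<longrightarrow> 0 < \<phi> i (z + \<theta> *\<^sub>R e \<theta> \<beta>)"
    using \<phi>'(1) by (intro eventually_ball_finite) auto
  obtain rN where rN: "rN > 0" "ball z rN \<subseteq> N" using N(1,2) open_contains_ball by blast
  have evN: "\<forall>\<^sub>F \<theta> in at_right 0. \<forall>\<beta>. box \<beta> \<longrightarrow> z + \<theta> *\<^sub>R e \<theta> \<beta> \<in> N"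
  proof -
    have "0 < rN / (BK + 1)" using rN BK by simp
    from eventually_at_right_real[OF this] unif[OF zero_less_one] show ?thesis
    proof eventually_elim
      case (elim \<theta>)
      show ?case
      proof (intro allI impI)
        fix \<beta> assume b: "box \<beta>"
        have "norm (e \<theta> \<beta> - W \<beta>) < 1" using elim(2) b by (simp add: box_def W_def)
        then have "norm (e \<theta> \<beta>) < BK + 1"
          using norm_triangle_ineq[of "e \<theta> \<beta> - W \<beta>" "W \<beta>"] BK(2)[OF WK[OF b]] by simp
        then have "\<theta> * norm (e \<theta> \<beta>) \<le> \<theta> * (BK + 1)" using elim(1) by (intro mult_left_mono) auto
        also have "\<dots> < rN" using elim(1) BK by (simp add: pos_less_divide_eq)
        finally have "z + \<theta> *\<^sub>R e \<theta> \<beta> \<in> ball z rN" using elim(1) by (simp add: dist_norm)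
        then show "z + \<theta> *\<^sub>R e \<theta> \<beta> \<in> N" using rN by blast
      qed
    qed
  qed
  from ev\<psi> ev\<phi> ev\<phi>' evN cont show ?thesis
  proof eventually_elim
    case (elim \<theta>)
    have "\<exists>\<beta>. (\<forall>i<q. \<bar>\<beta> i\<bar> \<le> \<epsilon>) \<and> (\<forall>l<q. \<psi> l (z + \<theta> *\<^sub>R e \<theta> \<beta>) = 0)"
    proof (rule poincare_miranda[OF \<epsilon>])
      fix \<sigma> :: "nat \<Rightarrow> nat \<Rightarrow> real" and \<beta> l
      assume s: "\<And>k i. i < q \<Longrightarrow> \<bar>\<sigma> k i\<bar> \<le> \<epsilon>" "\<And>i. i < q \<Longrightarrow> (\<lambda>k. \<sigma> k i) \<longlonglongrightarrow> \<beta> i" "l < q"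
      have b: "\<bar>\<beta> i\<bar> \<le> \<epsilon>" if "i < q" for i
        by (rule LIMSEQ_le_const2[OF tendsto_rabs[OF s(2)[OF that]]]) (use s(1) that in auto)
      have "(\<lambda>k. e \<theta> (\<sigma> k)) \<longlonglongrightarrow> e \<theta> \<beta>" using elim(5) s b by blast
      then have "(\<lambda>k. z + \<theta> *\<^sub>R e \<theta> (\<sigma> k)) \<longlonglongrightarrow> z + \<theta> *\<^sub>R e \<theta> \<beta>" by (intro tendsto_intros)
      then show "(\<lambda>k. \<psi> l (z + \<theta> *\<^sub>R e \<theta> (\<sigma> k))) \<longlonglongrightarrow> \<psi> l (z + \<theta> *\<^sub>R e \<theta> \<beta>)"
        by (rule continuous_on_tendsto_compose[OF N(3)[OF s(3)]])
          (use elim(4) s(1) b in \<open>auto simp: box_def\<close>)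
    next
      fix \<beta> l assume "\<And>i. i < q \<Longrightarrow> \<bar>\<beta> i\<bar> \<le> \<epsilon>" "l < q" "\<beta> l = - \<epsilon>"
      then show "\<psi> l (z + \<theta> *\<^sub>R e \<theta> \<beta>) \<le> 0" using elim(1) by (auto simp: box_def)
    next
      fix \<beta> l assume "\<And>i. i < q \<Longrightarrow> \<bar>\<beta> i\<bar> \<le> \<epsilon>" "l < q" "\<beta> l = \<epsilon>"
      then show "0 \<le> \<psi> l (z + \<theta> *\<^sub>R e \<theta> \<beta>)" using elim(1) by (auto simp: box_def)
    qed
    then show ?case using elim(2,3) unfolding box_def by blast
  qed
qed

text \<open>Biorthogonalisation: independence provides a vector on which the new functional differs
  from its reconstruction through the old ones. Projected off the old vectors and normalised, it
  becomes the new dual vector, by which the old ones are then corrected.\<close>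

lemma dual_vectors:
  fixes A :: "'i \<Rightarrow> 'y::real_vector \<Rightarrow> real"
  assumes "finite I" "\<And>i. i \<in> I \<Longrightarrow> linear (A i)"
    and "\<And>c. (\<And>y. (\<Sum>i\<in>I. c i * A i y) = 0) \<Longrightarrow> \<forall>i\<in>I. c i = 0"
  shows "\<exists>v. \<forall>i\<in>I. \<forall>k\<in>I. A i (v k) = (if i = k then 1 else 0)"
  using assms
proof (induction I)
  case (insert a I)
  have lin: "linear (A i)" if "i \<in> insert a I" for i using insert.prems(1) that .
  have "\<forall>i\<in>I. c i = 0" if c: "\<And>y. (\<Sum>i\<in>I. c i * A i y) = 0" for c
  proof -
    have "(\<Sum>i\<in>insert a I. (c(a := 0)) i * A i y) = 0" for y
    proof -
      have "(\<Sum>i\<in>I. (c(a := 0)) i * A i y) = (\<Sum>i\<in>I. c i * A i y)"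
        using insert.hyps(2) by (intro sum.cong) auto
      then show ?thesis using insert.hyps c[of y] by simp
    qed
    from insert.prems(2)[OF this] have z: "\<forall>i\<in>insert a I. (c(a := 0)) i = 0" .
    show ?thesis
    proof
      fix i assume "i \<in> I"
      then show "c i = 0" using bspec[OF z, of i] insert.hyps(2) by (auto split: if_splits)
    qed
  qed
  with insert.IH lin obtain v where v: "\<And>i k. i \<in> I \<Longrightarrow> k \<in> I \<Longrightarrow> A i (v k) = (if i = k then 1 else 0)" by blast
  have "\<exists>y. A a y \<noteq> (\<Sum>k\<in>I. A a (v k) * A k y)"
  proof (rule ccontr)
    assume "\<not> ?thesis"
    then have eq: "A a y = (\<Sum>k\<in>I. A a (v k) * A k y)" for y by blast
    have "(\<Sum>i\<in>insert a I. (\<lambda>i. if i = a then - 1 else A a (v i)) i * A i y) = 0" for y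
    proof -
      have "(\<Sum>i\<in>I. (\<lambda>i. if i = a then - 1 else A a (v i)) i * A i y) = (\<Sum>k\<in>I. A a (v k) * A k y)"
        using insert.hyps(2) by (intro sum.cong) auto
      then show ?thesis using insert.hyps eq[of y] by simp
    qed
    from insert.prems(2)[OF this] show False by simp
  qed
  then obtain y where y: "A a y \<noteq> (\<Sum>k\<in>I. A a (v k) * A k y)" by blast
  define \<gamma> where "\<gamma> = A a y - (\<Sum>k\<in>I. A a (v k) * A k y)"
  have \<gamma>: "\<gamma> \<noteq> 0" using y by (simp add: \<gamma>_def)
  define va where "va = (y - (\<Sum>k\<in>I. A k y *\<^sub>R v k)) /\<^sub>R \<gamma>"
  have va: "A i va = (A i y - (\<Sum>k\<in>I. A k y * A i (v k))) / \<gamma>" if "i \<in> insert a I" for i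
    using lin[OF that] by (simp add: va_def linear_scale linear_diff linear_sum divide_inverse mult_ac)
  have vaI: "A i va = 0" if "i \<in> I" for i
  proof -
    have "(\<Sum>k\<in>I. A k y * A i (v k)) = (\<Sum>k\<in>I. if k = i then A k y else 0)"
      using v that by (intro sum.cong) auto
    then show ?thesis using va[of i] that insert.hyps(1) by simp
  qed
  have vaa: "A a va = 1"
    using va[of a] \<gamma> by (simp add: \<gamma>_def mult.commute)
  define v' where "v' k = (if k = a then va else v k - A a (v k) *\<^sub>R va)" for k
  have "A i (v' k) = (if i = k then 1 else 0)" if "i \<in> insert a I" "k \<in> insert a I" for i k
    using that lin[OF that(1)] vaI vaa v insert.hyps(2)
    by (auto simp: v'_def linear_diff linear_scale)
  then show ?case by blast
qed simp

section \<open>Directional differentiability\<close>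

lemma has_gateaux_diff_unique:
  assumes "has_gateaux_diff F x D" "has_gateaux_diff F x D'"
  shows "D = D'"
proof (rule blinfun_eqI)
  show "blinfun_apply D v = blinfun_apply D' v" for v
    using assms tendsto_unique[OF trivial_limit_at_right_real]
    unfolding has_gateaux_diff_def has_gateaux_variation_def by blast
qed

lemma has_gateaux_diff_DG: "gateaux_differentiable F x \<Longrightarrow> has_gateaux_diff F x (DG F x)"
  unfolding gateaux_differentiable_def DG_def by (metis has_gateaux_diff_unique theI)

lemma has_hadamard_diff_DH: "hadamard_differentiable F x \<Longrightarrow> has_hadamard_diff F x (DH F x)"
  unfolding hadamard_differentiable_def DH_def
  by (metis has_gateaux_diff_unique has_hadamard_diff_def theI)

lemma DH_eq: "has_hadamard_diff F x D \<Longrightarrow> DH F x = D"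
  by (metis has_gateaux_diff_unique has_hadamard_diff_DH has_hadamard_diff_def hadamard_differentiable_def)

lemma has_hadamard_diff_iff: "has_hadamard_diff F x D \<longleftrightarrow> hadamard_lim F x (blinfun_apply D)"
proof
  assume h: "hadamard_lim F x (blinfun_apply D)"
  have "((\<lambda>\<theta>. (F (x + \<theta> *\<^sub>R v) - F x) /\<^sub>R \<theta>) \<longlongrightarrow> blinfun_apply D v) (at_right 0)" for v
    using hadamard_lim_compose[OF h filterlim_ident tendsto_const] .
  then show "has_hadamard_diff F x D"
    using h unfolding has_hadamard_diff_def has_gateaux_diff_def has_gateaux_variation_def hadamard_lim_def
    by blast
qed (auto simp: has_hadamard_diff_def hadamard_lim_def)

lemma hadamard_lim_DH: "hadamard_differentiable F x \<Longrightarrow> hadamard_lim F x (blinfun_apply (DH F x))"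
  using has_hadamard_diff_DH has_hadamard_diff_iff by blast

lemma has_derivative_DF:
  assumes "F differentiable (at x)"
  shows "(F has_derivative blinfun_apply (DF F x)) (at x)"
  using assms bounded_linear_Blinfun_apply[OF has_derivative_bounded_linear]
  unfolding frechet_derivative_works DF_def by metis

lemma DF_eq: "(F has_derivative blinfun_apply D) (at x) \<Longrightarrow> DF F x = D"
  using has_derivative_DF[of F x] by (metis blinfun_eqI differentiableI has_derivative_unique)

lemma has_derivative_imp_gateaux:
  assumes "(F has_derivative D) (at x)"
  shows "((\<lambda>\<theta>. (F (x + \<theta> *\<^sub>R v) - F x) /\<^sub>R \<theta>) \<longlongrightarrow> D v) (at_right 0)"
proof -
  have lin: "linear D" using assms has_derivative_linear by blast
  have "(\<lambda>\<theta>. x + \<theta> *\<^sub>R v) 0 = x" by simp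
  moreover have "((\<lambda>\<theta>. x + \<theta> *\<^sub>R v) has_derivative (\<lambda>\<theta>. \<theta> *\<^sub>R v)) (at 0)" by (auto intro!: derivative_eq_intros)
  ultimately have "((\<lambda>\<theta>. F (x + \<theta> *\<^sub>R v)) has_derivative (\<lambda>\<theta>. D (\<theta> *\<^sub>R v))) (at 0)"
    using has_derivative_compose[of "\<lambda>\<theta>. x + \<theta> *\<^sub>R v" _ 0 UNIV F D] assms by simp
  then have "((\<lambda>\<theta>. F (x + \<theta> *\<^sub>R v)) has_vector_derivative D v) (at 0 within {0<..})"
    using lin by (simp add: has_vector_derivative_def linear_scale has_derivative_at_withinI)
  then have "((\<lambda>\<theta>. norm (F (x + \<theta> *\<^sub>R v) - F x - \<theta> *\<^sub>R D v) / norm \<theta>) \<longlongrightarrow> 0) (at_right 0)"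
    by (simp add: has_vector_derivative_def has_derivative_iff_norm)
  moreover have "norm (F (x + \<theta> *\<^sub>R v) - F x - \<theta> *\<^sub>R D v) / norm \<theta> = norm ((F (x + \<theta> *\<^sub>R v) - F x) /\<^sub>R \<theta> - D v)" if "\<theta> \<noteq> 0" for \<theta>
  proof -
    have "(F (x + \<theta> *\<^sub>R v) - F x) /\<^sub>R \<theta> - D v = (F (x + \<theta> *\<^sub>R v) - F x - \<theta> *\<^sub>R D v) /\<^sub>R \<theta>"
      using that by (simp add: scaleR_diff_right)
    then show ?thesis by (simp add: divide_inverse mult.commute)
  qed
  then have "\<theta> \<noteq> 0 \<longrightarrow> \<theta> \<in> {0<..} \<longrightarrow> norm (F (x + \<theta> *\<^sub>R v) - F x - \<theta> *\<^sub>R D v) / norm \<theta> = norm ((F (x + \<theta> *\<^sub>R v) - F x) /\<^sub>R \<theta> - D v)" for \<theta>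
    by blast
  then have "\<forall>\<^sub>F \<theta> in at_right 0. norm (F (x + \<theta> *\<^sub>R v) - F x - \<theta> *\<^sub>R D v) / norm \<theta> = norm ((F (x + \<theta> *\<^sub>R v) - F x) /\<^sub>R \<theta> - D v)"
    unfolding eventually_at_filter by (intro always_eventually allI)
  ultimately have "((\<lambda>\<theta>. norm ((F (x + \<theta> *\<^sub>R v) - F x) /\<^sub>R \<theta> - D v)) \<longlongrightarrow> 0) (at_right 0)"
    by (simp add: tendsto_cong)
  then show ?thesis by (simp add: tendsto_norm_zero_iff LIM_zero_iff)
qed

text \<open>The right variations in the directions \<open>v\<close> and \<open>- v\<close> together
  give a two-sided derivative along the line, which makes the mean value inequality applicable
  although \<open>F\<close> is only Gateaux differentiable.\<close>

lemma has_gateaux_diff_has_vector_derivative: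
  assumes "has_gateaux_diff F (p + s *\<^sub>R v) D"
  shows "((\<lambda>\<sigma>. F (p + \<sigma> *\<^sub>R v)) has_vector_derivative D v) (at s)"
proof -
  define x where "x = p + s *\<^sub>R v"
  have q: "((\<lambda>\<theta>. (F (x + \<theta> *\<^sub>R v) - F x) /\<^sub>R \<theta>) \<longlongrightarrow> D v) (at_right 0)" for v
    using assms by (simp add: has_gateaux_diff_def has_gateaux_variation_def x_def)
  have "((\<lambda>\<theta>. (F (x + \<theta> *\<^sub>R v) - F x) /\<^sub>R \<theta>) \<longlongrightarrow> D v) (at_left 0)"
    using tendsto_minus[OF q[of "- v"]]
    by (simp add: at_left_minus[of 0] filterlim_filtermap blinfun.minus_right)
  with q have "((\<lambda>\<theta>. (F (x + \<theta> *\<^sub>R v) - F x) /\<^sub>R \<theta>) \<longlongrightarrow> D v) (at 0)"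
    by (simp add: filterlim_split_at)
  then have *: "((\<lambda>\<theta>. norm ((F (x + \<theta> *\<^sub>R v) - F x) /\<^sub>R \<theta> - D v)) \<longlongrightarrow> 0) (at 0)"
    by (simp add: tendsto_norm_zero_iff LIM_zero_iff)
  have "norm (F (x + \<theta> *\<^sub>R v) - F x - \<theta> *\<^sub>R D v) / norm \<theta> = norm ((F (x + \<theta> *\<^sub>R v) - F x) /\<^sub>R \<theta> - D v)" if "\<theta> \<noteq> 0" for \<theta>
  proof -
    have "(F (x + \<theta> *\<^sub>R v) - F x) /\<^sub>R \<theta> - D v = (F (x + \<theta> *\<^sub>R v) - F x - \<theta> *\<^sub>R D v) /\<^sub>R \<theta>"
      using that by (simp add: scaleR_diff_right)
    then show ?thesis by (simp add: divide_inverse mult.commute)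
  qed
  then have "\<theta> \<noteq> 0 \<longrightarrow> \<theta> \<in> UNIV \<longrightarrow> norm (F (x + \<theta> *\<^sub>R v) - F x - \<theta> *\<^sub>R D v) / norm \<theta> = norm ((F (x + \<theta> *\<^sub>R v) - F x) /\<^sub>R \<theta> - D v)" for \<theta>
    by blast
  then have "\<forall>\<^sub>F \<theta> in at 0. norm (F (x + \<theta> *\<^sub>R v) - F x - \<theta> *\<^sub>R D v) / norm \<theta> = norm ((F (x + \<theta> *\<^sub>R v) - F x) /\<^sub>R \<theta> - D v)"
    unfolding eventually_at_filter by (intro always_eventually allI)
  with * have "((\<lambda>\<theta>. norm (F (x + \<theta> *\<^sub>R v) - F x - \<theta> *\<^sub>R D v) / norm \<theta>) \<longlongrightarrow> 0) (at 0)"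
    by (simp add: tendsto_cong)
  then have "((\<lambda>\<theta>. F (x + \<theta> *\<^sub>R v)) has_vector_derivative D v) (at 0)"
    by (simp add: has_vector_derivative_def has_derivative_iff_norm bounded_linear_scaleR_left)
  then have d: "((\<lambda>\<theta>. F (x + \<theta> *\<^sub>R v)) has_vector_derivative D v) (at ((\<lambda>\<sigma>. \<sigma> - s) s))" by simp
  have "((\<lambda>\<sigma>. \<sigma> - s) has_vector_derivative 1) (at s)" by (auto intro!: derivative_eq_intros)
  from vector_diff_chain_at[OF this d] show ?thesis by (simp add: o_def x_def algebra_simps)
qed

lemma gateaux_mean_value:
  assumes "convex S" "p \<in> S" "p' \<in> S"
    and "\<And>\<xi>. \<xi> \<in> S \<Longrightarrow> has_gateaux_diff F \<xi> (D \<xi>)" "\<And>\<xi>. \<xi> \<in> S \<Longrightarrow> norm (D \<xi>) \<le> L"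
  shows "norm (F p' - F p) \<le> L * norm (p' - p)"
proof -
  define v where "v = p' - p"
  have S: "p + s *\<^sub>R v \<in> S" if "0 \<le> s" "s \<le> 1" for s
  proof -
    have "p + s *\<^sub>R v = (1 - s) *\<^sub>R p + s *\<^sub>R p'" by (simp add: v_def algebra_simps)
    then show ?thesis using convexD_alt[OF assms(1-3) that] by simp
  qed
  have d: "((\<lambda>\<sigma>. F (p + \<sigma> *\<^sub>R v)) has_vector_derivative D (p + s *\<^sub>R v) v) (at s)" if "0 \<le> s" "s \<le> 1" for s
    by (rule has_gateaux_diff_has_vector_derivative[OF assms(4)[OF S[OF that]]])
  have "norm (F (p + 1 *\<^sub>R v) - F (p + 0 *\<^sub>R v)) \<le> (L * norm v) * 1 - (L * norm v) * 0"
  proof (rule differentiable_bound_general[where f = "\<lambda>\<sigma>. F (p + \<sigma> *\<^sub>R v)" and \<phi> = "\<lambda>s. (L * norm v) * s"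
        and f' = "\<lambda>s. D (p + s *\<^sub>R v) v" and \<phi>' = "\<lambda>_. L * norm v"])
    show "continuous_on {0..1} (\<lambda>\<sigma>. F (p + \<sigma> *\<^sub>R v))"
      using d by (auto intro!: continuous_at_imp_continuous_on has_vector_derivative_continuous)
    show "((*) (L * norm v) has_vector_derivative L * norm v) (at s)" for s
      by (auto intro!: derivative_eq_intros simp: has_real_derivative_iff_has_vector_derivative[symmetric])
    show "norm (D (p + s *\<^sub>R v) v) \<le> L * norm v" if "0 < s" "s < 1" for s
      using norm_blinfun[of "D (p + s *\<^sub>R v)" v] mult_right_mono[OF assms(5)[OF S[of s]], of "norm v"] that by auto
  qed (use d in \<open>auto intro!: continuous_intros\<close>)
  then show ?thesis by (simp add: v_def)
qed

text \<open>A sequence escaping the derivative bound near the compact set accumulates at it, and together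
  with its limit it forms a compact set on which the derivatives would be unbounded.\<close>

lemma gateaux_lipschitz_tube:
  fixes f :: "real \<Rightarrow> 'x::real_normed_vector \<Rightarrow> 'y::real_normed_vector \<Rightarrow> 'b::real_normed_vector"
  assumes \<Omega>: "open \<Omega>" and x: "continuous_on {0..T} x" "\<And>t. t \<in> {0..T} \<Longrightarrow> x t \<in> \<Omega>"
    and gd: "\<And>t \<xi> \<zeta>. t \<in> {0..T} \<Longrightarrow> \<xi> \<in> \<Omega> \<Longrightarrow> \<zeta> \<in> U \<Longrightarrow> gateaux_differentiable (\<lambda>\<xi>'. f t \<xi>' \<zeta>) \<xi>"
    and bd: "\<And>K. compact K \<Longrightarrow> K \<noteq> {} \<Longrightarrow> K \<subseteq> \<Omega> \<times> U \<Longrightarrow>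
      bdd_above ((\<lambda>(t, \<xi>, \<zeta>). norm (DG (\<lambda>\<xi>'. f t \<xi>' \<zeta>) \<xi>)) ` ({0..T} \<times> K))"
    and K: "compact K" "K \<subseteq> U"
  shows "\<exists>r>0. \<exists>L. \<forall>t\<in>{0..T}. cball (x t) r \<subseteq> \<Omega> \<and>
    (\<forall>\<zeta>\<in>K. \<forall>\<xi>\<in>cball (x t) r. \<forall>\<xi>'\<in>cball (x t) r. norm (f t \<xi> \<zeta> - f t \<xi>' \<zeta>) \<le> L * norm (\<xi> - \<xi>'))"
proof -
  define C where "C = x ` {0..T}"
  have C: "compact C" "C \<subseteq> \<Omega>" using x by (auto simp: C_def intro!: compact_continuous_image)
  obtain r0 where r0: "r0 > 0" "(\<Union>c\<in>C. cball c r0) \<subseteq> \<Omega>"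
    using compact_subset_open_imp_cball_epsilon_subset[OF C(1) \<Omega> C(2)] .
  \<comment> \<open>The same \<open>n\<close> serves as derivative bound and, through
    \<open>1 / real (Suc n)\<close>, as radius, so that failure for all \<open>n\<close> produces
    points approaching \<open>C\<close> with unbounded derivatives.\<close>
  have "\<exists>n. \<forall>t\<in>{0..T}. \<forall>\<zeta>\<in>K. \<forall>c\<in>C. \<forall>\<xi>\<in>cball c (min r0 (1 / real (Suc n))).
      norm (DG (\<lambda>\<xi>'. f t \<xi>' \<zeta>) \<xi>) \<le> real n"
  proof (rule ccontr)
    assume "\<not> ?thesis"
    then have "\<forall>n. \<exists>t \<zeta> c \<xi>. t \<in> {0..T} \<and> \<zeta> \<in> K \<and> c \<in> C \<and> \<xi> \<in> cball c (min r0 (1 / real (Suc n))) \<and>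
        real n < norm (DG (\<lambda>\<xi>'. f t \<xi>' \<zeta>) \<xi>)" by (meson not_le)
    then obtain t \<zeta> c \<xi> where *: "\<And>n. t n \<in> {0..T}" "\<And>n. \<zeta> n \<in> K" "\<And>n. c n \<in> C"
      "\<And>n. \<xi> n \<in> cball (c n) (min r0 (1 / real (Suc n)))"
      "\<And>n. real n < norm (DG (\<lambda>\<xi>'. f (t n) \<xi>' (\<zeta> n)) (\<xi> n))" by metis
    obtain l r where r: "strict_mono r" "l \<in> C" "(c \<circ> r) \<longlonglongrightarrow> l"
      using compact_imp_seq_compact[OF C(1)] *(3) unfolding seq_compact_def by metis
    have inv: "(\<lambda>n. 1 / real (Suc (r n))) \<longlonglongrightarrow> 0"
      using LIMSEQ_subseq_LIMSEQ[OF LIMSEQ_inverse_real_of_nat r(1)] by (simp add: o_def inverse_eq_divide)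
    have "(\<lambda>n. \<xi> (r n) - c (r n)) \<longlonglongrightarrow> 0"
    proof (rule Lim_null_comparison[OF always_eventually inv], rule allI)
      fix n show "norm (\<xi> (r n) - c (r n)) \<le> 1 / real (Suc (r n))"
        using *(4)[of "r n"] by (simp add: dist_norm norm_minus_commute)
    qed
    from tendsto_add[OF this r(3)[unfolded o_def]] have lim: "(\<lambda>n. \<xi> (r n)) \<longlonglongrightarrow> l" by simp
    define K' where "K' = insert l (range (\<lambda>n. \<xi> (r n))) \<times> K"
    have "compactin euclidean (insert l (range (\<lambda>n. \<xi> (r n))))"
      by (rule compactin_sequence_with_limit) (use lim in auto)
    then have "compact (insert l (range (\<lambda>n. \<xi> (r n))))" by simp
    then have "compact K'" unfolding K'_def using K(1) by (rule compact_Times)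
    moreover have "\<xi> n \<in> \<Omega>" for n using *(3,4)[of n] r0(2) by force
    then have "K' \<subseteq> \<Omega> \<times> U" using r(2) C(2) K(2) by (auto simp: K'_def)
    moreover have "K' \<noteq> {}" using *(2) by (auto simp: K'_def)
    ultimately obtain B where B: "\<And>p. p \<in> {0..T} \<times> K' \<Longrightarrow> (\<lambda>(t, \<xi>, \<zeta>). norm (DG (\<lambda>\<xi>'. f t \<xi>' \<zeta>) \<xi>)) p \<le> B"
      using bd[of K'] unfolding bdd_above_def by blast
    obtain n where n: "B < real n" using reals_Archimedean2 by blast
    have "real n \<le> real (r n)" using seq_suble[OF r(1), of n] by simp
    also have "\<dots> < norm (DG (\<lambda>\<xi>'. f (t (r n)) \<xi>' (\<zeta> (r n))) (\<xi> (r n)))" by (rule *(5))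
    also have "\<dots> \<le> B" using B[of "(t (r n), \<xi> (r n), \<zeta> (r n))"] *(1,2) by (simp add: K'_def)
    finally show False using n by simp
  qed
  then obtain n where n: "\<And>t \<zeta> c \<xi>. t \<in> {0..T} \<Longrightarrow> \<zeta> \<in> K \<Longrightarrow> c \<in> C \<Longrightarrow> \<xi> \<in> cball c (min r0 (1 / real (Suc n))) \<Longrightarrow>
      norm (DG (\<lambda>\<xi>'. f t \<xi>' \<zeta>) \<xi>) \<le> real n" by blast
  define r where "r = min r0 (1 / real (Suc n))"
  have r: "r > 0" "r \<le> r0" using r0 by (auto simp: r_def)
  show ?thesis
  proof (rule exI[of _ r], rule conjI, rule r(1), rule exI[of _ "real n"], intro ballI conjI)
    fix t assume t: "t \<in> {0..T}"
    then have xC: "x t \<in> C" by (simp add: C_def)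
    show sub: "cball (x t) r \<subseteq> \<Omega>"
      using r0(2) xC r(2) by (meson UN_subset_iff order_trans subset_cball)
    fix \<zeta> \<xi> \<xi>' assume \<zeta>: "\<zeta> \<in> K" and \<xi>: "\<xi> \<in> cball (x t) r" "\<xi>' \<in> cball (x t) r"
    show "norm (f t \<xi> \<zeta> - f t \<xi>' \<zeta>) \<le> real n * norm (\<xi> - \<xi>')"
    proof (rule gateaux_mean_value[OF convex_cball \<xi>(2,1)])
      fix p assume p: "p \<in> cball (x t) r"
      show "has_gateaux_diff (\<lambda>\<xi>'. f t \<xi>' \<zeta>) p (DG (\<lambda>\<xi>'. f t \<xi>' \<zeta>) p)"
        using p \<zeta> K(2) sub by (intro has_gateaux_diff_DG gd[OF t]) blast+
      show "norm (DG (\<lambda>\<xi>'. f t \<xi>' \<zeta>) p) \<le> real n"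
        using n[OF t \<zeta> xC] p by (simp add: r_def)
    qed
  qed
qed

lemma PC1_bounded_linear:
  fixes Y :: "real \<Rightarrow> 'a::real_normed_vector" and L :: "'a \<Rightarrow> 'b::real_normed_vector"
  assumes T: "0 < T" and Y: "Y \<in> PC1 T W" and L: "bounded_linear L" "\<And>w. w \<in> W \<Longrightarrow> L w \<in> V"
  shows "(\<lambda>t. L (Y t)) \<in> PC1 T V" and "\<And>t. t \<in> {0..T} \<Longrightarrow> ext_deriv T (\<lambda>t. L (Y t)) t = L (ext_deriv T Y t)"
proof -
  obtain S where S: "finite S" "\<And>t. t \<in> {0<..<T} - S \<Longrightarrow> (Y has_vector_derivative ext_deriv T Y t) (at t)"
    using PC1D(4)[OF T Y] by blast
  have c: "continuous_on {0..T} (\<lambda>t. L (Y t))"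
    by (rule bounded_linear.continuous_on[OF L(1) PC1D(1)[OF T Y]])
  have v: "L (Y t) \<in> V" if "t \<in> {0..T}" for t using PC1D(2)[OF T Y that] L(2) by blast
  have d: "(\<lambda>t. L (ext_deriv T Y t)) \<in> NPC0R T UNIV"
    by (rule NPC0R_comp[OF T PC1D(3)[OF T Y]])
      (auto intro!: linear_continuous_on L(1))
  have "((\<lambda>t. L (Y t)) has_vector_derivative L (ext_deriv T Y t)) (at t)" if "t \<in> {0<..<T} - S" for t
    by (rule bounded_linear.has_vector_derivative[OF L(1) S(2)[OF that]])
  note * = PC1I(1,2)[OF T c v d S(1) this]
  show "(\<lambda>t. L (Y t)) \<in> PC1 T V" using *(1) by simp
  show "ext_deriv T (\<lambda>t. L (Y t)) t = L (ext_deriv T Y t)" if "t \<in> {0..T}" for t by (rule *(2)) (use that in auto)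
qed

lemma hadamard_lim_fst:
  assumes "hadamard_lim G (fst z) D"
  shows "hadamard_lim (\<lambda>p. G (fst p)) z (\<lambda>p. D (fst p))"
  unfolding hadamard_lim_def
proof
  fix v :: "'a \<times> 'c"
  have "((\<lambda>p. fst (snd p)) \<longlongrightarrow> fst v) (at_right 0 \<times>\<^sub>F nhds v)"
    by (rule tendsto_fst[OF filterlim_snd])
  from hadamard_lim_compose[OF assms filterlim_fst this]
  show "((\<lambda>(\<theta>, w). (G (fst (z + \<theta> *\<^sub>R w)) - G (fst z)) /\<^sub>R \<theta>) \<longlongrightarrow> D (fst v)) (at_right 0 \<times>\<^sub>F nhds v)"
    by (simp add: case_prod_unfold)
qed

text \<open>The objective in Mayer form is of this shape: the accumulated reward enters linearly,
  next to the terminal reward.\<close>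

lemma hadamard_lim_snd_add:
  fixes G :: "'a::real_normed_vector \<Rightarrow> real"
  assumes "hadamard_lim G (fst z) D"
  shows "hadamard_lim (\<lambda>p. snd p + G (fst p)) z (\<lambda>p. snd p + D (fst p))"
  unfolding hadamard_lim_def
proof
  fix v :: "'a \<times> real"
  have 1: "((\<lambda>p. snd (snd p)) \<longlongrightarrow> snd v) (at_right 0 \<times>\<^sub>F nhds v)"
    by (rule tendsto_snd[OF filterlim_snd])
  have 2: "((\<lambda>(\<theta>, w). (G (fst (z + \<theta> *\<^sub>R w)) - G (fst z)) /\<^sub>R \<theta>) \<longlongrightarrow> D (fst v)) (at_right 0 \<times>\<^sub>F nhds v)"
    using spec[OF hadamard_lim_fst[OF assms, unfolded hadamard_lim_def], of v] .
  have "\<forall>\<^sub>F p::real \<times> ('a \<times> real) in at_right 0 \<times>\<^sub>F nhds v. fst p \<noteq> 0"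
    by (rule eventually_compose_filterlim[OF _ filterlim_fst]) (auto simp: eventually_at_filter)
  then have "\<forall>\<^sub>F p in at_right 0 \<times>\<^sub>F nhds v. snd (snd p) + (case p of (\<theta>, w) \<Rightarrow> (G (fst (z + \<theta> *\<^sub>R w)) - G (fst z)) /\<^sub>R \<theta>) =
      (case p of (\<theta>, w) \<Rightarrow> (snd (z + \<theta> *\<^sub>R w) + G (fst (z + \<theta> *\<^sub>R w)) - (snd z + G (fst z))) /\<^sub>R \<theta>)"
    by eventually_elim (auto simp: case_prod_unfold field_simps)
  from Lim_transform_eventually[OF tendsto_add[OF 1 2] this]
  show "((\<lambda>(\<theta>, w). (snd (z + \<theta> *\<^sub>R w) + G (fst (z + \<theta> *\<^sub>R w)) - (snd z + G (fst z))) /\<^sub>R \<theta>) \<longlongrightarrow> snd v + D (fst v))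
      (at_right 0 \<times>\<^sub>F nhds v)" by simp
qed

section \<open>Solutions of the Bolza problem\<close>

text \<open>Hypotheses at one fixed parameter. Joint Hadamard differentiability in state, control
  and parameter is given at \<open>\<pi>0\<close> only and therefore left out, so that the locale
  can be used at every parameter of \<open>P\<close>; the control derivatives are those at time
  \<open>T\<close>.\<close>

locale bolza_process =
  fixes T :: real and \<Omega> :: "'x::banach set" and U :: "'y::real_normed_vector set" and \<xi>0 :: 'x
    and f0 :: "real \<Rightarrow> 'x \<Rightarrow> 'y \<Rightarrow> 'z::real_normed_vector \<Rightarrow> real" and f :: "real \<Rightarrow> 'x \<Rightarrow> 'y \<Rightarrow> 'z \<Rightarrow> 'x"
    and m q :: nat and g h :: "nat \<Rightarrow> 'x \<Rightarrow> 'z \<Rightarrow> real" and \<pi> :: 'z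
    and x :: "real \<Rightarrow> 'x" and u :: "real \<Rightarrow> 'y"
  assumes T: "0 < T" and \<Omega>: "open \<Omega>" and U: "open U"
    and sol: "bolza_solution T \<Omega> U \<xi>0 f0 f m q g h \<pi> x u"
    and f0_cont: "continuous_on ({0..T} \<times> \<Omega> \<times> U) (\<lambda>(t, \<xi>, \<zeta>). f0 t \<xi> \<zeta> \<pi>)"
    and f0_gd: "\<And>t \<xi> \<zeta>. t \<in> {0..T} \<Longrightarrow> \<xi> \<in> \<Omega> \<Longrightarrow> \<zeta> \<in> U \<Longrightarrow> gateaux_differentiable (\<lambda>\<xi>'. f0 t \<xi>' \<zeta> \<pi>) \<xi>"
    and f0_bd: "\<And>K. compact K \<Longrightarrow> K \<noteq> {} \<Longrightarrow> K \<subseteq> \<Omega> \<times> U \<Longrightarrow>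
      bdd_above ((\<lambda>(t, \<xi>, \<zeta>). norm (DG (\<lambda>\<xi>'. f0 t \<xi>' \<zeta> \<pi>) \<xi>)) ` ({0..T} \<times> K))"
    and f0_d: "\<And>t \<zeta>. t \<in> {0..T} \<Longrightarrow> \<zeta> \<in> U \<Longrightarrow> (\<lambda>\<xi>. f0 t \<xi> \<zeta> \<pi>) differentiable (at (x t))"
    and f0_dc: "continuous_on ({0..T} \<times> U) (\<lambda>(t, \<zeta>). DF (\<lambda>\<xi>. f0 t \<xi> \<zeta> \<pi>) (x t))"
    and f0_h: "hadamard_differentiable (\<lambda>\<zeta>. f0 T (x T) \<zeta> \<pi>) (u T)"
    and f_cont: "continuous_on ({0..T} \<times> \<Omega> \<times> U) (\<lambda>(t, \<xi>, \<zeta>). f t \<xi> \<zeta> \<pi>)"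
    and f_gd: "\<And>t \<xi> \<zeta>. t \<in> {0..T} \<Longrightarrow> \<xi> \<in> \<Omega> \<Longrightarrow> \<zeta> \<in> U \<Longrightarrow> gateaux_differentiable (\<lambda>\<xi>'. f t \<xi>' \<zeta> \<pi>) \<xi>"
    and f_bd: "\<And>K. compact K \<Longrightarrow> K \<noteq> {} \<Longrightarrow> K \<subseteq> \<Omega> \<times> U \<Longrightarrow>
      bdd_above ((\<lambda>(t, \<xi>, \<zeta>). norm (DG (\<lambda>\<xi>'. f t \<xi>' \<zeta> \<pi>) \<xi>)) ` ({0..T} \<times> K))"
    and f_d: "\<And>t \<zeta>. t \<in> {0..T} \<Longrightarrow> \<zeta> \<in> U \<Longrightarrow> (\<lambda>\<xi>. f t \<xi> \<zeta> \<pi>) differentiable (at (x t))"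
    and f_dc: "continuous_on ({0..T} \<times> U) (\<lambda>(t, \<zeta>). DF (\<lambda>\<xi>. f t \<xi> \<zeta> \<pi>) (x t))"
    and f_h: "hadamard_differentiable (\<lambda>\<zeta>. f T (x T) \<zeta> \<pi>) (u T)"
    and g_h: "\<And>i. i \<in> {0..m} \<Longrightarrow> hadamard_differentiable (\<lambda>\<xi>. g i \<xi> \<pi>) (x T)"
    and h_h: "\<And>j. j \<in> {1..q} \<Longrightarrow> hadamard_differentiable (\<lambda>\<xi>. h j \<xi> \<pi>) (x T)"
    and h_c: "\<And>j. j \<in> {1..q} \<Longrightarrow> \<exists>N. open N \<and> x T \<in> N \<and> N \<subseteq> \<Omega> \<and> continuous_on N (\<lambda>\<xi>. h j \<xi> \<pi>)"
begin

lemma adm: "bolza_admissible T \<Omega> U \<xi>0 f m q g h \<pi> x u"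
  using sol by (simp add: bolza_solution_def)

lemma x_PC1: "x \<in> PC1 T \<Omega>" and u_NPC0R: "u \<in> NPC0R T U"
  and ode: "t \<in> {0..T} \<Longrightarrow> ext_deriv T x t = f t (x t) (u t) \<pi>"
  using adm by (auto simp: bolza_admissible_def)

lemmas x_cont = PC1D(1)[OF T x_PC1] and x_\<Omega> = PC1D(2)[OF T x_PC1] and uU = NPC0R_D[OF u_NPC0R]

lemma field_NPC0R:
  fixes F :: "real \<Rightarrow> 'x \<Rightarrow> 'y \<Rightarrow> 'b::t2_space"
  assumes "continuous_on ({0..T} \<times> \<Omega> \<times> U) (\<lambda>(t, \<xi>, \<zeta>). F t \<xi> \<zeta>)" "continuous_on {0..T} w"
    "\<And>t. t \<in> {0..T} \<Longrightarrow> w t \<in> \<Omega>" "v \<in> NPC0R T U"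
  shows "(\<lambda>t. F t (w t) (v t)) \<in> NPC0R T UNIV"
proof -
  have "(\<lambda>t. t) \<in> NPC0R T {0..T}" by (rule NPC0R_continuous[OF T]) auto
  from NPC0R_comp[OF T NPC0R_Pair[OF T this NPC0R_Pair[OF T NPC0R_continuous[OF T assms(2,3)] assms(4)]] assms(1), of UNIV]
  show ?thesis by simp
qed

lemma control_NPC0R:
  fixes F :: "real \<Rightarrow> 'y \<Rightarrow> 'b::t2_space"
  assumes "continuous_on ({0..T} \<times> U) (\<lambda>(t, \<zeta>). F t \<zeta>)" "v \<in> NPC0R T U"
  shows "(\<lambda>t. F t (v t)) \<in> NPC0R T UNIV"
proof -
  have "(\<lambda>t. t) \<in> NPC0R T {0..T}" by (rule NPC0R_continuous[OF T]) auto
  from NPC0R_comp[OF T NPC0R_Pair[OF T this assms(2)] assms(1), of UNIV] show ?thesis by simp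
qed

text \<open>The running reward becomes an additional state, which turns the Bolza problem into a Mayer problem.\<close>

definition F :: "real \<Rightarrow> 'x \<times> real \<Rightarrow> 'y \<Rightarrow> 'x \<times> real" where
  "F t p \<zeta> = (f t (fst p) \<zeta> \<pi>, f0 t (fst p) \<zeta> \<pi>)"

definition y :: "real \<Rightarrow> 'x \<times> real" where
  "y t = (x t, integral {0..t} (\<lambda>t. f0 t (x t) (u t) \<pi>))"

definition inl :: "'x \<Rightarrow>\<^sub>L ('x \<times> real)" where "inl = Blinfun (\<lambda>\<xi>. (\<xi>, 0))"
definition inr :: "real \<Rightarrow>\<^sub>L ('x \<times> real)" where "inr = Blinfun (\<lambda>s. (0, s))"

lemma inl_apply [simp]: "blinfun_apply inl = (\<lambda>\<xi>. (\<xi>, 0))"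
  unfolding inl_def by (rule bounded_linear_Blinfun_apply) (intro bounded_linear_Pair bounded_linear_ident bounded_linear_zero)

lemma inr_apply [simp]: "blinfun_apply inr = (\<lambda>s. (0, s))"
  unfolding inr_def by (rule bounded_linear_Blinfun_apply) (intro bounded_linear_Pair bounded_linear_ident bounded_linear_zero)

definition A :: "real \<Rightarrow> (('x \<times> real) \<Rightarrow>\<^sub>L ('x \<times> real))" where
  "A t = ((inl o\<^sub>L DF (\<lambda>\<xi>. f t \<xi> (u t) \<pi>) (x t)) + (inr o\<^sub>L DF (\<lambda>\<xi>. f0 t \<xi> (u t) \<pi>) (x t))) o\<^sub>L fst_blinfun"

lemma A_apply: "A t p = (DF (\<lambda>\<xi>. f t \<xi> (u t) \<pi>) (x t) (fst p), DF (\<lambda>\<xi>. f0 t \<xi> (u t) \<pi>) (x t) (fst p))"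
  by (simp add: A_def blinfun.add_left)

lemma A_PC0: "A \<in> PC0 T UNIV"
proof -
  have "continuous_on (UNIV \<times> UNIV) (\<lambda>p. ((inl o\<^sub>L fst p) + (inr o\<^sub>L snd p)) o\<^sub>L fst_blinfun)"
    by (intro bounded_bilinear.continuous_on[OF bounded_bilinear_blinfun_compose] continuous_intros)
  from PC0_comp[OF T PC0_Pair[OF T NPC0R_PC0[OF control_NPC0R[OF f_dc u_NPC0R]] NPC0R_PC0[OF control_NPC0R[OF f0_dc u_NPC0R]]] this, of UNIV]
  show ?thesis by (simp add: A_def[abs_def])
qed

text \<open>A choice is made because the resolvent is known only to exist, while the interpretation
  of the Mayer system needs a term.\<close>

definition M :: "real \<Rightarrow> (('x \<times> real) \<Rightarrow>\<^sub>L ('x \<times> real))" where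
  "M = (SOME M. continuous_on {0..T} M \<and> M T = id_blinfun \<and>
     (\<exists>S. finite S \<and> (\<forall>t\<in>{0<..<T} - S. (M has_vector_derivative - (M t o\<^sub>L A t)) (at t))))"

lemma M_props: "continuous_on {0..T} M" "M T = id_blinfun"
  "\<exists>S. finite S \<and> (\<forall>t\<in>{0<..<T} - S. (M has_vector_derivative - (M t o\<^sub>L A t)) (at t))"
proof -
  have "\<exists>M. continuous_on {0..T} M \<and> M T = id_blinfun \<and>
     (\<exists>S. finite S \<and> (\<forall>t\<in>{0<..<T} - S. (M has_vector_derivative - (M t o\<^sub>L A t)) (at t)))"
    by (rule backward_resolvent[OF T A_PC0]) blast
  from someI_ex[OF this]
  show "continuous_on {0..T} M" "M T = id_blinfun"
    "\<exists>S. finite S \<and> (\<forall>t\<in>{0<..<T} - S. (M has_vector_derivative - (M t o\<^sub>L A t)) (at t))"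
    unfolding M_def by blast+
qed

lemma f0_NPC0R: "(\<lambda>t. f0 t (x t) (u t) \<pi>) \<in> NPC0R T UNIV"
  by (rule field_NPC0R[OF f0_cont x_cont x_\<Omega> u_NPC0R])

lemma y_PC1: "y \<in> PC1 T (\<Omega> \<times> UNIV)" and y_ode: "t \<in> {0..T} \<Longrightarrow> ext_deriv T y t = F t (y t) (u t)"
proof -
  obtain S where S: "finite S" "\<And>t. t \<in> {0<..<T} - S \<Longrightarrow> (x has_vector_derivative ext_deriv T x t) (at t)"
    using PC1D(4)[OF T x_PC1] by blast
  obtain R where R: "finite R" "\<And>t. t \<in> {0<..<T} - R \<Longrightarrow>
      ((\<lambda>t. integral {0..t} (\<lambda>t. f0 t (x t) (u t) \<pi>)) has_vector_derivative f0 t (x t) (u t) \<pi>) (at t)"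
    using PC0_indefinite_integral(2)[OF T NPC0R_PC0[OF f0_NPC0R]] by blast
  have fin: "finite (S \<union> R)" using S R by simp
  have c: "continuous_on {0..T} y"
    unfolding y_def[abs_def] by (intro continuous_on_Pair x_cont PC0_indefinite_integral(1)[OF T NPC0R_PC0[OF f0_NPC0R]])
  have yO: "y t \<in> \<Omega> \<times> UNIV" if "t \<in> {0..T}" for t using x_\<Omega>[OF that] by (simp add: y_def)
  have d: "(\<lambda>t. F t (y t) (u t)) \<in> NPC0R T UNIV"
    using NPC0R_Pair[OF T field_NPC0R[OF f_cont x_cont x_\<Omega> u_NPC0R] f0_NPC0R] by (simp add: F_def y_def)
  have "(y has_vector_derivative F t (y t) (u t)) (at t)" if t: "t \<in> {0<..<T} - (S \<union> R)" for t
    unfolding y_def[abs_def] F_def fst_conv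
    using S(2)[of t] R(2)[of t] ode[of t] t by (intro has_vector_derivative_Pair) auto
  note * = PC1I(1,2)[OF T c yO d fin this]
  show "y \<in> PC1 T (\<Omega> \<times> UNIV)" using *(1) by simp
  show "t \<in> {0..T} \<Longrightarrow> ext_deriv T y t = F t (y t) (u t)" by (rule *(2)) auto
qed

sublocale mayer: mayer_system T "\<Omega> \<times> UNIV" U F y u A M
proof
  show "continuous_on ({0..T} \<times> (\<Omega> \<times> UNIV) \<times> U) (\<lambda>(t, \<xi>, \<zeta>). F t \<xi> \<zeta>)"
  proof -
    have m: "continuous_on ({0..T} \<times> (\<Omega> \<times> (UNIV :: real set)) \<times> U) (\<lambda>p. (fst p, fst (fst (snd p)), snd (snd p)))"
      by (intro continuous_intros)
    have 1: "continuous_on ({0..T} \<times> (\<Omega> \<times> (UNIV :: real set)) \<times> U)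
       (\<lambda>p. (\<lambda>(t, \<xi>, \<zeta>). f t \<xi> \<zeta> \<pi>) (fst p, fst (fst (snd p)), snd (snd p)))"
      by (rule continuous_on_compose2[OF f_cont m]) auto
    have 2: "continuous_on ({0..T} \<times> (\<Omega> \<times> (UNIV :: real set)) \<times> U)
       (\<lambda>p. (\<lambda>(t, \<xi>, \<zeta>). f0 t \<xi> \<zeta> \<pi>) (fst p, fst (fst (snd p)), snd (snd p)))"
      by (rule continuous_on_compose2[OF f0_cont m]) auto
    show ?thesis using continuous_on_Pair[OF 1 2] by (simp add: F_def case_prod_unfold)
  qed
  fix K assume K: "compact K" "K \<subseteq> U"
  obtain r L where r: "r > 0" "\<And>t. t \<in> {0..T} \<Longrightarrow> cball (x t) r \<subseteq> \<Omega>"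
    "\<And>t \<zeta> \<xi> \<xi>'. t \<in> {0..T} \<Longrightarrow> \<zeta> \<in> K \<Longrightarrow> \<xi> \<in> cball (x t) r \<Longrightarrow> \<xi>' \<in> cball (x t) r \<Longrightarrow>
       norm (f t \<xi> \<zeta> \<pi> - f t \<xi>' \<zeta> \<pi>) \<le> L * norm (\<xi> - \<xi>')"
  proof -
    have "\<exists>r>0. \<exists>L. \<forall>t\<in>{0..T}. cball (x t) r \<subseteq> \<Omega> \<and>
      (\<forall>\<zeta>\<in>K. \<forall>\<xi>\<in>cball (x t) r. \<forall>\<xi>'\<in>cball (x t) r. norm (f t \<xi> \<zeta> \<pi> - f t \<xi>' \<zeta> \<pi>) \<le> L * norm (\<xi> - \<xi>'))"
      by (rule gateaux_lipschitz_tube[OF \<Omega> x_cont _ _ _ K]) (fact x_\<Omega> f_gd f_bd)+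
    then show thesis using that by blast
  qed
  obtain r' L' where r': "r' > 0" "\<And>t. t \<in> {0..T} \<Longrightarrow> cball (x t) r' \<subseteq> \<Omega>"
    "\<And>t \<zeta> \<xi> \<xi>'. t \<in> {0..T} \<Longrightarrow> \<zeta> \<in> K \<Longrightarrow> \<xi> \<in> cball (x t) r' \<Longrightarrow> \<xi>' \<in> cball (x t) r' \<Longrightarrow>
       norm (f0 t \<xi> \<zeta> \<pi> - f0 t \<xi>' \<zeta> \<pi>) \<le> L' * norm (\<xi> - \<xi>')"
  proof -
    have "\<exists>r>0. \<exists>L. \<forall>t\<in>{0..T}. cball (x t) r \<subseteq> \<Omega> \<and>
      (\<forall>\<zeta>\<in>K. \<forall>\<xi>\<in>cball (x t) r. \<forall>\<xi>'\<in>cball (x t) r. norm (f0 t \<xi> \<zeta> \<pi> - f0 t \<xi>' \<zeta> \<pi>) \<le> L * norm (\<xi> - \<xi>'))"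
      by (rule gateaux_lipschitz_tube[OF \<Omega> x_cont _ _ _ K]) (fact x_\<Omega> f0_gd f0_bd)+
    then show thesis using that by blast
  qed
  have fst_cball: "fst p \<in> cball (x t) (min r r')" if "p \<in> cball (y t) (min r r')" for p t
    using that dist_fst_le[of "y t" p] by (simp add: y_def)
  show "\<exists>r>0. \<exists>L. \<forall>t\<in>{0..T}. cball (y t) r \<subseteq> \<Omega> \<times> UNIV \<and>
      (\<forall>\<zeta>\<in>K. \<forall>\<xi>\<in>cball (y t) r. \<forall>\<xi>'\<in>cball (y t) r. norm (F t \<xi> \<zeta> - F t \<xi>' \<zeta>) \<le> L * norm (\<xi> - \<xi>'))"
  proof (rule exI[of _ "min r r'"], rule conjI, use r(1) r'(1) in simp,
      rule exI[of _ "\<bar>L\<bar> + \<bar>L'\<bar>"], intro ballI conjI)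
    fix t assume t: "t \<in> {0..T}"
    show "cball (y t) (min r r') \<subseteq> \<Omega> \<times> UNIV"
      using fst_cball[of _ t] r(2)[OF t] by (force simp: subset_iff)
    fix \<zeta> p p' assume z: "\<zeta> \<in> K" and p: "p \<in> cball (y t) (min r r')" "p' \<in> cball (y t) (min r r')"
    have n: "norm (fst p - fst p') \<le> norm (p - p')" using dist_fst_le[of p p'] by (simp add: dist_norm)
    have "norm (F t p \<zeta> - F t p' \<zeta>) \<le> norm (f t (fst p) \<zeta> \<pi> - f t (fst p') \<zeta> \<pi>) + norm (f0 t (fst p) \<zeta> \<pi> - f0 t (fst p') \<zeta> \<pi>)"
      using norm_Pair_le[of "f t (fst p) \<zeta> \<pi> - f t (fst p') \<zeta> \<pi>" "f0 t (fst p) \<zeta> \<pi> - f0 t (fst p') \<zeta> \<pi>"]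
      by (simp add: F_def)
    also have "\<dots> \<le> L * norm (fst p - fst p') + L' * norm (fst p - fst p')"
      using fst_cball[OF p(1)] fst_cball[OF p(2)] by (intro add_mono r(3) r'(3) t z) auto
    also have "\<dots> \<le> \<bar>L\<bar> * norm (p - p') + \<bar>L'\<bar> * norm (p - p')"
      using n by (intro add_mono mult_mono) auto
    finally show "norm (F t p \<zeta> - F t p' \<zeta>) \<le> (\<bar>L\<bar> + \<bar>L'\<bar>) * norm (p - p')" by (simp add: algebra_simps)
  qed
next
  fix t assume t: "t \<in> {0..T}"
  have d: "((\<lambda>p. f t (fst p) (u t) \<pi>) has_derivative (\<lambda>p. DF (\<lambda>\<xi>. f t \<xi> (u t) \<pi>) (x t) (fst p))) (at (y t))"
    using has_derivative_DF[OF f_d[OF t uU[OF t]]]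
    by (intro has_derivative_compose[of fst fst "y t" UNIV "\<lambda>\<xi>. f t \<xi> (u t) \<pi>"]) (auto intro!: derivative_eq_intros simp: y_def)
  have d0: "((\<lambda>p. f0 t (fst p) (u t) \<pi>) has_derivative (\<lambda>p. DF (\<lambda>\<xi>. f0 t \<xi> (u t) \<pi>) (x t) (fst p))) (at (y t))"
    using has_derivative_DF[OF f0_d[OF t uU[OF t]]]
    by (intro has_derivative_compose[of fst fst "y t" UNIV "\<lambda>\<xi>. f0 t \<xi> (u t) \<pi>"]) (auto intro!: derivative_eq_intros simp: y_def)
  show "((\<lambda>\<xi>. F t \<xi> (u t)) has_derivative blinfun_apply (A t)) (at (y t))"
    using has_derivative_Pair[OF d d0] by (simp add: F_def A_apply[abs_def])
qed (fact T y_PC1 u_NPC0R y_ode A_PC0 M_props)+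

text \<open>The first-order effect of a change of the final control value on the terminal velocity.
  As \<open>M T\<close> is the identity, it is also the limit of scaled needle directions at
  \<open>T\<close>, without transport.\<close>

definition B :: "'y \<Rightarrow> 'x \<times> real" where
  "B v = (DH (\<lambda>\<zeta>. f T (x T) \<zeta> \<pi>) (u T) v, DH (\<lambda>\<zeta>. f0 T (x T) \<zeta> \<pi>) (u T) v)"

lemma B_linear: "linear B"
  by (rule linearI) (auto simp: B_def blinfun.bilinear_simps)

lemma B_limit: "((\<lambda>s. (F T (y T) (u T + s *\<^sub>R v) - F T (y T) (u T)) /\<^sub>R s) \<longlongrightarrow> B v) (at_right 0)"
proof -
  have "((\<lambda>s. (f T (x T) (u T + s *\<^sub>R v) \<pi> - f T (x T) (u T) \<pi>) /\<^sub>R s) \<longlongrightarrow> DH (\<lambda>\<zeta>. f T (x T) \<zeta> \<pi>) (u T) v) (at_right 0)"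
    "((\<lambda>s. (f0 T (x T) (u T + s *\<^sub>R v) \<pi> - f0 T (x T) (u T) \<pi>) /\<^sub>R s) \<longlongrightarrow> DH (\<lambda>\<zeta>. f0 T (x T) \<zeta> \<pi>) (u T) v) (at_right 0)"
    using hadamard_lim_compose[OF hadamard_lim_DH[OF f_h] filterlim_ident tendsto_const]
      hadamard_lim_compose[OF hadamard_lim_DH[OF f0_h] filterlim_ident tendsto_const] by blast+
  from tendsto_Pair[OF this] show ?thesis by (simp add: F_def y_def B_def)
qed

text \<open>Two limits in succession: \<open>s\<close> is chosen first, so that the difference
  quotient at \<open>T\<close> is close to \<open>B v\<close>; for this fixed control value, left
  continuity of the needle direction then provides times before \<open>T\<close>. The order matters,
  since differentiability in the control is known at \<open>T\<close> only.\<close>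

lemma approximate_direction:
  assumes e: "0 < e"
  shows "\<exists>s>0. u T + s *\<^sub>R v \<in> U \<and>
    (\<exists>b<T. \<forall>t. b < t \<longrightarrow> t < T \<longrightarrow> norm (mayer.needle_direction (u T + s *\<^sub>R v) t /\<^sub>R s - B v) < e)"
proof -
  have "((\<lambda>s. u T + s *\<^sub>R v) \<longlongrightarrow> u T + 0 *\<^sub>R v) (at_right 0)" by (intro tendsto_intros)
  then have "\<forall>\<^sub>F s in at_right 0. u T + s *\<^sub>R v \<in> U"
    using U uU[of T] T by (intro topological_tendstoD) auto
  moreover have "\<forall>\<^sub>F s in at_right 0. dist ((F T (y T) (u T + s *\<^sub>R v) - F T (y T) (u T)) /\<^sub>R s) (B v) < e / 2"
    using B_limit e by (intro tendstoD) auto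
  moreover have "\<forall>\<^sub>F s::real in at_right 0. 0 < s" by (simp add: eventually_at_filter)
  ultimately have "\<forall>\<^sub>F s in at_right 0. 0 < s \<and> u T + s *\<^sub>R v \<in> U \<and>
      dist ((F T (y T) (u T + s *\<^sub>R v) - F T (y T) (u T)) /\<^sub>R s) (B v) < e / 2"
    by eventually_elim simp
  then obtain s where s: "0 < s" "u T + s *\<^sub>R v \<in> U"
      "dist ((F T (y T) (u T + s *\<^sub>R v) - F T (y T) (u T)) /\<^sub>R s) (B v) < e / 2"
    using eventually_happens'[OF trivial_limit_at_right_real] by blast
  have "(mayer.needle_direction (u T + s *\<^sub>R v) \<longlongrightarrow> mayer.needle_direction (u T + s *\<^sub>R v) T) (at_left T)"
    using mayer.needle_direction_NPC0R[OF s(2)] unfolding NPC0R_iff by blast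
  then have "((\<lambda>t. mayer.needle_direction (u T + s *\<^sub>R v) t /\<^sub>R s) \<longlongrightarrow> mayer.needle_direction (u T + s *\<^sub>R v) T /\<^sub>R s) (at_left T)"
    by (intro tendsto_intros)
  then have "\<forall>\<^sub>F t in at_left T. dist (mayer.needle_direction (u T + s *\<^sub>R v) t /\<^sub>R s) (mayer.needle_direction (u T + s *\<^sub>R v) T /\<^sub>R s) < e / 2"
    using e by (intro tendstoD) auto
  then obtain b where b: "b < T" "\<And>t. b < t \<Longrightarrow> t < T \<Longrightarrow>
      dist (mayer.needle_direction (u T + s *\<^sub>R v) t /\<^sub>R s) (mayer.needle_direction (u T + s *\<^sub>R v) T /\<^sub>R s) < e / 2"
    unfolding eventually_at_left_field by blast
  have "norm (mayer.needle_direction (u T + s *\<^sub>R v) t /\<^sub>R s - B v) < e" if "b < t" "t < T" for t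
  proof -
    have "mayer.needle_direction (u T + s *\<^sub>R v) T = F T (y T) (u T + s *\<^sub>R v) - F T (y T) (u T)"
      by (simp add: mayer.needle_direction_def M_props(2))
    then have "dist (mayer.needle_direction (u T + s *\<^sub>R v) T /\<^sub>R s) (B v) < e / 2" using s(3) by simp
    then show ?thesis using dist_triangle_half_l[OF b(2)[OF that], of "B v"]
      by (metis dist_commute dist_norm dist_triangle_half_r b(2) that)
  qed
  then show ?thesis using s b(1) by blast
qed

section \<open>Terminal functionals and optimality\<close>

definition \<Phi> :: "nat \<Rightarrow> 'x \<times> real \<Rightarrow> real" where
  "\<Phi> i p = (if i = 0 then snd p + g 0 (fst p) \<pi> else g i (fst p) \<pi>)"

definition D\<Phi> :: "nat \<Rightarrow> 'x \<times> real \<Rightarrow> real" where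
  "D\<Phi> i p = (if i = 0 then snd p else 0) + DH (\<lambda>\<xi>. g i \<xi> \<pi>) (x T) (fst p)"

definition D\<Psi> :: "nat \<Rightarrow> 'x \<times> real \<Rightarrow> real" where
  "D\<Psi> j p = DH (\<lambda>\<xi>. h j \<xi> \<pi>) (x T) (fst p)"

lemma \<Phi>_hadamard:
  assumes "i \<in> {0..m}"
  shows "hadamard_lim (\<Phi> i) (y T) (D\<Phi> i)"
proof -
  have g: "hadamard_lim (\<lambda>\<xi>. g i \<xi> \<pi>) (fst (y T)) (DH (\<lambda>\<xi>. g i \<xi> \<pi>) (x T))"
    using hadamard_lim_DH[OF g_h[OF assms]] by (simp add: y_def)
  show ?thesis
  proof (cases "i = 0")
    case True
    then show ?thesis using hadamard_lim_snd_add[OF g] by (simp add: \<Phi>_def[abs_def] D\<Phi>_def[abs_def])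
  next
    case False
    then show ?thesis using hadamard_lim_fst[OF g] by (simp add: \<Phi>_def[abs_def] D\<Phi>_def[abs_def])
  qed
qed

lemma D\<Phi>_bounded_linear: "bounded_linear (D\<Phi> i)"
proof (cases "i = 0")
  case True
  then show ?thesis unfolding D\<Phi>_def[abs_def] by (auto intro!: bounded_linear_intros)
next
  case False
  then show ?thesis unfolding D\<Phi>_def[abs_def] by (auto intro!: bounded_linear_intros)
qed

lemma D\<Psi>_bounded_linear: "bounded_linear (D\<Psi> j)"
  unfolding D\<Psi>_def[abs_def] by (auto intro!: bounded_linear_intros)

text \<open>The second component of an augmented trajectory accumulates the running reward, starting
  from 0 like that of \<open>y\<close>; gauge and Lebesgue integral agree on the piecewise
  continuous integrand.\<close>

lemma objective_eq:
  assumes Y: "Y \<in> PC1 T (\<Omega> \<times> UNIV)" "Y 0 = y 0" and V: "V \<in> NPC0R T U"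
    and ode: "\<And>t. t \<in> {0..T} \<Longrightarrow> ext_deriv T Y t = F t (Y t) (V t)"
  shows "bolza_objective T f0 g \<pi> (\<lambda>t. fst (Y t)) V = \<Phi> 0 (Y T)"
    and "(\<lambda>t. fst (Y t)) \<in> PC1 T \<Omega>" and "\<And>t. t \<in> {0..T} \<Longrightarrow> ext_deriv T (\<lambda>t. fst (Y t)) t = f t (fst (Y t)) (V t) \<pi>"
proof -
  note * = PC1_bounded_linear[OF T Y(1) bounded_linear_fst, of \<Omega>]
  show P: "(\<lambda>t. fst (Y t)) \<in> PC1 T \<Omega>" using * by auto
  show "ext_deriv T (\<lambda>t. fst (Y t)) t = f t (fst (Y t)) (V t) \<pi>" if "t \<in> {0..T}" for t
    using *(2)[OF _ that] ode[OF that] by (auto simp: F_def)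
  note s = PC1_bounded_linear[OF T Y(1) bounded_linear_snd, of UNIV, simplified]
  have n: "(\<lambda>t. f0 t (fst (Y t)) (V t) \<pi>) \<in> NPC0R T UNIV"
    by (rule field_NPC0R[OF f0_cont PC1D(1)[OF T P] PC1D(2)[OF T P] V])
  have "((\<lambda>t. ext_deriv T (\<lambda>t. snd (Y t)) t) has_integral snd (Y T) - snd (Y 0)) {0..T}"
    by (rule PC1_has_integral[OF T s(1)]) (use T in auto)
  then have "((\<lambda>t. f0 t (fst (Y t)) (V t) \<pi>) has_integral snd (Y T) - snd (Y 0)) {0..T}"
    by (rule has_integral_eq[rotated]) (use s(2) ode in \<open>auto simp: F_def\<close>)
  then have "integral {0..T} (\<lambda>t. f0 t (fst (Y t)) (V t) \<pi>) = snd (Y T)"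
    using Y(2) by (simp add: y_def integral_unique)
  then show "bolza_objective T f0 g \<pi> (\<lambda>t. fst (Y t)) V = \<Phi> 0 (Y T)"
    using set_borel_integral_eq_integral(2)[OF PC0_set_integrable[OF T NPC0R_PC0[OF n]]]
    by (simp add: bolza_objective_def \<Phi>_def)
qed

lemma optimal:
  assumes Y: "Y \<in> PC1 T (\<Omega> \<times> UNIV)" "Y 0 = y 0" and V: "V \<in> NPC0R T U"
    and o: "\<And>t. t \<in> {0..T} \<Longrightarrow> ext_deriv T Y t = F t (Y t) (V t)"
    and c: "\<And>i. i \<in> {1..m} \<Longrightarrow> 0 \<le> g i (fst (Y T)) \<pi>" "\<And>j. j \<in> {1..q} \<Longrightarrow> h j (fst (Y T)) \<pi> = 0"
  shows "\<Phi> 0 (Y T) \<le> \<Phi> 0 (y T)"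
proof -
  note * = objective_eq[OF Y V o]
  have x0: "x 0 = \<xi>0" using adm by (simp add: bolza_admissible_def)
  have "bolza_admissible T \<Omega> U \<xi>0 f m q g h \<pi> (\<lambda>t. fst (Y t)) V"
    unfolding bolza_admissible_def using * V c Y(2) x0 by (simp add: y_def)
  then have "bolza_objective T f0 g \<pi> (\<lambda>t. fst (Y t)) V \<le> bolza_objective T f0 g \<pi> x u"
    using sol by (simp add: bolza_solution_def)
  moreover have "bolza_objective T f0 g \<pi> (\<lambda>t. fst (y t)) u = \<Phi> 0 (y T)"
    by (rule objective_eq(1)[OF y_PC1 refl u_NPC0R y_ode])
  then have "bolza_objective T f0 g \<pi> x u = \<Phi> 0 (y T)" by (simp add: y_def)
  ultimately show ?thesis using *(1) by simp
qed

text \<open>Of the \<open>q + 2\<close> needles, \<open>q\<close> correct the equality constraints,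
  the one with index \<open>q\<close> realises the improving control direction, and the one with
  index \<open>Suc q\<close> is the extra needle of weight \<open>c\<close>. Lengths cannot be
  negative while the corrections have both signs; the multiple \<open>\<epsilon>\<close> of the sum
  of the \<open>\<omega> j\<close> in \<open>w\<close> shifts the box so that every coefficient
  \<open>\<epsilon> + \<beta> j\<close> is nonnegative.\<close>

lemma not_improvable_by_needles:
  fixes \<tau> :: "nat \<Rightarrow> real" and \<zeta> :: "nat \<Rightarrow> 'y" and s :: "nat \<Rightarrow> real" and \<epsilon> c :: real
  assumes \<epsilon>: "0 < \<epsilon>" and c: "0 \<le> c"
    and \<tau>: "\<And>i. i < q + 2 \<Longrightarrow> \<tau> i \<in> {0..<T}" "inj_on \<tau> {..<q + 2}" and \<zeta>: "\<And>i. i < q + 2 \<Longrightarrow> \<zeta> i \<in> U"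
    and s: "\<And>k. k \<le> q \<Longrightarrow> 0 < s k"
    and \<omega>: "\<And>k. k \<le> q \<Longrightarrow> \<omega> k = mayer.needle_direction (\<zeta> k) (\<tau> k) /\<^sub>R s k"
    and w: "w = c *\<^sub>R mayer.needle_direction (\<zeta> (Suc q)) (\<tau> (Suc q)) + \<omega> q + \<epsilon> *\<^sub>R (\<Sum>j<q. \<omega> j)"
    and w\<Psi>: "\<And>l. l < q \<Longrightarrow> \<bar>D\<Psi> (Suc l) w\<bar> + \<epsilon> * (\<Sum>j<q. \<bar>D\<Psi> (Suc l) (\<omega> j) - (if j = l then 1 else 0)\<bar>) < \<epsilon>"
    and w\<Phi>: "\<And>i. i \<in> {0..m} \<Longrightarrow> i = 0 \<or> g i (x T) \<pi> = 0 \<Longrightarrow> \<epsilon> * (\<Sum>j<q. \<bar>D\<Phi> i (\<omega> j)\<bar>) < D\<Phi> i w"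
  shows False
proof -
  obtain r Y V C where r: "0 < r"
    and Y: "\<And>a. (\<forall>i<q + 2. 0 \<le> a i \<and> a i \<le> r) \<Longrightarrow> Y a \<in> PC1 T (\<Omega> \<times> UNIV) \<and> V a \<in> NPC0R T U \<and> Y a 0 = y 0 \<and>
       (\<forall>t\<in>{0..T}. ext_deriv T (Y a) t = F t (Y a t) (V a t))"
    and lip: "\<And>a b. (\<forall>i<q + 2. 0 \<le> a i \<and> a i \<le> r) \<Longrightarrow> (\<forall>i<q + 2. 0 \<le> b i \<and> b i \<le> r) \<Longrightarrow>
       norm (Y a T - Y b T) \<le> C * (\<Sum>i<q + 2. \<bar>a i - b i\<bar>)"
    and ex: "\<And>e. 0 < e \<Longrightarrow> \<exists>\<delta>>0. \<forall>a. (\<forall>i<q + 2. 0 \<le> a i \<and> a i \<le> r) \<longrightarrow> (\<Sum>i<q + 2. a i) \<le> \<delta> \<longrightarrow>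
       norm (Y a T - y T - (\<Sum>i<q + 2. a i *\<^sub>R mayer.needle_direction (\<zeta> i) (\<tau> i))) \<le> e * (\<Sum>i<q + 2. a i)"
    by (rule mayer.needle_variation[OF \<tau> \<zeta>]) blast+
  \<comment> \<open>Needle lengths per unit of \<open>\<theta>\<close>; dividing by
    \<open>s k\<close> accounts for the scaling in \<open>\<omega> k\<close>.\<close>
  define \<gamma> where "\<gamma> \<beta> k = (if k < q then (\<epsilon> + \<beta> k) / s k else if k = q then 1 / s q else c)" for \<beta> :: "nat \<Rightarrow> real" and k
  define \<Gamma> where "\<Gamma> = (\<Sum>k<q. 2 * \<epsilon> / s k) + 1 / s q + c"
  define box where "box \<beta> \<longleftrightarrow> (\<forall>j<q. \<bar>\<beta> j\<bar> \<le> \<epsilon>)" for \<beta> :: "nat \<Rightarrow> real"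
  have \<Gamma>: "0 < \<Gamma>" unfolding \<Gamma>_def using \<epsilon> c s
    by (intro add_pos_nonneg add_nonneg_pos sum_nonneg divide_nonneg_nonneg) (auto simp: less_imp_le)
  have sumq: "(\<Sum>k<q + 2. G k) = (\<Sum>k<q. G k) + G q + G (Suc q)" for G :: "nat \<Rightarrow> 'b::comm_monoid_add"
    by (simp add: numeral_2_eq_2)
  have \<gamma>0: "0 \<le> \<gamma> \<beta> k" if "box \<beta>" for \<beta> k
  proof -
    have "0 \<le> \<epsilon> + \<beta> k" if "k < q" using \<open>box \<beta>\<close> that by (auto simp: box_def abs_le_iff)
    then show ?thesis using s c by (auto simp: \<gamma>_def less_imp_le)
  qed
  have \<gamma>sum: "(\<Sum>k<q + 2. \<gamma> \<beta> k) \<le> \<Gamma>" if "box \<beta>" for \<beta>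
  proof -
    have "(\<Sum>k<q. \<gamma> \<beta> k) \<le> (\<Sum>k<q. 2 * \<epsilon> / s k)"
    proof (rule sum_mono)
      fix k assume "k \<in> {..<q}"
      then have k: "k < q" by simp
      then have "\<epsilon> + \<beta> k \<le> 2 * \<epsilon>" using that by (auto simp: box_def abs_le_iff)
      then show "\<gamma> \<beta> k \<le> 2 * \<epsilon> / s k" using s[of k] k by (simp add: \<gamma>_def divide_right_mono)
    qed
    then show ?thesis unfolding sumq \<Gamma>_def by (simp add: \<gamma>_def)
  qed
  have \<gamma>\<Gamma>: "\<gamma> \<beta> k \<le> \<Gamma>" if "box \<beta>" "k < q + 2" for \<beta> k
  proof -
    have "\<gamma> \<beta> k \<le> (\<Sum>k<q + 2. \<gamma> \<beta> k)" using that \<gamma>0 by (intro member_le_sum) auto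
    then show ?thesis using \<gamma>sum[OF that(1)] by linarith
  qed
  define a where "a \<theta> \<beta> k = \<theta> * \<gamma> \<beta> k" for \<theta> \<beta> k
  define e where "e \<theta> \<beta> = (Y (a \<theta> \<beta>) T - y T) /\<^sub>R \<theta>" for \<theta> \<beta>
  have abox: "\<forall>i<q + 2. 0 \<le> a \<theta> \<beta> i \<and> a \<theta> \<beta> i \<le> r" if "0 < \<theta>" "\<theta> * \<Gamma> \<le> r" "box \<beta>" for \<theta> \<beta>
  proof (intro allI impI conjI)
    fix i assume i: "i < q + 2"
    show "0 \<le> a \<theta> \<beta> i" using that \<gamma>0 by (simp add: a_def)
    have "a \<theta> \<beta> i \<le> \<theta> * \<Gamma>" unfolding a_def using that \<gamma>\<Gamma>[OF that(3) i] by (intro mult_left_mono) auto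
    then show "a \<theta> \<beta> i \<le> r" using that by linarith
  qed
  have asum: "(\<Sum>i<q + 2. a \<theta> \<beta> i *\<^sub>R mayer.needle_direction (\<zeta> i) (\<tau> i)) = \<theta> *\<^sub>R (w + (\<Sum>j<q. \<beta> j *\<^sub>R \<omega> j))" for \<theta> \<beta>
  proof -
    have "(\<Sum>k<q. a \<theta> \<beta> k *\<^sub>R mayer.needle_direction (\<zeta> k) (\<tau> k)) = (\<Sum>k<q. \<theta> *\<^sub>R ((\<epsilon> + \<beta> k) *\<^sub>R \<omega> k))"
      by (intro sum.cong) (auto simp: a_def \<gamma>_def \<omega> divide_inverse)
    also have "\<dots> = \<theta> *\<^sub>R (\<epsilon> *\<^sub>R (\<Sum>j<q. \<omega> j) + (\<Sum>j<q. \<beta> j *\<^sub>R \<omega> j))"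
      by (simp add: scaleR_sum_right[symmetric] scaleR_add_left sum.distrib)
    finally show ?thesis unfolding sumq by (simp add: w a_def \<gamma>_def \<omega> algebra_simps divide_inverse)
  qed
  have ev\<Gamma>: "\<forall>\<^sub>F \<theta> in at_right 0. 0 < \<theta> \<and> \<theta> * \<Gamma> \<le> d" if "0 < d" for d
  proof -
    have "0 < d / \<Gamma>" using that \<Gamma> by simp
    from eventually_at_right_real[OF this] show ?thesis
      by eventually_elim (use \<Gamma> in \<open>auto simp: pos_less_divide_eq\<close>)
  qed
  have unif: "\<forall>\<^sub>F \<theta> in at_right 0. \<forall>\<beta>. (\<forall>j<q. \<bar>\<beta> j\<bar> \<le> \<epsilon>) \<longrightarrow>
      norm (e \<theta> \<beta> - (w + (\<Sum>j<q. \<beta> j *\<^sub>R \<omega> j))) < \<eta>" if \<eta>: "0 < \<eta>" for \<eta>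
  proof -
    have "0 < \<eta> / (2 * \<Gamma>)" using \<eta> \<Gamma> by simp
    from ex[OF this] obtain \<delta> where \<delta>: "0 < \<delta>" "\<And>a. (\<forall>i<q + 2. 0 \<le> a i \<and> a i \<le> r) \<Longrightarrow> (\<Sum>i<q + 2. a i) \<le> \<delta> \<Longrightarrow>
       norm (Y a T - y T - (\<Sum>i<q + 2. a i *\<^sub>R mayer.needle_direction (\<zeta> i) (\<tau> i))) \<le> \<eta> / (2 * \<Gamma>) * (\<Sum>i<q + 2. a i)" by blast
    from ev\<Gamma>[OF r] ev\<Gamma>[OF \<delta>(1)] show ?thesis
    proof eventually_elim
      case (elim \<theta>)
      show ?case
      proof (intro allI impI)
        fix \<beta> :: "nat \<Rightarrow> real" assume "\<forall>j<q. \<bar>\<beta> j\<bar> \<le> \<epsilon>"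
        then have b: "box \<beta>" by (simp add: box_def)
        have sa: "(\<Sum>i<q + 2. a \<theta> \<beta> i) \<le> \<theta> * \<Gamma>"
          unfolding a_def sum_distrib_left[symmetric] using elim(1) by (intro mult_left_mono \<gamma>sum b) simp
        have "norm (Y (a \<theta> \<beta>) T - y T - \<theta> *\<^sub>R (w + (\<Sum>j<q. \<beta> j *\<^sub>R \<omega> j))) \<le> \<eta> / (2 * \<Gamma>) * (\<Sum>i<q + 2. a \<theta> \<beta> i)"
          unfolding asum[symmetric] using elim sa by (intro \<delta>(2) abox b) auto
        also have "\<dots> \<le> \<eta> / (2 * \<Gamma>) * (\<theta> * \<Gamma>)" using sa \<eta> \<Gamma> by (intro mult_left_mono) auto
        also have "\<dots> = \<theta> * (\<eta> / 2)" using \<Gamma> by simp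
        finally have n: "norm (Y (a \<theta> \<beta>) T - y T - \<theta> *\<^sub>R (w + (\<Sum>j<q. \<beta> j *\<^sub>R \<omega> j))) \<le> \<theta> * (\<eta> / 2)" .
        have "e \<theta> \<beta> - (w + (\<Sum>j<q. \<beta> j *\<^sub>R \<omega> j)) = (Y (a \<theta> \<beta>) T - y T - \<theta> *\<^sub>R (w + (\<Sum>j<q. \<beta> j *\<^sub>R \<omega> j))) /\<^sub>R \<theta>"
          using elim(1) by (simp add: e_def scaleR_diff_right)
        then have "norm (e \<theta> \<beta> - (w + (\<Sum>j<q. \<beta> j *\<^sub>R \<omega> j))) =
            norm (Y (a \<theta> \<beta>) T - y T - \<theta> *\<^sub>R (w + (\<Sum>j<q. \<beta> j *\<^sub>R \<omega> j))) / \<theta>"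
          using elim(1) by (simp add: divide_inverse mult.commute)
        also have "\<dots> \<le> \<eta> / 2" using n elim(1) by (simp add: pos_divide_le_eq mult.commute)
        also have "\<dots> < \<eta>" using \<eta> by simp
        finally show "norm (e \<theta> \<beta> - (w + (\<Sum>j<q. \<beta> j *\<^sub>R \<omega> j))) < \<eta>" .
      qed
    qed
  qed
  have cont: "\<forall>\<^sub>F \<theta> in at_right 0. \<forall>\<sigma> \<beta>. (\<forall>k. \<forall>j<q. \<bar>\<sigma> k j\<bar> \<le> \<epsilon>) \<longrightarrow> (\<forall>j<q. \<bar>\<beta> j\<bar> \<le> \<epsilon>) \<longrightarrow>
      (\<forall>j<q. (\<lambda>k. \<sigma> k j) \<longlonglongrightarrow> \<beta> j) \<longrightarrow> (\<lambda>k. e \<theta> (\<sigma> k)) \<longlonglongrightarrow> e \<theta> \<beta>"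
    using ev\<Gamma>[OF r]
  proof eventually_elim
    case (elim \<theta>)
    show ?case
    proof (intro allI impI)
      fix \<sigma> :: "nat \<Rightarrow> nat \<Rightarrow> real" and \<beta> :: "nat \<Rightarrow> real"
      assume sb: "\<forall>k. \<forall>j<q. \<bar>\<sigma> k j\<bar> \<le> \<epsilon>" "\<forall>j<q. \<bar>\<beta> j\<bar> \<le> \<epsilon>" "\<forall>j<q. (\<lambda>k. \<sigma> k j) \<longlonglongrightarrow> \<beta> j"
      have \<gamma>lim: "(\<lambda>k. \<gamma> (\<sigma> k) i) \<longlonglongrightarrow> \<gamma> \<beta> i" if "i < q + 2" for i
      proof (cases "i < q")
        case True
        then have "s i \<noteq> 0" using s[of i] by simp
        then show ?thesis using sb(3) True by (auto simp: \<gamma>_def intro!: tendsto_intros)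
      qed (simp add: \<gamma>_def)
      have "(\<lambda>k. C * (\<Sum>i<q + 2. \<bar>a \<theta> (\<sigma> k) i - a \<theta> \<beta> i\<bar>)) \<longlonglongrightarrow> C * (\<Sum>i<q + 2. \<bar>a \<theta> \<beta> i - a \<theta> \<beta> i\<bar>)"
        unfolding a_def by (intro tendsto_intros \<gamma>lim) auto
      then have z: "(\<lambda>k. C * (\<Sum>i<q + 2. \<bar>a \<theta> (\<sigma> k) i - a \<theta> \<beta> i\<bar>)) \<longlonglongrightarrow> 0" by simp
      have "norm (Y (a \<theta> (\<sigma> k)) T - Y (a \<theta> \<beta>) T) \<le> C * (\<Sum>i<q + 2. \<bar>a \<theta> (\<sigma> k) i - a \<theta> \<beta> i\<bar>)" for k
        using elim sb by (intro lip abox) (auto simp: box_def)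
      then have "(\<lambda>k. Y (a \<theta> (\<sigma> k)) T - Y (a \<theta> \<beta>) T) \<longlonglongrightarrow> 0"
        by (intro Lim_null_comparison[OF _ z] always_eventually) blast
      then have "(\<lambda>k. Y (a \<theta> (\<sigma> k)) T) \<longlonglongrightarrow> Y (a \<theta> \<beta>) T" by (simp add: LIM_zero_iff)
      then show "(\<lambda>k. e \<theta> (\<sigma> k)) \<longlonglongrightarrow> e \<theta> \<beta>" unfolding e_def by (intro tendsto_intros)
    qed
  qed
  have hz: "h (Suc l) (x T) \<pi> = 0" if "l < q" for l using adm that by (auto simp: bolza_admissible_def)
  have gz: "0 \<le> g i (x T) \<pi>" if "i \<in> {1..m}" for i using adm that by (auto simp: bolza_admissible_def)
  obtain N where N: "\<And>j. j \<in> {1..q} \<Longrightarrow> open (N j) \<and> x T \<in> N j \<and> continuous_on (N j) (\<lambda>\<xi>. h j \<xi> \<pi>)"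
    using h_c by metis
  define N' where "N' = (\<Inter>j\<in>{1..q}. N j) \<times> (UNIV :: real set)"
  have N': "open N'" "y T \<in> N'"
    using N by (auto simp: N'_def y_def intro!: open_Times open_INT)
  have cN': "continuous_on N' (\<lambda>p. h (Suc l) (fst p) \<pi>)" if "l < q" for l
  proof (rule continuous_on_compose2[OF conjunct2[OF conjunct2[OF N[of "Suc l"]]]])
    show "continuous_on N' fst" by (intro continuous_intros)
  qed (use that in \<open>auto simp: N'_def\<close>)
  have \<psi>h: "hadamard_lim (\<lambda>p. h (Suc l) (fst p) \<pi>) (y T) (D\<Psi> (Suc l))" if "l < q" for l
  proof -
    have "hadamard_lim (\<lambda>\<xi>. h (Suc l) \<xi> \<pi>) (fst (y T)) (DH (\<lambda>\<xi>. h (Suc l) \<xi> \<pi>) (x T))"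
      using hadamard_lim_DH[OF h_h[of "Suc l"]] that by (simp add: y_def)
    from hadamard_lim_fst[OF this] show ?thesis by (simp add: D\<Psi>_def[abs_def])
  qed
  \<comment> \<open>Index 0 puts the objective among the functionals that have to increase, together
    with the active constraints.\<close>
  define J where "J = {i \<in> {0..m}. i = 0 \<or> g i (x T) \<pi> = 0}"
  define J' where "J' = {i \<in> {1..m}. 0 < g i (x T) \<pi>}"
  have "\<forall>\<^sub>F \<theta> in at_right 0. \<exists>\<beta>. (\<forall>j<q. \<bar>\<beta> j\<bar> \<le> \<epsilon>) \<and> (\<forall>l<q. h (Suc l) (fst (y T + \<theta> *\<^sub>R e \<theta> \<beta>)) \<pi> = 0) \<and>
    (\<forall>i\<in>J. \<Phi> i (y T) < \<Phi> i (y T + \<theta> *\<^sub>R e \<theta> \<beta>)) \<and> (\<forall>i\<in>J'. 0 < \<Phi> i (y T + \<theta> *\<^sub>R e \<theta> \<beta>))"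
  proof (rule constrained_improvement[where \<psi> = "\<lambda>l p. h (Suc l) (fst p) \<pi>" and D\<psi> = "\<lambda>l. D\<Psi> (Suc l)" and \<phi> = \<Phi> and D\<phi> = D\<Phi>
        and w = w and \<omega> = \<omega> and N = N'])
    show "0 < \<Phi> i (y T)" if "i \<in> J'" for i using that by (auto simp: J'_def \<Phi>_def y_def)
    show "h (Suc l) (fst (y T)) \<pi> = 0" if "l < q" for l using hz[OF that] by (simp add: y_def)
    show "finite J" "finite J'" by (simp_all add: J_def J'_def)
    show "hadamard_lim (\<Phi> i) (y T) (D\<Phi> i)" if "i \<in> J" for i using that by (intro \<Phi>_hadamard) (simp add: J_def)
    show "hadamard_lim (\<Phi> i) (y T) (D\<Phi> i)" if "i \<in> J'" for i using that by (intro \<Phi>_hadamard) (simp add: J'_def)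
    show "\<epsilon> * (\<Sum>j<q. \<bar>D\<Phi> i (\<omega> j)\<bar>) < D\<Phi> i w" if "i \<in> J" for i using that by (intro w\<Phi>) (simp_all add: J_def)
  qed ((rule \<epsilon> unif cont \<psi>h D\<Psi>_bounded_linear N' cN' D\<Phi>_bounded_linear w\<Psi>; assumption?)+)
  with ev\<Gamma>[OF r] have "\<forall>\<^sub>F \<theta> in at_right 0. 0 < \<theta> \<and> \<theta> * \<Gamma> \<le> r \<and> (\<exists>\<beta>. box \<beta> \<and> (\<forall>l<q. h (Suc l) (fst (y T + \<theta> *\<^sub>R e \<theta> \<beta>)) \<pi> = 0) \<and>
    (\<forall>i\<in>J. \<Phi> i (y T) < \<Phi> i (y T + \<theta> *\<^sub>R e \<theta> \<beta>)) \<and> (\<forall>i\<in>J'. 0 < \<Phi> i (y T + \<theta> *\<^sub>R e \<theta> \<beta>)))"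
    by eventually_elim (simp add: box_def)
  from eventually_happens'[OF trivial_limit_at_right_real this] obtain \<theta> \<beta> where \<theta>: "0 < \<theta>" "\<theta> * \<Gamma> \<le> r" "box \<beta>" "\<And>l. l < q \<Longrightarrow> h (Suc l) (fst (y T + \<theta> *\<^sub>R e \<theta> \<beta>)) \<pi> = 0"
    "\<And>i. i \<in> J \<Longrightarrow> \<Phi> i (y T) < \<Phi> i (y T + \<theta> *\<^sub>R e \<theta> \<beta>)" "\<And>i. i \<in> J' \<Longrightarrow> 0 < \<Phi> i (y T + \<theta> *\<^sub>R e \<theta> \<beta>)"
    by blast
  define a' where "a' = a \<theta> \<beta>"
  have YT: "y T + \<theta> *\<^sub>R e \<theta> \<beta> = Y a' T" using \<theta>(1) by (simp add: e_def a'_def)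
  have Ya: "Y a' \<in> PC1 T (\<Omega> \<times> UNIV)" "V a' \<in> NPC0R T U" "Y a' 0 = y 0"
    "\<And>t. t \<in> {0..T} \<Longrightarrow> ext_deriv T (Y a') t = F t (Y a' t) (V a' t)"
    using Y[OF abox[OF \<theta>(1-3)]] by (auto simp: a'_def)
  have "\<Phi> 0 (Y a' T) \<le> \<Phi> 0 (y T)"
  proof (rule optimal[OF Ya(1,3,2,4)])
    show "0 \<le> g i (fst (Y a' T)) \<pi>" if i: "i \<in> {1..m}" for i
    proof (cases "g i (x T) \<pi> = 0")
      case True
      then have "\<Phi> i (y T) < \<Phi> i (Y a' T)" using \<theta>(5)[of i] i YT by (auto simp: J_def)
      then show ?thesis using i True by (simp add: \<Phi>_def y_def)
    next
      case False
      then have "i \<in> J'" using gz[OF i] i by (auto simp: J'_def)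
      then show ?thesis using \<theta>(6)[of i] i YT by (simp add: \<Phi>_def)
    qed
    show "h j (fst (Y a' T)) \<pi> = 0" if j: "j \<in> {1..q}" for j
    proof -
      obtain l where "j = Suc l" "l < q" using j by (cases j) auto
      then show ?thesis using \<theta>(4)[of l] YT by simp
    qed
  qed
  moreover have "\<Phi> 0 (y T) < \<Phi> 0 (Y a' T)" using \<theta>(5)[of 0] YT by (simp add: J_def)
  ultimately show False by simp
qed

text \<open>Needles close to \<open>T\<close> with values \<open>u T + s *\<^sub>R v\<close> realise every direction \<open>B v\<close> up to a small error,
  and the conditions below are open.\<close>

lemma not_improvable:
  fixes v :: 'y and vj :: "nat \<Rightarrow> 'y" and \<epsilon> c \<tau>0 :: real
  assumes \<epsilon>: "0 < \<epsilon>" and c: "0 \<le> c" and \<tau>0: "\<tau>0 \<in> {0..<T}" and \<zeta>0: "\<zeta>0 \<in> U"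
    and w: "w = c *\<^sub>R mayer.needle_direction \<zeta>0 \<tau>0 + B v"
    and w\<Psi>: "\<And>l. l < q \<Longrightarrow> \<bar>D\<Psi> (Suc l) w\<bar> + \<epsilon> * (\<Sum>j<q. \<bar>D\<Psi> (Suc l) (B (vj j)) - (if j = l then 1 else 0)\<bar>) < \<epsilon>"
    and w\<Phi>: "\<And>i. i \<in> {0..m} \<Longrightarrow> i = 0 \<or> g i (x T) \<pi> = 0 \<Longrightarrow> \<epsilon> * (\<Sum>j<q. \<bar>D\<Phi> i (B (vj j))\<bar>) < D\<Phi> i w"
  shows False
proof -
  \<comment> \<open>Subtracting \<open>\<epsilon>\<close> times the sum of the \<open>vj j\<close>
    from \<open>v\<close> cancels the shift that the needle lemma adds to keep the lengths
    nonnegative.\<close>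
  define vv where "vv k = (if k < q then vj k else v - \<epsilon> *\<^sub>R (\<Sum>j<q. vj j))" for k
  have "\<forall>n k. \<exists>s b. 0 < s \<and> u T + s *\<^sub>R vv k \<in> U \<and> b < T \<and>
      (\<forall>t. b < t \<longrightarrow> t < T \<longrightarrow> norm (mayer.needle_direction (u T + s *\<^sub>R vv k) t /\<^sub>R s - B (vv k)) < 1 / real (Suc n))"
  proof (intro allI)
    fix n k
    have "0 < 1 / real (Suc n)" by simp
    from approximate_direction[OF this, of "vv k"] show "\<exists>s b. 0 < s \<and> u T + s *\<^sub>R vv k \<in> U \<and> b < T \<and>
      (\<forall>t. b < t \<longrightarrow> t < T \<longrightarrow> norm (mayer.needle_direction (u T + s *\<^sub>R vv k) t /\<^sub>R s - B (vv k)) < 1 / real (Suc n))"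
      by blast
  qed
  then obtain s b where sb: "\<And>n k. 0 < s n k" "\<And>n k. u T + s n k *\<^sub>R vv k \<in> U" "\<And>n k. b n k < T"
    "\<And>n k t. b n k < t \<Longrightarrow> t < T \<Longrightarrow>
      norm (mayer.needle_direction (u T + s n k *\<^sub>R vv k) t /\<^sub>R s n k - B (vv k)) < 1 / real (Suc n)"
    unfolding choice_iff by blast
  \<comment> \<open>After this time all approximations are valid, and needles placed later cannot
    share their start with the one at \<open>\<tau>0\<close>.\<close>
  define b' where "b' n = Max (insert \<tau>0 (b n ` {..q}))" for n
  have b'T: "b' n < T" for n using sb(3) \<tau>0 unfolding b'_def by (subst Max_less_iff) auto
  have b'le: "\<tau>0 \<le> b' n" "k \<le> q \<Longrightarrow> b n k \<le> b' n" for n k unfolding b'_def by (intro Max_ge; simp)+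
  \<comment> \<open>\<open>Suc k\<close> runs from 1 to \<open>q + 1\<close>, so dividing by
    \<open>q + 2\<close> places the times strictly between \<open>b' n\<close> and
    \<open>T\<close>.\<close>
  define \<tau> where "\<tau> n k = (if k \<le> q then b' n + (T - b' n) * (real (Suc k) / real (q + 2)) else \<tau>0)" for n k
  have \<tau>b: "b' n < \<tau> n k" "\<tau> n k < T" if "k \<le> q" for n k
  proof -
    have f: "0 < real (Suc k) / real (q + 2)" "real (Suc k) / real (q + 2) < 1" using that by auto
    show "b' n < \<tau> n k" using f(1) b'T[of n] that by (simp add: \<tau>_def)
    have "(T - b' n) * (real (Suc k) / real (q + 2)) < (T - b' n) * 1"
      using f(2) b'T[of n] by (intro mult_strict_left_mono) auto
    then show "\<tau> n k < T" using that by (simp add: \<tau>_def)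
  qed
  define \<zeta> where "\<zeta> n k = (if k \<le> q then u T + s n k *\<^sub>R vv k else \<zeta>0)" for n k
  define \<omega> where "\<omega> n k = mayer.needle_direction (\<zeta> n k) (\<tau> n k) /\<^sub>R s n k" for n k
  have near: "norm (\<omega> n k - B (vv k)) \<le> inverse (real (Suc n))" if "k \<le> q" for n k
  proof -
    have "norm (mayer.needle_direction (u T + s n k *\<^sub>R vv k) (\<tau> n k) /\<^sub>R s n k - B (vv k)) < 1 / real (Suc n)"
      using \<tau>b[OF that, of n] b'le(2)[OF that, of n] by (intro sb(4)) auto
    then show ?thesis using that by (simp add: \<omega>_def \<zeta>_def inverse_eq_divide)
  qed
  have \<omega>lim: "(\<lambda>n. \<omega> n k) \<longlonglongrightarrow> B (vv k)" if "k \<le> q" for k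
    by (rule LIM_zero_cancel, rule Lim_null_comparison[OF always_eventually LIMSEQ_inverse_real_of_nat])
      (use near[OF that] in blast)
  have \<omega>lim': "(\<lambda>n. \<omega> n j) \<longlonglongrightarrow> B (vj j)" if "j < q" for j
    using \<omega>lim[of j] that by (simp add: vv_def)
  define wn where "wn n = c *\<^sub>R mayer.needle_direction \<zeta>0 \<tau>0 + \<omega> n q + \<epsilon> *\<^sub>R (\<Sum>j<q. \<omega> n j)" for n
  have "wn \<longlonglongrightarrow> c *\<^sub>R mayer.needle_direction \<zeta>0 \<tau>0 + B (vv q) + \<epsilon> *\<^sub>R (\<Sum>j<q. B (vj j))"
    unfolding wn_def using \<omega>lim' \<omega>lim by (intro tendsto_intros) auto
  moreover have "c *\<^sub>R mayer.needle_direction \<zeta>0 \<tau>0 + B (vv q) + \<epsilon> *\<^sub>R (\<Sum>j<q. B (vj j)) = w"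
    using B_linear by (simp add: w vv_def linear_diff linear_scale linear_sum)
  ultimately have wlim: "wn \<longlonglongrightarrow> w" by simp
  have "\<forall>\<^sub>F n in sequentially. \<forall>l\<in>{..<q}.
      \<bar>D\<Psi> (Suc l) (wn n)\<bar> + \<epsilon> * (\<Sum>j<q. \<bar>D\<Psi> (Suc l) (\<omega> n j) - (if j = l then 1 else 0)\<bar>) < \<epsilon>"
  proof (intro eventually_ball_finite ballI)
    fix l assume l: "l \<in> {..<q}"
    have "(\<lambda>n. \<bar>D\<Psi> (Suc l) (wn n)\<bar> + \<epsilon> * (\<Sum>j<q. \<bar>D\<Psi> (Suc l) (\<omega> n j) - (if j = l then 1 else 0)\<bar>)) \<longlonglongrightarrow>
        \<bar>D\<Psi> (Suc l) w\<bar> + \<epsilon> * (\<Sum>j<q. \<bar>D\<Psi> (Suc l) (B (vj j)) - (if j = l then 1 else 0)\<bar>)"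
      by (intro tendsto_intros bounded_linear.tendsto[OF D\<Psi>_bounded_linear] wlim \<omega>lim') auto
    then show "\<forall>\<^sub>F n in sequentially.
      \<bar>D\<Psi> (Suc l) (wn n)\<bar> + \<epsilon> * (\<Sum>j<q. \<bar>D\<Psi> (Suc l) (\<omega> n j) - (if j = l then 1 else 0)\<bar>) < \<epsilon>"
      using w\<Psi> l by (intro order_tendstoD(2)) auto
  qed simp
  moreover have "\<forall>\<^sub>F n in sequentially. \<forall>i\<in>{i \<in> {0..m}. i = 0 \<or> g i (x T) \<pi> = 0}.
      \<epsilon> * (\<Sum>j<q. \<bar>D\<Phi> i (\<omega> n j)\<bar>) < D\<Phi> i (wn n)"
  proof (intro eventually_ball_finite ballI)
    fix i assume i: "i \<in> {i \<in> {0..m}. i = 0 \<or> g i (x T) \<pi> = 0}"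
    have "(\<lambda>n. D\<Phi> i (wn n) - \<epsilon> * (\<Sum>j<q. \<bar>D\<Phi> i (\<omega> n j)\<bar>)) \<longlonglongrightarrow> D\<Phi> i w - \<epsilon> * (\<Sum>j<q. \<bar>D\<Phi> i (B (vj j))\<bar>)"
      by (intro tendsto_intros bounded_linear.tendsto[OF D\<Phi>_bounded_linear] wlim \<omega>lim') auto
    then have "\<forall>\<^sub>F n in sequentially. 0 < D\<Phi> i (wn n) - \<epsilon> * (\<Sum>j<q. \<bar>D\<Phi> i (\<omega> n j)\<bar>)"
      using w\<Phi> i by (intro order_tendstoD(1)) auto
    then show "\<forall>\<^sub>F n in sequentially. \<epsilon> * (\<Sum>j<q. \<bar>D\<Phi> i (\<omega> n j)\<bar>) < D\<Phi> i (wn n)"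
      by eventually_elim simp
  qed simp
  ultimately have "\<forall>\<^sub>F n in sequentially. (\<forall>l\<in>{..<q}.
      \<bar>D\<Psi> (Suc l) (wn n)\<bar> + \<epsilon> * (\<Sum>j<q. \<bar>D\<Psi> (Suc l) (\<omega> n j) - (if j = l then 1 else 0)\<bar>) < \<epsilon>) \<and>
      (\<forall>i\<in>{i \<in> {0..m}. i = 0 \<or> g i (x T) \<pi> = 0}. \<epsilon> * (\<Sum>j<q. \<bar>D\<Phi> i (\<omega> n j)\<bar>) < D\<Phi> i (wn n))"
    by (rule eventually_conj)
  from eventually_happens'[OF sequentially_bot this] obtain n where n: "\<And>l. l < q \<Longrightarrow>
      \<bar>D\<Psi> (Suc l) (wn n)\<bar> + \<epsilon> * (\<Sum>j<q. \<bar>D\<Psi> (Suc l) (\<omega> n j) - (if j = l then 1 else 0)\<bar>) < \<epsilon>"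
      "\<And>i. i \<in> {0..m} \<Longrightarrow> i = 0 \<or> g i (x T) \<pi> = 0 \<Longrightarrow> \<epsilon> * (\<Sum>j<q. \<bar>D\<Phi> i (\<omega> n j)\<bar>) < D\<Phi> i (wn n)"
    by blast
  show False
  proof (rule not_improvable_by_needles[OF \<epsilon> c, where \<tau> = "\<tau> n" and \<zeta> = "\<zeta> n" and s = "s n" and \<omega> = "\<omega> n" and w = "wn n"])
    show "\<tau> n i \<in> {0..<T}" for i
    proof (cases "i \<le> q")
      case True
      then show ?thesis using \<tau>b[OF True, of n] b'le(1)[of n] \<tau>0 by auto
    qed (use \<tau>0 in \<open>simp add: \<tau>_def\<close>)
    show "inj_on (\<tau> n) {..<q + 2}"
    proof (rule inj_onI)
      fix i j assume ij: "i \<in> {..<q + 2}" "j \<in> {..<q + 2}" "\<tau> n i = \<tau> n j"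
      have ne: "\<tau> n k \<noteq> \<tau>0" if "k \<le> q" for k using \<tau>b(1)[OF that, of n] b'le(1)[of n] by simp
      consider "i \<le> q" "j \<le> q" | "i \<le> q" "\<not> j \<le> q" | "\<not> i \<le> q" "j \<le> q" | "\<not> i \<le> q" "\<not> j \<le> q" by blast
      then show "i = j"
      proof cases
        case 1
        then have "(T - b' n) * (real (Suc i) / real (q + 2)) = (T - b' n) * (real (Suc j) / real (q + 2))"
          using ij(3) by (simp add: \<tau>_def)
        then have "real (Suc i) / real (q + 2) = real (Suc j) / real (q + 2)" using b'T[of n] by simp
        then have "real (Suc i) = real (Suc j)" by (simp add: divide_cancel_right)
        then show ?thesis by simp
      next
        case 2
        then show ?thesis using ij(3) ne[of i] by (simp add: \<tau>_def)
      next
        case 3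
        then show ?thesis using ij(3) ne[of j] by (simp add: \<tau>_def)
      next
        case 4
        then show ?thesis using ij by simp
      qed
    qed
    show "\<zeta> n i \<in> U" for i using sb(2) \<zeta>0 by (simp add: \<zeta>_def)
    show "wn n = c *\<^sub>R mayer.needle_direction (\<zeta> n (Suc q)) (\<tau> n (Suc q)) + \<omega> n q + \<epsilon> *\<^sub>R (\<Sum>j<q. \<omega> n j)"
      by (simp add: wn_def \<zeta>_def \<tau>_def)
  qed (use sb(1) n in \<open>auto simp: \<omega>_def\<close>)
qed

section \<open>Multipliers\<close>

text \<open>The dual directions turn the choice of a control variation into a choice of
  coefficients: \<open>\<alpha> i\<close> and \<open>\<beta> j\<close> prescribe the changes of the
  constraints independently, and the effect on the objective is read off on the dual directions. All
  inequality constraints are made to increase, active or not.\<close>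

lemma dual_improvement:
  fixes vg vh :: "nat \<Rightarrow> 'y" and \<alpha> \<beta> :: "nat \<Rightarrow> real"
  assumes gg: "\<And>i k. i \<in> {1..m} \<Longrightarrow> k \<in> {1..m} \<Longrightarrow> D\<Phi> i (B (vg k)) = (if i = k then 1 else 0)"
    and gh: "\<And>i j. i \<in> {1..m} \<Longrightarrow> j \<in> {1..q} \<Longrightarrow> D\<Phi> i (B (vh j)) = 0"
    and hg: "\<And>j k. j \<in> {1..q} \<Longrightarrow> k \<in> {1..m} \<Longrightarrow> D\<Psi> j (B (vg k)) = 0"
    and hh: "\<And>j k. j \<in> {1..q} \<Longrightarrow> k \<in> {1..q} \<Longrightarrow> D\<Psi> j (B (vh k)) = (if j = k then 1 else 0)"
    and c: "0 \<le> c" and \<tau>0: "\<tau>0 \<in> {0..<T}" and \<zeta>0: "\<zeta>0 \<in> U"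
    and d: "d = c *\<^sub>R mayer.needle_direction \<zeta>0 \<tau>0"
    and \<Psi>: "\<And>j. j \<in> {1..q} \<Longrightarrow> D\<Psi> j d + \<beta> j = 0"
    and \<Phi>: "\<And>i. i \<in> {1..m} \<Longrightarrow> 0 < D\<Phi> i d + \<alpha> i"
    and \<Phi>0: "0 < D\<Phi> 0 d + (\<Sum>k=1..m. \<alpha> k * D\<Phi> 0 (B (vg k))) + (\<Sum>j=1..q. \<beta> j * D\<Phi> 0 (B (vh j)))"
  shows False
proof -
  define v where "v = (\<Sum>k=1..m. \<alpha> k *\<^sub>R vg k) + (\<Sum>j=1..q. \<beta> j *\<^sub>R vh j)"
  define w where "w = d + B v"
  have lin: "D (B v) = (\<Sum>k=1..m. \<alpha> k * D (B (vg k))) + (\<Sum>j=1..q. \<beta> j * D (B (vh j)))"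
    if "bounded_linear D" for D :: "'x \<times> real \<Rightarrow> real"
    using bounded_linear.linear[OF that] B_linear
    by (simp add: v_def linear_add linear_sum linear_scale)
  have Dw: "D w = D d + D (B v)" if "bounded_linear D" for D :: "'x \<times> real \<Rightarrow> real"
    using bounded_linear.linear[OF that] by (simp add: w_def linear_add)
  have w\<Psi>: "D\<Psi> j w = 0" if j: "j \<in> {1..q}" for j
  proof -
    have "(\<Sum>k=1..m. \<alpha> k * D\<Psi> j (B (vg k))) = 0" using hg[OF j] by (intro sum.neutral) auto
    moreover have "(\<Sum>k=1..q. \<beta> k * D\<Psi> j (B (vh k))) = (\<Sum>k=1..q. if k = j then \<beta> k else 0)"
      using hh[OF j] by (intro sum.cong) auto
    ultimately show ?thesis using \<Psi>[OF j] j by (simp add: Dw[OF D\<Psi>_bounded_linear] lin[OF D\<Psi>_bounded_linear])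
  qed
  have w\<Phi>: "0 < D\<Phi> i w" if i: "i \<in> {1..m}" for i
  proof -
    have "(\<Sum>k=1..q. \<beta> k * D\<Phi> i (B (vh k))) = 0" using gh[OF i] by (intro sum.neutral) auto
    moreover have "(\<Sum>k=1..m. \<alpha> k * D\<Phi> i (B (vg k))) = (\<Sum>k=1..m. if k = i then \<alpha> k else 0)"
      using gg[OF i] by (intro sum.cong) auto
    ultimately show ?thesis using \<Phi>[OF i] i by (simp add: Dw[OF D\<Phi>_bounded_linear] lin[OF D\<Phi>_bounded_linear])
  qed
  have w0: "0 < D\<Phi> 0 w" using \<Phi>0 by (simp add: Dw[OF D\<Phi>_bounded_linear] lin[OF D\<Phi>_bounded_linear])
  define vj where "vj j = vh (Suc j)" for j
  define S where "S = (\<Sum>j<q. \<bar>D\<Phi> 0 (B (vj j))\<bar>)"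
  have S: "0 \<le> S" unfolding S_def by (intro sum_nonneg) auto
  \<comment> \<open>The correcting directions pair exactly with the constraints, so the margin
    competes only with their effect \<open>S\<close> on the objective; \<open>S + 1\<close> avoids a
    division by 0.\<close>
  define \<epsilon> where "\<epsilon> = D\<Phi> 0 w / (S + 1)"
  have \<epsilon>: "0 < \<epsilon>" using w0 S by (simp add: \<epsilon>_def)
  have "\<epsilon> * S < D\<Phi> 0 w"
  proof -
    have "\<epsilon> * S < \<epsilon> * (S + 1)" using \<epsilon> by simp
    also have "\<dots> = D\<Phi> 0 w" using S by (simp add: \<epsilon>_def)
    finally show ?thesis .
  qed
  show False
  proof (rule not_improvable[OF \<epsilon> c \<tau>0 \<zeta>0, where w = w and v = v and vj = vj])
    show "w = c *\<^sub>R mayer.needle_direction \<zeta>0 \<tau>0 + B v" by (simp add: w_def d)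
    show "\<bar>D\<Psi> (Suc l) w\<bar> + \<epsilon> * (\<Sum>j<q. \<bar>D\<Psi> (Suc l) (B (vj j)) - (if j = l then 1 else 0)\<bar>) < \<epsilon>" if l: "l < q" for l
    proof -
      have "(\<Sum>j<q. \<bar>D\<Psi> (Suc l) (B (vj j)) - (if j = l then 1 else 0)\<bar>) = 0"
        using hh l by (intro sum.neutral) (auto simp: vj_def)
      then show ?thesis using w\<Psi>[of "Suc l"] l \<epsilon> by simp
    qed
    show "\<epsilon> * (\<Sum>j<q. \<bar>D\<Phi> i (B (vj j))\<bar>) < D\<Phi> i w" if "i \<in> {0..m}" for i
    proof (cases "i = 0")
      case True
      then show ?thesis using \<open>\<epsilon> * S < D\<Phi> 0 w\<close> by (simp add: S_def)
    next
      case False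
      then have i: "i \<in> {1..m}" using that by auto
      have "(\<Sum>j<q. \<bar>D\<Phi> i (B (vj j))\<bar>) = 0" using gh[OF i] by (intro sum.neutral) (auto simp: vj_def)
      then show ?thesis using w\<Phi>[OF i] by simp
    qed
  qed
qed

text \<open>The differential of the Lagrangian at the terminal state of the augmented system;
  transported backwards by \<open>M\<close> it yields the costate.\<close>

definition adjoint_form :: "(nat \<Rightarrow> real) \<Rightarrow> (nat \<Rightarrow> real) \<Rightarrow> 'x \<times> real \<Rightarrow> real" where
  "adjoint_form lam mu w = (\<Sum>i=0..m. lam i * D\<Phi> i w) + (\<Sum>j=1..q. mu j * D\<Psi> j w)"

lemma adjoint_form_eq:
  assumes "lam 0 = 1"
  shows "adjoint_form lam mu w = D\<Phi> 0 w + (\<Sum>i=1..m. lam i * D\<Phi> i w) + (\<Sum>j=1..q. mu j * D\<Psi> j w)"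
  using assms by (simp add: adjoint_form_def sum.atLeast_Suc_atMost[of 0])

lemma adjoint_form_terminal:
  assumes "lam 0 = 1"
  shows "adjoint_form lam mu w = snd w +
    ((\<Sum>i=0..m. lam i *\<^sub>R DH (\<lambda>\<xi>. g i \<xi> \<pi>) (x T)) + (\<Sum>j=1..q. mu j *\<^sub>R DH (\<lambda>\<xi>. h j \<xi> \<pi>) (x T))) (fst w)"
proof -
  have "(\<Sum>i=0..m. lam i * (if i = 0 then snd w else 0)) = (\<Sum>i=0..m. if i = 0 then snd w else 0)"
    using assms by (intro sum.cong) auto
  then have "(\<Sum>i=0..m. lam i * (if i = 0 then snd w else 0)) = snd w" by simp
  then have "(\<Sum>i=0..m. lam i * D\<Phi> i w) = snd w + (\<Sum>i=0..m. lam i * DH (\<lambda>\<xi>. g i \<xi> \<pi>) (x T) (fst w))"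
    by (simp add: D\<Phi>_def distrib_left sum.distrib)
  then show ?thesis
    by (simp add: adjoint_form_def D\<Psi>_def blinfun.add_left blinfun.sum_left blinfun.scaleR_left)
qed

text \<open>The multipliers are prices: \<open>- lam i\<close> is the change of the objective along
  \<open>vg i\<close>. A violation of either claim would leave enough gain to raise every inequality
  constraint strictly by a small \<open>\<eta>\<close>, at total cost \<open>\<eta> * S\<close>, and
  still improve the objective.\<close>

lemma multipliers_from_dual:
  fixes vg vh :: "nat \<Rightarrow> 'y"
  assumes dual: "\<And>i k. i \<in> {1..m} \<Longrightarrow> k \<in> {1..m} \<Longrightarrow> D\<Phi> i (B (vg k)) = (if i = k then 1 else 0)"
      "\<And>i j. i \<in> {1..m} \<Longrightarrow> j \<in> {1..q} \<Longrightarrow> D\<Phi> i (B (vh j)) = 0"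
      "\<And>j k. j \<in> {1..q} \<Longrightarrow> k \<in> {1..m} \<Longrightarrow> D\<Psi> j (B (vg k)) = 0"
      "\<And>j k. j \<in> {1..q} \<Longrightarrow> k \<in> {1..q} \<Longrightarrow> D\<Psi> j (B (vh k)) = (if j = k then 1 else 0)"
    and lam: "lam 0 = 1" "\<And>i. i \<in> {1..m} \<Longrightarrow> lam i = - D\<Phi> 0 (B (vg i))"
    and mu: "\<And>j. j \<in> {1..q} \<Longrightarrow> mu j = - D\<Phi> 0 (B (vh j))"
  shows "i \<in> {1..m} \<Longrightarrow> 0 \<le> lam i"
    and "t \<in> {0..<T} \<Longrightarrow> \<zeta> \<in> U \<Longrightarrow> adjoint_form lam mu (mayer.needle_direction \<zeta> t) \<le> 0"
proof -
  have small: "\<exists>\<eta>>0. 0 < a - \<eta> * S" if "0 < a" for a S :: real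
  proof (intro exI[of _ "a / (2 * (\<bar>S\<bar> + 1))"] conjI)
    have "a / (2 * (\<bar>S\<bar> + 1)) * S \<le> a / (2 * (\<bar>S\<bar> + 1)) * (\<bar>S\<bar> + 1)" using that by (intro mult_left_mono) auto
    also have "\<dots> = a / 2" by (simp add: field_simps)
    finally show "0 < a - a / (2 * (\<bar>S\<bar> + 1)) * S" using that by linarith
  qed (use that in auto)
  define S where "S = (\<Sum>k=1..m. lam k)"
  have lam_sum: "(\<Sum>k=1..m. c k * D\<Phi> 0 (B (vg k))) = - (\<Sum>k=1..m. lam k * c k)" for c
    by (simp add: sum_negf[symmetric] lam(2) mult.commute)
  have mu_sum: "(\<Sum>k=1..q. c k * D\<Phi> 0 (B (vh k))) = - (\<Sum>k=1..q. mu k * c k)" for c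
    by (simp add: sum_negf[symmetric] mu mult.commute)
  have T0: "0 \<in> {0..<T}" "u 0 \<in> U" using T uU[of 0] by auto
  have D0: "D\<Phi> i 0 = 0" "D\<Psi> j 0 = 0" for i j
    using bounded_linear.linear[OF D\<Phi>_bounded_linear] bounded_linear.linear[OF D\<Psi>_bounded_linear] linear_0 by blast+
  show "0 \<le> lam i" if i: "i \<in> {1..m}"
  proof (rule ccontr)
    assume "\<not> 0 \<le> lam i"
    then obtain \<eta> where \<eta>: "0 < \<eta>" "0 < - lam i - \<eta> * S" using small[of "- lam i" S] by auto
    \<comment> \<open>Constraint \<open>i\<close> is raised by one unit, which pays
      \<open>- lam i\<close>, and all constraints by \<open>\<eta>\<close>, which makes the
      inequalities strict.\<close>
    show False
    proof (rule dual_improvement[OF dual, where c = 0 and \<alpha> = "\<lambda>k. \<eta> + (if k = i then 1 else 0)" and \<beta> = "\<lambda>_. 0" and d = 0, OF _ _ _ _ _ _ _ _ order_refl T0])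
      have "(\<Sum>k=1..m. lam k * (\<eta> + (if k = i then 1 else 0))) = (\<Sum>k=1..m. \<eta> * lam k + (if k = i then lam k else 0))"
        by (intro sum.cong) (auto simp: algebra_simps)
      also have "\<dots> = \<eta> * S + lam i" using i by (simp add: sum.distrib sum_distrib_left S_def)
      finally have "(\<Sum>k=1..m. lam k * (\<eta> + (if k = i then 1 else 0))) = \<eta> * S + lam i" .
      then show "0 < D\<Phi> 0 0 + (\<Sum>k=1..m. (\<eta> + (if k = i then 1 else 0)) * D\<Phi> 0 (B (vg k))) + (\<Sum>j=1..q. 0 * D\<Phi> 0 (B (vh j)))"
        using \<eta>(2) unfolding lam_sum by (simp add: D0)
    qed (use \<eta> in \<open>auto simp: D0\<close>)
  qed
  show "adjoint_form lam mu (mayer.needle_direction \<zeta> t) \<le> 0" if t: "t \<in> {0..<T}" and \<zeta>: "\<zeta> \<in> U"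
  proof (rule ccontr)
    define d where "d = mayer.needle_direction \<zeta> t"
    assume "\<not> adjoint_form lam mu (mayer.needle_direction \<zeta> t) \<le> 0"
    then obtain \<eta> where \<eta>: "0 < \<eta>" "0 < adjoint_form lam mu d - \<eta> * S"
      using small[of "adjoint_form lam mu d" S] by (auto simp: d_def)
    \<comment> \<open>The coefficients undo the effect of the needle on the constraints, exactly for
      the equalities and up to \<open>\<eta>\<close> for the inequalities; what remains for the
      objective is the adjoint form minus \<open>\<eta> * S\<close>.\<close>
    show False
    proof (rule dual_improvement[OF dual, where c = 1 and \<alpha> = "\<lambda>k. \<eta> - D\<Phi> k d" and \<beta> = "\<lambda>j. - D\<Psi> j d" and d = d, OF _ _ _ _ _ _ _ _ _ t \<zeta>])
      have "(\<Sum>k=1..m. lam k * (\<eta> - D\<Phi> k d)) = \<eta> * S - (\<Sum>k=1..m. lam k * D\<Phi> k d)"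
        by (simp add: right_diff_distrib sum_subtractf sum_distrib_left S_def mult.commute)
      then show "0 < D\<Phi> 0 d + (\<Sum>k=1..m. (\<eta> - D\<Phi> k d) * D\<Phi> 0 (B (vg k))) + (\<Sum>j=1..q. - D\<Psi> j d * D\<Phi> 0 (B (vh j)))"
        using \<eta>(2) unfolding lam_sum mu_sum adjoint_form_eq[of lam, OF lam(1)] by (simp add: sum_negf)
    qed (use \<eta> in \<open>auto simp: d_def\<close>)
  qed
qed

section \<open>Construction of the Pontryagin triple\<close>

lemma hamiltonian_continuous:
  "continuous_on ({0..T} \<times> \<Omega> \<times> U \<times> UNIV) (\<lambda>(t, \<xi>, \<zeta>, p). hamiltonian f0 f \<pi> t \<xi> \<zeta> p 1)"
proof -
  have m: "continuous_on ({0..T} \<times> \<Omega> \<times> U \<times> (UNIV :: ('x \<Rightarrow>\<^sub>L real) set)) (\<lambda>z. (fst z, fst (snd z), fst (snd (snd z))))"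
    by (intro continuous_intros)
  have 1: "continuous_on ({0..T} \<times> \<Omega> \<times> U \<times> (UNIV :: ('x \<Rightarrow>\<^sub>L real) set))
      (\<lambda>z. (\<lambda>(t, \<xi>, \<zeta>). f t \<xi> \<zeta> \<pi>) (fst z, fst (snd z), fst (snd (snd z))))"
    by (rule continuous_on_compose2[OF f_cont m]) auto
  have 2: "continuous_on ({0..T} \<times> \<Omega> \<times> U \<times> (UNIV :: ('x \<Rightarrow>\<^sub>L real) set))
      (\<lambda>z. (\<lambda>(t, \<xi>, \<zeta>). f0 t \<xi> \<zeta> \<pi>) (fst z, fst (snd z), fst (snd (snd z))))"
    by (rule continuous_on_compose2[OF f0_cont m]) auto
  have "continuous_on ({0..T} \<times> \<Omega> \<times> U \<times> (UNIV :: ('x \<Rightarrow>\<^sub>L real) set))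
      (\<lambda>z. blinfun_apply (snd (snd (snd z))) (f (fst z) (fst (snd z)) (fst (snd (snd z))) \<pi>) +
        1 * f0 (fst z) (fst (snd z)) (fst (snd (snd z))) \<pi>)"
    using 1 2 by (intro continuous_intros) simp_all
  then show ?thesis by (simp add: hamiltonian_def case_prod_unfold)
qed

lemma DF_hamiltonian:
  assumes t: "t \<in> {0..T}"
  shows "DF (\<lambda>\<xi>. hamiltonian f0 f \<pi> t \<xi> (u t) p 1) (x t) =
    (p o\<^sub>L DF (\<lambda>\<xi>. f t \<xi> (u t) \<pi>) (x t)) + DF (\<lambda>\<xi>. f0 t \<xi> (u t) \<pi>) (x t)"
proof (rule DF_eq)
  show "((\<lambda>\<xi>. hamiltonian f0 f \<pi> t \<xi> (u t) p 1) has_derivative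
      blinfun_apply ((p o\<^sub>L DF (\<lambda>\<xi>. f t \<xi> (u t) \<pi>) (x t)) + DF (\<lambda>\<xi>. f0 t \<xi> (u t) \<pi>) (x t))) (at (x t))"
    unfolding hamiltonian_def
    using has_derivative_add[OF bounded_linear.has_derivative[OF blinfun.bounded_linear_right has_derivative_DF[OF f_d[OF t uU[OF t]]], of p]
      has_derivative_DF[OF f0_d[OF t uU[OF t]]]]
    by (simp add: blinfun.bilinear_simps[abs_def] plus_blinfun.rep_eq o_def)
qed

text \<open>The costate is the terminal differential of the Lagrangian composed with
  \<open>M\<close> and restricted to the state component. The needle inequality is the maximum
  condition before \<open>T\<close>, and a limit from the left extends it to \<open>T\<close>. The
  Hamiltonian is continuous at a jump of \<open>u\<close> because both the value and the left limit
  of the control maximise it.\<close>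

lemma pontryagin_tripleI:
  assumes lam: "lam 0 = 1" "\<And>i. i \<in> {1..m} \<Longrightarrow> 0 \<le> lam i" "\<And>i. i \<in> {1..m} \<Longrightarrow> lam i * g i (x T) \<pi> = 0"
    and ineq: "\<And>t \<zeta>. t \<in> {0..<T} \<Longrightarrow> \<zeta> \<in> U \<Longrightarrow> adjoint_form lam mu (mayer.needle_direction \<zeta> t) \<le> 0"
  shows "\<exists>p. pontryagin_triple T U f0 f m q g h \<pi> x u lam mu p"
proof -
  define pT where "pT = (\<Sum>i=0..m. lam i *\<^sub>R DH (\<lambda>\<xi>. g i \<xi> \<pi>) (x T)) + (\<Sum>j=1..q. mu j *\<^sub>R DH (\<lambda>\<xi>. h j \<xi> \<pi>) (x T))"
  have form: "adjoint_form lam mu w = snd w + pT (fst w)" for w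
    unfolding pT_def by (rule adjoint_form_terminal[of lam, OF lam(1)])
  define Q where "Q t = (snd_blinfun + (pT o\<^sub>L fst_blinfun)) o\<^sub>L M t" for t
  define p where "p t = Q t o\<^sub>L inl" for t
  obtain S where S: "finite S" "\<And>t. t \<in> {0<..<T} - S \<Longrightarrow> (M has_vector_derivative - (M t o\<^sub>L A t)) (at t)"
    using M_props(3) by blast
  have Qc: "continuous_on {0..T} Q"
    unfolding Q_def by (intro bounded_bilinear.continuous_on[OF bounded_bilinear_blinfun_compose] continuous_intros M_props)
  have Qd: "(Q has_vector_derivative - (Q t o\<^sub>L A t)) (at t)" if "t \<in> {0<..<T} - S" for t
  proof -
    have "bounded_linear (\<lambda>m :: ('x \<times> real) \<Rightarrow>\<^sub>L ('x \<times> real). (snd_blinfun + (pT o\<^sub>L fst_blinfun)) o\<^sub>L m)"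
      by (rule bounded_bilinear.bounded_linear_right[OF bounded_bilinear_blinfun_compose])
    from bounded_linear.has_vector_derivative[OF this S(2)[OF that]]
    have "(Q has_vector_derivative (snd_blinfun + (pT o\<^sub>L fst_blinfun)) o\<^sub>L (- (M t o\<^sub>L A t))) (at t)"
      by (simp add: Q_def[abs_def])
    moreover have "(snd_blinfun + (pT o\<^sub>L fst_blinfun)) o\<^sub>L (- (M t o\<^sub>L A t)) = - (Q t o\<^sub>L A t)"
      by (rule blinfun_eqI) (simp add: Q_def blinfun.bilinear_simps)
    ultimately show ?thesis by simp
  qed
  \<comment> \<open>The reward component of the transported differential is constantly 1, because
    nothing in the dynamics depends on the accumulated reward; it is the normalised multiplier
    \<open>lam 0\<close>.\<close>
  have Q1: "Q t (0, s) = s" if t: "t \<in> {0..T}" for t s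
  proof -
    have "((\<lambda>_. 0) has_integral Q T (0, 1) - Q t (0, 1)) {t..T}"
    proof (rule fundamental_theorem_of_calculus_interior_strong[OF S(1)])
      show "t \<le> T" using t by simp
      show "continuous_on {t..T} (\<lambda>t. Q t (0, 1))"
        using t by (intro continuous_intros continuous_on_subset[OF Qc]) auto
      show "((\<lambda>t. Q t (0, 1)) has_vector_derivative 0) (at s)" if "s \<in> {t<..<T} - S" for s
      proof -
        have "(Q has_vector_derivative - (Q s o\<^sub>L A s)) (at s)" using Qd[of s] that t by auto
        from bounded_linear.has_vector_derivative[OF bounded_bilinear.bounded_linear_left[OF bounded_bilinear_blinfun_apply] this, of "(0, 1)"]
        show ?thesis by (simp add: A_apply blinfun.bilinear_simps zero_prod_def[symmetric])
      qed
    qed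
    then have "Q t (0, 1) = Q T (0, 1)" using has_integral_unique[OF _ has_integral_0] by force
    also have "\<dots> = 1" by (simp add: Q_def M_props(2) blinfun.bilinear_simps)
    finally have "s * Q t (0, 1) = s" by simp
    moreover have "(0, s) = s *\<^sub>R (0 :: 'x, 1 :: real)" by simp
    ultimately show ?thesis by (simp only: blinfun.scaleR_right real_scaleR_def)
  qed
  have Qp: "Q t w = p t (fst w) + snd w" if "t \<in> {0..T}" for t w
  proof -
    have "w = (fst w, 0) + (0, snd w)" by simp
    then have "Q t w = Q t (fst w, 0) + Q t (0, snd w)" by (metis blinfun.add_right)
    then show ?thesis using Q1[OF that] by (simp add: p_def)
  qed
  have pc: "continuous_on {0..T} p"
    unfolding p_def by (intro bounded_bilinear.continuous_on[OF bounded_bilinear_blinfun_compose] continuous_intros Qc)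
  define dp where "dp t = - ((p t o\<^sub>L DF (\<lambda>\<xi>. f t \<xi> (u t) \<pi>) (x t)) + DF (\<lambda>\<xi>. f0 t \<xi> (u t) \<pi>) (x t))" for t
  have dpN: "dp \<in> NPC0R T UNIV"
  proof -
    have "continuous_on (UNIV \<times> UNIV \<times> UNIV) (\<lambda>z. - ((fst z o\<^sub>L fst (snd z)) + snd (snd z)) :: 'x \<Rightarrow>\<^sub>L real)"
      by (intro bounded_bilinear.continuous_on[OF bounded_bilinear_blinfun_compose] continuous_intros)
    from NPC0R_comp[OF T NPC0R_Pair[OF T NPC0R_continuous[OF T pc] NPC0R_Pair[OF T control_NPC0R[OF f_dc u_NPC0R] control_NPC0R[OF f0_dc u_NPC0R]]] this, of UNIV]
    show ?thesis by (simp add: dp_def[abs_def])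
  qed
  have pd: "(p has_vector_derivative dp t) (at t)" if "t \<in> {0<..<T} - S" for t
  proof -
    have t: "t \<in> {0..T}" using that by auto
    have "(p has_vector_derivative - (Q t o\<^sub>L A t) o\<^sub>L inl) (at t)"
      using bounded_linear.has_vector_derivative[OF bounded_bilinear.bounded_linear_left[OF bounded_bilinear_blinfun_compose] Qd[OF that], of inl]
      by (simp add: p_def[abs_def])
    moreover have "- (Q t o\<^sub>L A t) o\<^sub>L inl = dp t"
      by (rule blinfun_eqI) (simp add: dp_def blinfun.bilinear_simps A_apply Qp[OF t])
    ultimately show ?thesis by simp
  qed
  have pP: "p \<in> PC1 T UNIV" and pe: "\<And>t. t \<in> {0..T} \<Longrightarrow> ext_deriv T p t = dp t"
    using PC1I(1,2)[OF T pc _ dpN S(1) pd, of UNIV] by simp_all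
  define H where "H t \<zeta> = hamiltonian f0 f \<pi> t (x t) \<zeta> (p t) (lam 0)" for t \<zeta>
  have H_lim: "((\<lambda>s. H s (v s)) \<longlongrightarrow> H t z) G"
    if "(v \<longlongrightarrow> z) G" "z \<in> U" "\<And>s. s \<in> {0..T} \<Longrightarrow> v s \<in> U" "t \<in> {0..T}" "G \<le> at t within {0..T}" for v z t G
  proof -
    have "((\<lambda>s. (s, x s, v s, p s)) \<longlongrightarrow> (t, x t, z, p t)) G"
      using that(1,4,5) x_cont pc
      by (intro tendsto_Pair) (auto simp: continuous_on_def intro: tendsto_mono tendsto_ident_at)
    moreover have "\<forall>\<^sub>F s in G. (s, x s, v s, p s) \<in> {0..T} \<times> \<Omega> \<times> U \<times> UNIV"
      by (rule filter_leD[OF that(5)]) (auto simp: eventually_at_filter x_\<Omega> that(3))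
    ultimately have "((\<lambda>s. (\<lambda>(t, \<xi>, \<zeta>, p). hamiltonian f0 f \<pi> t \<xi> \<zeta> p 1) (s, x s, v s, p s)) \<longlongrightarrow>
        (\<lambda>(t, \<xi>, \<zeta>, p). hamiltonian f0 f \<pi> t \<xi> \<zeta> p 1) (t, x t, z, p t)) G"
      using that x_\<Omega>[OF that(4)] by (intro continuous_on_tendsto_compose[OF hamiltonian_continuous]) auto
    then show ?thesis by (simp add: H_def lam(1))
  qed
  have max0: "H t \<zeta> \<le> H t (u t)" if t: "t \<in> {0..<T}" and \<zeta>: "\<zeta> \<in> U" for t \<zeta>
  proof -
    have t': "t \<in> {0..T}" using t by simp
    have "adjoint_form lam mu (mayer.needle_direction \<zeta> t) = Q t (F t (y t) \<zeta> - F t (y t) (u t))"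
      by (simp add: form mayer.needle_direction_def Q_def blinfun.bilinear_simps)
    also have "\<dots> = H t \<zeta> - H t (u t)"
      by (simp add: Qp[OF t'] F_def y_def H_def hamiltonian_def lam(1) blinfun.bilinear_simps)
    finally show ?thesis using ineq[OF t \<zeta>] by simp
  qed
  have u_right: "(u \<longlongrightarrow> u t) (at_right t)" if "t \<in> {0..<T}" for t
    using u_NPC0R that unfolding NPC0R_iff by blast
  have max: "H t \<zeta> \<le> H t (u t)" if t: "t \<in> {0..T}" and \<zeta>: "\<zeta> \<in> U" for t \<zeta>
  proof (cases "t < T")
    case True
    then show ?thesis using max0 t \<zeta> by simp
  next
    case False
    then have tT: "t = T" using t by simp
    have le: "at_left T \<le> at T within {0..T}" using T by (intro at_left_le_within_Icc) auto
    have u_left: "(u \<longlongrightarrow> u T) (at_left T)" using u_NPC0R unfolding NPC0R_iff by blast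
    have 1: "((\<lambda>s. H s \<zeta>) \<longlongrightarrow> H T \<zeta>) (at_left T)"
      using H_lim[of "\<lambda>_. \<zeta>" \<zeta> "at_left T" T] \<zeta> le T by auto
    have 2: "((\<lambda>s. H s (u s)) \<longlongrightarrow> H T (u T)) (at_left T)"
      using H_lim[OF u_left _ _ _ le] uU T by auto
    have "\<forall>\<^sub>F s in at_left T. 0 < s" using T eventually_at_left by blast
    moreover have "\<forall>\<^sub>F s in at_left T. s < T" by (simp add: eventually_at_filter)
    ultimately have "\<forall>\<^sub>F s in at_left T. H s \<zeta> \<le> H s (u s)"
      by eventually_elim (use max0 \<zeta> in auto)
    from tendsto_le[OF trivial_limit_at_left_real 2 1 this] show ?thesis by (simp add: tT)
  qed
  have left: "((\<lambda>s. H s (u s)) \<longlongrightarrow> H t (u t)) (at_left t)" if t: "t \<in> {0<..T}" for t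
  proof -
    have t': "t \<in> {0..T}" using t by simp
    have le: "at_left t \<le> at t within {0..T}" using t by (intro at_left_le_within_Icc) auto
    obtain z where z: "z \<in> U" "(u \<longlongrightarrow> z) (at_left t)" using NPC0R_PC0[OF u_NPC0R] t unfolding PC0_iff[OF T] by blast
    have 2: "((\<lambda>s. H s (u s)) \<longlongrightarrow> H t z) (at_left t)" using H_lim[OF z(2,1) _ t' le] uU by blast
    have 1: "((\<lambda>s. H s (u t)) \<longlongrightarrow> H t (u t)) (at_left t)"
      using H_lim[of "\<lambda>_. u t" "u t" "at_left t" t] le t' uU[OF t'] by auto
    have "\<forall>\<^sub>F s in at_left t. 0 < s" using t eventually_at_left[of 0 t] by auto
    moreover have "\<forall>\<^sub>F s in at_left t. s < t" by (simp add: eventually_at_filter)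
    ultimately have "\<forall>\<^sub>F s in at_left t. H s (u t) \<le> H s (u s)"
      by eventually_elim (use max t uU[OF t'] in auto)
    from tendsto_le[OF trivial_limit_at_left_real 2 1 this] have "H t (u t) \<le> H t z" .
    then have "H t z = H t (u t)" using max[OF t' z(1)] by simp
    then show ?thesis using 2 by simp
  qed
  have right: "((\<lambda>s. H s (u s)) \<longlongrightarrow> H t (u t)) (at_right t)" if t: "t \<in> {0..<T}" for t
    using H_lim[OF u_right[OF t] _ _ _ at_right_le_within_Icc[of t T]] uU t by auto
  have Hc: "continuous_on {0..T} (\<lambda>t. H t (u t))"
    unfolding continuous_on_def
  proof
    fix t assume t: "t \<in> {0..T}"
    consider "t = 0" | "t = T" | "0 < t" "t < T" using t by fastforce
    then show "((\<lambda>t. H t (u t)) \<longlongrightarrow> H t (u t)) (at t within {0..T})"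
    proof cases
      case 1
      then show ?thesis using right[of 0] T by (simp add: at_within_Icc_at_right)
    next
      case 2
      then show ?thesis using left[of T] T by (simp add: at_within_Icc_at_left)
    next
      case 3
      then show ?thesis using left[of t] right[of t] by (simp add: at_within_Icc_at filterlim_split_at)
    qed
  qed
  have DH: "- DF (\<lambda>\<xi>. hamiltonian f0 f \<pi> t \<xi> (u t) (p t) (lam 0)) (x t) = dp t" if t: "t \<in> {0..T}" for t
    unfolding lam(1) DF_hamiltonian[OF t] dp_def ..
  have pT: "p T = pT"
    by (rule blinfun_eqI) (simp add: p_def Q_def M_props(2) blinfun.bilinear_simps)
  have "pontryagin_triple T U f0 f m q g h \<pi> x u lam mu p"
    unfolding pontryagin_triple_def
  proof (intro conjI ballI)
    show "\<not> ((\<forall>i\<in>{0..m}. lam i = 0) \<and> (\<forall>j\<in>{1..q}. mu j = 0))" using lam(1) by force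
    show "0 \<le> lam i" if "i \<in> {0..m}" for i using lam(1) lam(2)[of i] that by (cases "i = 0") auto
    show "continuous_on {0..T} (\<lambda>t. hamiltonian f0 f \<pi> t (x t) (u t) (p t) (lam 0))"
      using Hc by (simp add: H_def)
    show "hamiltonian f0 f \<pi> t (x t) \<zeta> (p t) (lam 0) \<le> hamiltonian f0 f \<pi> t (x t) (u t) (p t) (lam 0)"
      if "t \<in> {0..T}" "\<zeta> \<in> U" for t \<zeta> using max[OF that] by (simp add: H_def)
  qed (use pP pe DH pT lam(3) in \<open>auto simp: pT_def\<close>)
  then show ?thesis by blast
qed

text \<open>\<open>U\<close> is open, so the maximum is interior: the limits of the right quotients
  are nonpositive in the directions \<open>v\<close> and \<open>- v\<close>, and they depend
  linearly on \<open>v\<close>.\<close>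

lemma hamiltonian_stationary:
  assumes p: "pontryagin_triple T U f0 f m q g h \<pi> x u lam mu p" "lam 0 = 1" and t: "t \<in> {0..T}"
    and hd: "hadamard_differentiable (\<lambda>\<zeta>. f t (x t) \<zeta> \<pi>) (u t)" "hadamard_differentiable (\<lambda>\<zeta>. f0 t (x t) \<zeta> \<pi>) (u t)"
  shows "p t (DH (\<lambda>\<zeta>. f t (x t) \<zeta> \<pi>) (u t) v) + DH (\<lambda>\<zeta>. f0 t (x t) \<zeta> \<pi>) (u t) v = 0"
proof -
  have le: "p t (DH (\<lambda>\<zeta>. f t (x t) \<zeta> \<pi>) (u t) v) + DH (\<lambda>\<zeta>. f0 t (x t) \<zeta> \<pi>) (u t) v \<le> 0" for v
  proof (rule tendsto_upperbound)
    have "((\<lambda>s. (f t (x t) (u t + s *\<^sub>R v) \<pi> - f t (x t) (u t) \<pi>) /\<^sub>R s) \<longlongrightarrow> DH (\<lambda>\<zeta>. f t (x t) \<zeta> \<pi>) (u t) v) (at_right 0)"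
      "((\<lambda>s. (f0 t (x t) (u t + s *\<^sub>R v) \<pi> - f0 t (x t) (u t) \<pi>) /\<^sub>R s) \<longlongrightarrow> DH (\<lambda>\<zeta>. f0 t (x t) \<zeta> \<pi>) (u t) v) (at_right 0)"
      using hadamard_lim_compose[OF hadamard_lim_DH[OF hd(1)] filterlim_ident tendsto_const]
        hadamard_lim_compose[OF hadamard_lim_DH[OF hd(2)] filterlim_ident tendsto_const] by blast+
    then show "((\<lambda>s. p t ((f t (x t) (u t + s *\<^sub>R v) \<pi> - f t (x t) (u t) \<pi>) /\<^sub>R s) +
        (f0 t (x t) (u t + s *\<^sub>R v) \<pi> - f0 t (x t) (u t) \<pi>) /\<^sub>R s) \<longlongrightarrow>
        p t (DH (\<lambda>\<zeta>. f t (x t) \<zeta> \<pi>) (u t) v) + DH (\<lambda>\<zeta>. f0 t (x t) \<zeta> \<pi>) (u t) v) (at_right 0)"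
      by (intro tendsto_intros)
    have "((\<lambda>s. u t + s *\<^sub>R v) \<longlongrightarrow> u t + 0 *\<^sub>R v) (at_right 0)" by (intro tendsto_intros)
    then have "\<forall>\<^sub>F s in at_right 0. u t + s *\<^sub>R v \<in> U"
      using U uU[OF t] by (intro topological_tendstoD) auto
    moreover have "\<forall>\<^sub>F s::real in at_right 0. 0 < s" by (simp add: eventually_at_filter)
    ultimately show "\<forall>\<^sub>F s in at_right 0. p t ((f t (x t) (u t + s *\<^sub>R v) \<pi> - f t (x t) (u t) \<pi>) /\<^sub>R s) +
        (f0 t (x t) (u t + s *\<^sub>R v) \<pi> - f0 t (x t) (u t) \<pi>) /\<^sub>R s \<le> 0"
    proof eventually_elim
      case (elim s)
      have "hamiltonian f0 f \<pi> t (x t) (u t + s *\<^sub>R v) (p t) (lam 0) \<le> hamiltonian f0 f \<pi> t (x t) (u t) (p t) (lam 0)"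
        using p(1) t elim(1) unfolding pontryagin_triple_def by blast
      then have "p t (f t (x t) (u t + s *\<^sub>R v) \<pi> - f t (x t) (u t) \<pi>) +
          (f0 t (x t) (u t + s *\<^sub>R v) \<pi> - f0 t (x t) (u t) \<pi>) \<le> 0"
        by (simp add: hamiltonian_def p(2) blinfun.bilinear_simps)
      then have "inverse s * (p t (f t (x t) (u t + s *\<^sub>R v) \<pi> - f t (x t) (u t) \<pi>) +
          (f0 t (x t) (u t + s *\<^sub>R v) \<pi> - f0 t (x t) (u t) \<pi>)) \<le> 0"
        using elim(2) by (intro mult_nonneg_nonpos) auto
      then show ?case by (simp add: blinfun.scaleR_right distrib_left)
    qed
  qed (rule trivial_limit_at_right_real)
  show ?thesis using le[of v] le[of "- v"] by (simp add: blinfun.bilinear_simps)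
qed

lemma pontryagin_tripleD:
  assumes "pontryagin_triple T U f0 f m q g h \<pi> x u lam mu p" "lam 0 = 1"
  shows "p \<in> PC1 T UNIV"
    "p T = (\<Sum>i=0..m. lam i *\<^sub>R DH (\<lambda>\<xi>. g i \<xi> \<pi>) (x T)) + (\<Sum>j=1..q. mu j *\<^sub>R DH (\<lambda>\<xi>. h j \<xi> \<pi>) (x T))"
    "t \<in> {0..T} \<Longrightarrow> ext_deriv T p t =
      - ((p t o\<^sub>L DF (\<lambda>\<xi>. f t \<xi> (u t) \<pi>) (x t)) + DF (\<lambda>\<xi>. f0 t \<xi> (u t) \<pi>) (x t))"
proof -
  show "p \<in> PC1 T UNIV" using assms(1) by (simp only: pontryagin_triple_def)
  have "(\<Sum>i=0..m. lam i *\<^sub>R DH (\<lambda>\<xi>. g i \<xi> \<pi>) (x T)) + (\<Sum>j=1..q. mu j *\<^sub>R DH (\<lambda>\<xi>. h j \<xi> \<pi>) (x T)) = p T"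
    using assms(1) by (simp only: pontryagin_triple_def)
  then show "p T = (\<Sum>i=0..m. lam i *\<^sub>R DH (\<lambda>\<xi>. g i \<xi> \<pi>) (x T)) + (\<Sum>j=1..q. mu j *\<^sub>R DH (\<lambda>\<xi>. h j \<xi> \<pi>) (x T))"
    by (rule sym)
  show "ext_deriv T p t = - ((p t o\<^sub>L DF (\<lambda>\<xi>. f t \<xi> (u t) \<pi>) (x t)) + DF (\<lambda>\<xi>. f0 t \<xi> (u t) \<pi>) (x t))" if t: "t \<in> {0..T}"
  proof -
    have "ext_deriv T p t = - DF (\<lambda>\<xi>. hamiltonian f0 f \<pi> t \<xi> (u t) (p t) (lam 0)) (x t)"
      using assms(1) t by (simp only: pontryagin_triple_def)
    then show ?thesis unfolding assms(2) DF_hamiltonian[OF t] .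
  qed
qed

text \<open>Stationarity of the Hamiltonian at \<open>T\<close> combined with transversality. Tested
  on dual directions it determines the multipliers, which is how their uniqueness arises.\<close>

lemma adjoint_form_B:
  assumes p: "pontryagin_triple T U f0 f m q g h \<pi> x u lam mu p" "lam 0 = 1"
  shows "adjoint_form lam mu (B v) = 0"
proof -
  have "adjoint_form lam mu (B v) = snd (B v) + p T (fst (B v))"
    unfolding pontryagin_tripleD(2)[OF p] by (rule adjoint_form_terminal[of lam, OF p(2)])
  then show ?thesis using hamiltonian_stationary[OF p _ f_h f0_h, of v] T by (simp add: B_def)
qed

text \<open>The difference of two costates solves a homogeneous linear equation with terminal value
  0; after time reversal the Gronwall estimate applies with \<open>c = 0\<close>. The rate has to be
  positive, hence \<open>K + 1\<close>.\<close>

lemma costate_unique: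
  assumes p: "pontryagin_triple T U f0 f m q g h \<pi> x u lam mu p" "lam 0 = 1"
    and p': "pontryagin_triple T U f0 f m q g h \<pi> x u lam' mu' p'" "lam' 0 = 1"
    and eq: "\<And>i. i \<in> {0..m} \<Longrightarrow> lam' i = lam i" "\<And>j. j \<in> {1..q} \<Longrightarrow> mu' j = mu j" and t: "t \<in> {0..T}"
  shows "p' t = p t"
proof -
  define Df where "Df t = DF (\<lambda>\<xi>. f t \<xi> (u t) \<pi>) (x t)" for t
  define d where "d t = p' t + (- 1) *\<^sub>R p t" for t
  note pP = pontryagin_tripleD(1)[OF p] pontryagin_tripleD(1)[OF p']
  have e: "ext_deriv T p t = - ((p t o\<^sub>L Df t) + DF (\<lambda>\<xi>. f0 t \<xi> (u t) \<pi>) (x t))"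
      "ext_deriv T p' t = - ((p' t o\<^sub>L Df t) + DF (\<lambda>\<xi>. f0 t \<xi> (u t) \<pi>) (x t))" if "t \<in> {0..T}" for t
    unfolding Df_def by (rule pontryagin_tripleD(3)[OF p that], rule pontryagin_tripleD(3)[OF p' that])
  have dP: "d \<in> PC1 T UNIV" unfolding d_def[abs_def] by (rule PC1_add_scaleR(1)[OF T pP(2,1)])
  have de: "ext_deriv T d t = - (d t o\<^sub>L Df t)" if "t \<in> {0..T}" for t
  proof -
    have "ext_deriv T d t = ext_deriv T p' t + (- 1) *\<^sub>R ext_deriv T p t"
      unfolding d_def[abs_def] by (rule PC1_add_scaleR(2)[OF T pP(2,1) that])
    also have "\<dots> = - (d t o\<^sub>L Df t)"
      unfolding e[OF that] by (rule blinfun_eqI) (simp add: d_def blinfun.bilinear_simps)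
    finally show ?thesis .
  qed
  have "(\<Sum>i=0..m. lam' i *\<^sub>R DH (\<lambda>\<xi>. g i \<xi> \<pi>) (x T)) = (\<Sum>i=0..m. lam i *\<^sub>R DH (\<lambda>\<xi>. g i \<xi> \<pi>) (x T))"
    "(\<Sum>j=1..q. mu' j *\<^sub>R DH (\<lambda>\<xi>. h j \<xi> \<pi>) (x T)) = (\<Sum>j=1..q. mu j *\<^sub>R DH (\<lambda>\<xi>. h j \<xi> \<pi>) (x T))"
    using eq by (auto intro!: sum.cong)
  then have "p' T = p T" unfolding pontryagin_tripleD(2)[OF p] pontryagin_tripleD(2)[OF p'] by (simp only:)
  then have dT: "d T = 0" by (simp add: d_def)
  obtain K where K: "K \<ge> 0" "\<And>t. t \<in> {0..T} \<Longrightarrow> norm (Df t) \<le> K"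
    using PC0_bounded[OF T NPC0R_PC0[OF control_NPC0R[OF f_dc u_NPC0R]]] unfolding Df_def by blast
  obtain S where S: "finite S" "\<And>t. t \<in> {0<..<T} - S \<Longrightarrow> (d has_vector_derivative ext_deriv T d t) (at t)"
    using PC1D(4)[OF T dP] by blast
  define D where "D s = d (T - s)" for s
  have Dc: "continuous_on {0..T} D" unfolding D_def
    by (rule continuous_on_compose2[OF PC1D(1)[OF T dP]]) (auto intro!: continuous_intros)
  have Dd: "(D has_vector_derivative D s o\<^sub>L Df (T - s)) (at s)" if s: "s \<in> {0<..<T} - (\<lambda>s. T - s) ` S" for s
  proof -
    have "T - s \<notin> S" using s by (metis DiffD2 diff_diff_eq2 add_diff_cancel_left' image_eqI)
    then have "(d has_vector_derivative ext_deriv T d (T - s)) (at (T - s))" using s by (intro S(2)) auto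
    then have "(d has_vector_derivative - (D s o\<^sub>L Df (T - s))) (at (T - s))"
      using de[of "T - s"] s by (simp add: D_def)
    moreover have "((\<lambda>t. T - t) has_vector_derivative - 1) (at s)" by (auto intro!: derivative_eq_intros)
    ultimately have "((d \<circ> (\<lambda>t. T - t)) has_vector_derivative (- 1) *\<^sub>R (- (D s o\<^sub>L Df (T - s)))) (at s)"
      by (intro vector_diff_chain_at) simp_all
    then show ?thesis by (simp add: o_def D_def[abs_def])
  qed
  have "norm (D s) \<le> 0 + (K + 1) * integral {0..s} (\<lambda>s. norm (D s))" if s: "s \<in> {0..T}" for s
  proof -
    have i: "((\<lambda>s. D s o\<^sub>L Df (T - s)) has_integral D s - D 0) {0..s}"
      by (rule fundamental_theorem_of_calculus_interior_strong[of "(\<lambda>s. T - s) ` S"])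
        (use S(1) s Dd in \<open>auto intro: continuous_on_subset[OF Dc]\<close>)
    have n: "(\<lambda>s. norm (D s)) integrable_on {0..s}"
      by (intro integrable_continuous_real continuous_intros continuous_on_subset[OF Dc]) (use s in auto)
    have "norm (integral {0..s} (\<lambda>s. D s o\<^sub>L Df (T - s))) \<le> integral {0..s} (\<lambda>s. (K + 1) * norm (D s))"
    proof (rule Henstock_Kurzweil_Integration.integral_norm_bound_integral)
      show "(\<lambda>s. D s o\<^sub>L Df (T - s)) integrable_on {0..s}" using i by blast
      show "(\<lambda>s. (K + 1) * norm (D s)) integrable_on {0..s}" using n by (rule integrable_on_mult_right)
      show "norm (D r o\<^sub>L Df (T - r)) \<le> (K + 1) * norm (D r)" if r: "r \<in> {0..s}" for r
      proof -
        have "norm (D r o\<^sub>L Df (T - r)) \<le> norm (D r) * norm (Df (T - r))" by (rule norm_blinfun_compose)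
        also have "\<dots> \<le> norm (D r) * (K + 1)" using K(2)[of "T - r"] r s by (intro mult_left_mono) auto
        finally show ?thesis by (simp add: mult.commute)
      qed
    qed
    moreover have "D 0 = 0" by (simp add: D_def dT)
    ultimately show ?thesis using integral_unique[OF i] by simp
  qed
  then have "norm (D s) \<le> 2 * 0 * exp (2 * (K + 1) * s)" if "s \<in> {0..T}" for s
    using K(1) Dc that by (intro gronwall_integral[of "K + 1" 0 T "\<lambda>s. norm (D s)"] continuous_intros) auto
  from this[of "T - t"] have "d t = 0" using t by (simp add: D_def)
  then show ?thesis by (simp add: d_def)
qed

lemma D\<Phi>_B: "D\<Phi> i (B v) = (if i = 0 then DH (\<lambda>\<zeta>. f0 T (x T) \<zeta> \<pi>) (u T) v else 0) +
    (DH (\<lambda>\<xi>. g i \<xi> \<pi>) (x T) o\<^sub>L DH (\<lambda>\<zeta>. f T (x T) \<zeta> \<pi>) (u T)) v"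
  by (simp add: D\<Phi>_def B_def)

lemma D\<Psi>_B: "D\<Psi> j (B v) = (DH (\<lambda>\<xi>. h j \<xi> \<pi>) (x T) o\<^sub>L DH (\<lambda>\<zeta>. f T (x T) \<zeta> \<pi>) (u T)) v"
  by (simp add: D\<Psi>_def B_def)

text \<open>The case \<open>c = 0\<close> without an additional needle, phrased with explicit
  functionals of the control so that they can be compared across different parameters.\<close>

lemma terminal_not_improvable:
  assumes AG: "\<And>i v. AG i v = (if i = 0 then DH (\<lambda>\<zeta>. f0 T (x T) \<zeta> \<pi>) (u T) v else 0) +
    (DH (\<lambda>\<xi>. g i \<xi> \<pi>) (x T) o\<^sub>L DH (\<lambda>\<zeta>. f T (x T) \<zeta> \<pi>) (u T)) v"
    and AH: "\<And>j v. AH j v = (DH (\<lambda>\<xi>. h j \<xi> \<pi>) (x T) o\<^sub>L DH (\<lambda>\<zeta>. f T (x T) \<zeta> \<pi>) (u T)) v"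
    and \<epsilon>: "0 < \<epsilon>"
    and H: "\<And>l. l < q \<Longrightarrow> \<bar>AH (Suc l) v\<bar> + \<epsilon> * (\<Sum>j<q. \<bar>AH (Suc l) (vh (Suc j)) - (if j = l then 1 else 0)\<bar>) < \<epsilon>"
    and G: "\<And>i. i \<in> {0..m} \<Longrightarrow> i = 0 \<or> g i (x T) \<pi> = 0 \<Longrightarrow> \<epsilon> * (\<Sum>j<q. \<bar>AG i (vh (Suc j))\<bar>) < AG i v"
  shows False
proof (rule not_improvable[OF \<epsilon> order_refl, of 0 "u 0" "B v" v "\<lambda>j. vh (Suc j)"])
  show "0 \<in> {0..<T}" "u 0 \<in> U" using T uU[of 0] by auto
qed (use H G in \<open>simp_all add: D\<Phi>_B D\<Psi>_B AG AH\<close>)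

lemma value_eq: "bolza_value T \<Omega> U \<xi>0 f0 f m q g h \<pi> = bolza_objective T f0 g \<pi> x u"
  unfolding bolza_value_def
  by (rule cSup_eq_maximum) (use sol in \<open>auto simp: bolza_solution_def\<close>)

end

section \<open>The envelope formula\<close>

text \<open>Restriction to an affine subspace; coordinate embeddings as \<open>L\<close> give the
  partial differentials.\<close>

lemma has_hadamard_diff_affine:
  assumes "has_hadamard_diff \<phi> z D" "bounded_linear L"
  shows "has_hadamard_diff (\<lambda>w. \<phi> (z + L (w - w0))) w0 (D o\<^sub>L Blinfun L)"
  unfolding has_hadamard_diff_iff hadamard_lim_def
proof
  fix v
  have z: "L 0 = 0" and sc: "\<And>c x. L (c *\<^sub>R x) = c *\<^sub>R L x"
    using bounded_linear.linear[OF assms(2)] by (simp_all add: linear_0 linear_scale)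
  have "((\<lambda>p. L (snd p)) \<longlongrightarrow> L v) (at_right 0 \<times>\<^sub>F nhds v)"
    by (rule bounded_linear.tendsto[OF assms(2) filterlim_snd])
  from hadamard_lim_compose[OF assms(1)[unfolded has_hadamard_diff_iff] filterlim_fst this]
  show "((\<lambda>(\<theta>, w). (\<phi> (z + L (w0 + \<theta> *\<^sub>R w - w0)) - \<phi> (z + L (w0 - w0))) /\<^sub>R \<theta>) \<longlongrightarrow> blinfun_apply (D o\<^sub>L Blinfun L) v)
      (at_right 0 \<times>\<^sub>F nhds v)"
    by (simp add: z sc case_prod_unfold bounded_linear_Blinfun_apply[OF assms(2)])
qed

text \<open>Partial differentials are restrictions of the joint one to coordinate directions. The
  state differential is of Frechet type instead, but both have the same right variations.\<close>

lemma hadamard_partials: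
  assumes h: "hadamard_differentiable (\<lambda>(\<xi>, \<zeta>, \<pi>). G \<xi> \<zeta> \<pi>) (a, b, c)"
  defines "D \<equiv> DH (\<lambda>(\<xi>, \<zeta>, \<pi>). G \<xi> \<zeta> \<pi>) (a, b, c)"
  shows "hadamard_differentiable (\<lambda>\<zeta>. G a \<zeta> c) b" "DH (\<lambda>\<zeta>. G a \<zeta> c) b v = D (0, v, 0)"
    "hadamard_differentiable (\<lambda>\<pi>. G a b \<pi>) c" "DH (\<lambda>\<pi>. G a b \<pi>) c w = D (0, 0, w)"
    "(\<lambda>\<xi>. G \<xi> b c) differentiable (at a) \<Longrightarrow> DF (\<lambda>\<xi>. G \<xi> b c) a y = D (y, 0, 0)"
proof -
  have hD: "has_hadamard_diff (\<lambda>(\<xi>, \<zeta>, \<pi>). G \<xi> \<zeta> \<pi>) (a, b, c) D"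
    unfolding D_def by (rule has_hadamard_diff_DH[OF h])
  have b2: "bounded_linear (\<lambda>v. (0, v, 0))" and b3: "bounded_linear (\<lambda>v. (0, 0, v))"
    by (intro bounded_linear_Pair bounded_linear_ident bounded_linear_zero)+
  have 2: "has_hadamard_diff (\<lambda>\<zeta>. G a \<zeta> c) b (D o\<^sub>L Blinfun (\<lambda>v. (0, v, 0)))"
    using has_hadamard_diff_affine[OF hD b2, of b] by simp
  have 3: "has_hadamard_diff (\<lambda>\<pi>. G a b \<pi>) c (D o\<^sub>L Blinfun (\<lambda>v. (0, 0, v)))"
    using has_hadamard_diff_affine[OF hD b3, of c] by simp
  show "hadamard_differentiable (\<lambda>\<zeta>. G a \<zeta> c) b" "hadamard_differentiable (\<lambda>\<pi>. G a b \<pi>) c"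
    using 2 3 by (auto simp: hadamard_differentiable_def)
  show "DH (\<lambda>\<zeta>. G a \<zeta> c) b v = D (0, v, 0)" "DH (\<lambda>\<pi>. G a b \<pi>) c w = D (0, 0, w)"
    by (simp_all add: DH_eq[OF 2] DH_eq[OF 3] bounded_linear_Blinfun_apply b2 b3)
  show "DF (\<lambda>\<xi>. G \<xi> b c) a y = D (y, 0, 0)" if d: "(\<lambda>\<xi>. G \<xi> b c) differentiable (at a)"
  proof (rule tendsto_unique[OF trivial_limit_at_right_real])
    show "((\<lambda>\<theta>. (G (a + \<theta> *\<^sub>R y) b c - G a b c) /\<^sub>R \<theta>) \<longlongrightarrow> DF (\<lambda>\<xi>. G \<xi> b c) a y) (at_right 0)"
      by (rule has_derivative_imp_gateaux[OF has_derivative_DF[OF d]])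
    show "((\<lambda>\<theta>. (G (a + \<theta> *\<^sub>R y) b c - G a b c) /\<^sub>R \<theta>) \<longlongrightarrow> D (y, 0, 0)) (at_right 0)"
      using hadamard_lim_compose[OF hD[unfolded has_hadamard_diff_iff] filterlim_ident tendsto_const, of "(y, 0, 0)"]
      by simp
  qed
qed

lemma hadamard_partials2:
  assumes h: "hadamard_differentiable (\<lambda>(\<xi>, \<pi>). G \<xi> \<pi>) (a, c)"
  defines "D \<equiv> DH (\<lambda>(\<xi>, \<pi>). G \<xi> \<pi>) (a, c)"
  shows "D (y, w) = DH (\<lambda>\<xi>. G \<xi> c) a y + DH (\<lambda>\<pi>. G a \<pi>) c w"
proof -
  have hD: "has_hadamard_diff (\<lambda>(\<xi>, \<pi>). G \<xi> \<pi>) (a, c) D"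
    unfolding D_def by (rule has_hadamard_diff_DH[OF h])
  have b1: "bounded_linear (\<lambda>v. (v, 0))" and b2: "bounded_linear (\<lambda>v. (0, v))"
    by (intro bounded_linear_Pair bounded_linear_ident bounded_linear_zero)+
  have 1: "has_hadamard_diff (\<lambda>\<xi>. G \<xi> c) a (D o\<^sub>L Blinfun (\<lambda>v. (v, 0)))"
    using has_hadamard_diff_affine[OF hD b1, of a] by simp
  have 2: "has_hadamard_diff (\<lambda>\<pi>. G a \<pi>) c (D o\<^sub>L Blinfun (\<lambda>v. (0, v)))"
    using has_hadamard_diff_affine[OF hD b2, of c] by simp
  have "D (y, w) = D (y, 0) + D (0, w)" by (simp add: blinfun.add_right[symmetric])
  then show ?thesis by (simp add: DH_eq[OF 1] DH_eq[OF 2] bounded_linear_Blinfun_apply b1 b2)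
qed

lemma PC1_difference_quotient:
  fixes a b c :: "real \<Rightarrow> 'a::real_normed_vector"
  assumes T: "0 < T" and a: "a \<in> PC1 T A" and b: "b \<in> PC1 T B" and c: "c \<in> PC1 T C"
  shows "(\<lambda>t. (a t - b t) /\<^sub>R \<theta> - c t) \<in> PC1 T UNIV"
    and "t \<in> {0..T} \<Longrightarrow> ext_deriv T (\<lambda>t. (a t - b t) /\<^sub>R \<theta> - c t) t =
      (ext_deriv T a t - ext_deriv T b t) /\<^sub>R \<theta> - ext_deriv T c t"
proof -
  note 1 = PC1_add_scaleR[OF T a b, where c = "- 1"]
  note 2 = PC1_bounded_linear[OF T 1(1) bounded_linear_scaleR_right[of "inverse \<theta>"], where V = UNIV, OF UNIV_I]
  note 3 = PC1_add_scaleR[OF T 2(1) c, where c = "- 1"]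
  show "(\<lambda>t. (a t - b t) /\<^sub>R \<theta> - c t) \<in> PC1 T UNIV" using 3(1) by simp
  show "ext_deriv T (\<lambda>t. (a t - b t) /\<^sub>R \<theta> - c t) t = (ext_deriv T a t - ext_deriv T b t) /\<^sub>R \<theta> - ext_deriv T c t"
    if t: "t \<in> {0..T}" using 3(2)[OF t] 2(2)[OF t] 1(2)[OF t] by simp
qed

lemma norm_le_sup_norm:
  assumes "0 < T" "z \<in> PC0 T W" "t \<in> {0..T}"
  shows "norm (z t) \<le> sup_norm T z"
proof -
  obtain B where B: "\<And>t. t \<in> {0..T} \<Longrightarrow> norm (z t) \<le> B" using PC0_bounded[OF assms(1,2)] by blast
  have "bdd_above ((\<lambda>t. norm (z t)) ` {0..T})" by (rule bdd_aboveI2[OF B])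
  then show ?thesis unfolding sup_norm_def using assms(3) by (rule cSUP_upper[rotated])
qed

text \<open>Measurability of \<open>Q\<close> comes from its being a pointwise limit. It will be a
  Hadamard differential at time \<open>t\<close>, whose dependence on \<open>t\<close> is not
  otherwise controlled.\<close>

lemma set_dominated_convergence:
  fixes q :: "nat \<Rightarrow> real \<Rightarrow> real"
  assumes q: "\<And>n. set_integrable lborel {0..T} (q n)" and w: "set_integrable lborel {0..T} w"
    and le: "\<And>n t. t \<in> {0..T} \<Longrightarrow> \<bar>q n t\<bar> \<le> w t"
    and lim: "\<And>t. t \<in> {0..T} \<Longrightarrow> (\<lambda>n. q n t) \<longlonglongrightarrow> Q t"
  shows "set_integrable lborel {0..T} Q"
    "(\<lambda>n. LINT t:{0..T}|lborel. q n t) \<longlonglongrightarrow> (LINT t:{0..T}|lborel. Q t)"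
proof -
  have m: "(\<lambda>t. indicator {0..T} t *\<^sub>R q n t) \<in> borel_measurable lborel" for n
    using q[of n] unfolding set_integrable_def by (rule borel_measurable_integrable)
  have l: "(\<lambda>n. indicator {0..T} t *\<^sub>R q n t) \<longlonglongrightarrow> indicator {0..T} t *\<^sub>R Q t" for t
    using lim[of t] by (cases "t \<in> {0..T}") auto
  have mQ: "(\<lambda>t. indicator {0..T} t *\<^sub>R Q t) \<in> borel_measurable lborel"
    by (rule borel_measurable_LIMSEQ_real[OF l m])
  have b: "AE t in lborel. norm (indicator {0..T} t *\<^sub>R q n t) \<le> indicator {0..T} t *\<^sub>R w t" for n
    using le by (auto simp: indicator_def)
  show "set_integrable lborel {0..T} Q"
    unfolding set_integrable_def
    by (rule integrable_dominated_convergence[where s = "\<lambda>n t. indicator {0..T} t *\<^sub>R q n t"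
          and w = "\<lambda>t. indicator {0..T} t *\<^sub>R w t"])
      (rule mQ m w[unfolded set_integrable_def] b AE_I2 l)+
  show "(\<lambda>n. LINT t:{0..T}|lborel. q n t) \<longlonglongrightarrow> (LINT t:{0..T}|lborel. Q t)"
    unfolding set_lebesgue_integral_def
    by (rule integral_dominated_convergence[where w = "\<lambda>t. indicator {0..T} t *\<^sub>R w t"])
      (rule mQ m w[unfolded set_integrable_def] b AE_I2 l)+
qed

theorem theorem3p1:
  fixes T :: real
    and \<Omega> :: "'x::banach set"
    and U :: "'y::real_normed_vector set"
    and P :: "'z::real_normed_vector set"
    and \<xi>0 :: 'x
    and m q :: nat
    and f0 :: "real \<Rightarrow> 'x \<Rightarrow> 'y \<Rightarrow> 'z \<Rightarrow> real"
    and f :: "real \<Rightarrow> 'x \<Rightarrow> 'y \<Rightarrow> 'z \<Rightarrow> 'x"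
    and g h :: "nat \<Rightarrow> 'x \<Rightarrow> 'z \<Rightarrow> real"
    and \<pi>0 \<delta>\<pi> :: 'z
    and x :: "'z \<Rightarrow> real \<Rightarrow> 'x"
    and u :: "'z \<Rightarrow> real \<Rightarrow> 'y"
  assumes T: "0 < T"
    and \<Omega>: "open \<Omega>" "\<Omega> \<noteq> {}"
    and U: "open U" "U \<noteq> {}"
    and \<xi>0: "\<xi>0 \<in> \<Omega>"
    and mq: "m \<ge> 1" "q \<ge> 1"
    and SO: "open P" "\<pi>0 \<in> P"
      "\<And>\<pi>. \<pi> \<in> P \<Longrightarrow> bolza_solution T \<Omega> U \<xi>0 f0 f m q g h \<pi> (x \<pi>) (u \<pi>)"
      "gateaux_variation_exists_in (PC1 T UNIV) (PC1_norm T) x \<pi>0 \<delta>\<pi>"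
      "gateaux_variation_exists_in (NPC0R T UNIV) (sup_norm T) u \<pi>0 \<delta>\<pi>"
    and IC1: "continuous_on ({0..T} \<times> \<Omega> \<times> U \<times> P) (\<lambda>(t, \<xi>, \<zeta>, \<pi>). f0 t \<xi> \<zeta> \<pi>)"
      "\<And>t \<xi> \<zeta> \<pi>. t \<in> {0..T} \<Longrightarrow> \<xi> \<in> \<Omega> \<Longrightarrow> \<zeta> \<in> U \<Longrightarrow> \<pi> \<in> P \<Longrightarrow>
         gateaux_differentiable (\<lambda>\<xi>'. f0 t \<xi>' \<zeta> \<pi>) \<xi>"
      "\<And>\<pi> K. \<pi> \<in> P \<Longrightarrow> compact K \<Longrightarrow> K \<noteq> {} \<Longrightarrow> K \<subseteq> \<Omega> \<times> U \<Longrightarrow>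
         bdd_above ((\<lambda>(t, \<xi>, \<zeta>). norm (DG (\<lambda>\<xi>'. f0 t \<xi>' \<zeta> \<pi>) \<xi>)) ` ({0..T} \<times> K))"
    and IC2: "\<And>t. t \<in> {0..T} \<Longrightarrow>
         hadamard_differentiable (\<lambda>(\<xi>, \<zeta>, \<pi>). f0 t \<xi> \<zeta> \<pi>) (x \<pi>0 t, u \<pi>0 t, \<pi>0)"
      "\<And>\<pi>. \<pi> \<in> P \<Longrightarrow> hadamard_differentiable (\<lambda>\<zeta>. f0 T (x \<pi> T) \<zeta> \<pi>) (u \<pi> T)"
      "continuous_on P (\<lambda>\<pi>. DH (\<lambda>\<zeta>. f0 T (x \<pi> T) \<zeta> \<pi>) (u \<pi> T))"
    and IC3: "\<exists>\<kappa> \<rho>. set_integrable lborel {0..T} \<kappa> \<and> (\<forall>t\<in>{0..T}. \<kappa> t \<ge> 0) \<and> \<rho> > 0 \<and>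
         (\<forall>t\<in>{0..T}. \<forall>\<xi>1\<in>\<Omega>. \<forall>\<zeta>1\<in>U. \<forall>\<pi>1\<in>P. \<forall>\<xi>2\<in>\<Omega>. \<forall>\<zeta>2\<in>U. \<forall>\<pi>2\<in>P.
            norm1 ((\<xi>1, \<zeta>1, \<pi>1) - (x \<pi>0 t, u \<pi>0 t, \<pi>0)) < \<rho> \<longrightarrow>
            norm1 ((\<xi>2, \<zeta>2, \<pi>2) - (x \<pi>0 t, u \<pi>0 t, \<pi>0)) < \<rho> \<longrightarrow>
            \<bar>f0 t \<xi>1 \<zeta>1 \<pi>1 - f0 t \<xi>2 \<zeta>2 \<pi>2\<bar>
              \<le> \<kappa> t * norm1 ((\<xi>1, \<zeta>1, \<pi>1) - (\<xi>2, \<zeta>2, \<pi>2)))"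
    and IC4: "\<And>t \<zeta> \<pi>. t \<in> {0..T} \<Longrightarrow> \<zeta> \<in> U \<Longrightarrow> \<pi> \<in> P \<Longrightarrow>
         (\<lambda>\<xi>. f0 t \<xi> \<zeta> \<pi>) differentiable (at (x \<pi> t))"
      "\<And>\<pi>. \<pi> \<in> P \<Longrightarrow>
         continuous_on ({0..T} \<times> U) (\<lambda>(t, \<zeta>). DF (\<lambda>\<xi>. f0 t \<xi> \<zeta> \<pi>) (x \<pi> t))"
    and V1: "\<And>\<pi>. \<pi> \<in> P \<Longrightarrow>
         continuous_on ({0..T} \<times> \<Omega> \<times> U) (\<lambda>(t, \<xi>, \<zeta>). f t \<xi> \<zeta> \<pi>)"
      "\<And>t \<xi> \<zeta> \<pi>. t \<in> {0..T} \<Longrightarrow> \<xi> \<in> \<Omega> \<Longrightarrow> \<zeta> \<in> U \<Longrightarrow> \<pi> \<in> P \<Longrightarrow>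
         gateaux_differentiable (\<lambda>\<xi>'. f t \<xi>' \<zeta> \<pi>) \<xi>"
      "\<And>\<pi> K. \<pi> \<in> P \<Longrightarrow> compact K \<Longrightarrow> K \<noteq> {} \<Longrightarrow> K \<subseteq> \<Omega> \<times> U \<Longrightarrow>
         bdd_above ((\<lambda>(t, \<xi>, \<zeta>). norm (DG (\<lambda>\<xi>'. f t \<xi>' \<zeta> \<pi>) \<xi>)) ` ({0..T} \<times> K))"
    and V2: "\<And>t. t \<in> {0..T} \<Longrightarrow>
         hadamard_differentiable (\<lambda>(\<xi>, \<zeta>, \<pi>). f t \<xi> \<zeta> \<pi>) (x \<pi>0 t, u \<pi>0 t, \<pi>0)"
      "\<And>\<pi>. \<pi> \<in> P \<Longrightarrow> hadamard_differentiable (\<lambda>\<zeta>. f T (x \<pi> T) \<zeta> \<pi>) (u \<pi> T)"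
    and V3: "\<And>t \<zeta> \<pi>. t \<in> {0..T} \<Longrightarrow> \<zeta> \<in> U \<Longrightarrow> \<pi> \<in> P \<Longrightarrow>
         (\<lambda>\<xi>. f t \<xi> \<zeta> \<pi>) differentiable (at (x \<pi> t))"
      "\<And>\<pi>. \<pi> \<in> P \<Longrightarrow>
         continuous_on ({0..T} \<times> U) (\<lambda>(t, \<zeta>). DF (\<lambda>\<xi>. f t \<xi> \<zeta> \<pi>) (x \<pi> t))"
    and CT1: "\<And>\<phi>. \<phi> \<in> g ` {0..m} \<union> h ` {1..q} \<Longrightarrow>
         hadamard_differentiable (\<lambda>(\<xi>, \<pi>). \<phi> \<xi> \<pi>) (x \<pi>0 T, \<pi>0)"
      "\<And>\<phi> \<pi>. \<phi> \<in> g ` {0..m} \<union> h ` {1..q} \<Longrightarrow> \<pi> \<in> P \<Longrightarrow>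
         hadamard_differentiable (\<lambda>\<xi>. \<phi> \<xi> \<pi>) (x \<pi> T)"
    and CT2: "\<And>\<pi> j. \<pi> \<in> P \<Longrightarrow> j \<in> {1..q} \<Longrightarrow>
         \<exists>N. open N \<and> x \<pi> T \<in> N \<and> N \<subseteq> \<Omega> \<and> continuous_on N (\<lambda>\<xi>. h j \<xi> \<pi>)"
    and CVT1: "lin_indep_family ({1..m} <+> {1..q})
         (case_sum
           (\<lambda>i. DH (\<lambda>\<xi>. g i \<xi> \<pi>0) (x \<pi>0 T) o\<^sub>L DH (\<lambda>\<zeta>. f T (x \<pi>0 T) \<zeta> \<pi>0) (u \<pi>0 T))
           (\<lambda>j. DH (\<lambda>\<xi>. h j \<xi> \<pi>0) (x \<pi>0 T) o\<^sub>L DH (\<lambda>\<zeta>. f T (x \<pi>0 T) \<zeta> \<pi>0) (u \<pi>0 T)))"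
    and CVT2: "\<And>\<phi>. \<phi> \<in> g ` {0..m} \<union> h ` {1..q} \<Longrightarrow> continuous_on P
         (\<lambda>\<pi>. DH (\<lambda>\<xi>. \<phi> \<xi> \<pi>) (x \<pi> T) o\<^sub>L DH (\<lambda>\<zeta>. f T (x \<pi> T) \<zeta> \<pi>) (u \<pi> T))"
    and ESP: "\<exists>ip :: ('y \<Rightarrow>\<^sub>L real) \<Rightarrow> ('y \<Rightarrow>\<^sub>L real) \<Rightarrow> real.
         is_inner_product ip \<and> continuous_on UNIV (\<lambda>(a, b). ip a b)"
  shows "\<exists>lam mu p.
    pontryagin_triple T U f0 f m q g h \<pi>0 (x \<pi>0) (u \<pi>0) lam mu p \<and> lam 0 = 1 \<and>
    (\<forall>lam' mu' p'.
       pontryagin_triple T U f0 f m q g h \<pi>0 (x \<pi>0) (u \<pi>0) lam' mu' p' \<and> lam' 0 = 1 \<longrightarrow>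
       (\<forall>i\<in>{0..m}. lam' i = lam i) \<and> (\<forall>j\<in>{1..q}. mu' j = mu j) \<and> (\<forall>t\<in>{0..T}. p' t = p t)) \<and>
    set_integrable lborel {0..T} (\<lambda>t. DH (\<lambda>\<pi>. f0 t (x \<pi>0 t) (u \<pi>0 t) \<pi>) \<pi>0 \<delta>\<pi>) \<and>
    set_integrable lborel {0..T} (\<lambda>t. p t (DH (\<lambda>\<pi>. f t (x \<pi>0 t) (u \<pi>0 t) \<pi>) \<pi>0 \<delta>\<pi>)) \<and>
    has_gateaux_variation (bolza_value T \<Omega> U \<xi>0 f0 f m q g h) \<pi>0 \<delta>\<pi>
      (DH (\<lambda>\<pi>. g 0 (x \<pi>0 T) \<pi>) \<pi>0 \<delta>\<pi>
       + (\<Sum>i=1..m. lam i * DH (\<lambda>\<pi>. g i (x \<pi>0 T) \<pi>) \<pi>0 \<delta>\<pi>)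
       + (\<Sum>j=1..q. mu j * DH (\<lambda>\<pi>. h j (x \<pi>0 T) \<pi>) \<pi>0 \<delta>\<pi>)
       + (LINT t:{0..T}|lborel. DH (\<lambda>\<pi>. f0 t (x \<pi>0 t) (u \<pi>0 t) \<pi>) \<pi>0 \<delta>\<pi>)
       + (LINT t:{0..T}|lborel. p t (DH (\<lambda>\<pi>. f t (x \<pi>0 t) (u \<pi>0 t) \<pi>) \<pi>0 \<delta>\<pi>)))"
proof -

  \<comment> \<open>The solutions at all parameters of \<open>P\<close>\<close>
  have proc: "bolza_process T \<Omega> U \<xi>0 f0 f m q g h \<pi> (x \<pi>) (u \<pi>)" if P: "\<pi> \<in> P" for \<pi>
  proof
    have "continuous_on ({0..T} \<times> \<Omega> \<times> U) (\<lambda>z. (\<lambda>(t, \<xi>, \<zeta>, \<pi>). f0 t \<xi> \<zeta> \<pi>) (fst z, fst (snd z), snd (snd z), \<pi>))"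
      by (rule continuous_on_compose2[OF IC1(1)]) (use P in \<open>auto intro!: continuous_intros\<close>)
    then show "continuous_on ({0..T} \<times> \<Omega> \<times> U) (\<lambda>(t, \<xi>, \<zeta>). f0 t \<xi> \<zeta> \<pi>)" by (simp add: case_prod_unfold)
    show "bdd_above ((\<lambda>(t, \<xi>, \<zeta>). norm (DG (\<lambda>\<xi>'. f0 t \<xi>' \<zeta> \<pi>) \<xi>)) ` ({0..T} \<times> K))"
      if "compact K" "K \<noteq> {}" "K \<subseteq> \<Omega> \<times> U" for K by (rule IC1(3)[OF P that])
    show "bdd_above ((\<lambda>(t, \<xi>, \<zeta>). norm (DG (\<lambda>\<xi>'. f t \<xi>' \<zeta> \<pi>) \<xi>)) ` ({0..T} \<times> K))"
      if "compact K" "K \<noteq> {}" "K \<subseteq> \<Omega> \<times> U" for K by (rule V1(3)[OF P that])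
    show "gateaux_differentiable (\<lambda>\<xi>'. f0 t \<xi>' \<zeta> \<pi>) \<xi>" if "t \<in> {0..T}" "\<xi> \<in> \<Omega>" "\<zeta> \<in> U" for t \<xi> \<zeta> by (rule IC1(2)[OF that P])
    show "gateaux_differentiable (\<lambda>\<xi>'. f t \<xi>' \<zeta> \<pi>) \<xi>" if "t \<in> {0..T}" "\<xi> \<in> \<Omega>" "\<zeta> \<in> U" for t \<xi> \<zeta> by (rule V1(2)[OF that P])
    show "(\<lambda>\<xi>. f0 t \<xi> \<zeta> \<pi>) differentiable (at (x \<pi> t))" if "t \<in> {0..T}" "\<zeta> \<in> U" for t \<zeta> by (rule IC4(1)[OF that P])
    show "(\<lambda>\<xi>. f t \<xi> \<zeta> \<pi>) differentiable (at (x \<pi> t))" if "t \<in> {0..T}" "\<zeta> \<in> U" for t \<zeta> by (rule V3(1)[OF that P])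
    show "hadamard_differentiable (\<lambda>\<xi>. g i \<xi> \<pi>) (x \<pi> T)" if "i \<in> {0..m}" for i
      by (rule CT1(2)[OF _ P]) (use that in blast)
    show "hadamard_differentiable (\<lambda>\<xi>. h j \<xi> \<pi>) (x \<pi> T)" if "j \<in> {1..q}" for j
      by (rule CT1(2)[OF _ P]) (use that in blast)
    show "\<exists>N. open N \<and> x \<pi> T \<in> N \<and> N \<subseteq> \<Omega> \<and> continuous_on N (\<lambda>\<xi>. h j \<xi> \<pi>)" if "j \<in> {1..q}" for j
      by (rule CT2[OF P that])
  qed (fact T \<Omega>(1) U(1) SO(3)[OF P] IC4(2)[OF P] IC2(2)[OF P] V1(1)[OF P] V3(2)[OF P] V2(2)[OF P])+
  interpret b0: bolza_process T \<Omega> U \<xi>0 f0 f m q g h \<pi>0 "x \<pi>0" "u \<pi>0" by (rule proc[OF SO(2)])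

  \<comment> \<open>Dual control directions and multipliers\<close>
  define AG where "AG \<pi> i v = (if i = 0 then DH (\<lambda>\<zeta>. f0 T (x \<pi> T) \<zeta> \<pi>) (u \<pi> T) v else 0) +
    (DH (\<lambda>\<xi>. g i \<xi> \<pi>) (x \<pi> T) o\<^sub>L DH (\<lambda>\<zeta>. f T (x \<pi> T) \<zeta> \<pi>) (u \<pi> T)) v" for \<pi> i v
  define AH where "AH \<pi> j v = (DH (\<lambda>\<xi>. h j \<xi> \<pi>) (x \<pi> T) o\<^sub>L DH (\<lambda>\<zeta>. f T (x \<pi> T) \<zeta> \<pi>) (u \<pi> T)) v" for \<pi> j v
  \<comment> \<open>At \<open>\<pi>0\<close> these are the terminal differentials along
    \<open>b0.B v\<close>; as functions of \<open>\<pi>\<close> they remain available at parameters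
    to which the interpretation \<open>b0\<close> does not apply.\<close>
  have AG0: "b0.D\<Phi> i (b0.B v) = AG \<pi>0 i v" and AH0: "b0.D\<Psi> j (b0.B v) = AH \<pi>0 j v" for i j v
    unfolding AG_def AH_def by (rule b0.D\<Phi>_B, rule b0.D\<Psi>_B)
  have AG_add: "AG \<pi> i (v + w) = AG \<pi> i v + AG \<pi> i w" and AG_scale: "AG \<pi> i (c *\<^sub>R v) = c * AG \<pi> i v"
    and AH_add: "AH \<pi> j (v + w) = AH \<pi> j v + AH \<pi> j w" and AH_scale: "AH \<pi> j (c *\<^sub>R v) = c * AH \<pi> j v" for \<pi> i j v w c
    by (auto simp: AG_def AH_def blinfun.bilinear_simps algebra_simps)
  have AG_lin: "linear (AG \<pi> i)" and AH_lin: "linear (AH \<pi> j)" for \<pi> i j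
    by (intro linearI; simp add: AG_add AG_scale AH_add AH_scale)+
  \<comment> \<open>One index set for both families makes the directions for \<open>g\<close>
    annihilate the functionals for \<open>h\<close> and conversely.\<close>
  have "\<exists>V. \<forall>k\<in>{1..m} <+> {1..q}. \<forall>l\<in>{1..m} <+> {1..q}.
      case_sum (AG \<pi>0) (AH \<pi>0) k (V l) = (if k = l then 1 else 0)"
  proof (rule dual_vectors)
    show "finite ({1..m} <+> {1..q})" by simp
    show "linear (case_sum (AG \<pi>0) (AH \<pi>0) k)" for k by (cases k) (simp_all add: AG_lin AH_lin)
    fix c :: "nat + nat \<Rightarrow> real"
    assume c: "\<And>y. (\<Sum>k\<in>{1..m} <+> {1..q}. c k * case_sum (AG \<pi>0) (AH \<pi>0) k y) = 0"
    let ?v = "case_sum (\<lambda>i. DH (\<lambda>\<xi>. g i \<xi> \<pi>0) (x \<pi>0 T) o\<^sub>L DH (\<lambda>\<zeta>. f T (x \<pi>0 T) \<zeta> \<pi>0) (u \<pi>0 T))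
           (\<lambda>j. DH (\<lambda>\<xi>. h j \<xi> \<pi>0) (x \<pi>0 T) o\<^sub>L DH (\<lambda>\<zeta>. f T (x \<pi>0 T) \<zeta> \<pi>0) (u \<pi>0 T))"
    have "(\<Sum>k\<in>{1..m} <+> {1..q}. c k *\<^sub>R ?v k) = 0"
    proof (rule blinfun_eqI)
      fix y
      have "blinfun_apply (\<Sum>k\<in>{1..m} <+> {1..q}. c k *\<^sub>R ?v k) y = (\<Sum>k\<in>{1..m} <+> {1..q}. c k * ?v k y)"
        by (simp add: blinfun.sum_left blinfun.scaleR_left)
      also have "\<dots> = (\<Sum>k\<in>{1..m} <+> {1..q}. c k * case_sum (AG \<pi>0) (AH \<pi>0) k y)"
        by (intro sum.cong) (auto simp: AG_def AH_def)
      also have "\<dots> = 0" by (rule c)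
      finally show "blinfun_apply (\<Sum>k\<in>{1..m} <+> {1..q}. c k *\<^sub>R ?v k) y = blinfun_apply 0 y" by simp
    qed
    then show "\<forall>k\<in>{1..m} <+> {1..q}. c k = 0" using CVT1 unfolding lin_indep_family_def by blast
  qed
  then obtain V where V: "\<And>k l. k \<in> {1..m} <+> {1..q} \<Longrightarrow> l \<in> {1..m} <+> {1..q} \<Longrightarrow>
      case_sum (AG \<pi>0) (AH \<pi>0) k (V l) = (if k = l then 1 else 0)" by blast
  define vg where "vg i = V (Inl i)" for i
  define vh where "vh j = V (Inr j)" for j
  have dual: "\<And>i k. i \<in> {1..m} \<Longrightarrow> k \<in> {1..m} \<Longrightarrow> AG \<pi>0 i (vg k) = (if i = k then 1 else 0)"
      "\<And>i j. i \<in> {1..m} \<Longrightarrow> j \<in> {1..q} \<Longrightarrow> AG \<pi>0 i (vh j) = 0"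
      "\<And>j k. j \<in> {1..q} \<Longrightarrow> k \<in> {1..m} \<Longrightarrow> AH \<pi>0 j (vg k) = 0"
      "\<And>j k. j \<in> {1..q} \<Longrightarrow> k \<in> {1..q} \<Longrightarrow> AH \<pi>0 j (vh k) = (if j = k then 1 else 0)"
  proof -
    show "AG \<pi>0 i (vg k) = (if i = k then 1 else 0)" if "i \<in> {1..m}" "k \<in> {1..m}" for i k
      using V[OF InlI[OF that(1)] InlI[OF that(2)]] by (simp add: vg_def)
    show "AG \<pi>0 i (vh j) = 0" if "i \<in> {1..m}" "j \<in> {1..q}" for i j
      using V[OF InlI[OF that(1)] InrI[OF that(2)]] by (simp add: vh_def)
    show "AH \<pi>0 j (vg k) = 0" if "j \<in> {1..q}" "k \<in> {1..m}" for j k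
      using V[OF InrI[OF that(1)] InlI[OF that(2)]] by (simp add: vg_def)
    show "AH \<pi>0 j (vh k) = (if j = k then 1 else 0)" if "j \<in> {1..q}" "k \<in> {1..q}" for j k
      using V[OF InrI[OF that(1)] InrI[OF that(2)]] by (simp add: vh_def)
  qed
  \<comment> \<open>Forced by stationarity: the adjoint form has to vanish on every
    \<open>b0.B v\<close>, and on a dual direction all terms but the objective and one multiplier
    drop out.\<close>
  define lam where "lam i = (if i = 0 then 1 else - AG \<pi>0 0 (vg i))" for i
  define mu where "mu j = - AG \<pi>0 0 (vh j)" for j
  have lam0: "lam 0 = 1" by (simp add: lam_def)
  note mult = b0.multipliers_from_dual[of vg vh lam mu, unfolded AG0 AH0, OF dual lam0]
  have lam_nonneg: "0 \<le> lam i" if "i \<in> {1..m}" for i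
    by (rule mult(1)) (use that in \<open>auto simp: lam_def mu_def\<close>)
  have needle: "b0.adjoint_form lam mu (b0.mayer.needle_direction \<zeta> t) \<le> 0" if "t \<in> {0..<T}" "\<zeta> \<in> U" for t \<zeta>
    by (rule mult(2)) (use that in \<open>auto simp: lam_def mu_def\<close>)

  \<comment> \<open>Constraints with positive multiplier stay active\<close>
  have AG_cont: "((\<lambda>\<pi>. AG \<pi> i v) \<longlongrightarrow> AG \<pi>0 i v) (nhds \<pi>0)" if i: "i \<in> {0..m}" for i v
  proof -
    have c: "continuous_on P (\<lambda>\<pi>. DH (\<lambda>\<xi>. g i \<xi> \<pi>) (x \<pi> T) o\<^sub>L DH (\<lambda>\<zeta>. f T (x \<pi> T) \<zeta> \<pi>) (u \<pi> T))"
      by (rule CVT2) (use i in blast)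
    note c1 = bounded_bilinear.continuous_on[OF bounded_bilinear_blinfun_apply c continuous_on_const]
    note c2 = bounded_bilinear.continuous_on[OF bounded_bilinear_blinfun_apply IC2(3) continuous_on_const]
    have "continuous_on P (\<lambda>\<pi>. AG \<pi> i v)"
      unfolding AG_def
      by (rule continuous_on_add[OF _ c1], cases "i = 0") (simp_all add: c2)
    then have "isCont (\<lambda>\<pi>. AG \<pi> i v) \<pi>0" using SO(1,2) by (simp add: continuous_on_eq_continuous_at)
    then show ?thesis using tendsto_at_iff_tendsto_nhds[of "\<lambda>\<pi>. AG \<pi> i v" \<pi>0] by (simp add: isCont_def)
  qed
  have AH_cont: "((\<lambda>\<pi>. AH \<pi> j v) \<longlongrightarrow> AH \<pi>0 j v) (nhds \<pi>0)" if j: "j \<in> {1..q}" for j v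
  proof -
    have c: "continuous_on P (\<lambda>\<pi>. DH (\<lambda>\<xi>. h j \<xi> \<pi>) (x \<pi> T) o\<^sub>L DH (\<lambda>\<zeta>. f T (x \<pi> T) \<zeta> \<pi>) (u \<pi> T))"
      by (rule CVT2) (use j in blast)
    have "continuous_on P (\<lambda>\<pi>. AH \<pi> j v)"
      unfolding AH_def
      by (rule bounded_bilinear.continuous_on[OF bounded_bilinear_blinfun_apply c continuous_on_const])
    then have "isCont (\<lambda>\<pi>. AH \<pi> j v) \<pi>0" using SO(1,2) by (simp add: continuous_on_eq_continuous_at)
    then show ?thesis using tendsto_at_iff_tendsto_nhds[of "\<lambda>\<pi>. AH \<pi> j v" \<pi>0] by (simp add: isCont_def)
  qed
  \<comment> \<open>A constraint \<open>i\<close> inactive at \<open>\<pi>\<close> could be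
    sacrificed: moving along \<open>- vg i\<close> gains \<open>lam i\<close>, part of which buys a
    strict increase of all other inequality constraints. As the terminal differentials depend
    continuously on the parameter, this contradicts optimality at every \<open>\<pi>\<close> near
    \<open>\<pi>0\<close>.\<close>
  have active: "\<forall>\<^sub>F \<pi> in nhds \<pi>0. g i (x \<pi> T) \<pi> = 0" if i: "i \<in> {1..m}" and pos: "0 < lam i" for i
  proof -
    define S where "S = (\<Sum>k=1..m. lam k)"
    have S: "0 \<le> S" unfolding S_def using lam_nonneg by (intro sum_nonneg) auto
    \<comment> \<open>Keeps the price \<open>\<eta> * S\<close> of the strict increase at most half
      the gain \<open>lam i\<close>.\<close>
    define \<eta> where "\<eta> = lam i / (2 * (S + 1))"
    have \<eta>: "0 < \<eta>" using pos S by (simp add: \<eta>_def)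
    have "\<eta> * S \<le> \<eta> * (S + 1)" using \<eta> by simp
    also have "\<dots> = lam i / 2" using S by (simp add: \<eta>_def field_simps)
    finally have \<eta>S: "\<eta> * S < lam i" using pos by linarith
    define v where "v = (- 1) *\<^sub>R vg i + \<eta> *\<^sub>R (\<Sum>k=1..m. vg k)"
    have AGv: "AG \<pi>0 k v = - AG \<pi>0 k (vg i) + \<eta> * (\<Sum>l=1..m. AG \<pi>0 k (vg l))" for k
      using linear_sum[OF AG_lin, of \<pi>0 k vg "{1..m}"] by (simp only: v_def AG_add AG_scale mult_minus1)
    have AGv0: "0 < AG \<pi>0 0 v"
    proof -
      have "(\<Sum>l=1..m. AG \<pi>0 0 (vg l)) = - S" by (simp add: S_def lam_def sum_negf)
      moreover have "AG \<pi>0 0 (vg i) = - lam i" using i by (simp add: lam_def)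
      ultimately show ?thesis unfolding AGv using \<eta>S by simp
    qed
    have AGvk: "AG \<pi>0 k v = \<eta>" if "k \<in> {1..m}" "k \<noteq> i" for k
    proof -
      have "(\<Sum>l=1..m. AG \<pi>0 k (vg l)) = (\<Sum>l=1..m. if k = l then 1 else 0)"
        using dual(1)[OF that(1)] by (intro sum.cong) auto
      then show ?thesis unfolding AGv using dual(1)[OF that(1) i] that by simp
    qed
    have AHv: "AH \<pi>0 j v = 0" if "j \<in> {1..q}" for j
    proof -
      have "AH \<pi>0 j v = - AH \<pi>0 j (vg i) + \<eta> * (\<Sum>l=1..m. AH \<pi>0 j (vg l))"
        using linear_sum[OF AH_lin, of \<pi>0 j vg "{1..m}"] by (simp only: v_def AH_add AH_scale mult_minus1)
      also have "\<dots> = 0" using dual(3)[OF that] i by simp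
      finally show ?thesis .
    qed
    define S0 where "S0 = (\<Sum>j<q. \<bar>AG \<pi>0 0 (vh (Suc j))\<bar>)"
    have S0: "0 \<le> S0" unfolding S0_def by (intro sum_nonneg) auto
    \<comment> \<open>At \<open>\<pi>0\<close> the corrections affect the objective only, with total
      effect at most \<open>S0\<close> per unit; the margin leaves the gain of the objective above
      it.\<close>
    define \<epsilon> where "\<epsilon> = AG \<pi>0 0 v / (S0 + 1)"
    have \<epsilon>: "0 < \<epsilon>" using AGv0 S0 by (simp add: \<epsilon>_def)
    have "\<epsilon> * S0 < \<epsilon> * (S0 + 1)" using \<epsilon> by simp
    also have "\<dots> = AG \<pi>0 0 v" using S0 by (simp add: \<epsilon>_def)
    finally have \<epsilon>S0: "\<epsilon> * S0 < AG \<pi>0 0 v" .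
    have "\<forall>\<^sub>F \<pi> in nhds \<pi>0. \<forall>l\<in>{..<q}.
        \<bar>AH \<pi> (Suc l) v\<bar> + \<epsilon> * (\<Sum>j<q. \<bar>AH \<pi> (Suc l) (vh (Suc j)) - (if j = l then 1 else 0)\<bar>) < \<epsilon>"
    proof (intro eventually_ball_finite ballI)
      fix l assume l: "l \<in> {..<q}"
      have "((\<lambda>\<pi>. \<bar>AH \<pi> (Suc l) v\<bar> + \<epsilon> * (\<Sum>j<q. \<bar>AH \<pi> (Suc l) (vh (Suc j)) - (if j = l then 1 else 0)\<bar>)) \<longlongrightarrow>
          \<bar>AH \<pi>0 (Suc l) v\<bar> + \<epsilon> * (\<Sum>j<q. \<bar>AH \<pi>0 (Suc l) (vh (Suc j)) - (if j = l then 1 else 0)\<bar>)) (nhds \<pi>0)"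
        using l by (intro tendsto_intros AH_cont) auto
      moreover have "(\<Sum>j<q. \<bar>AH \<pi>0 (Suc l) (vh (Suc j)) - (if j = l then 1 else 0)\<bar>) = 0"
        using dual(4) l by (intro sum.neutral) auto
      then have "\<bar>AH \<pi>0 (Suc l) v\<bar> + \<epsilon> * (\<Sum>j<q. \<bar>AH \<pi>0 (Suc l) (vh (Suc j)) - (if j = l then 1 else 0)\<bar>) < \<epsilon>"
        using AHv[of "Suc l"] l \<epsilon> by simp
      ultimately show "\<forall>\<^sub>F \<pi> in nhds \<pi>0.
        \<bar>AH \<pi> (Suc l) v\<bar> + \<epsilon> * (\<Sum>j<q. \<bar>AH \<pi> (Suc l) (vh (Suc j)) - (if j = l then 1 else 0)\<bar>) < \<epsilon>"
        by (rule order_tendstoD(2))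
    qed simp
    \<comment> \<open>Only \<open>i\<close> is omitted. The other constraints receive a positive
      differential whether or not they are active, because the active set may change with
      \<open>\<pi>\<close>.\<close>
    moreover have "\<forall>\<^sub>F \<pi> in nhds \<pi>0. \<forall>k\<in>{0..m} - {i}. 0 < AG \<pi> k v - \<epsilon> * (\<Sum>j<q. \<bar>AG \<pi> k (vh (Suc j))\<bar>)"
    proof (intro eventually_ball_finite ballI)
      fix k assume k: "k \<in> {0..m} - {i}"
      have "((\<lambda>\<pi>. AG \<pi> k v - \<epsilon> * (\<Sum>j<q. \<bar>AG \<pi> k (vh (Suc j))\<bar>)) \<longlongrightarrow>
          AG \<pi>0 k v - \<epsilon> * (\<Sum>j<q. \<bar>AG \<pi>0 k (vh (Suc j))\<bar>)) (nhds \<pi>0)"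
        using k by (intro tendsto_intros AG_cont) auto
      moreover have "0 < AG \<pi>0 k v - \<epsilon> * (\<Sum>j<q. \<bar>AG \<pi>0 k (vh (Suc j))\<bar>)"
      proof (cases "k = 0")
        case True
        then show ?thesis using \<epsilon>S0 by (simp add: S0_def)
      next
        case False
        then have k': "k \<in> {1..m}" "k \<noteq> i" using k by auto
        have "(\<Sum>j<q. \<bar>AG \<pi>0 k (vh (Suc j))\<bar>) = 0" using dual(2)[OF k'(1)] by (intro sum.neutral) auto
        then show ?thesis using AGvk[OF k'] \<eta> by simp
      qed
      ultimately show "\<forall>\<^sub>F \<pi> in nhds \<pi>0. 0 < AG \<pi> k v - \<epsilon> * (\<Sum>j<q. \<bar>AG \<pi> k (vh (Suc j))\<bar>)"
        by (rule order_tendstoD(1))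
    qed simp
    moreover have "\<forall>\<^sub>F \<pi> in nhds \<pi>0. \<pi> \<in> P" using SO(1,2) by (rule eventually_nhds_in_open)
    ultimately show ?thesis
    proof eventually_elim
      case (elim \<pi>)
      show ?case
      proof (rule ccontr)
        assume ne: "g i (x \<pi> T) \<pi> \<noteq> 0"
        show False
        proof (rule bolza_process.terminal_not_improvable[OF proc[OF elim(3)], of "AG \<pi>" "AH \<pi>" \<epsilon> v vh, OF AG_def AH_def \<epsilon>])
          show "\<bar>AH \<pi> (Suc l) v\<bar> + \<epsilon> * (\<Sum>j<q. \<bar>AH \<pi> (Suc l) (vh (Suc j)) - (if j = l then 1 else 0)\<bar>) < \<epsilon>"
            if "l < q" for l using elim(1) that by blast
          show "\<epsilon> * (\<Sum>j<q. \<bar>AG \<pi> k (vh (Suc j))\<bar>) < AG \<pi> k v"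
            if k: "k \<in> {0..m}" "k = 0 \<or> g k (x \<pi> T) \<pi> = 0" for k
          proof -
            have "k \<in> {0..m} - {i}" using k ne i by auto
            then have "0 < AG \<pi> k v - \<epsilon> * (\<Sum>j<q. \<bar>AG \<pi> k (vh (Suc j))\<bar>)" using elim(2) by blast
            then show ?thesis by linarith
          qed
        qed
      qed
    qed
  qed

  \<comment> \<open>Existence and uniqueness of the Pontryagin triple\<close>
  have compl: "lam i * g i (x \<pi>0 T) \<pi>0 = 0" if "i \<in> {1..m}" for i
    using lam_nonneg[OF that] active[OF that] eventually_nhds_x_imp_x by fastforce
  obtain p where p: "pontryagin_triple T U f0 f m q g h \<pi>0 (x \<pi>0) (u \<pi>0) lam mu p"
    using b0.pontryagin_tripleI[of lam mu] lam0 lam_nonneg compl needle by blast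
  have unique: "(\<forall>i\<in>{0..m}. lam' i = lam i) \<and> (\<forall>j\<in>{1..q}. mu' j = mu j) \<and> (\<forall>t\<in>{0..T}. p' t = p t)"
    if p': "pontryagin_triple T U f0 f m q g h \<pi>0 (x \<pi>0) (u \<pi>0) lam' mu' p'" "lam' 0 = 1" for lam' mu' p'
  proof -
    \<comment> \<open>Every normal triple annihilates the terminal control directions, so evaluation
      on \<open>vg i\<close> and \<open>vh j\<close> recovers its multipliers.\<close>
    have z: "AG \<pi>0 0 v + (\<Sum>i=1..m. lam' i * AG \<pi>0 i v) + (\<Sum>j=1..q. mu' j * AH \<pi>0 j v) = 0" for v
      using b0.adjoint_form_B[OF p', of v] b0.adjoint_form_eq[of lam' mu' "b0.B v"] p'(2) by (simp add: AG0 AH0)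
    have l: "lam' i = lam i" if i: "i \<in> {0..m}" for i
    proof (cases "i = 0")
      case True
      then show ?thesis using p'(2) lam0 by simp
    next
      case False
      then have i': "i \<in> {1..m}" using i by auto
      have "(\<Sum>k=1..m. lam' k * AG \<pi>0 k (vg i)) = (\<Sum>k=1..m. if k = i then lam' k else 0)"
        using dual(1)[OF _ i'] by (intro sum.cong) auto
      moreover have "(\<Sum>j=1..q. mu' j * AH \<pi>0 j (vg i)) = 0"
        using dual(3)[OF _ i'] by (intro sum.neutral) auto
      ultimately show ?thesis using z[of "vg i"] i' by (simp add: lam_def)
    qed
    have m: "mu' j = mu j" if j: "j \<in> {1..q}" for j
    proof -
      have "(\<Sum>k=1..m. lam' k * AG \<pi>0 k (vh j)) = 0"
        using dual(2)[OF _ j] by (intro sum.neutral) auto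
      moreover have "(\<Sum>k=1..q. mu' k * AH \<pi>0 k (vh j)) = (\<Sum>k=1..q. if k = j then mu' k else 0)"
        using dual(4)[OF _ j] by (intro sum.cong) auto
      ultimately show ?thesis using z[of "vh j"] j by (simp add: mu_def)
    qed
    have "p' t = p t" if t: "t \<in> {0..T}" for t
      by (rule b0.costate_unique[OF p lam0 p' _ _ t]) (rule l m; assumption)+
    then show ?thesis using l m by blast
  qed

  \<comment> \<open>Variations of state and control along the perturbation\<close>
  define pert where "pert \<theta> = \<pi>0 + \<theta> *\<^sub>R \<delta>\<pi>" for \<theta>
  obtain y where y: "y \<in> PC1 T UNIV"
    and ylim: "((\<lambda>\<theta>. PC1_norm T (\<lambda>t. (x (pert \<theta>) t - x \<pi>0 t) /\<^sub>R \<theta> - y t)) \<longlongrightarrow> 0) (at_right 0)"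
    using SO(4) unfolding gateaux_variation_exists_in_def pert_def by blast
  obtain v where v: "v \<in> NPC0R T UNIV"
    and vlim: "((\<lambda>\<theta>. sup_norm T (\<lambda>t. (u (pert \<theta>) t - u \<pi>0 t) /\<^sub>R \<theta> - v t)) \<longlongrightarrow> 0) (at_right 0)"
    using SO(5) unfolding gateaux_variation_exists_in_def pert_def by blast
  define dx where "dx \<theta> t = (x (pert \<theta>) t - x \<pi>0 t) /\<^sub>R \<theta>" for \<theta> t
  define du where "du \<theta> t = (u (pert \<theta>) t - u \<pi>0 t) /\<^sub>R \<theta>" for \<theta> t
  have pertlim: "(pert \<longlongrightarrow> \<pi>0) (at_right 0)"
  proof -
    have "(pert \<longlongrightarrow> \<pi>0 + 0 *\<^sub>R \<delta>\<pi>) (at_right 0)" unfolding pert_def by (intro tendsto_intros)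
    then show ?thesis by simp
  qed
  have evpert: "\<forall>\<^sub>F \<theta> in at_right 0. pert \<theta> \<in> P"
    using pertlim SO(1,2) by (rule topological_tendstoD)
  have ev0: "\<forall>\<^sub>F \<theta>::real in at_right 0. 0 < \<theta>" by (simp add: eventually_at_filter)
  have bp: "x \<pi> \<in> PC1 T \<Omega>" "u \<pi> \<in> NPC0R T U" "\<And>t. t \<in> {0..T} \<Longrightarrow> ext_deriv T (x \<pi>) t = f t (x \<pi> t) (u \<pi> t) \<pi>"
    "\<And>t. t \<in> {0..T} \<Longrightarrow> x \<pi> t \<in> \<Omega>" "\<And>t. t \<in> {0..T} \<Longrightarrow> u \<pi> t \<in> U" if "\<pi> \<in> P" for \<pi>
    using bolza_process.x_PC1[OF proc[OF that]] bolza_process.u_NPC0R[OF proc[OF that]]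
      bolza_process.ode[OF proc[OF that]] bolza_process.x_\<Omega>[OF proc[OF that]] bolza_process.uU[OF proc[OF that]] by blast+
  note bp0 = bp[OF SO(2)]
  \<comment> \<open>The third estimate comes from the derivative part of the \<open>PC1\<close>
    norm: by the state equation the extended derivatives are values of \<open>f\<close> along the
    solutions.\<close>
  have near: "\<forall>\<^sub>F \<theta> in at_right 0. 0 < \<theta> \<and> pert \<theta> \<in> P \<and> (\<forall>t\<in>{0..T}. norm (dx \<theta> t - y t) < \<eta> \<and> norm (du \<theta> t - v t) < \<eta> \<and>
      norm ((f t (x (pert \<theta>) t) (u (pert \<theta>) t) (pert \<theta>) - f t (x \<pi>0 t) (u \<pi>0 t) \<pi>0) /\<^sub>R \<theta> - ext_deriv T y t) < \<eta>)"
    if \<eta>: "0 < \<eta>" for \<eta>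
    using order_tendstoD(2)[OF ylim \<eta>] order_tendstoD(2)[OF vlim \<eta>] evpert ev0
  proof eventually_elim
    case (elim \<theta>)
    define z where "z t = (x (pert \<theta>) t - x \<pi>0 t) /\<^sub>R \<theta> - y t" for t
    have zP: "z \<in> PC1 T UNIV" and ze: "\<And>t. t \<in> {0..T} \<Longrightarrow> ext_deriv T z t =
        (f t (x (pert \<theta>) t) (u (pert \<theta>) t) (pert \<theta>) - f t (x \<pi>0 t) (u \<pi>0 t) \<pi>0) /\<^sub>R \<theta> - ext_deriv T y t"
      using PC1_difference_quotient[OF T bp(1)[OF elim(3)] bp0(1) y, where \<theta> = \<theta>] bp(3)[OF elim(3)] bp0(3)
      unfolding z_def[abs_def] by simp_all
    have z1: "norm (z t) \<le> sup_norm T z" if "t \<in> {0..T}" for t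
      using norm_le_sup_norm[OF T PC0_continuous[OF PC1D(1)[OF T zP]] that, of UNIV] by simp
    have z2: "norm (ext_deriv T z t) \<le> sup_norm T (ext_deriv T z)" if "t \<in> {0..T}" for t
      by (rule norm_le_sup_norm[OF T NPC0R_PC0[OF PC1D(3)[OF T zP]] that])
    have z0: "0 \<le> sup_norm T z" "0 \<le> sup_norm T (ext_deriv T z)"
      using order_trans[OF norm_ge_zero z1[of 0]] order_trans[OF norm_ge_zero z2[of 0]] T by auto
    have zn: "sup_norm T z + sup_norm T (ext_deriv T z) < \<eta>"
      using elim(1) unfolding z_def[symmetric] PC1_norm_def by simp
    have duP: "(\<lambda>t. (u (pert \<theta>) t - u \<pi>0 t) /\<^sub>R \<theta> - v t) \<in> PC0 T UNIV"
    proof -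
      have "continuous_on (U \<times> U \<times> UNIV) (\<lambda>p. (fst p - fst (snd p)) /\<^sub>R \<theta> - snd (snd p))" by (intro continuous_intros)
      from PC0_comp[OF T PC0_Pair[OF T NPC0R_PC0[OF bp(2)[OF elim(3)]] PC0_Pair[OF T NPC0R_PC0[OF bp0(2)] NPC0R_PC0[OF v]]] this, of UNIV]
      show ?thesis by simp
    qed
    have "norm (dx \<theta> t - y t) < \<eta> \<and> norm (du \<theta> t - v t) < \<eta> \<and>
      norm ((f t (x (pert \<theta>) t) (u (pert \<theta>) t) (pert \<theta>) - f t (x \<pi>0 t) (u \<pi>0 t) \<pi>0) /\<^sub>R \<theta> - ext_deriv T y t) < \<eta>"
      if t: "t \<in> {0..T}" for t
      using z1[OF t] z2[OF t] z0 zn norm_le_sup_norm[OF T duP t] elim(2) unfolding ze[OF t]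
      by (simp add: z_def dx_def du_def)
    then show ?case using elim by blast
  qed
  have dxlim: "((\<lambda>\<theta>. dx \<theta> t) \<longlongrightarrow> y t) (at_right 0)" and dulim: "((\<lambda>\<theta>. du \<theta> t) \<longlongrightarrow> v t) (at_right 0)"
    and dflim: "((\<lambda>\<theta>. (f t (x (pert \<theta>) t) (u (pert \<theta>) t) (pert \<theta>) - f t (x \<pi>0 t) (u \<pi>0 t) \<pi>0) /\<^sub>R \<theta>) \<longlongrightarrow> ext_deriv T y t) (at_right 0)"
    if t: "t \<in> {0..T}" for t
  proof -
    show "((\<lambda>\<theta>. dx \<theta> t) \<longlongrightarrow> y t) (at_right 0)"
      by (rule tendstoI) (use near t in \<open>fastforce simp: dist_norm elim: eventually_mono\<close>)
    show "((\<lambda>\<theta>. du \<theta> t) \<longlongrightarrow> v t) (at_right 0)"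
      by (rule tendstoI) (use near t in \<open>fastforce simp: dist_norm elim: eventually_mono\<close>)
    show "((\<lambda>\<theta>. (f t (x (pert \<theta>) t) (u (pert \<theta>) t) (pert \<theta>) - f t (x \<pi>0 t) (u \<pi>0 t) \<pi>0) /\<^sub>R \<theta>) \<longlongrightarrow> ext_deriv T y t) (at_right 0)"
      by (rule tendstoI) (use near t in \<open>fastforce simp: dist_norm elim: eventually_mono\<close>)
  qed
  \<comment> \<open>The directions \<open>dx\<close> and \<open>du\<close> converge without being
    constant, which is what a Hadamard differential, unlike a Gateaux differential,
    tolerates.\<close>
  have quot: "((\<lambda>\<theta>. (G (x (pert \<theta>) t) (u (pert \<theta>) t) (pert \<theta>) - G (x \<pi>0 t) (u \<pi>0 t) \<pi>0) /\<^sub>R \<theta>) \<longlongrightarrow>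
      DH (\<lambda>(\<xi>, \<zeta>, \<pi>). G \<xi> \<zeta> \<pi>) (x \<pi>0 t, u \<pi>0 t, \<pi>0) (y t, v t, \<delta>\<pi>)) (at_right 0)"
    if G: "hadamard_differentiable (\<lambda>(\<xi>, \<zeta>, \<pi>). G \<xi> \<zeta> \<pi>) (x \<pi>0 t, u \<pi>0 t, \<pi>0)" and t: "t \<in> {0..T}"
    for G :: "'x \<Rightarrow> 'y \<Rightarrow> 'z \<Rightarrow> 'b::real_normed_vector" and t
  proof -
    have "((\<lambda>\<theta>. (dx \<theta> t, du \<theta> t, \<delta>\<pi>)) \<longlongrightarrow> (y t, v t, \<delta>\<pi>)) (at_right 0)"
      by (intro tendsto_intros dxlim dulim t)
    note l = hadamard_lim_compose[OF hadamard_lim_DH[OF G] filterlim_ident this]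
    show ?thesis
    proof (rule Lim_transform_eventually[OF l])
      show "\<forall>\<^sub>F \<theta> in at_right 0. ((\<lambda>(\<xi>, \<zeta>, \<pi>). G \<xi> \<zeta> \<pi>) ((x \<pi>0 t, u \<pi>0 t, \<pi>0) + \<theta> *\<^sub>R (dx \<theta> t, du \<theta> t, \<delta>\<pi>)) -
          (\<lambda>(\<xi>, \<zeta>, \<pi>). G \<xi> \<zeta> \<pi>) (x \<pi>0 t, u \<pi>0 t, \<pi>0)) /\<^sub>R \<theta> =
          (G (x (pert \<theta>) t) (u (pert \<theta>) t) (pert \<theta>) - G (x \<pi>0 t) (u \<pi>0 t) \<pi>0) /\<^sub>R \<theta>"
        using ev0 by eventually_elim (simp add: dx_def du_def pert_def)
    qed
  qed
  have quotT: "((\<lambda>\<theta>. (\<phi> (x (pert \<theta>) T) (pert \<theta>) - \<phi> (x \<pi>0 T) \<pi>0) /\<^sub>R \<theta>) \<longlongrightarrow>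
      DH (\<lambda>\<xi>. \<phi> \<xi> \<pi>0) (x \<pi>0 T) (y T) + DH (\<lambda>\<pi>. \<phi> (x \<pi>0 T) \<pi>) \<pi>0 \<delta>\<pi>) (at_right 0)"
    if \<phi>: "\<phi> \<in> g ` {0..m} \<union> h ` {1..q}" for \<phi>
  proof -
    have "((\<lambda>\<theta>. (dx \<theta> T, \<delta>\<pi>)) \<longlongrightarrow> (y T, \<delta>\<pi>)) (at_right 0)"
      using T by (intro tendsto_intros dxlim) auto
    note l = hadamard_lim_compose[OF hadamard_lim_DH[OF CT1(1)[OF \<phi>]] filterlim_ident this]
    show ?thesis
      unfolding hadamard_partials2[OF CT1(1)[OF \<phi>], symmetric]
    proof (rule Lim_transform_eventually[OF l])
      show "\<forall>\<^sub>F \<theta> in at_right 0. ((\<lambda>(\<xi>, \<pi>). \<phi> \<xi> \<pi>) ((x \<pi>0 T, \<pi>0) + \<theta> *\<^sub>R (dx \<theta> T, \<delta>\<pi>)) -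
          (\<lambda>(\<xi>, \<pi>). \<phi> \<xi> \<pi>) (x \<pi>0 T, \<pi>0)) /\<^sub>R \<theta> = (\<phi> (x (pert \<theta>) T) (pert \<theta>) - \<phi> (x \<pi>0 T) \<pi>0) /\<^sub>R \<theta>"
        using ev0 by eventually_elim (simp add: dx_def pert_def)
    qed
  qed
  \<comment> \<open>An identity valid near \<open>\<pi>0\<close> may be differentiated along the
    perturbation; it applies to the equalities and to the inequality constraints that stay
    active.\<close>
  have zero_of_eventually: "DH (\<lambda>\<xi>. \<phi> \<xi> \<pi>0) (x \<pi>0 T) (y T) + DH (\<lambda>\<pi>. \<phi> (x \<pi>0 T) \<pi>) \<pi>0 \<delta>\<pi> = 0"
    if \<phi>: "\<phi> \<in> g ` {0..m} \<union> h ` {1..q}" and z: "\<forall>\<^sub>F \<pi> in nhds \<pi>0. \<phi> (x \<pi> T) \<pi> = 0" for \<phi>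
  proof (rule tendsto_unique[OF trivial_limit_at_right_real quotT[OF \<phi>]])
    have "\<forall>\<^sub>F \<theta> in at_right 0. \<phi> (x (pert \<theta>) T) (pert \<theta>) = 0"
      by (rule eventually_compose_filterlim[OF z pertlim])
    moreover have "\<phi> (x \<pi>0 T) \<pi>0 = 0" using eventually_nhds_x_imp_x[OF z] .
    ultimately have "\<forall>\<^sub>F \<theta> in at_right 0. (\<phi> (x (pert \<theta>) T) (pert \<theta>) - \<phi> (x \<pi>0 T) \<pi>0) /\<^sub>R \<theta> = 0"
      by (auto elim: eventually_mono)
    then show "((\<lambda>\<theta>. (\<phi> (x (pert \<theta>) T) (pert \<theta>) - \<phi> (x \<pi>0 T) \<pi>0) /\<^sub>R \<theta>) \<longlongrightarrow> 0) (at_right 0)"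
      by (rule tendsto_eventually)
  qed
  have gz: "lam i * (DH (\<lambda>\<xi>. g i \<xi> \<pi>0) (x \<pi>0 T) (y T) + DH (\<lambda>\<pi>. g i (x \<pi>0 T) \<pi>) \<pi>0 \<delta>\<pi>) = 0"
    if i: "i \<in> {1..m}" for i
  proof (cases "lam i = 0")
    case False
    then have "\<forall>\<^sub>F \<pi> in nhds \<pi>0. g i (x \<pi> T) \<pi> = 0" using lam_nonneg[OF i] by (intro active[OF i]) simp
    moreover have "g i \<in> g ` {0..m} \<union> h ` {1..q}" using i by auto
    ultimately show ?thesis using zero_of_eventually[of "g i"] by simp
  qed simp
  have hz: "DH (\<lambda>\<xi>. h j \<xi> \<pi>0) (x \<pi>0 T) (y T) + DH (\<lambda>\<pi>. h j (x \<pi>0 T) \<pi>) \<pi>0 \<delta>\<pi> = 0" if j: "j \<in> {1..q}" for j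
  proof (rule zero_of_eventually)
    show "h j \<in> g ` {0..m} \<union> h ` {1..q}" using j by auto
    have "\<forall>\<^sub>F \<pi> in nhds \<pi>0. \<pi> \<in> P" using SO(1,2) by (rule eventually_nhds_in_open)
    then show "\<forall>\<^sub>F \<pi> in nhds \<pi>0. h j (x \<pi> T) \<pi> = 0"
      by eventually_elim (use SO(3) j in \<open>auto simp: bolza_solution_def bolza_admissible_def\<close>)
  qed

  \<comment> \<open>Differentiation of the value under the integral\<close>
  define Q where "Q t = DH (\<lambda>(\<xi>, \<zeta>, \<pi>). f0 t \<xi> \<zeta> \<pi>) (x \<pi>0 t, u \<pi>0 t, \<pi>0) (y t, v t, \<delta>\<pi>)" for t
  define d4 where "d4 t = DH (\<lambda>\<pi>. f0 t (x \<pi>0 t) (u \<pi>0 t) \<pi>) \<pi>0 \<delta>\<pi>" for t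
  define dq where "dq \<theta> t = (f0 t (x (pert \<theta>) t) (u (pert \<theta>) t) (pert \<theta>) - f0 t (x \<pi>0 t) (u \<pi>0 t) \<pi>0) /\<^sub>R \<theta>" for \<theta> t
  \<comment> \<open>State and control are frozen here: these quotients serve to obtain integrability
    of the partial differential \<open>d4\<close>.\<close>
  define dq' where "dq' \<theta> t = (f0 t (x \<pi>0 t) (u \<pi>0 t) (pert \<theta>) - f0 t (x \<pi>0 t) (u \<pi>0 t) \<pi>0) /\<^sub>R \<theta>" for \<theta> t
  have dqlim: "((\<lambda>\<theta>. dq \<theta> t) \<longlongrightarrow> Q t) (at_right 0)" if t: "t \<in> {0..T}" for t
    unfolding dq_def Q_def by (rule quot[OF IC2(1)[OF t] t])
  have dq'lim: "((\<lambda>\<theta>. dq' \<theta> t) \<longlongrightarrow> d4 t) (at_right 0)" if t: "t \<in> {0..T}" for t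
    unfolding dq'_def d4_def pert_def
    by (rule hadamard_lim_compose[OF hadamard_lim_DH[OF hadamard_partials(3)[OF IC2(1)[OF t]]] filterlim_ident tendsto_const])
  have f0_int: "set_integrable lborel {0..T} (\<lambda>t. f0 t (x \<pi> t) (u \<pi> t) \<pi>)" if "\<pi> \<in> P" for \<pi>
    by (rule PC0_set_integrable[OF T NPC0R_PC0[OF bolza_process.f0_NPC0R[OF proc[OF that]]]])
  have f0_int': "set_integrable lborel {0..T} (\<lambda>t. f0 t (x \<pi>0 t) (u \<pi>0 t) \<pi>)" if "\<pi> \<in> P" for \<pi>
    by (rule PC0_set_integrable[OF T NPC0R_PC0[OF b0.field_NPC0R[OF bolza_process.f0_cont[OF proc[OF that]] b0.x_cont b0.x_\<Omega> b0.u_NPC0R]]])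
  from IC3 obtain \<kappa> \<rho> where IC: "set_integrable lborel {0..T} \<kappa> \<and> (\<forall>t\<in>{0..T}. \<kappa> t \<ge> 0) \<and> \<rho> > 0 \<and>
         (\<forall>t\<in>{0..T}. \<forall>\<xi>1\<in>\<Omega>. \<forall>\<zeta>1\<in>U. \<forall>\<pi>1\<in>P. \<forall>\<xi>2\<in>\<Omega>. \<forall>\<zeta>2\<in>U. \<forall>\<pi>2\<in>P.
            norm1 ((\<xi>1, \<zeta>1, \<pi>1) - (x \<pi>0 t, u \<pi>0 t, \<pi>0)) < \<rho> \<longrightarrow>
            norm1 ((\<xi>2, \<zeta>2, \<pi>2) - (x \<pi>0 t, u \<pi>0 t, \<pi>0)) < \<rho> \<longrightarrow>
            \<bar>f0 t \<xi>1 \<zeta>1 \<pi>1 - f0 t \<xi>2 \<zeta>2 \<pi>2\<bar>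
              \<le> \<kappa> t * norm1 ((\<xi>1, \<zeta>1, \<pi>1) - (\<xi>2, \<zeta>2, \<pi>2)))"
    by (elim exE)
  then have \<kappa>: "set_integrable lborel {0..T} \<kappa>" "\<And>t. t \<in> {0..T} \<Longrightarrow> 0 \<le> \<kappa> t" and \<rho>: "0 < \<rho>" by simp_all
  have lip: "\<And>t \<xi>1 \<zeta>1 \<pi>1 \<xi>2 \<zeta>2 \<pi>2. t \<in> {0..T} \<Longrightarrow> \<xi>1 \<in> \<Omega> \<Longrightarrow> \<zeta>1 \<in> U \<Longrightarrow> \<pi>1 \<in> P \<Longrightarrow> \<xi>2 \<in> \<Omega> \<Longrightarrow> \<zeta>2 \<in> U \<Longrightarrow> \<pi>2 \<in> P \<Longrightarrow>
      norm1 ((\<xi>1, \<zeta>1, \<pi>1) - (x \<pi>0 t, u \<pi>0 t, \<pi>0)) < \<rho> \<Longrightarrow> norm1 ((\<xi>2, \<zeta>2, \<pi>2) - (x \<pi>0 t, u \<pi>0 t, \<pi>0)) < \<rho> \<Longrightarrow>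
      \<bar>f0 t \<xi>1 \<zeta>1 \<pi>1 - f0 t \<xi>2 \<zeta>2 \<pi>2\<bar> \<le> \<kappa> t * norm1 ((\<xi>1, \<zeta>1, \<pi>1) - (\<xi>2, \<zeta>2, \<pi>2))"
    by (rule IC[THEN conjunct2, THEN conjunct2, THEN conjunct2, rule_format])
  obtain Cy where Cy: "0 \<le> Cy" "\<And>t. t \<in> {0..T} \<Longrightarrow> norm (y t) \<le> Cy"
    using PC0_bounded[OF T PC0_continuous[OF PC1D(1)[OF T y] UNIV_I]] by blast
  obtain Cv where Cv: "0 \<le> Cv" "\<And>t. t \<in> {0..T} \<Longrightarrow> norm (v t) \<le> Cv"
    using PC0_bounded[OF T NPC0R_PC0[OF v]] by blast
  \<comment> \<open>For small \<open>\<theta>\<close> the state and control quotients are within 1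
    of their limits, so the perturbed point lies within \<open>\<theta> * C\<close> of the reference
    point in the norm of the Lipschitz condition.\<close>
  define C where "C = (Cy + 1) + (Cv + 1) + norm \<delta>\<pi>"
  have C: "0 < C" using Cy Cv by (simp add: C_def add_pos_nonneg)
  have "\<forall>\<^sub>F \<theta> in at_right 0. 0 < \<theta> \<and> \<theta> * C < \<rho> \<and> pert \<theta> \<in> P \<and> (\<forall>t\<in>{0..T}. norm (dx \<theta> t - y t) < 1 \<and> norm (du \<theta> t - v t) < 1)"
  proof -
    have "0 < \<rho> / C" using \<rho> C by simp
    from eventually_at_right_real[OF this] near[OF zero_less_one] show ?thesis
      by eventually_elim (use C in \<open>auto simp: pos_less_divide_eq\<close>)
  qed
  then obtain b where b: "0 < b" "\<And>\<theta>. 0 < \<theta> \<Longrightarrow> \<theta> < b \<Longrightarrow> \<theta> * C < \<rho> \<and> pert \<theta> \<in> P \<and>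
      (\<forall>t\<in>{0..T}. norm (dx \<theta> t - y t) < 1 \<and> norm (du \<theta> t - v t) < 1)"
    unfolding eventually_at_right_field by blast
  have dom: "\<bar>dq \<theta> t\<bar> \<le> \<kappa> t * C" "\<bar>dq' \<theta> t\<bar> \<le> \<kappa> t * C" if \<theta>: "0 < \<theta>" "\<theta> < b" and t: "t \<in> {0..T}" for \<theta> t
  proof -
    note b' = b(2)[OF \<theta>]
    have in0: "norm1 ((x \<pi>0 t, u \<pi>0 t, \<pi>0) - (x \<pi>0 t, u \<pi>0 t, \<pi>0)) < \<rho>" using \<rho> by (simp add: norm1_def zero_prod_def)
    have bound: "\<bar>(f0 t a z (pert \<theta>) - f0 t (x \<pi>0 t) (u \<pi>0 t) \<pi>0) /\<^sub>R \<theta>\<bar> \<le> \<kappa> t * C"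
      if "a \<in> \<Omega>" "z \<in> U" "norm (a - x \<pi>0 t) \<le> \<theta> * (Cy + 1)" "norm (z - u \<pi>0 t) \<le> \<theta> * (Cv + 1)" for a z
    proof -
      have n: "norm1 ((a, z, pert \<theta>) - (x \<pi>0 t, u \<pi>0 t, \<pi>0)) \<le> \<theta> * C"
        using that(3,4) \<theta>(1) by (simp add: norm1_def pert_def C_def algebra_simps)
      then have "\<bar>f0 t a z (pert \<theta>) - f0 t (x \<pi>0 t) (u \<pi>0 t) \<pi>0\<bar> \<le> \<kappa> t * norm1 ((a, z, pert \<theta>) - (x \<pi>0 t, u \<pi>0 t, \<pi>0))"
        using b' by (intro lip t that(1,2) bp0(4)[OF t] bp0(5)[OF t] SO(2) in0) auto
      also have "\<dots> \<le> \<kappa> t * (\<theta> * C)" using n \<kappa>(2)[OF t] by (intro mult_left_mono)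
      finally have "\<bar>f0 t a z (pert \<theta>) - f0 t (x \<pi>0 t) (u \<pi>0 t) \<pi>0\<bar> / \<theta> \<le> \<kappa> t * C"
        using \<theta>(1) by (simp add: pos_divide_le_eq mult_ac)
      then show ?thesis using \<theta>(1) by (simp add: abs_mult divide_inverse mult.commute)
    qed
    have sc: "norm a \<le> \<theta> * (c + 1)" if "norm (a /\<^sub>R \<theta> - w) < 1" "norm w \<le> c" for a w :: "'c::real_normed_vector" and c
    proof -
      have "norm (a /\<^sub>R \<theta>) \<le> c + 1" using norm_triangle_sub[of "a /\<^sub>R \<theta>" w] that by linarith
      then have "norm a / \<theta> \<le> c + 1" using \<theta>(1) by (simp add: divide_inverse mult.commute)
      then show ?thesis using \<theta>(1) by (simp add: pos_divide_le_eq mult.commute)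
    qed
    have pertP: "pert \<theta> \<in> P" using b' by blast
    show "\<bar>dq \<theta> t\<bar> \<le> \<kappa> t * C"
      unfolding dq_def
    proof (rule bound)
      show "norm (x (pert \<theta>) t - x \<pi>0 t) \<le> \<theta> * (Cy + 1)"
        by (rule sc[of _ "y t"]) (use b' t Cy in \<open>auto simp: dx_def\<close>)
      show "norm (u (pert \<theta>) t - u \<pi>0 t) \<le> \<theta> * (Cv + 1)"
        by (rule sc[of _ "v t"]) (use b' t Cv in \<open>auto simp: du_def\<close>)
    qed (use bp(4,5)[OF pertP t] in auto)
    show "\<bar>dq' \<theta> t\<bar> \<le> \<kappa> t * C"
      unfolding dq'_def by (rule bound) (use bp0(4,5)[OF t] \<theta>(1) Cy(1) Cv(1) in auto)
  qed
  have dq_int: "set_integrable lborel {0..T} (dq \<theta>)" "set_integrable lborel {0..T} (dq' \<theta>)"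
    "(LINT t:{0..T}|lborel. dq \<theta> t) = ((LINT t:{0..T}|lborel. f0 t (x (pert \<theta>) t) (u (pert \<theta>) t) (pert \<theta>)) -
       (LINT t:{0..T}|lborel. f0 t (x \<pi>0 t) (u \<pi>0 t) \<pi>0)) /\<^sub>R \<theta>" if "pert \<theta> \<in> P" for \<theta>
    unfolding dq_def dq'_def real_scaleR_def
    using set_integral_diff[OF f0_int[OF that] f0_int[OF SO(2)]] set_integral_diff(1)[OF f0_int'[OF that] f0_int'[OF SO(2)]]
    by simp_all
  have \<kappa>C: "set_integrable lborel {0..T} (\<lambda>t. \<kappa> t * C)" using \<kappa>(1) by simp
  have seq: "filterlim S (at_right 0) sequentially" if "\<And>n. 0 < S n" "S \<longlonglongrightarrow> 0" for S :: "nat \<Rightarrow> real"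
  proof -
    have "0 < S n \<and> S n \<noteq> 0" for n using that(1)[of n] by simp
    then show ?thesis using that(2) by (simp add: filterlim_at)
  qed
  \<comment> \<open>A concrete null sequence; \<open>n + 2\<close> keeps it strictly below
    \<open>b\<close> already for \<open>n = 0\<close>. One sequence suffices for integrability of
    the limits, whereas the limit of the integrals needs all of them.\<close>
  have S0: "(\<lambda>n. b / real (n + 2)) \<longlonglongrightarrow> 0" "0 < b / real (n + 2)" "b / real (n + 2) < b" for n
  proof -
    show "(\<lambda>n. b / real (n + 2)) \<longlonglongrightarrow> 0" by (rule LIMSEQ_ignore_initial_segment[OF lim_const_over_n])
    show "0 < b / real (n + 2)" "b / real (n + 2) < b" using b(1) by (auto simp: divide_less_eq)
  qed
  have Q_int: "set_integrable lborel {0..T} Q"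
    by (rule set_dominated_convergence(1)[OF dq_int(1) \<kappa>C dom(1) filterlim_compose[OF dqlim seq[OF S0(2,1)]]])
      (use b(2) S0 in auto)
  have d4_int: "set_integrable lborel {0..T} d4"
    by (rule set_dominated_convergence(1)[OF dq_int(2) \<kappa>C dom(2) filterlim_compose[OF dq'lim seq[OF S0(2,1)]]])
      (use b(2) S0 in auto)
  have LINT_lim: "((\<lambda>\<theta>. LINT t:{0..T}|lborel. dq \<theta> t) \<longlongrightarrow> (LINT t:{0..T}|lborel. Q t)) (at_right 0)"
  proof (rule tendsto_at_right_sequentially[OF b(1)])
    fix S :: "nat \<Rightarrow> real" assume S: "\<And>n. 0 < S n" "\<And>n. S n < b" "S \<longlonglongrightarrow> 0"
    show "(\<lambda>n. LINT t:{0..T}|lborel. dq (S n) t) \<longlonglongrightarrow> (LINT t:{0..T}|lborel. Q t)"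
      by (rule set_dominated_convergence(2)[OF dq_int(1) \<kappa>C dom(1) filterlim_compose[OF dqlim seq[OF S(1,3)]]])
        (use b(2) S in auto)
  qed
  define Dg where "Dg = DH (\<lambda>\<xi>. g 0 \<xi> \<pi>0) (x \<pi>0 T) (y T) + DH (\<lambda>\<pi>. g 0 (x \<pi>0 T) \<pi>) \<pi>0 \<delta>\<pi>"
  have var: "has_gateaux_variation (bolza_value T \<Omega> U \<xi>0 f0 f m q g h) \<pi>0 \<delta>\<pi> ((LINT t:{0..T}|lborel. Q t) + Dg)"
    unfolding has_gateaux_variation_def
  proof (rule Lim_transform_eventually)
    show "((\<lambda>\<theta>. (LINT t:{0..T}|lborel. dq \<theta> t) + (g 0 (x (pert \<theta>) T) (pert \<theta>) - g 0 (x \<pi>0 T) \<pi>0) /\<^sub>R \<theta>) \<longlongrightarrow>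
        (LINT t:{0..T}|lborel. Q t) + Dg) (at_right 0)"
      unfolding Dg_def by (intro tendsto_add LINT_lim quotT) auto
    show "\<forall>\<^sub>F \<theta> in at_right 0. (LINT t:{0..T}|lborel. dq \<theta> t) + (g 0 (x (pert \<theta>) T) (pert \<theta>) - g 0 (x \<pi>0 T) \<pi>0) /\<^sub>R \<theta> =
        (bolza_value T \<Omega> U \<xi>0 f0 f m q g h (\<pi>0 + \<theta> *\<^sub>R \<delta>\<pi>) - bolza_value T \<Omega> U \<xi>0 f0 f m q g h \<pi>0) /\<^sub>R \<theta>"
      using evpert
    proof eventually_elim
      case (elim \<theta>)
      show ?case
        unfolding dq_int(3)[OF elim] pert_def[symmetric] bolza_process.value_eq[OF proc[OF elim]] b0.value_eq bolza_objective_def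
        by (simp add: algebra_simps)
    qed
  qed

  \<comment> \<open>Elimination of the variations of state and control\<close>
  define Df where "Df t = DF (\<lambda>\<xi>. f t \<xi> (u \<pi>0 t) \<pi>0) (x \<pi>0 t)" for t
  define Df0 where "Df0 t = DF (\<lambda>\<xi>. f0 t \<xi> (u \<pi>0 t) \<pi>0) (x \<pi>0 t)" for t
  define pf where "pf t = p t (DH (\<lambda>\<pi>. f t (x \<pi>0 t) (u \<pi>0 t) \<pi>) \<pi>0 \<delta>\<pi>)" for t
  \<comment> \<open>The derivative of \<open>p t (y t)\<close> after the adjoint equation has
    replaced the derivative of \<open>p\<close>.\<close>
  define r where "r t = p t (ext_deriv T y t) - p t (Df t (y t)) - Df0 t (y t)" for t
  note pc = b0.pontryagin_tripleD[OF p lam0]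
  have pf_eq: "pf t = r t + Q t - d4 t" if t: "t \<in> {0..T}" for t
  proof -
    let ?J = "blinfun_apply (DH (\<lambda>(\<xi>, \<zeta>, \<pi>). f t \<xi> \<zeta> \<pi>) (x \<pi>0 t, u \<pi>0 t, \<pi>0))"
    let ?K = "blinfun_apply (DH (\<lambda>(\<xi>, \<zeta>, \<pi>). f0 t \<xi> \<zeta> \<pi>) (x \<pi>0 t, u \<pi>0 t, \<pi>0))"
    note hp = hadamard_partials[OF V2(1)[OF t]] and hp0 = hadamard_partials[OF IC2(1)[OF t]]
    have split: "(y t, v t, \<delta>\<pi>) = (y t, 0, 0) + (0, v t, 0) + (0, 0, \<delta>\<pi>)" by simp
    \<comment> \<open>The same quotients of \<open>f\<close> have two limits, one from the
      \<open>PC1\<close> norm and one from the Hadamard differential; equating them gives the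
      linearised state equation.\<close>
    have ey: "ext_deriv T y t = ?J (y t, v t, \<delta>\<pi>)"
      by (rule tendsto_unique[OF trivial_limit_at_right_real dflim[OF t] quot[OF V2(1)[OF t] t]])
    have "ext_deriv T y t = Df t (y t) + ?J (0, v t, 0) + DH (\<lambda>\<pi>. f t (x \<pi>0 t) (u \<pi>0 t) \<pi>) \<pi>0 \<delta>\<pi>"
      unfolding ey split blinfun.add_right hp(4) Df_def
      using hp(5)[OF V3(1)[OF t bp0(5)[OF t] SO(2)], of "y t"] by simp
    moreover have "Q t = Df0 t (y t) + ?K (0, v t, 0) + d4 t"
      unfolding Q_def split blinfun.add_right d4_def hp0(4) Df0_def
      using hp0(5)[OF IC4(1)[OF t bp0(5)[OF t] SO(2)], of "y t"] by simp
    moreover have "p t (?J (0, v t, 0)) + ?K (0, v t, 0) = 0"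
      using b0.hamiltonian_stationary[OF p lam0 t hp(1) hp0(1), of "v t"] unfolding hp(2) hp0(2) .
    ultimately show ?thesis by (simp add: pf_def r_def blinfun.add_right)
  qed
  \<comment> \<open>All solutions share the initial state, so \<open>p 0 (y 0)\<close> does not
    contribute to the integral of \<open>r\<close>.\<close>
  have y0: "y 0 = 0"
  proof (rule tendsto_unique[OF trivial_limit_at_right_real dxlim])
    show "0 \<in> {0..T}" using T by simp
    have "\<forall>\<^sub>F \<theta> in at_right 0. dx \<theta> 0 = 0"
      using evpert by eventually_elim (use SO(3) SO(2) in \<open>simp add: dx_def bolza_solution_def bolza_admissible_def\<close>)
    then show "((\<lambda>\<theta>. dx \<theta> 0) \<longlongrightarrow> 0) (at_right 0)" by (rule tendsto_eventually)
  qed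
  have yPC0: "y \<in> PC0 T UNIV" and pPC0: "p \<in> PC0 T UNIV"
    using PC0_continuous[OF PC1D(1)[OF T y], of UNIV] PC0_continuous[OF PC1D(1)[OF T pc(1)], of UNIV] by simp_all
  have rPC0: "r \<in> PC0 T UNIV"
  proof -
    have "continuous_on (UNIV \<times> UNIV \<times> UNIV \<times> UNIV \<times> UNIV)
        (\<lambda>z. blinfun_apply (fst z) (fst (snd z)) - blinfun_apply (fst z) (blinfun_apply (fst (snd (snd z))) (fst (snd (snd (snd z))))) -
          blinfun_apply (snd (snd (snd (snd z)))) (fst (snd (snd (snd z)))) :: real)"
      by (intro continuous_intros)
    from PC0_comp[OF T PC0_Pair[OF T pPC0 PC0_Pair[OF T NPC0R_PC0[OF PC1D(3)[OF T y]]
      PC0_Pair[OF T NPC0R_PC0[OF b0.control_NPC0R[OF b0.f_dc b0.u_NPC0R]]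
      PC0_Pair[OF T yPC0 NPC0R_PC0[OF b0.control_NPC0R[OF b0.f0_dc b0.u_NPC0R]]]]]] this, of UNIV]
    show ?thesis by (simp add: r_def[abs_def] Df_def Df0_def)
  qed
  have r_int: "set_integrable lborel {0..T} r" by (rule PC0_set_integrable[OF T rPC0])
  have "(r has_integral p T (y T) - p 0 (y 0)) {0..T}"
  proof -
    obtain S where S: "finite S" "\<And>t. t \<in> {0<..<T} - S \<Longrightarrow> (y has_vector_derivative ext_deriv T y t) (at t)"
      using PC1D(4)[OF T y] by blast
    obtain R where R: "finite R" "\<And>t. t \<in> {0<..<T} - R \<Longrightarrow> (p has_vector_derivative ext_deriv T p t) (at t)"
      using PC1D(4)[OF T pc(1)] by blast
    show ?thesis
    proof (rule fundamental_theorem_of_calculus_interior_strong[of "S \<union> R"])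
      show "((\<lambda>t. p t (y t)) has_vector_derivative r t) (at t)" if t: "t \<in> {0<..<T} - (S \<union> R)" for t
      proof -
        have "((\<lambda>t. p t (y t)) has_vector_derivative p t (ext_deriv T y t) + (ext_deriv T p t) (y t)) (at t)"
          using S(2)[of t] R(2)[of t] t
          by (intro bounded_bilinear.has_vector_derivative[OF bounded_bilinear_blinfun_apply]) auto
        moreover have "p t (ext_deriv T y t) + (ext_deriv T p t) (y t) = r t"
          using pc(3)[of t] t by (simp add: r_def Df_def Df0_def blinfun.bilinear_simps)
        ultimately show ?thesis by simp
      qed
      show "continuous_on {0..T} (\<lambda>t. p t (y t))"
        by (intro continuous_intros PC1D(1)[OF T y] PC1D(1)[OF T pc(1)])
    qed (use S R T in auto)
  qed
  then have r_val: "(LINT t:{0..T}|lborel. r t) = p T (y T)"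
    using set_borel_integral_eq_integral(2)[OF r_int] y0 by (simp add: integral_unique)
  \<comment> \<open>No bound on the parameter differential of \<open>f\<close> is at hand;
    integrability is inherited from the three summands in \<open>pf_eq\<close>.\<close>
  have pf_int: "set_integrable lborel {0..T} pf"
  proof -
    have "set_integrable lborel {0..T} (\<lambda>t. r t + Q t - d4 t)"
      by (intro set_integral_diff(1) set_integral_add(1) r_int Q_int d4_int)
    then show ?thesis by (subst set_integrable_cong[OF refl refl pf_eq]) simp_all
  qed
  have "(LINT t:{0..T}|lborel. pf t) = (LINT t:{0..T}|lborel. r t + Q t - d4 t)"
    using pf_eq by (intro set_lebesgue_integral_cong) auto
  also have "\<dots> = p T (y T) + (LINT t:{0..T}|lborel. Q t) - (LINT t:{0..T}|lborel. d4 t)"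
    using r_int Q_int d4_int by (simp add: set_integral_diff set_integral_add r_val)
  finally have pf_val: "(LINT t:{0..T}|lborel. pf t) = p T (y T) + (LINT t:{0..T}|lborel. Q t) - (LINT t:{0..T}|lborel. d4 t)" .
  have pTy: "p T (y T) = DH (\<lambda>\<xi>. g 0 \<xi> \<pi>0) (x \<pi>0 T) (y T) + (\<Sum>i=1..m. lam i * DH (\<lambda>\<xi>. g i \<xi> \<pi>0) (x \<pi>0 T) (y T))
      + (\<Sum>j=1..q. mu j * DH (\<lambda>\<xi>. h j \<xi> \<pi>0) (x \<pi>0 T) (y T))"
    unfolding pc(2)
    by (simp add: blinfun.add_left blinfun.sum_left blinfun.scaleR_left sum.atLeast_Suc_atMost[of 0] lam0)
  have "(\<Sum>i=1..m. lam i * DH (\<lambda>\<xi>. g i \<xi> \<pi>0) (x \<pi>0 T) (y T)) + (\<Sum>i=1..m. lam i * DH (\<lambda>\<pi>. g i (x \<pi>0 T) \<pi>) \<pi>0 \<delta>\<pi>) = 0"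
    unfolding sum.distrib[symmetric] distrib_left[symmetric] using gz by (intro sum.neutral) blast
  moreover have "(\<Sum>j=1..q. mu j * DH (\<lambda>\<xi>. h j \<xi> \<pi>0) (x \<pi>0 T) (y T)) + (\<Sum>j=1..q. mu j * DH (\<lambda>\<pi>. h j (x \<pi>0 T) \<pi>) \<pi>0 \<delta>\<pi>) = 0"
    unfolding sum.distrib[symmetric] distrib_left[symmetric] using hz by (intro sum.neutral) simp
  ultimately have total: "(LINT t:{0..T}|lborel. Q t) + Dg = DH (\<lambda>\<pi>. g 0 (x \<pi>0 T) \<pi>) \<pi>0 \<delta>\<pi>
       + (\<Sum>i=1..m. lam i * DH (\<lambda>\<pi>. g i (x \<pi>0 T) \<pi>) \<pi>0 \<delta>\<pi>)
       + (\<Sum>j=1..q. mu j * DH (\<lambda>\<pi>. h j (x \<pi>0 T) \<pi>) \<pi>0 \<delta>\<pi>)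
       + (LINT t:{0..T}|lborel. d4 t) + (LINT t:{0..T}|lborel. pf t)"
    unfolding pf_val pTy Dg_def by linarith
  show ?thesis
    using p lam0 unique d4_int pf_int var[unfolded total] unfolding d4_def pf_def by blast
qed

end
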